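(* Let $(M,g)$ be a generalized gravitational wave spacetime (see context). Then $(M,g)$ is globally hyperbolic if and only if for every $e_0=(t_0,q_0),\,e_1=(t_1,q_1)\in E$ with $t_0<t_1$ the action functional $\mathcal S_{e_0,e_1}$ is coercive.
   Context: Setting. $r\ge 2$; $Q$ is a connected $d$-dimensional ($C^{r+1}$, Hausdorff, paracompact, boundaryless) manifold; $T\subset\mathbb{R}$ is a connected interval, open because spacetimes are without boundary; $E=T\times Q$ with points $e=(t,q)$. On $Q$ there are given a time-dependent Riemannian metric $a_t$, a time-dependent 1-form $b_t$ and a function $V(t,q)$, all $C^r$ in $(t,q)\in E$. The Lagrangian is $L(t,q,v)=\frac12 a_t(v,v)+b_t(v)-V(t,q)$. The generalized gravitational wave spacetime is $M=T\times Q\times\mathbb{R}$ with points $x=(t,q,y)$ and Lorentzian metric (signature $(-,+,\dots,+)$) $g=a_t-dt\otimes(dy-b_t)-(dy-b_t)\otimes dt-2V\,dt^2$, time oriented by the timelike vector field $W=\partial_t-(V-\tfrac12)\partial_y$. Action functional. For $t_0<t_1$, $\mathcal S_{e_0,e_1}[q]=\int_{t_0}^{t_1}L(t,q(t),\dot q(t))\,dt$ on the set $C^1_{e_0,e_1}$ of $C^1$ curves $q:[t_0,t_1]\to Q$ with $q(t_0)=q_0$, $q(t_1)=q_1$. It is coercive if for every sequence $q_n\in C^1_{e_0,e_1}$ such that $\mathcal S_{e_0,e_1}[q_n]$ is bounded from above, the images $q_n([t_0,t_1])$ are all contained in one compact subset of $Q$. A spacetime is globally hyperbolic if it is causal (no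 closed causal curves) and $J^+(x_0)\cap J^-(x_1)$ is compact for all $x_0,x_1\in M$, where $J^\pm(x)$ are the causal future and past of $x$ (including $x$). *)

theory Defs
  imports "HOL-Analysis.Analysis"
begin

section \<open>Manifolds of finite differentiability class\<close>

text \<open>For an open set \<open>S\<close> this is membership in the class $C^k(S)$: the space is finite-dimensional,
  so continuity of the iterated directional derivatives suffices.\<close>

fun Ck_on :: "nat \<Rightarrow> 'a::euclidean_space set \<Rightarrow> ('a \<Rightarrow> 'b::euclidean_space) \<Rightarrow> bool" where
  "Ck_on 0 S f \<longleftrightarrow> continuous_on S f"
| "Ck_on (Suc k) S f \<longleftrightarrow> (\<forall>x\<in>S. f differentiable (at x)) \<and>
     (\<forall>v. Ck_on k S (\<lambda>x. frechet_derivative f (at x) v))"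

definition paracompact_space :: "'a topology \<Rightarrow> bool" where
  "paracompact_space X \<longleftrightarrow>
     (\<forall>\<U>. (\<forall>U\<in>\<U>. openin X U) \<and> \<Union>\<U> = topspace X \<longrightarrow>
        (\<exists>\<V>. (\<forall>V\<in>\<V>. openin X V \<and> (\<exists>U\<in>\<U>. V \<subseteq> U)) \<and> \<Union>\<V> = topspace X \<and> locally_finite_in X \<V>))"

text \<open>A chart is a domain together with a coordinate map; values of the map outside the domain
  are irrelevant.\<close>

type_synonym ('q, 'e) chart = "'q set \<times> ('q \<Rightarrow> 'e)"

definition is_chart :: "('q::topological_space, 'e::euclidean_space) chart \<Rightarrow> bool" where
  "is_chart c \<longleftrightarrow> open (fst c) \<and> open (snd c ` fst c) \<and>
     (\<exists>g. homeomorphism (fst c) (snd c ` fst c) (snd c) g)"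

definition chart_inv :: "('q, 'e) chart \<Rightarrow> 'e \<Rightarrow> 'q" where
  "chart_inv c = inv_into (fst c) (snd c)"

definition transition :: "('q, 'e) chart \<Rightarrow> ('q, 'e) chart \<Rightarrow> 'e \<Rightarrow> 'e" where
  "transition c c' = snd c' \<circ> chart_inv c"

definition Ck_atlas :: "nat \<Rightarrow> ('q::topological_space, 'e::euclidean_space) chart set \<Rightarrow> bool" where
  "Ck_atlas k A \<longleftrightarrow> (\<forall>c\<in>A. is_chart c) \<and> (\<Union>c\<in>A. fst c) = UNIV \<and>
     (\<forall>c\<in>A. \<forall>c'\<in>A. Ck_on k (snd c ` (fst c \<inter> fst c')) (transition c c'))"

text \<open>A tangent vector at \<open>q\<close> is given by its components in all charts around \<open>q\<close>, which transform
  by the derivatives of the coordinate changes. (Derivations are not an option: for finite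
  differentiability class they form an infinite-dimensional space.)  The components in the
  other charts are set to zero, so that distinct families are distinct vectors.\<close>

type_synonym ('q, 'e) tangent_vector = "('q, 'e) chart \<Rightarrow> 'e"

definition tangent_space ::
    "('q, 'e::euclidean_space) chart set \<Rightarrow> 'q \<Rightarrow> ('q, 'e) tangent_vector set" where
  "tangent_space A q = {v.
     (\<forall>c. \<not> (c \<in> A \<and> q \<in> fst c) \<longrightarrow> v c = 0) \<and>
     (\<forall>c\<in>A. \<forall>c'\<in>A. q \<in> fst c \<inter> fst c' \<longrightarrow>
        v c' = frechet_derivative (transition c c') (at (snd c q)) (v c))}"

text \<open>The tangent vector at \<open>q\<close> with components \<open>u\<close> in the chart \<open>c\<close>. For a chart \<open>c\<close> of \<open>A\<close> around
  \<open>q\<close>, the map \<open>coord_vector A c q\<close> is a bijection of the model space onto \<open>tangent_space A q\<close>,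
  and carries the linear structure over to it.\<close>

definition coord_vector ::
    "('q, 'e::euclidean_space) chart set \<Rightarrow> ('q, 'e) chart \<Rightarrow> 'q \<Rightarrow> 'e \<Rightarrow> ('q, 'e) tangent_vector" where
  "coord_vector A c q u = (\<lambda>c'. if c' \<in> A \<and> q \<in> fst c'
     then frechet_derivative (transition c c') (at (snd c q)) u else 0)"

definition C1_curve ::
    "('q::topological_space, 'e::euclidean_space) chart set \<Rightarrow> real \<Rightarrow> real \<Rightarrow> (real \<Rightarrow> 'q) \<Rightarrow> bool" where
  "C1_curve A \<alpha> \<beta> \<gamma> \<longleftrightarrow> continuous_on {\<alpha>..\<beta>} \<gamma> \<and>
     (\<forall>c\<in>A.
        (\<forall>s\<in>{\<alpha>..\<beta>}. \<gamma> s \<in> fst c \<longrightarrow> (snd c \<circ> \<gamma>) differentiable (at s within {\<alpha>..\<beta>})) \<and>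
        continuous_on {s\<in>{\<alpha>..\<beta>}. \<gamma> s \<in> fst c}
          (\<lambda>s. vector_derivative (snd c \<circ> \<gamma>) (at s within {\<alpha>..\<beta>})))"

definition velocity ::
    "('q, 'e::euclidean_space) chart set \<Rightarrow> real \<Rightarrow> real \<Rightarrow> (real \<Rightarrow> 'q) \<Rightarrow> real \<Rightarrow> ('q, 'e) tangent_vector" where
  "velocity A \<alpha> \<beta> \<gamma> s = (\<lambda>c. if c \<in> A \<and> \<gamma> s \<in> fst c
     then vector_derivative (snd c \<circ> \<gamma>) (at s within {\<alpha>..\<beta>}) else 0)"


section \<open>Generalized gravitational wave spacetimes\<close>

text \<open>The manifold \<open>Q\<close> is the whole type \<open>'q\<close>, with differentiable structure given by the
  atlas \<open>A\<close>; its dimension is \<open>DIM('e)\<close>. The arguments of \<open>a\<close>, \<open>b\<close>, \<open>V\<close> are the time, the point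
  and (for \<open>a\<close>, \<open>b\<close>) tangent vectors at the point; their values for \<open>t \<notin> T\<close> or for arguments that
  are not tangent vectors at \<open>q\<close> are irrelevant.\<close>

locale generalized_gravitational_wave =
  fixes r :: nat
    and A :: "('q::t2_space, 'e::euclidean_space) chart set"
    and T :: "real set"
    and a :: "real \<Rightarrow> 'q \<Rightarrow> ('q, 'e) tangent_vector \<Rightarrow> ('q, 'e) tangent_vector \<Rightarrow> real"
    and b :: "real \<Rightarrow> 'q \<Rightarrow> ('q, 'e) tangent_vector \<Rightarrow> real"
    and V :: "real \<Rightarrow> 'q \<Rightarrow> real"
  assumes r_ge_2: "2 \<le> r"
    and Q_connected: "connected (UNIV :: 'q set)"
    and Q_paracompact: "paracompact_space (euclidean :: 'q topology)"
    and Q_atlas: "Ck_atlas (r + 1) A"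
    and T_interval: "is_interval T" "open T"
    and a_bilinear: "\<And>t q c. \<lbrakk>t \<in> T; c \<in> A; q \<in> fst c\<rbrakk> \<Longrightarrow>
          bilinear (\<lambda>u w. a t q (coord_vector A c q u) (coord_vector A c q w))"
    and a_sym: "\<And>t q v w. \<lbrakk>t \<in> T; v \<in> tangent_space A q; w \<in> tangent_space A q\<rbrakk> \<Longrightarrow>
          a t q v w = a t q w v"
    and a_pos_def: "\<And>t q v. \<lbrakk>t \<in> T; v \<in> tangent_space A q; v \<noteq> (\<lambda>_. 0)\<rbrakk> \<Longrightarrow> 0 < a t q v v"
    and a_Cr: "\<And>c u w. c \<in> A \<Longrightarrow> Ck_on r (T \<times> snd c ` fst c)
          (\<lambda>(t, x). let q = chart_inv c x in a t q (coord_vector A c q u) (coord_vector A c q w))"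
    and b_linear: "\<And>t q c. \<lbrakk>t \<in> T; c \<in> A; q \<in> fst c\<rbrakk> \<Longrightarrow>
          linear (\<lambda>u. b t q (coord_vector A c q u))"
    and b_Cr: "\<And>c u. c \<in> A \<Longrightarrow> Ck_on r (T \<times> snd c ` fst c)
          (\<lambda>(t, x). let q = chart_inv c x in b t q (coord_vector A c q u))"
    and V_Cr: "\<And>c. c \<in> A \<Longrightarrow> Ck_on r (T \<times> snd c ` fst c) (\<lambda>(t, x). V t (chart_inv c x))"
begin

subsection \<open>Action functional\<close>

definition Lagrangian :: "real \<Rightarrow> 'q \<Rightarrow> ('q, 'e) tangent_vector \<Rightarrow> real" where
  "Lagrangian t q v = 1/2 * a t q v v + b t q v - V t q"

definition C1_curves_between :: "real \<times> 'q \<Rightarrow> real \<times> 'q \<Rightarrow> (real \<Rightarrow> 'q) set" where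
  "C1_curves_between e0 e1 =
     {\<gamma>. C1_curve A (fst e0) (fst e1) \<gamma> \<and> \<gamma> (fst e0) = snd e0 \<and> \<gamma> (fst e1) = snd e1}"

definition action :: "real \<times> 'q \<Rightarrow> real \<times> 'q \<Rightarrow> (real \<Rightarrow> 'q) \<Rightarrow> real" where
  "action e0 e1 \<gamma> =
     integral {fst e0..fst e1} (\<lambda>t. Lagrangian t (\<gamma> t) (velocity A (fst e0) (fst e1) \<gamma> t))"

definition coercive :: "real \<times> 'q \<Rightarrow> real \<times> 'q \<Rightarrow> bool" where
  "coercive e0 e1 \<longleftrightarrow>
     (\<forall>\<gamma> :: nat \<Rightarrow> real \<Rightarrow> 'q.
        (\<forall>n. \<gamma> n \<in> C1_curves_between e0 e1) \<and> (\<exists>B. \<forall>n. action e0 e1 (\<gamma> n) \<le> B) \<longrightarrow>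
        (\<exists>K. compact K \<and> (\<forall>n. \<gamma> n ` {fst e0..fst e1} \<subseteq> K)))"


subsection \<open>The spacetime\<close>

text \<open>Tangent vectors to $M = T \times Q \times \mathbb{R}$ at \<open>(t, q, y)\<close> are triples \<open>(\<tau>, v, \<eta>)\<close>
  with \<open>v\<close> tangent to \<open>Q\<close> at \<open>q\<close>, \<open>\<tau> = dt(X)\<close> and \<open>\<eta> = dy(X)\<close>.\<close>

definition M :: "(real \<times> 'q \<times> real) set" where
  "M = T \<times> UNIV \<times> UNIV"

fun metric :: "real \<times> 'q \<times> real \<Rightarrow> real \<times> ('q, 'e) tangent_vector \<times> real \<Rightarrow>
    real \<times> ('q, 'e) tangent_vector \<times> real \<Rightarrow> real" where
  "metric (t, q, y) (\<tau>, v, \<eta>) (\<tau>', v', \<eta>') =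
     a t q v v' - \<tau> * (\<eta>' - b t q v') - (\<eta> - b t q v) * \<tau>' - 2 * V t q * \<tau> * \<tau>'"

fun time_orientation :: "real \<times> 'q \<times> real \<Rightarrow> real \<times> ('q, 'e) tangent_vector \<times> real" where
  "time_orientation (t, q, y) = (1, (\<lambda>_. 0), - (V t q - 1/2))"

text \<open>In signature $(-,+,\dots,+)$ a causal vector lies in the same cone as the timelike vector
  \<open>W\<close> iff its product with \<open>W\<close> is negative.\<close>

definition future_causal_vector ::
    "real \<times> 'q \<times> real \<Rightarrow> real \<times> ('q, 'e) tangent_vector \<times> real \<Rightarrow> bool" where
  "future_causal_vector x X \<longleftrightarrow>
     X \<noteq> (0, (\<lambda>_. 0), 0) \<and> metric x X X \<le> 0 \<and> metric x X (time_orientation x) < 0"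

definition C1_curve_M :: "real \<Rightarrow> real \<Rightarrow> (real \<Rightarrow> real \<times> 'q \<times> real) \<Rightarrow> bool" where
  "C1_curve_M \<alpha> \<beta> \<gamma> \<longleftrightarrow> \<gamma> ` {\<alpha>..\<beta>} \<subseteq> M \<and>
     (\<lambda>s. fst (\<gamma> s)) differentiable_on {\<alpha>..\<beta>} \<and>
     continuous_on {\<alpha>..\<beta>} (\<lambda>s. vector_derivative (\<lambda>s. fst (\<gamma> s)) (at s within {\<alpha>..\<beta>})) \<and>
     C1_curve A \<alpha> \<beta> (\<lambda>s. fst (snd (\<gamma> s))) \<and>
     (\<lambda>s. snd (snd (\<gamma> s))) differentiable_on {\<alpha>..\<beta>} \<and>
     continuous_on {\<alpha>..\<beta>} (\<lambda>s. vector_derivative (\<lambda>s. snd (snd (\<gamma> s))) (at s within {\<alpha>..\<beta>}))"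

definition velocity_M ::
    "real \<Rightarrow> real \<Rightarrow> (real \<Rightarrow> real \<times> 'q \<times> real) \<Rightarrow> real \<Rightarrow> real \<times> ('q, 'e) tangent_vector \<times> real" where
  "velocity_M \<alpha> \<beta> \<gamma> s =
     (vector_derivative (\<lambda>s. fst (\<gamma> s)) (at s within {\<alpha>..\<beta>}),
      velocity A \<alpha> \<beta> (\<lambda>s. fst (snd (\<gamma> s))) s,
      vector_derivative (\<lambda>s. snd (snd (\<gamma> s))) (at s within {\<alpha>..\<beta>}))"

definition future_causal_C1_curve :: "real \<Rightarrow> real \<Rightarrow> (real \<Rightarrow> real \<times> 'q \<times> real) \<Rightarrow> bool" where
  "future_causal_C1_curve \<alpha> \<beta> \<gamma> \<longleftrightarrow> C1_curve_M \<alpha> \<beta> \<gamma> \<and>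
     (\<forall>s\<in>{\<alpha>..\<beta>}. future_causal_vector (\<gamma> s) (velocity_M \<alpha> \<beta> \<gamma> s))"

text \<open>Future-directed causal curves are piecewise $C^1$; at a breakpoint both one-sided
  velocities are future-directed causal.\<close>

definition future_causal_curve :: "real \<Rightarrow> real \<Rightarrow> (real \<Rightarrow> real \<times> 'q \<times> real) \<Rightarrow> bool" where
  "future_causal_curve \<alpha> \<beta> \<gamma> \<longleftrightarrow>
     (\<exists>(n::nat) p. 0 < n \<and> p 0 = \<alpha> \<and> p n = \<beta> \<and>
        (\<forall>i<n. p i < p (Suc i) \<and> future_causal_C1_curve (p i) (p (Suc i)) \<gamma>))"

definition J_plus :: "real \<times> 'q \<times> real \<Rightarrow> (real \<times> 'q \<times> real) set" where
  "J_plus x = {x} \<union> {\<gamma> \<beta> |\<alpha> \<beta> \<gamma>. future_causal_curve \<alpha> \<beta> \<gamma> \<and> \<gamma> \<alpha> = x}"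

definition J_minus :: "real \<times> 'q \<times> real \<Rightarrow> (real \<times> 'q \<times> real) set" where
  "J_minus x = {x} \<union> {\<gamma> \<alpha> |\<alpha> \<beta> \<gamma>. future_causal_curve \<alpha> \<beta> \<gamma> \<and> \<gamma> \<beta> = x}"

text \<open>Reversing a past-directed closed causal curve makes it future-directed, so it suffices to
  exclude the latter.\<close>

definition causal :: bool where
  "causal \<longleftrightarrow> \<not> (\<exists>\<alpha> \<beta> \<gamma>. future_causal_curve \<alpha> \<beta> \<gamma> \<and> \<gamma> \<alpha> = \<gamma> \<beta>)"

definition globally_hyperbolic :: bool where
  "globally_hyperbolic \<longleftrightarrow> causal \<and> (\<forall>x0\<in>M. \<forall>x1\<in>M. compact (J_plus x0 \<inter> J_minus x1))"

end

end

theory Submission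
  imports Defs
begin

text \<open>Write \<open>w = \<eta> - b(v) + V \<tau>\<close> for a tangent vector \<open>(\<tau>, v, \<eta>)\<close>. It is future-directed causal iff
  \<open>\<tau>, w \<ge> 0\<close> do not both vanish and \<open>a(v, v) \<le> 2 \<tau> w\<close>; for \<open>\<tau> = 1\<close> this says \<open>\<eta> \<ge> L(v)\<close>. So a curve of
  action at most \<open>y\<^sub>1 - y\<^sub>0\<close> lifts to a causal curve, and compactness of causal diamonds
  projects to coercivity. Causality itself is automatic, since \<open>(t, y)\<close> increases
  lexicographically along causal curves.

  Conversely, a causal curve is approximated by a curve parametrised by time, whose action
  exceeds the increment of \<open>y\<close> by arbitrarily little. By coercivity and an exhaustion of \<open>Q\<close> by compact sets,
  all these curves stay in one compact set, so a causal diamond is relatively compact. To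
  see that it is closed, a converging sequence of curves is cut into short arcs, and the arcs of the limit are
  replaced by minimisers of the action. On short intervals these are found by solving the
  boundary value problem for the Euler-Lagrange equation with Banach's fixed point theorem; a Taylor
  estimate shows that the solution has the least action among all curves in the chart. No
  Sobolev spaces are needed, because the action is lower semicontinuous along curves whose
  endpoints are corrected by affine functions.\<close>

section \<open>Bounds for functions of class C2\<close>

text \<open>Causal futures are defined with piecewise C1 curves, whereas a limit of curves of
  bounded action is a priori only of class H1. That the coefficients are C2 enters twice: it makes
  the acceleration locally Lipschitz, and it leaves a quadratic Taylor remainder. Arcs of varying
  duration \<open>h\<close> are brought to the fixed interval [0, 1] by making the Lagrangian a
  quadratic form in the pair \<open>(h, u)\<close>; changes of the end times are then perturbations
  like changes of the end points. Coercivity concerns fixed end events. A point of a diamond is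
  therefore reached by one approximating curve that joins the two tips, with separate control of the
  action before and after that point. The Lagrangian has no sign, but over a compact part of
  \<open>Q\<close> it is bounded below, so a bound for the whole action bounds the action of every
  subarc. \<open>Q\<close> carries no metric: all estimates are made in charts and spread over
  compact sets by finite covers.\<close>

lemma Ck_on_cong:
  assumes "open S" "\<And>x. x \<in> S \<Longrightarrow> f x = g x"
  shows "Ck_on k S f \<longleftrightarrow> Ck_on k S g"
  using assms(2)
proof (induction k arbitrary: f g)
  case 0
  then show ?case by (simp cong: continuous_on_cong)
next
  case (Suc k)
  \<comment> \<open>\<open>frechet_derivative\<close> is a choice among the derivatives at a point.
    Since both functions have the same ones, the choices coincide, also where there is none.\<close>
  have D: "(f has_derivative D) (at x) \<longleftrightarrow> (g has_derivative D) (at x)" if "x \<in> S" for x D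
    using has_derivative_transform_within_open[OF _ assms(1) that, of _ D UNIV] Suc.prems by metis
  then have "frechet_derivative f (at x) = frechet_derivative g (at x)" if "x \<in> S" for x
    using that by (simp add: frechet_derivative_def)
  then have "Ck_on k S (\<lambda>x. frechet_derivative f (at x) v) \<longleftrightarrow>
      Ck_on k S (\<lambda>x. frechet_derivative g (at x) v)" for v
    by (intro Suc.IH) simp
  moreover have "f differentiable (at x) \<longleftrightarrow> g differentiable (at x)" if "x \<in> S" for x
    using D[OF that] by (simp add: differentiable_def)
  ultimately show ?case by simp
qed

lemma Ck_on_SucD: "Ck_on (Suc k) S f \<Longrightarrow> Ck_on k S f"
proof (induction k arbitrary: f)
  case 0
  then show ?case
    by (auto intro!: continuous_at_imp_continuous_on differentiable_imp_continuous_within)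
next
  case (Suc k)
  then show ?case by (metis Ck_on.simps(2))
qed

lemma Ck_on_antimono: "j \<le> k \<Longrightarrow> Ck_on k S f \<Longrightarrow> Ck_on j S f"
  by (induction k rule: dec_induct) (blast dest: Ck_on_SucD)+

text \<open>With the lemma on multiples this covers the coordinate form, which for fixed vectors is
  a linear combination of the given coefficients. Openness of \<open>S\<close> enters because the
  derivative of the sum is rewritten on \<open>S\<close> only.\<close>

lemma Ck_on_add:
  assumes "open S" "Ck_on k S f" "Ck_on k S g"
  shows "Ck_on k S (\<lambda>x. f x + g x)"
  using assms(2,3)
proof (induction k arbitrary: f g)
  case 0
  then show ?case by (auto intro: continuous_on_add)
next
  case (Suc k)
  have "frechet_derivative (\<lambda>x. f x + g x) (at x) v =
      frechet_derivative f (at x) v + frechet_derivative g (at x) v" if "x \<in> S" for x v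
  proof -
    have "((\<lambda>x. f x + g x) has_derivative
        (\<lambda>v. frechet_derivative f (at x) v + frechet_derivative g (at x) v)) (at x)"
      using Suc.prems that by (intro has_derivative_add) (auto intro: iffD1[OF frechet_derivative_works])
    from frechet_derivative_at[OF this] show ?thesis by metis
  qed
  then have "Ck_on k S (\<lambda>x. frechet_derivative (\<lambda>x. f x + g x) (at x) v)" for v
    using Suc by (subst Ck_on_cong[OF assms(1)]) auto
  then show ?case using Suc.prems by auto
qed

lemma Ck_on_scaleR:
  assumes "open S" "Ck_on k S f"
  shows "Ck_on k S (\<lambda>x. (c::real) *\<^sub>R f x)"
  using assms(2)
proof (induction k arbitrary: f)
  case 0
  then show ?case by (auto intro!: continuous_intros)
next
  case (Suc k)
  have "frechet_derivative (\<lambda>x. c *\<^sub>R f x) (at x) v =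
      c *\<^sub>R frechet_derivative f (at x) v" if "x \<in> S" for x v
  proof -
    have "((\<lambda>x. c *\<^sub>R f x) has_derivative (\<lambda>v. c *\<^sub>R frechet_derivative f (at x) v)) (at x)"
      using Suc.prems that
      by (intro has_derivative_scaleR_right) (auto intro: iffD1[OF frechet_derivative_works])
    from frechet_derivative_at[OF this] show ?thesis by metis
  qed
  then have "Ck_on k S (\<lambda>x. frechet_derivative (\<lambda>x. c *\<^sub>R f x) (at x) v)" for v
    using Suc by (subst Ck_on_cong[OF assms(1)]) auto
  then show ?case using Suc.prems by auto
qed

lemma continuous_on_compact_bound:
  fixes f :: "'a::topological_space \<Rightarrow> real"
  assumes "compact P" "continuous_on P f"
  obtains B where "0 \<le> B" "\<And>x. x \<in> P \<Longrightarrow> \<bar>f x\<bar> \<le> B"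
proof -
  have "bounded (f ` P)" by (intro compact_imp_bounded compact_continuous_image assms)
  then obtain B where "\<And>x. x \<in> P \<Longrightarrow> \<bar>f x\<bar> \<le> B" by (auto simp: bounded_iff)
  then show ?thesis using that[of "\<bar>B\<bar>"] by force
qed

lemma mult_right_mono_trans:
  fixes x c d n :: real
  shows "x \<le> c * n \<Longrightarrow> c \<le> d \<Longrightarrow> 0 \<le> n \<Longrightarrow> x \<le> d * n"
  using mult_right_mono order_trans by blast

text \<open>The factor \<open>k\<close> is kept apart from the constants \<open>c i\<close>, so that
  the same constants serve at all points while \<open>k\<close> is 1, a distance between points, or
  the norm of a direction.\<close>

lemma linear_basis_bound:
  fixes L :: "'a::euclidean_space \<Rightarrow> real"
  assumes "linear L" "\<And>i. i \<in> Basis \<Longrightarrow> \<bar>L i\<bar> \<le> c i * k"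
  shows "\<bar>L Z\<bar> \<le> (\<Sum>i\<in>Basis. c i) * k * norm Z"
proof -
  have "L Z = (\<Sum>i\<in>Basis. (Z \<bullet> i) * L i)"
    by (subst euclidean_representation[of Z, symmetric])
      (simp add: linear_sum[OF assms(1)] linear_scale[OF assms(1)] del: euclidean_representation)
  also have "\<bar>\<dots>\<bar> \<le> (\<Sum>i\<in>Basis. norm Z * (c i * k))"
    by (intro order_trans[OF sum_abs] sum_mono)
      (auto simp: abs_mult Basis_le_norm assms intro!: mult_mono)
  also have "\<dots> = (\<Sum>i\<in>Basis. c i) * k * norm Z"
    by (simp add: sum_distrib_left sum_distrib_right algebra_simps)
  finally show ?thesis .
qed

lemma bilinear_basis_bound:
  fixes L :: "'a::euclidean_space \<Rightarrow> 'a \<Rightarrow> real"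
  assumes "bilinear L" "\<And>i j. i \<in> Basis \<Longrightarrow> j \<in> Basis \<Longrightarrow> \<bar>L i j\<bar> \<le> c i j * k"
  shows "\<bar>L U W\<bar> \<le> (\<Sum>i\<in>Basis. \<Sum>j\<in>Basis. c i j) * k * norm U * norm W"
proof -
  have "\<bar>L i W\<bar> \<le> (\<Sum>j\<in>Basis. c i j) * (k * norm W)" if "i \<in> Basis" for i
    using linear_basis_bound[of "L i" "c i" k W] assms that by (simp add: bilinear_def algebra_simps)
  then show ?thesis
    using linear_basis_bound[of "\<lambda>U. L U W" "\<lambda>i. \<Sum>j\<in>Basis. c i j" "k * norm W" U] assms(1)
    by (simp add: bilinear_def algebra_simps)
qed

text \<open>Each directional derivative is bounded on the compact set. The bounds in the basis
  directions add up to a bound for the operator norm, and convexity lets the mean value inequality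
  turn it into a Lipschitz constant.\<close>

lemma C1_lipschitz:
  fixes f :: "'a::euclidean_space \<Rightarrow> real"
  assumes "Ck_on 1 S f" "P \<subseteq> S" "compact P" "convex P"
  obtains C where "0 \<le> C" "\<And>x. x \<in> P \<Longrightarrow> \<bar>f x\<bar> \<le> C"
    "\<And>x Z. x \<in> P \<Longrightarrow> \<bar>frechet_derivative f (at x) Z\<bar> \<le> C * norm Z"
    "\<And>x y. x \<in> P \<Longrightarrow> y \<in> P \<Longrightarrow> \<bar>f y - f x\<bar> \<le> C * norm (y - x)"
proof -
  have 1: "f differentiable (at x)" if "x \<in> P" for x using assms that by auto
  have 2: "continuous_on P (\<lambda>x. frechet_derivative f (at x) v)" for v
    using assms by (auto intro: continuous_on_subset)
  have "continuous_on P f"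
    using 1 by (auto intro!: continuous_at_imp_continuous_on differentiable_imp_continuous_within)
  then obtain B where B: "0 \<le> B" "\<And>x. x \<in> P \<Longrightarrow> \<bar>f x\<bar> \<le> B"
    using continuous_on_compact_bound[OF assms(3)] by metis
  have "\<exists>B\<ge>0. \<forall>x\<in>P. \<bar>frechet_derivative f (at x) v\<bar> \<le> B" for v
    using continuous_on_compact_bound[OF assms(3) 2] by metis
  then obtain D where D: "\<And>v. 0 \<le> D v" "\<And>v x. x \<in> P \<Longrightarrow> \<bar>frechet_derivative f (at x) v\<bar> \<le> D v"
    by metis
  let ?D = "\<Sum>i\<in>(Basis::'a set). D i"
  have 3: "\<bar>frechet_derivative f (at x) Z\<bar> \<le> ?D * norm Z" if "x \<in> P" for x Z
    using linear_basis_bound[of "frechet_derivative f (at x)" D 1 Z] D(2) that 1[OF that]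
    by (simp add: linear_frechet_derivative)
  have 4: "\<bar>f y - f x\<bar> \<le> ?D * norm (y - x)" if "x \<in> P" "y \<in> P" for x y
  proof -
    have "norm (f y - f x) \<le> ?D * norm (y - x)"
    proof (rule differentiable_bound[OF assms(4)])
      fix z assume z: "z \<in> P"
      show "(f has_derivative frechet_derivative f (at z)) (at z within P)"
        using 1[OF z] by (rule has_derivative_at_withinI[OF iffD1[OF frechet_derivative_works]])
      show "onorm (frechet_derivative f (at z)) \<le> ?D" using 3[OF z] by (intro onorm_le) simp
    qed (use that in auto)
    then show ?thesis by simp
  qed
  have "0 \<le> ?D" by (intro sum_nonneg D)
  then show ?thesis
  proof (intro that[of "B + ?D"])
    fix x y Z :: 'a assume "x \<in> P"
    then show "\<bar>f x\<bar> \<le> B + ?D" using B(2) \<open>0 \<le> ?D\<close> by fastforce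
    show "\<bar>frechet_derivative f (at x) Z\<bar> \<le> (B + ?D) * norm Z"
      by (rule mult_right_mono_trans[OF 3[OF \<open>x \<in> P\<close>, of Z]]) (use B(1) in auto)
    assume "y \<in> P"
    show "\<bar>f y - f x\<bar> \<le> (B + ?D) * norm (y - x)"
      using \<open>y \<in> P\<close> by (intro mult_right_mono_trans[OF 4[OF \<open>x \<in> P\<close>]]) (use B(1) in auto)
  qed (use B in auto)
qed

text \<open>The Lipschitz estimate is applied to the directional derivatives. On the segment from
  \<open>x\<close> to \<open>y\<close> the derivative then differs from that at \<open>x\<close> by
  at most a multiple of the distance, and the mean value inequality for the linearisation gives the
  quadratic remainder, without its factor 1/2.\<close>

lemma C2_bounds:
  fixes f :: "'a::euclidean_space \<Rightarrow> real"
  assumes "Ck_on 2 S f" "P \<subseteq> S" "compact P" "convex P"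
  obtains C where "0 \<le> C" "\<And>x. x \<in> P \<Longrightarrow> \<bar>f x\<bar> \<le> C"
    "\<And>x Z. x \<in> P \<Longrightarrow> \<bar>frechet_derivative f (at x) Z\<bar> \<le> C * norm Z"
    "\<And>x y. x \<in> P \<Longrightarrow> y \<in> P \<Longrightarrow> \<bar>f y - f x\<bar> \<le> C * norm (y - x)"
    "\<And>x y Z. x \<in> P \<Longrightarrow> y \<in> P \<Longrightarrow>
       \<bar>frechet_derivative f (at y) Z - frechet_derivative f (at x) Z\<bar> \<le> C * norm (y - x) * norm Z"
    "\<And>x y. x \<in> P \<Longrightarrow> y \<in> P \<Longrightarrow>
       \<bar>f y - f x - frechet_derivative f (at x) (y - x)\<bar> \<le> C * norm (y - x) ^ 2"
proof -
  let ?d = "\<lambda>x. frechet_derivative f (at x)"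
  have "Ck_on 1 S f" using assms(1) Ck_on_antimono[of 1 2] by simp
  from C1_lipschitz[OF this assms(2-4)] obtain C where C: "0 \<le> C" "\<And>x. x \<in> P \<Longrightarrow> \<bar>f x\<bar> \<le> C"
    "\<And>x Z. x \<in> P \<Longrightarrow> \<bar>?d x Z\<bar> \<le> C * norm Z"
    "\<And>x y. x \<in> P \<Longrightarrow> y \<in> P \<Longrightarrow> \<bar>f y - f x\<bar> \<le> C * norm (y - x)"
    by metis
  have lin: "linear (?d x)" if "x \<in> P" for x
    using assms that by (auto simp: numeral_2_eq_2 intro: linear_frechet_derivative)
  have "Ck_on 1 S (\<lambda>x. ?d x v)" for v using assms(1) by (simp add: numeral_2_eq_2)
  then have "\<exists>D\<ge>0. \<forall>x\<in>P. \<forall>y\<in>P. \<bar>?d y v - ?d x v\<bar> \<le> D * norm (y - x)" for v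
    by (rule C1_lipschitz[OF _ assms(2-4), of "\<lambda>x. ?d x v"]) auto
  then obtain D where D: "\<And>v. 0 \<le> D v"
     "\<And>v x y. x \<in> P \<Longrightarrow> y \<in> P \<Longrightarrow> \<bar>?d y v - ?d x v\<bar> \<le> D v * norm (y - x)"
    by metis
  let ?D = "\<Sum>i\<in>(Basis::'a set). D i"
  have D0: "0 \<le> ?D" by (intro sum_nonneg D)
  have 3: "\<bar>?d y Z - ?d x Z\<bar> \<le> ?D * norm (y - x) * norm Z" if "x \<in> P" "y \<in> P" for x y Z
    using linear_basis_bound[of "\<lambda>Z. ?d y Z - ?d x Z" D "norm (y - x)" Z] D(2)[OF that] lin that
    by (simp add: linear_compose_sub)
  have 4: "\<bar>f y - f x - ?d x (y - x)\<bar> \<le> ?D * norm (y - x) ^ 2" if xy: "x \<in> P" "y \<in> P" for x y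
  proof -
    let ?S = "closed_segment x y"
    have S: "?S \<subseteq> P" using xy assms(4) by (simp add: closed_segment_subset)
    have "norm (f y - f x - ?d x (y - x)) \<le> norm (y - x) * (?D * norm (y - x))"
    proof (rule differentiable_bound_linearization[where S = ?S])
      show "x + t *\<^sub>R (y - x) \<in> ?S" if "t \<in> {0..1}" for t
        using that by (force simp: closed_segment_def algebra_simps)
      show "(f has_derivative ?d z) (at z within ?S)" if "z \<in> ?S" for z
      proof -
        have "f differentiable (at z)" using that S assms(1,2) by (auto simp: numeral_2_eq_2)
        then show ?thesis by (rule has_derivative_at_withinI[OF iffD1[OF frechet_derivative_works]])
      qed
      show "onorm (?d z - ?d x) \<le> ?D * norm (y - x)" if z: "z \<in> ?S" for z
      proof (rule onorm_le)
        fix Z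
        have "norm ((?d z - ?d x) Z) \<le> ?D * norm (z - x) * norm Z"
          using 3[of x z Z] S z xy by auto
        also have "\<dots> \<le> ?D * norm (y - x) * norm Z"
          using z segment_bound1[of z x y] D0 by (intro mult_right_mono mult_left_mono) auto
        finally show "norm ((?d z - ?d x) Z) \<le> ?D * norm (y - x) * norm Z" .
      qed
    qed auto
    then show ?thesis by (simp add: power2_eq_square algebra_simps)
  qed
  show ?thesis
  proof (intro that[of "C + ?D"])
    fix x y Z :: 'a assume "x \<in> P"
    then show "\<bar>f x\<bar> \<le> C + ?D" using C(2) D0 by fastforce
    show "\<bar>?d x Z\<bar> \<le> (C + ?D) * norm Z"
      by (rule mult_right_mono_trans[OF C(3)[OF \<open>x \<in> P\<close>, of Z]]) (use D0 in auto)
    assume "y \<in> P"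
    show "\<bar>f y - f x\<bar> \<le> (C + ?D) * norm (y - x)"
      using \<open>y \<in> P\<close> by (intro mult_right_mono_trans[OF C(4)[OF \<open>x \<in> P\<close>]]) (use D0 in auto)
    show "\<bar>?d y Z - ?d x Z\<bar> \<le> (C + ?D) * norm (y - x) * norm Z"
      using mult_right_mono_trans[of _ ?D "norm (y - x) * norm Z" "C + ?D"]
        3[OF \<open>x \<in> P\<close> \<open>y \<in> P\<close>, of Z] C(1) by (simp add: mult.assoc)
    show "\<bar>f y - f x - ?d x (y - x)\<bar> \<le> (C + ?D) * norm (y - x) ^ 2"
      by (rule mult_right_mono_trans[OF 4[OF \<open>x \<in> P\<close> \<open>y \<in> P\<close>]]) (use C(1) in auto)
  qed (use C D0 in auto)
qed

section \<open>Local minimisers of a quadratic Lagrangian\<close>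

text \<open>Continuity and differentiability of the form are known only for fixed vectors. This
  expansion transfers them to vectors that move with the parameter.\<close>

lemma bilinear_expand:
  fixes L :: "'a::euclidean_space \<Rightarrow> 'a \<Rightarrow> real"
  assumes "bilinear L"
  shows "L U W = (\<Sum>i\<in>Basis. \<Sum>j\<in>Basis. (U \<bullet> i) * (W \<bullet> j) * L i j)"
proof -
  have "L U W = L (\<Sum>i\<in>Basis. (U \<bullet> i) *\<^sub>R i) (\<Sum>j\<in>Basis. (W \<bullet> j) *\<^sub>R j)"
    by (simp only: euclidean_representation)
  also have "\<dots> = (\<Sum>(i, j)\<in>Basis \<times> Basis. L ((U \<bullet> i) *\<^sub>R i) ((W \<bullet> j) *\<^sub>R j))"
    by (simp add: bilinear_sum[OF assms])
  finally show ?thesis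
    by (simp add: sum.cartesian_product bilinear_lmul[OF assms] bilinear_rmul[OF assms] mult_ac)
qed

text \<open>Everything that the local variational problem uses of the action, over a compact time
  interval and a closed ball in one chart. \<open>DG e Z\<close> is the derivative of
  \<open>G\<close> at \<open>e\<close> in direction \<open>Z\<close>. One constant \<open>C\<close>
  serves for all upper bounds; ellipticity \<open>pos\<close> concerns space vectors only, since the
  form may be negative in the time direction.\<close>

locale lagrangian_box =
  fixes G :: "real \<times> 'e::euclidean_space \<Rightarrow> real \<times> 'e \<Rightarrow> real \<times> 'e \<Rightarrow> real"
    and DG :: "real \<times> 'e \<Rightarrow> real \<times> 'e \<Rightarrow> real \<times> 'e \<Rightarrow> real \<times> 'e \<Rightarrow> real"
    and \<alpha> \<beta> :: real and xc :: 'e and \<rho> C c :: real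
  assumes C_pos: "0 < C" and c_pos: "0 < c"
    and bil: "\<And>e. e \<in> {\<alpha>..\<beta>} \<times> cball xc \<rho> \<Longrightarrow> bilinear (G e)"
    and sym: "\<And>e U W. e \<in> {\<alpha>..\<beta>} \<times> cball xc \<rho> \<Longrightarrow> G e U W = G e W U"
    and Dlin: "\<And>e U W. e \<in> {\<alpha>..\<beta>} \<times> cball xc \<rho> \<Longrightarrow> linear (\<lambda>Z. DG e Z U W)"
    and Dbil: "\<And>e Z. e \<in> {\<alpha>..\<beta>} \<times> cball xc \<rho> \<Longrightarrow> bilinear (DG e Z)"
    and deriv: "\<And>e U W. e \<in> {\<alpha>..\<beta>} \<times> cball xc \<rho> \<Longrightarrow>
        ((\<lambda>e. G e U W) has_derivative (\<lambda>Z. DG e Z U W)) (at e)"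
    and bound: "\<And>e U W. e \<in> {\<alpha>..\<beta>} \<times> cball xc \<rho> \<Longrightarrow> \<bar>G e U W\<bar> \<le> C * norm U * norm W"
    and Dbound: "\<And>e Z U W. e \<in> {\<alpha>..\<beta>} \<times> cball xc \<rho> \<Longrightarrow>
        \<bar>DG e Z U W\<bar> \<le> C * norm Z * norm U * norm W"
    and lip: "\<And>e e' U W. e \<in> {\<alpha>..\<beta>} \<times> cball xc \<rho> \<Longrightarrow> e' \<in> {\<alpha>..\<beta>} \<times> cball xc \<rho> \<Longrightarrow>
        \<bar>G e' U W - G e U W\<bar> \<le> C * norm (e' - e) * norm U * norm W"
    and Dlip: "\<And>e e' Z U W. e \<in> {\<alpha>..\<beta>} \<times> cball xc \<rho> \<Longrightarrow> e' \<in> {\<alpha>..\<beta>} \<times> cball xc \<rho> \<Longrightarrow>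
        \<bar>DG e' Z U W - DG e Z U W\<bar> \<le> C * norm (e' - e) * norm Z * norm U * norm W"
    and taylor: "\<And>e e' U W. e \<in> {\<alpha>..\<beta>} \<times> cball xc \<rho> \<Longrightarrow> e' \<in> {\<alpha>..\<beta>} \<times> cball xc \<rho> \<Longrightarrow>
        \<bar>G e' U W - G e U W - DG e (e' - e) U W\<bar> \<le> C * (norm (e' - e))\<^sup>2 * norm U * norm W"
    and pos: "\<And>e u. e \<in> {\<alpha>..\<beta>} \<times> cball xc \<rho> \<Longrightarrow> c * (norm u)\<^sup>2 \<le> G e (0, u) (0, u)"
begin

abbreviation box where "box \<equiv> {\<alpha>..\<beta>} \<times> cball xc \<rho>"

text \<open>Arcs are rescaled to the parameter interval \<open>[0, 1]\<close>: an arc of duration \<open>h\<close> has the extended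
  velocity \<open>U = (h, u)\<close>, and its action is the integral of \<open>G U U / (2 h)\<close>. The acceleration comes from the
  Euler-Lagrange equation for variations of the space components only.\<close>

definition accel :: "real \<times> 'e \<Rightarrow> real \<times> 'e \<Rightarrow> 'e" where
  "accel e U = (SOME F. \<forall>z. G e (0, F) (0, z) = DG e (0, z) U U / 2 - DG e U U (0, z))"

lemma linear_Pair0: "linear (\<lambda>z. (0::real, z::'e))"
  by (auto intro!: linearI)

text \<open>Positivity makes the restriction of \<open>G e\<close> to space vectors an injective,
  hence bijective, linear map of the finite-dimensional model space into its dual, identified with
  the space itself by the inner product. The right-hand side is linear in \<open>z\<close>, so it is
  represented by some \<open>F\<close>.\<close>

lemma accel:
  assumes "e \<in> box"
  shows "G e (0, accel e U) (0, z) = DG e (0, z) U U / 2 - DG e U U (0, z)"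
proof -
  define f where "f z = DG e (0, z) U U / 2 - DG e U U (0, z)" for z
  have 1: "linear (\<lambda>z. DG e (0, z) U U)"
    using linear_compose[OF linear_Pair0 Dlin[OF assms, of U U]] by (simp add: o_def)
  have 2: "linear (\<lambda>z. DG e U U (0, z))"
  proof -
    have "linear (DG e U U)" using Dbil[OF assms, of U] unfolding bilinear_def by blast
    from linear_compose[OF linear_Pair0 this] show ?thesis by (simp add: o_def)
  qed
  have f: "linear f"
    unfolding f_def using linear_compose_sub[OF linear_compose_scale_right[OF 1, of "1/2"] 2] by simp
  have G2: "linear (\<lambda>z. G e U (0, z))" for U
  proof -
    have "linear (G e U)" using bil[OF assms] unfolding bilinear_def by blast
    from linear_compose[OF linear_Pair0 this] show ?thesis by (simp add: o_def)
  qed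
  have G1: "linear (\<lambda>F. G e (0, F) W)" for W
  proof -
    have "linear (\<lambda>U. G e U W)" using bil[OF assms] unfolding bilinear_def by blast
    from linear_compose[OF linear_Pair0 this] show ?thesis by (simp add: o_def)
  qed
  have riesz: "g z = (\<Sum>i\<in>Basis. g i *\<^sub>R i) \<bullet> z" if "linear g" for g :: "'e \<Rightarrow> real" and z
  proof -
    have "g z = g (\<Sum>i\<in>Basis. (z \<bullet> i) *\<^sub>R i)" by (simp only: euclidean_representation)
    also have "\<dots> = (\<Sum>i\<in>Basis. g i * (i \<bullet> z))"
      by (simp add: linear_sum[OF that] linear_scale[OF that] inner_commute mult.commute)
    finally show ?thesis by (simp add: inner_sum_left)
  qed
  define L where "L F = (\<Sum>i\<in>Basis. G e (0, F) (0, i) *\<^sub>R i)" for F :: 'e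
  have L: "L F \<bullet> z = G e (0, F) (0, z)" for F z
    unfolding L_def by (rule riesz[OF G2, symmetric])
  have "linear L"
  proof (rule linearI)
    show "L (x + y) = L x + L y" for x y
      unfolding L_def linear_add[OF G1] scaleR_left_distrib sum.distrib ..
    show "L (k *\<^sub>R x) = k *\<^sub>R L x" for k x
      unfolding L_def linear_scale[OF G1] scaleR_sum_right by simp
  qed
  moreover have "inj L"
  proof (subst linear_injective_0[OF \<open>linear L\<close>], intro allI impI)
    fix F assume "L F = 0"
    then have "G e (0, F) (0, F) = 0" using L[of F F] by simp
    then have "c * (norm F)\<^sup>2 \<le> 0" using pos[OF assms, of F] by simp
    then show "F = 0" using c_pos by (simp add: mult_le_0_iff)
  qed
  ultimately have "surj L" using linear_injective_imp_surjective by blast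
  then obtain F where F: "L F = (\<Sum>i\<in>Basis. f i *\<^sub>R i)" by (metis surjD)
  have "\<exists>F. \<forall>z. G e (0, F) (0, z) = DG e (0, z) U U / 2 - DG e U U (0, z)"
    using L[of F] riesz[OF f] F by (auto simp: f_def)
  from someI_ex[OF this] show ?thesis unfolding accel_def by blast
qed

text \<open>Ellipticity yields \<open>c * norm d * norm d \<le> B * norm d\<close>, and one factor
  cancels. The bounds for the acceleration arise in this way, by testing its equation with the
  vector to be estimated.\<close>

lemma pos_imp_norm_le:
  assumes "e \<in> box" "G e (0, d) (0, d) \<le> B * norm d" "0 \<le> B"
  shows "norm d \<le> B / c"
proof (cases "d = 0")
  case False
  have "c * norm d * norm d \<le> B * norm d"
    using pos[OF assms(1), of d] assms(2) by (simp add: power2_eq_square)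
  then show ?thesis using False c_pos by (simp add: field_simps)
qed (use assms c_pos in auto)

lemma accel_norm:
  assumes "e \<in> box"
  shows "norm (accel e U) \<le> 2 * C / c * (norm U)\<^sup>2"
proof -
  let ?F = "accel e U"
  have "G e (0, ?F) (0, ?F) \<le> 2 * C * (norm U)\<^sup>2 * norm ?F"
    using accel[OF assms, of U ?F] Dbound[OF assms, of "(0, ?F)" U U] Dbound[OF assms, of U U "(0, ?F)"] C_pos
    by (simp add: power2_eq_square algebra_simps)
  from pos_imp_norm_le[OF assms this] show ?thesis using C_pos by (simp add: mult.assoc)
qed

text \<open>The two derivative terms contribute 3 C, of which one third carries the factor 1/2 of
  the equation. The second summand is the Lipschitz constant of \<open>G\<close> times the bound for
  the acceleration. The outer division is by the ellipticity constant.\<close>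

definition "accel_lip = (3 * C + 2 * C\<^sup>2 / c) / c"

lemma accel_lipschitz:
  assumes e: "e \<in> box" and e': "e' \<in> box" and U: "norm U \<le> m" "norm U' \<le> m"
  shows "norm (accel e' U' - accel e U) \<le> accel_lip * (m\<^sup>2 * norm (e' - e) + m * norm (U' - U))"
proof -
  let ?F = "accel e U" and ?F' = "accel e' U'"
  define d where "d = ?F' - ?F"
  define D where "D = (0::real, d)"
  define k where "k = norm (e' - e)"
  define l where "l = norm (U' - U)"
  have m: "0 \<le> m" using U norm_ge_zero order_trans by blast
  have k: "0 \<le> k" and l: "0 \<le> l" by (auto simp: k_def l_def)
  have nD: "norm D = norm d" by (simp add: D_def)
  have C0: "0 \<le> C" using C_pos by simp
  note b = bilinear_lsub bilinear_rsub bilinear_ladd bilinear_radd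
  \<comment> \<open>Both equations are tested with the difference of the accelerations. The last
    bracket appears because they hold for different inner products, at \<open>e\<close> and at
    \<open>e'\<close>.\<close>
  have G: "G e' D D = (DG e' D U' U' / 2 - DG e' U' U' D) - (DG e D U U / 2 - DG e U U D)
      - (G e' (0, ?F) D - G e (0, ?F) D)"
  proof -
    have "D = (0, ?F') - (0, ?F)" by (simp add: D_def d_def)
    then have "G e' D D = G e' (0, ?F') D - G e' (0, ?F) D" using b(1)[OF bil[OF e']] by metis
    then show ?thesis using accel[OF e, of U d] accel[OF e', of U' d] by (simp add: D_def)
  qed
  have 1: "\<bar>DG e' D U' U' - DG e D U U\<bar> \<le> (C * 2 * m * l + C * k * m\<^sup>2) * norm d"
  proof -
    have "DG e' D U' U' - DG e D U U = DG e' D (U' - U) U' + DG e' D U (U' - U) + (DG e' D U U - DG e D U U)"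
      using b[OF Dbil[OF e']] by simp
    moreover have "\<bar>DG e' D (U' - U) U'\<bar> \<le> C * norm d * l * m"
      using U C0 m by (intro order_trans[OF Dbound[OF e']]) (auto simp: nD l_def intro!: mult_mono mult_nonneg_nonneg)
    moreover have "\<bar>DG e' D U (U' - U)\<bar> \<le> C * norm d * m * l"
      using U C0 m by (intro order_trans[OF Dbound[OF e']]) (auto simp: nD l_def intro!: mult_mono mult_nonneg_nonneg)
    moreover have "\<bar>DG e' D U U - DG e D U U\<bar> \<le> C * k * norm d * m * m"
      using U C0 m by (intro order_trans[OF Dlip[OF e e']]) (auto simp: nD k_def intro!: mult_mono)
    ultimately show ?thesis by (simp add: algebra_simps power2_eq_square)
  qed
  have 2: "\<bar>DG e' U' U' D - DG e U U D\<bar> \<le> (C * 2 * m * l + C * k * m\<^sup>2) * norm d"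
  proof -
    have "DG e' U' U' D = DG e' (U' - U) U' D + DG e' U U' D"
      using linear_diff[OF Dlin[OF e', of U' D], of U' U] by simp
    then have "DG e' U' U' D - DG e U U D = DG e' (U' - U) U' D + DG e' U (U' - U) D + (DG e' U U D - DG e U U D)"
      using b[OF Dbil[OF e']] by simp
    moreover have "\<bar>DG e' (U' - U) U' D\<bar> \<le> C * l * m * norm d"
      using U C0 m by (intro order_trans[OF Dbound[OF e']]) (auto simp: nD l_def intro!: mult_mono mult_nonneg_nonneg)
    moreover have "\<bar>DG e' U (U' - U) D\<bar> \<le> C * m * l * norm d"
      using U C0 m by (intro order_trans[OF Dbound[OF e']]) (auto simp: nD l_def intro!: mult_mono mult_nonneg_nonneg)
    moreover have "\<bar>DG e' U U D - DG e U U D\<bar> \<le> C * k * m * m * norm d"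
      using U C0 m by (intro order_trans[OF Dlip[OF e e']]) (auto simp: nD k_def intro!: mult_mono)
    ultimately show ?thesis by (simp add: algebra_simps power2_eq_square)
  qed
  have 3: "\<bar>G e' (0, ?F) D - G e (0, ?F) D\<bar> \<le> C * k * (2 * C / c * m\<^sup>2) * norm d"
  proof -
    have "norm ?F \<le> 2 * C / c * m\<^sup>2"
      using U C0 c_pos by (intro order_trans[OF accel_norm[OF e]] mult_left_mono power_mono) auto
    then have "C * k * norm ?F * norm d \<le> C * k * (2 * C / c * m\<^sup>2) * norm d"
      using C0 k by (intro mult_right_mono mult_left_mono) auto
    then show ?thesis using lip[OF e e', of "(0, ?F)" D] by (simp add: nD k_def)
  qed
  have "G e' D D \<le> (3 * (C * m * l) + 3 / 2 * (C * k * m\<^sup>2) + C * k * (2 * C / c * m\<^sup>2)) * norm d"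
    using G 1 2 3 by (simp add: algebra_simps abs_if split: if_splits)
  also have "\<dots> \<le> ((3 * C + 2 * C\<^sup>2 / c) * (m\<^sup>2 * k + m * l)) * norm d"
  proof (intro mult_right_mono)
    have "0 \<le> C * k * m\<^sup>2" "0 \<le> C\<^sup>2 / c * m * l" using C0 c_pos k m l by simp_all
    then have "0 \<le> 3 * (C * k * m\<^sup>2) + 4 * (C\<^sup>2 / c * m * l)" by simp
    then show "3 * (C * m * l) + 3 / 2 * (C * k * m\<^sup>2) + C * k * (2 * C / c * m\<^sup>2)
        \<le> (3 * C + 2 * C\<^sup>2 / c) * (m\<^sup>2 * k + m * l)"
      by (simp add: algebra_simps power2_eq_square add_divide_distrib)
  qed simp
  finally have "G e' (0, d) (0, d) \<le> ((3 * C + 2 * C\<^sup>2 / c) * (m\<^sup>2 * k + m * l)) * norm d"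
    by (simp add: D_def)
  then have "norm d \<le> (3 * C + 2 * C\<^sup>2 / c) * (m\<^sup>2 * k + m * l) / c"
    using C0 c_pos k m l by (intro pos_imp_norm_le[OF e']) auto
  then show ?thesis by (simp add: d_def k_def l_def accel_lip_def)
qed

text \<open>The acceleration is a choice of a solution, so its continuity has to come from the
  Lipschitz estimate, which is uniform only for bounded velocities.\<close>

lemma continuous_on_accel:
  assumes e: "continuous_on S e" and U: "continuous_on S U"
    and eS: "\<And>s. s \<in> S \<Longrightarrow> e s \<in> box" and US: "\<And>s. s \<in> S \<Longrightarrow> norm (U s) \<le> m"
  shows "continuous_on S (\<lambda>s. accel (e s) (U s))"
  unfolding continuous_on_def
proof
  fix s assume s: "s \<in> S"
  have "((\<lambda>\<sigma>. accel_lip * (m\<^sup>2 * norm (e \<sigma> - e s) + m * norm (U \<sigma> - U s))) \<longlongrightarrow>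
      accel_lip * (m\<^sup>2 * norm (e s - e s) + m * norm (U s - U s))) (at s within S)"
    using e U s unfolding continuous_on_def by (intro tendsto_intros) auto
  then have "((\<lambda>\<sigma>. accel_lip * (m\<^sup>2 * norm (e \<sigma> - e s) + m * norm (U \<sigma> - U s))) \<longlongrightarrow> 0) (at s within S)"
    by simp
  moreover have "\<forall>\<^sub>F \<sigma> in at s within S. norm (accel (e \<sigma>) (U \<sigma>) - accel (e s) (U s)) \<le>
      accel_lip * (m\<^sup>2 * norm (e \<sigma> - e s) + m * norm (U \<sigma> - U s))"
    using accel_lipschitz[OF eS eS US US] s by (auto simp: eventually_at_filter)
  ultimately have "((\<lambda>\<sigma>. accel (e \<sigma>) (U \<sigma>) - accel (e s) (U s)) \<longlongrightarrow> 0) (at s within S)"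
    by (rule Lim_null_comparison[rotated])
  then show "((\<lambda>s. accel (e s) (U s)) \<longlongrightarrow> accel (e s) (U s)) (at s within S)"
    by (simp add: Lim_null[symmetric])
qed

section \<open>The form along moving points and vectors\<close>

lemma continuous_on_G:
  assumes e: "continuous_on S e" and U: "continuous_on S U" and W: "continuous_on S W"
    and eS: "\<And>s. s \<in> S \<Longrightarrow> e s \<in> box"
  shows "continuous_on S (\<lambda>s. G (e s) (U s) (W s))"
proof -
  have "continuous_on (e ` S) (\<lambda>e. G e i j)" for i j
    using deriv eS by (intro continuous_at_imp_continuous_on) (blast dest: has_derivative_continuous)
  then have "continuous_on S (\<lambda>s. G (e s) i j)" for i j
    using continuous_on_compose[OF e, of "\<lambda>e. G e i j"] by (simp add: o_def)
  then have "continuous_on S (\<lambda>s. \<Sum>i\<in>Basis. \<Sum>j\<in>Basis. (U s \<bullet> i) * (W s \<bullet> j) * G (e s) i j)"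
    using U W by (intro continuous_intros) auto
  then show ?thesis using bilinear_expand[OF bil[OF eS]] by (simp cong: continuous_on_cong)
qed

text \<open>The product rule in the three moving arguments, carried out on the finite sum of
  coordinates because \<open>deriv\<close> speaks of fixed vectors.\<close>

lemma has_vector_derivative_G:
  assumes e: "(e has_vector_derivative e') (at s within S)"
    and U: "(U has_vector_derivative U') (at s within S)"
    and W: "(W has_vector_derivative W') (at s within S)"
    and eS: "\<And>s. s \<in> S \<Longrightarrow> e s \<in> box" and s: "s \<in> S"
  shows "((\<lambda>s. G (e s) (U s) (W s)) has_vector_derivative
    DG (e s) e' (U s) (W s) + G (e s) U' (W s) + G (e s) (U s) W') (at s within S)"
proof -
  have g: "((\<lambda>s. G (e s) i j) has_vector_derivative DG (e s) e' i j) (at s within S)" for i j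
  proof -
    have "((\<lambda>e. G e i j) has_derivative (\<lambda>Z. DG (e s) Z i j)) (at (e s) within e ` S)"
      using deriv[OF eS[OF s]] by (rule has_derivative_at_withinI)
    from diff_chain_within[OF e[unfolded has_vector_derivative_def] this] show ?thesis
      by (simp add: has_vector_derivative_def o_def linear_scale[OF Dlin[OF eS[OF s]]])
  qed
  have u: "((\<lambda>s. U s \<bullet> i) has_vector_derivative U' \<bullet> i) (at s within S)" for i
    using U by (auto intro: bounded_linear.has_vector_derivative[OF bounded_linear_inner_left])
  have w: "((\<lambda>s. W s \<bullet> i) has_vector_derivative W' \<bullet> i) (at s within S)" for i
    using W by (auto intro: bounded_linear.has_vector_derivative[OF bounded_linear_inner_left])
  have "((\<lambda>s. \<Sum>i\<in>Basis. \<Sum>j\<in>Basis. (U s \<bullet> i) * (W s \<bullet> j) * G (e s) i j) has_vector_derivative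
      (\<Sum>i\<in>Basis. \<Sum>j\<in>Basis. (U s \<bullet> i) * (W s \<bullet> j) * DG (e s) e' i j +
        ((U s \<bullet> i) * (W' \<bullet> j) + (U' \<bullet> i) * (W s \<bullet> j)) * G (e s) i j)) (at s within S)"
    by (intro has_vector_derivative_sum has_vector_derivative_mult u w g)
  also have "(\<Sum>i\<in>Basis. \<Sum>j\<in>Basis. (U s \<bullet> i) * (W s \<bullet> j) * DG (e s) e' i j +
        ((U s \<bullet> i) * (W' \<bullet> j) + (U' \<bullet> i) * (W s \<bullet> j)) * G (e s) i j) =
     DG (e s) e' (U s) (W s) + G (e s) U' (W s) + G (e s) (U s) W'"
    by (simp add: bilinear_expand[OF Dbil[OF eS[OF s]], of e' "U s" "W s"]
       bilinear_expand[OF bil[OF eS[OF s]], of U' "W s"] bilinear_expand[OF bil[OF eS[OF s]], of "U s" W']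
       sum.distrib algebra_simps)
  finally show ?thesis
    by (rule has_vector_derivative_transform[OF s, rotated]) (simp add: bilinear_expand[OF bil[OF eS]])
qed

section \<open>Existence and minimality of short solutions\<close>

text \<open>The fixed point is sought among velocities, not curves: the curve is recovered by
  integration from \<open>x0\<close>, and the map integrates the acceleration once. Smallness of
  \<open>m\<close> makes the map preserve a ball and contract by the factor 1/2.\<close>

lemma el_solution:
  assumes t: "t \<in> {\<alpha>..\<beta>}" "t + h \<in> {\<alpha>..\<beta>}" and h: "0 \<le> h"
    and m: "norm (x1 - x0) + h \<le> m" "norm (x0 - xc) + 2 * m \<le> \<rho>"
      "36 * (C / c) * m \<le> 1" "4 * accel_lip * (9 * m\<^sup>2 + 3 * m) \<le> 1"
  obtains x u where "\<And>s. s \<in> {0..1} \<Longrightarrow> (x has_vector_derivative u s) (at s within {0..1})"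
    "\<And>s. s \<in> {0..1} \<Longrightarrow> (u has_vector_derivative accel (t + h * s, x s) (h, u s)) (at s within {0..1})"
    "x 0 = x0" "x 1 = x1" "\<And>s. s \<in> {0..1} \<Longrightarrow> norm (u s) \<le> 2 * m"
    "\<And>s. s \<in> {0..1} \<Longrightarrow> x s \<in> cball xc \<rho>"
proof -
  define X where "X v s = x0 + integral {0..s} v" for v :: "real \<Rightarrow> 'e" and s
  define f where "f v s = accel (t + h * s, X v s) (h, v s)" for v :: "real \<Rightarrow> 'e" and s
  define g where "g v s = integral {0..s} (f v)" for v s
  \<comment> \<open>Subtracting the mean of \<open>g v\<close> gives every image the integral
    \<open>x1 - x0\<close>, so the second boundary value is built into the map.\<close>
  define p where "p v s = (x1 - x0) + g v s - integral {0..1} (g v)" for v s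
  have m0: "0 \<le> m" using m(1) h norm_ge_zero[of "x1 - x0"] by linarith
  have hm: "h \<le> m" using m(1) norm_ge_zero[of "x1 - x0"] by linarith
  have K0: "0 \<le> accel_lip" using C_pos c_pos by (simp add: accel_lip_def)
  \<comment> \<open>Of the radius 2 m, one half is for the mean velocity \<open>x1 - x0\<close> and
    the other for the integrated acceleration. With \<open>h \<le> m\<close> the extended velocity
    is bounded by 3 m, whence the terms 9 \<open>m\<^sup>2\<close> and 3 m in the
    hypotheses.\<close>
  define S where "S = {v :: real \<Rightarrow>\<^sub>C 'e. \<forall>s. norm (v s) \<le> 2 * m}"
  have th: "t + h * s \<in> {\<alpha>..\<beta>}" if "s \<in> {0..1}" for s
  proof -
    have "0 \<le> h * s" "h * s \<le> h" using that h by (auto simp: mult_left_le)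
    then show ?thesis using t by auto
  qed
  have cont: "continuous_on Z (apply_bcontfun v)" for Z and v :: "real \<Rightarrow>\<^sub>C 'e" by simp
  have X_deriv: "(X v has_vector_derivative v s) (at s within {0..1})" if "s \<in> {0..1}" for v :: "real \<Rightarrow>\<^sub>C 'e" and s
    unfolding X_def using integral_has_vector_derivative[OF cont that] by (auto intro!: derivative_eq_intros)
  then have X_cont: "continuous_on {0..1} (X v)" for v :: "real \<Rightarrow>\<^sub>C 'e"
    by (intro continuous_on_vector_derivative) auto
  have X_box: "X v s \<in> cball xc \<rho>" if "v \<in> S" "s \<in> {0..1}" for v s
  proof -
    have "norm (integral {0..s} v) \<le> 2 * m * (s - 0)"
      using that by (intro integral_bound cont) (auto simp: S_def)
    also have "\<dots> \<le> 2 * m" using that m0 by (simp add: mult_left_le)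
    finally have "norm (X v s - xc) \<le> norm (x0 - xc) + 2 * m"
      unfolding X_def using norm_triangle_ineq[of "x0 - xc" "integral {0..s} v"] by (simp add: algebra_simps)
    then show ?thesis using m(2) by (simp add: dist_norm norm_minus_commute)
  qed
  have e_box: "(t + h * s, X v s) \<in> box" if "v \<in> S" "s \<in> {0..1}" for v s
    using X_box[OF that] th[OF that(2)] by simp
  have U_norm: "norm (h, v s) \<le> 3 * m" if "v \<in> S" for v :: "real \<Rightarrow>\<^sub>C 'e" and s
  proof -
    have "norm (v s) \<le> 2 * m" using that by (simp add: S_def)
    then show ?thesis using norm_Pair_le[of h "v s"] h hm by simp
  qed
  have f_cont: "continuous_on {0..1} (f v)" if "v \<in> S" for v
    unfolding f_def using e_box[OF that] U_norm[OF that]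
    by (intro continuous_on_accel[where m = "3 * m"] continuous_intros X_cont cont) auto
  have f_norm: "norm (f v s) \<le> 18 * (C / c) * m\<^sup>2" if "v \<in> S" "s \<in> {0..1}" for v s
  proof -
    have "norm (f v s) \<le> 2 * C / c * (norm (h, v s))\<^sup>2"
      unfolding f_def by (rule accel_norm[OF e_box[OF that]])
    also have "\<dots> \<le> 2 * C / c * (3 * m)\<^sup>2"
      using U_norm[OF that(1), of s] C_pos c_pos by (intro mult_left_mono power_mono) auto
    finally show ?thesis by (simp add: power_mult_distrib)
  qed
  have g_deriv: "(g v has_vector_derivative f v s) (at s within {0..1})" if "v \<in> S" "s \<in> {0..1}" for v s
    unfolding g_def using integral_has_vector_derivative[OF f_cont that(2)] that by auto
  then have g_cont: "continuous_on {0..1} (g v)" if "v \<in> S" for v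
    using that by (intro continuous_on_vector_derivative) auto
  then have p_cont: "continuous_on {0..1} (p v)" if "v \<in> S" for v
    unfolding p_def using that by (intro continuous_intros)
  \<comment> \<open>A primitive and its mean value are each bounded by \<open>B\<close>. The
    estimate serves twice, for the invariance of \<open>S\<close> and for the contraction.\<close>
  have two: "norm (integral {0..s} a - integral {0..1} (\<lambda>s. integral {0..s} a)) \<le> 2 * B"
    if a: "continuous_on {0..1} a" "\<And>s. s \<in> {0..1} \<Longrightarrow> norm (a s) \<le> B" and s: "s \<in> {0..1}" "0 \<le> B"
    for a :: "real \<Rightarrow> 'e" and B s
  proof -
    have 1: "norm (integral {0..s} a) \<le> B" if "s \<in> {0..1}" for s
    proof -
      have "norm (integral {0..s} a) \<le> B * (s - 0)"
        using a that by (intro integral_bound) (auto intro: continuous_on_subset)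
      also have "\<dots> \<le> B" using that s(2) by (simp add: mult_left_le)
      finally show ?thesis .
    qed
    have "continuous_on {0..1} (\<lambda>s. integral {0..s} a)"
      using integral_has_vector_derivative[OF a(1)] by (intro continuous_on_vector_derivative) auto
    then have "norm (integral {0..1} (\<lambda>s. integral {0..s} a)) \<le> B * (1 - 0)"
      using 1 by (intro integral_bound) auto
    then have "norm (integral {0..1} (\<lambda>s. integral {0..s} a)) \<le> B" by simp
    then show ?thesis
      using 1[OF s(1)] norm_triangle_ineq4[of "integral {0..s} a" "integral {0..1} (\<lambda>s. integral {0..s} a)"]
      by linarith
  qed
  have p_norm: "norm (p v s) \<le> 2 * m" if "v \<in> S" "s \<in> {0..1}" for v s
  proof -
    have "norm (g v s - integral {0..1} (g v)) \<le> 2 * (18 * (C / c) * m\<^sup>2)"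
      unfolding g_def using f_norm[OF that(1)] C_pos c_pos by (intro two f_cont that) auto
    also have "\<dots> \<le> 1 * m"
      using mult_right_mono[OF m(3) m0] by (simp add: power2_eq_square mult.assoc)
    finally show ?thesis
      using m(1) h norm_triangle_ineq[of "x1 - x0" "g v s - integral {0..1} (g v)"]
      by (simp add: p_def algebra_simps)
  qed
  \<comment> \<open>Functions on [0, 1] are continued by their end values, so that the complete
    space of bounded continuous functions on the line can be used.\<close>
  have "\<exists>w :: real \<Rightarrow>\<^sub>C 'e. \<forall>s. w s = p v (clamp 0 1 s)" if "v \<in> S" for v
    using continuous_on_cbox_bcontfunE[of 0 1 "p v"] p_cont[OF that] by (metis cbox_interval)
  then obtain \<Phi> where \<Phi>: "\<And>v s. v \<in> S \<Longrightarrow> apply_bcontfun (\<Phi> v) s = p v (clamp 0 1 s)"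
    by metis
  have clamp: "clamp 0 1 s \<in> {0..1}" for s :: real
    using clamp_in_interval[of 0 1 s] by simp
  have "closed S"
  proof -
    have "S = PiC UNIV (\<lambda>_. cball 0 (2 * m))" by (auto simp: S_def mem_PiC_iff Pi_iff)
    then show ?thesis by (simp add: closed_PiC)
  qed
  then have "complete S" by (simp add: complete_eq_closed)
  moreover have "0 \<in> S" using m0 by (simp add: S_def)
  moreover have "\<Phi> ` S \<subseteq> S" using \<Phi> p_norm clamp by (auto simp: S_def)
  moreover have "dist (\<Phi> v) (\<Phi> w) \<le> 1 / 2 * dist v w" if vw: "v \<in> S" "w \<in> S" for v w
  proof (rule dist_bound)
    fix s :: real
    define \<sigma> where "\<sigma> = clamp 0 1 s"
    have \<sigma>: "\<sigma> \<in> {0..1}" using clamp by (simp add: \<sigma>_def)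
    define d where "d = dist v w"
    have d: "norm (v s - w s) \<le> d" "0 \<le> d" for s using dist_bounded[of v s w] by (auto simp: d_def dist_norm)
    have fd: "norm (f v s - f w s) \<le> accel_lip * (9 * m\<^sup>2 + 3 * m) * d" if s: "s \<in> {0..1}" for s
    proof -
      have "X v s - X w s = integral {0..s} (\<lambda>s. v s - w s)"
        unfolding X_def by (subst Henstock_Kurzweil_Integration.integral_diff) (auto intro!: integrable_continuous_interval)
      also have "norm \<dots> \<le> d * (s - 0)"
        using d s by (intro integral_bound) (auto intro!: continuous_intros)
      also have "\<dots> \<le> d" using s d(2) by (simp add: mult_left_le)
      finally have "norm ((t + h * s, X v s) - (t + h * s, X w s)) \<le> d" by simp
      moreover have "norm ((h, v s) - (h, w s)) \<le> d" using d by simp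
      ultimately have "(3 * m)\<^sup>2 * norm ((t + h * s, X v s) - (t + h * s, X w s)) +
          3 * m * norm ((h, v s) - (h, w s)) \<le> (3 * m)\<^sup>2 * d + 3 * m * d"
        using m0 by (intro add_mono mult_left_mono) auto
      from order_trans[OF accel_lipschitz[OF e_box e_box U_norm U_norm] mult_left_mono[OF this K0]] vw s
      show ?thesis by (auto simp: f_def power_mult_distrib algebra_simps)
    qed
    have gd: "g v s - g w s = integral {0..s} (\<lambda>s. f v s - f w s)" if "s \<in> {0..1}" for s
    proof -
      have "continuous_on {0..s} (f v)" "continuous_on {0..s} (f w)"
        using continuous_on_subset[OF f_cont[OF vw(1)]] continuous_on_subset[OF f_cont[OF vw(2)]] that by auto
      then show ?thesis unfolding g_def
        by (simp add: Henstock_Kurzweil_Integration.integral_diff integrable_continuous_interval)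
    qed
    have "p v \<sigma> - p w \<sigma> = (g v \<sigma> - g w \<sigma>) - integral {0..1} (\<lambda>s. g v s - g w s)"
      unfolding p_def using g_cont vw
      by (subst Henstock_Kurzweil_Integration.integral_diff) (auto intro!: integrable_continuous_interval)
    also have "integral {0..1} (\<lambda>s. g v s - g w s) = integral {0..1} (\<lambda>s. integral {0..s} (\<lambda>s. f v s - f w s))"
      using gd by (intro integral_cong) auto
    finally have "norm (p v \<sigma> - p w \<sigma>) \<le> 2 * (accel_lip * (9 * m\<^sup>2 + 3 * m) * d)"
      unfolding gd[OF \<sigma>] using fd f_cont vw \<sigma> K0 m0 d(2)
      by (simp only:) (intro two continuous_intros; auto)
    also have "\<dots> \<le> 1 / 2 * d"
      using mult_right_mono[OF m(4) d(2)] by simp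
    finally show "dist (\<Phi> v s) (\<Phi> w s) \<le> 1 / 2 * dist v w"
      using \<Phi> vw by (simp add: dist_norm \<sigma>_def d_def)
  qed
  ultimately have "\<exists>!v. v \<in> S \<and> \<Phi> v = v"
    by (intro Banach_fix[where c = "1/2"]) auto
  then obtain v where v: "v \<in> S" "\<Phi> v = v" by blast
  have vp: "v s = p v s" if "s \<in> {0..1}" for s
    using \<Phi>[OF v(1), of s] v(2) that by (metis cbox_interval clamp_cancel_cbox)
  have "integral {0..1} v = integral {0..1} (p v)" using vp by (intro integral_cong) auto
  also have "\<dots> = x1 - x0"
  proof -
    have "g v integrable_on {0..1}" using g_cont[OF v(1)] by (rule integrable_continuous_interval)
    then have "((\<lambda>s. (x1 - x0) + g v s - integral {0..1} (g v)) has_integral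
        (x1 - x0) + integral {0..1} (g v) - integral {0..1} (g v)) {0..1}"
      using has_integral_const_real[of "x1 - x0" 0 1] has_integral_const_real[of "integral {0..1} (g v)" 0 1]
      by (intro has_integral_diff[OF has_integral_add[OF _ integrable_integral]]) auto
    then show ?thesis by (simp add: p_def[abs_def] integral_unique)
  qed
  finally have "X v 1 = x1" by (simp add: X_def)
  moreover have "(v has_vector_derivative accel (t + h * s, X v s) (h, v s)) (at s within {0..1})"
    if s: "s \<in> {0..1}" for s
  proof -
    have "(p v has_vector_derivative f v s) (at s within {0..1})"
      unfolding p_def using g_deriv[OF v(1) s] by (auto intro!: derivative_eq_intros)
    then show ?thesis
      unfolding f_def by (rule has_vector_derivative_transform[OF s, rotated]) (use vp in auto)
  qed
  ultimately show ?thesis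
    using X_deriv X_box[OF v(1)] v(1) by (intro that[of "X v" v]) (auto simp: X_def S_def)
qed

text \<open>Along a short solution the second variation is positive, because \<open>\<bar>\<xi>\<bar>\<close> is at most the integral
  \<open>I\<close> of \<open>\<bar>\<eta>\<bar>\<close>, whereas \<open>\<bar>\<eta>\<bar>\<^sup>2 \<ge> 2 I \<bar>\<eta>\<bar> - I\<^sup>2\<close>.\<close>

lemma el_minimal:
  fixes x u z w :: "real \<Rightarrow> 'e"
  assumes t: "t \<in> {\<alpha>..\<beta>}" "t + h \<in> {\<alpha>..\<beta>}" and h: "0 \<le> h" "h \<le> m"
    and x: "\<And>s. s \<in> {0..1} \<Longrightarrow> (x has_vector_derivative u s) (at s within {0..1})"
    and u: "\<And>s. s \<in> {0..1} \<Longrightarrow>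
      (u has_vector_derivative accel (t + h * s, x s) (h, u s)) (at s within {0..1})"
    and um: "\<And>s. s \<in> {0..1} \<Longrightarrow> norm (u s) \<le> 2 * m"
    and xb: "\<And>s. s \<in> {0..1} \<Longrightarrow> x s \<in> cball xc \<rho>"
    and z: "\<And>s. s \<in> {0..1} \<Longrightarrow> (z has_vector_derivative w s) (at s within {0..1})"
    and w: "continuous_on {0..1} w"
    and zb: "\<And>s. s \<in> {0..1} \<Longrightarrow> z s \<in> cball xc \<rho>"
    and ends: "z 0 = x 0" "z 1 = x 1"
    and m: "9 * C * m\<^sup>2 + 6 * C * m \<le> c"
  shows "integral {0..1} (\<lambda>s. G (t + h * s, x s) (h, u s) (h, u s))
    \<le> integral {0..1} (\<lambda>s. G (t + h * s, z s) (h, w s) (h, w s))"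
proof -
  define e where "e s = (t + h * s, x s)" for s
  define e' where "e' s = (t + h * s, z s)" for s
  define U where "U s = (h, u s)" for s
  define W where "W s = (h, w s)" for s
  define \<xi> where "\<xi> s = (0::real, z s - x s)" for s
  define \<eta> where "\<eta> s = (0::real, w s - u s)" for s
  have th: "t + h * s \<in> {\<alpha>..\<beta>}" if "s \<in> {0..1}" for s
  proof -
    have "0 \<le> h * s" "h * s \<le> h" using that h by (auto simp: mult_left_le)
    then show ?thesis using t by auto
  qed
  have eb: "e s \<in> box" and eb': "e' s \<in> box" if "s \<in> {0..1}" for s
    unfolding e_def e'_def using th[OF that] xb[OF that] zb[OF that] by simp_all
  have m0: "0 \<le> m" using h by simp
  have C0: "0 \<le> C" using C_pos by simp
  have u_cont: "continuous_on {0..1} u" using u by (rule continuous_on_vector_derivative)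
  have x_cont: "continuous_on {0..1} x" using x by (rule continuous_on_vector_derivative)
  have z_cont: "continuous_on {0..1} z" using z by (rule continuous_on_vector_derivative)
  have Um: "norm (U s) \<le> 3 * m" if "s \<in> {0..1}" for s
    using norm_Pair_le[of h "u s"] h um[OF that] by (simp add: U_def)
  define I where "I = integral {0..1} (\<lambda>s. norm (w s - u s))"
  have nc: "continuous_on {0..1} (\<lambda>s. norm (w s - u s))" by (intro continuous_intros w u_cont)
  have I0: "0 \<le> I" unfolding I_def by (intro integral_nonneg integrable_continuous_interval nc) simp
  have xiI: "norm (\<xi> s) \<le> I" if s: "s \<in> {0..1}" for s
  proof -
    have "((\<lambda>s. w s - u s) has_integral (z s - x s) - (z 0 - x 0)) {0..s}"
      using s by (intro fundamental_theorem_of_calculus)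
        (auto intro!: has_vector_derivative_diff intro: has_vector_derivative_within_subset[OF z]
          has_vector_derivative_within_subset[OF x])
    then have "z s - x s = integral {0..s} (\<lambda>s. w s - u s)" using ends by (simp add: integral_unique)
    also have "norm \<dots> \<le> integral {0..s} (\<lambda>s. norm (w s - u s))"
      using s by (intro Henstock_Kurzweil_Integration.integral_norm_bound_integral integrable_continuous_interval)
        (auto intro!: continuous_intros intro: continuous_on_subset[OF w] continuous_on_subset[OF u_cont])
    also have "\<dots> \<le> I"
      unfolding I_def using s
      by (intro integral_subset_le integrable_continuous_interval nc) (auto intro: continuous_on_subset[OF nc])
    finally show ?thesis by (simp add: \<xi>_def)
  qed
  \<comment> \<open>By the Euler-Lagrange equation this is the derivative of the momentum paired
    with the variation \<open>\<xi>\<close>. Twice it is the part of the integrand's change that is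
    linear in the variation, so that part integrates to zero when \<open>\<xi>\<close> vanishes at
    both ends.\<close>
  define p' where "p' s = DG (e s) (\<xi> s) (U s) (U s) / 2 + G (e s) (U s) (\<eta> s)" for s
  have p: "((\<lambda>s. G (e s) (U s) (\<xi> s)) has_vector_derivative p' s) (at s within {0..1})" if s: "s \<in> {0..1}" for s
  proof -
    have "(e has_vector_derivative U s) (at s within {0..1})"
      unfolding e_def U_def using x[OF s]
      by (intro has_vector_derivative_Pair) (auto intro!: derivative_eq_intros)
    moreover have "(U has_vector_derivative (0, accel (e s) (U s))) (at s within {0..1})"
      unfolding U_def e_def using u[OF s]
      by (intro has_vector_derivative_Pair) (auto intro!: derivative_eq_intros)
    moreover have "(\<xi> has_vector_derivative \<eta> s) (at s within {0..1})"
      unfolding \<xi>_def \<eta>_def using x[OF s] z[OF s]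
      by (intro has_vector_derivative_Pair) (auto intro!: derivative_eq_intros)
    ultimately have "((\<lambda>s. G (e s) (U s) (\<xi> s)) has_vector_derivative
        DG (e s) (U s) (U s) (\<xi> s) + G (e s) (0, accel (e s) (U s)) (\<xi> s) + G (e s) (U s) (\<eta> s))
        (at s within {0..1})"
      by (rule has_vector_derivative_G) (use eb s in auto)
    moreover have "G (e s) (0, accel (e s) (U s)) (\<xi> s) =
        DG (e s) (\<xi> s) (U s) (U s) / 2 - DG (e s) (U s) (U s) (\<xi> s)"
      unfolding \<xi>_def by (rule accel[OF eb[OF s]])
    ultimately show ?thesis by (simp add: p'_def)
  qed
  have "(p' has_integral G (e 1) (U 1) (\<xi> 1) - G (e 0) (U 0) (\<xi> 0)) {0..1}"
    using p by (intro fundamental_theorem_of_calculus) auto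
  moreover have "\<xi> 1 = 0" "\<xi> 0 = 0" using ends by (auto simp: \<xi>_def zero_prod_def)
  ultimately have p'_int: "(p' has_integral 0) {0..1}"
    using bilinear_rzero[OF bil[OF eb]] by simp
  \<comment> \<open>The terms with 6 C m and 9 C \<open>m\<^sup>2\<close> are the errors of
    \<open>lip\<close> and \<open>taylor\<close> with \<open>norm (U s) \<le> 3 * m\<close>; the
    terms with \<open>c\<close> are the quadratic lower bound. As the norm of
    \<open>w s - u s\<close> has integral \<open>I\<close>, the whole integrates to (c - 6 C m - 9 C
    \<open>m\<^sup>2\<close>) \<open>I\<^sup>2\<close>.\<close>
  let ?R = "\<lambda>s. (2 * c * I - 6 * C * m * I) * norm (w s - u s) - (9 * C * m\<^sup>2 + c) * I\<^sup>2"
  have le: "G (e s) (U s) (U s) + 2 * p' s + ?R s \<le> G (e' s) (W s) (W s)" if s: "s \<in> {0..1}" for s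
  proof -
    define k where "k = norm (w s - u s)"
    have nk: "norm (\<eta> s) = k" and k0: "0 \<le> k" by (auto simp: \<eta>_def k_def)
    have W: "W s = U s + \<eta> s" and e': "e' s - e s = \<xi> s"
      by (auto simp: W_def U_def \<eta>_def e'_def e_def \<xi>_def)
    note b = bilinear_ladd[OF bil] bilinear_radd[OF bil]
    have "G (e' s) (W s) (W s) = G (e' s) (U s) (U s) + 2 * G (e' s) (U s) (\<eta> s) + G (e' s) (\<eta> s) (\<eta> s)"
      unfolding W using b[OF eb'[OF s]] sym[OF eb'[OF s], of "\<eta> s" "U s"] by simp
    moreover have "c * k\<^sup>2 \<le> G (e' s) (\<eta> s) (\<eta> s)"
      using pos[OF eb'[OF s], of "w s - u s"] by (simp add: k_def \<eta>_def)
    moreover have "\<bar>G (e' s) (U s) (U s) - G (e s) (U s) (U s) - DG (e s) (\<xi> s) (U s) (U s)\<bar> \<le> C * I\<^sup>2 * (3 * m) * (3 * m)"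
    proof (rule order_trans)
      show "\<bar>G (e' s) (U s) (U s) - G (e s) (U s) (U s) - DG (e s) (\<xi> s) (U s) (U s)\<bar>
          \<le> C * (norm (\<xi> s))\<^sup>2 * norm (U s) * norm (U s)"
        using taylor[OF eb eb', OF s s, of "U s" "U s"] by (simp add: e')
      show "C * (norm (\<xi> s))\<^sup>2 * norm (U s) * norm (U s) \<le> C * I\<^sup>2 * (3 * m) * (3 * m)"
        using C0 Um[OF s] xiI[OF s] m0 I0 by (intro mult_mono power_mono mult_nonneg_nonneg) auto
    qed
    moreover have "\<bar>G (e' s) (U s) (\<eta> s) - G (e s) (U s) (\<eta> s)\<bar> \<le> C * I * (3 * m) * k"
    proof (rule order_trans)
      show "\<bar>G (e' s) (U s) (\<eta> s) - G (e s) (U s) (\<eta> s)\<bar> \<le> C * norm (\<xi> s) * norm (U s) * k"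
        using lip[OF eb eb', OF s s, of "U s" "\<eta> s"] by (simp add: e' nk)
      show "C * norm (\<xi> s) * norm (U s) * k \<le> C * I * (3 * m) * k"
        using C0 Um[OF s] xiI[OF s] m0 I0 k0 by (intro mult_mono mult_nonneg_nonneg) auto
    qed
    moreover have "c * (2 * I * k - I\<^sup>2) \<le> c * k\<^sup>2"
    proof -
      have "0 \<le> (k - I)\<^sup>2" by simp
      then show ?thesis using c_pos by (intro mult_left_mono) (auto simp: power2_eq_square algebra_simps)
    qed
    ultimately show ?thesis unfolding p'_def k_def[symmetric]
      by (simp add: algebra_simps power2_eq_square abs_le_iff)
  qed
  have GU: "(\<lambda>s. G (e s) (U s) (U s)) integrable_on {0..1}"
    unfolding e_def U_def using eb[unfolded e_def]
    by (intro integrable_continuous_interval continuous_on_G continuous_intros x_cont u_cont) auto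
  have GW: "(\<lambda>s. G (e' s) (W s) (W s)) integrable_on {0..1}"
    unfolding e'_def W_def using eb'[unfolded e'_def]
    by (intro integrable_continuous_interval continuous_on_G continuous_intros z_cont w) auto
  have "((\<lambda>s. norm (w s - u s)) has_integral I) {0..1}"
    unfolding I_def by (intro integrable_integral integrable_continuous_interval nc)
  then have R: "(?R has_integral (2 * c * I - 6 * C * m * I) * I - (9 * C * m\<^sup>2 + c) * I\<^sup>2) {0..1}"
    using has_integral_const_real[of "(9 * C * m\<^sup>2 + c) * I\<^sup>2" 0 1]
    by (intro has_integral_diff[OF has_integral_mult_right]) auto
  have "((\<lambda>s. G (e s) (U s) (U s) + 2 * p' s + ?R s) has_integral
     (integral {0..1} (\<lambda>s. G (e s) (U s) (U s)) + 2 * 0 +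
       ((2 * c * I - 6 * C * m * I) * I - (9 * C * m\<^sup>2 + c) * I\<^sup>2))) {0..1}"
    using p'_int by (intro has_integral_add R has_integral_mult_right integrable_integral GU) auto
  from has_integral_le[OF this integrable_integral[OF GW] le]
  have "integral {0..1} (\<lambda>s. G (e s) (U s) (U s)) + (c - 6 * C * m - 9 * C * m\<^sup>2) * I\<^sup>2
      \<le> integral {0..1} (\<lambda>s. G (e' s) (W s) (W s))"
    by (simp add: algebra_simps power2_eq_square)
  moreover have "0 \<le> (c - 6 * C * m - 9 * C * m\<^sup>2) * I\<^sup>2" using m by simp
  ultimately show ?thesis by (simp add: e_def e'_def U_def W_def)
qed

section \<open>Energy estimates and lower semicontinuity\<close>

definition "energy_const = 2 * (C + 2 * C\<^sup>2 / c)"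

text \<open>Young's inequality absorbs the mixed time-space term into half of the ellipticity, at
  the price of 2 \<open>C\<^sup>2\<close> / c times \<open>h\<^sup>2\<close>; the pure time part
  costs at most C \<open>h\<^sup>2\<close>. Multiplication by 2 restores the full ellipticity and
  gives \<open>energy_const\<close>.\<close>

lemma energy_bound:
  assumes "e \<in> box"
  shows "c * (norm u)\<^sup>2 \<le> 2 * G e (h, u) (h, u) + energy_const * h\<^sup>2"
proof -
  have b: "G e (U + W) (U + W) = G e U U + G e U W + G e W U + G e W W" for U W
    by (simp add: bilinear_ladd[OF bil[OF assms]] bilinear_radd[OF bil[OF assms]])
  have "(h, u) = (h, 0) + (0, u)" by simp
  then have "G e (h, u) (h, u) = G e (h, 0) (h, 0) + 2 * G e (h, 0) (0, u) + G e (0, u) (0, u)"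
    using b[of "(h, 0)" "(0, u)"] sym[OF assms, of "(0, u)" "(h, 0)"] by (simp del: add_Pair)
  moreover have "\<bar>G e (h, 0) (h, 0)\<bar> \<le> C * h\<^sup>2"
    using bound[OF assms, of "(h, 0)" "(h, 0)"] by (simp add: power2_eq_square)
  moreover have "\<bar>G e (h, 0) (0, u)\<bar> \<le> C * \<bar>h\<bar> * norm u"
    using bound[OF assms, of "(h, 0)" "(0, u)"] by simp
  moreover have "2 * (C * \<bar>h\<bar> * norm u) \<le> c / 2 * (norm u)\<^sup>2 + 2 * C\<^sup>2 / c * h\<^sup>2"
  proof -
    have "0 \<le> (c * norm u - 2 * C * \<bar>h\<bar>)\<^sup>2 / (2 * c)" using c_pos by simp
    also have "\<dots> = c / 2 * (norm u)\<^sup>2 + 2 * C\<^sup>2 / c * h\<^sup>2 - 2 * (C * \<bar>h\<bar> * norm u)"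
      using c_pos by (simp add: field_simps power2_eq_square)
    finally show ?thesis by simp
  qed
  ultimately show ?thesis using pos[OF assms, of u] by (simp add: energy_const_def algebra_simps)
qed

text \<open>If \<open>m\<close> is small, the boundary value problem with \<open>\<bar>x\<^sub>1 - x\<^sub>0\<bar> + h \<le> m\<close> is solvable and
  its solution is minimal.\<close>

definition small :: "real \<Rightarrow> bool" where
  "small m \<longleftrightarrow> 0 < m \<and> 4 * m \<le> \<rho> \<and> 36 * (C / c) * m \<le> 1 \<and>
     4 * accel_lip * (9 * m\<^sup>2 + 3 * m) \<le> 1 \<and> 9 * C * m\<^sup>2 + 6 * C * m \<le> c"

text \<open>Apart from positivity, all conditions hold strictly at m = 0 and are continuous in
  m.\<close>

lemma small_exists:
  assumes "0 < \<rho>"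
  obtains m where "small m"
proof -
  have ev: "\<forall>\<^sub>F m in at_right 0. f m < K" if "isCont f 0" "f 0 < K" for f :: "real \<Rightarrow> real" and K
    using order_tendstoD(2)[of f "f 0" "at 0" K] that
    by (auto simp: isCont_def eventually_at_filter elim: eventually_mono)
  have "\<forall>\<^sub>F m in at_right 0. 4 * m < \<rho>" by (rule ev) (use assms in auto)
  moreover have "\<forall>\<^sub>F m in at_right 0. 36 * (C / c) * m < 1"
    by (rule ev) (use c_pos in \<open>auto intro!: continuous_intros\<close>)
  moreover have "\<forall>\<^sub>F m in at_right 0. 4 * accel_lip * (9 * m\<^sup>2 + 3 * m) < 1" by (rule ev) auto
  moreover have "\<forall>\<^sub>F m in at_right 0. 9 * C * m\<^sup>2 + 6 * C * m < c" by (rule ev) (use c_pos in auto)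
  moreover have "\<forall>\<^sub>F m in at_right (0::real). 0 < m" by (rule eventually_at_right_less)
  ultimately have "\<forall>\<^sub>F m in at_right 0. small m"
    by eventually_elim (auto simp: small_def)
  then show ?thesis using that eventually_happens'[OF trivial_limit_at_right_real] by blast
qed

text \<open>The error is quadratic in a velocity that is not bounded along the approximating curves.
  The energy estimate converts its square into a multiple of the form itself plus a constant, so
  that after integration only a bound for the action is needed.\<close>

lemma action_perturbation:
  assumes e: "e \<in> box" and e': "e' \<in> box" and d: "norm (e' - e) \<le> d" "norm ((h', u') - (h, u)) \<le> d" "d \<le> 1"
    and h: "\<bar>h\<bar> \<le> l"
  shows "G e' (h', u') (h', u') \<le> (1 + 8 * C * d / c) * G e (h, u) (h, u) + C * d * (5 + 4 * (1 + energy_const / c) * l\<^sup>2)"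
proof -
  define U where "U = (h, u)"
  define U' where "U' = (h', u')"
  define k where "k = norm U"
  note b = bilinear_lsub[OF bil[OF e']] bilinear_rsub[OF bil[OF e']]
  have d0: "0 \<le> d" using d(1) norm_ge_zero order_trans by blast
  have C0: "0 \<le> C" using C_pos by simp
  have k0: "0 \<le> k" by (simp add: k_def)
  have k': "norm U' \<le> k + 1"
    using norm_triangle_ineq[of U "U' - U"] d(2,3) by (simp add: U_def[symmetric] U'_def[symmetric] k_def)
  have "G e' U' U' = G e U U + (G e' U U - G e U U) + G e' U (U' - U) + G e' (U' - U) U'"
    using b by simp
  moreover have "\<bar>G e' U U - G e U U\<bar> \<le> C * d * k * k"
    using d C0 d0 by (intro order_trans[OF lip[OF e e']] mult_mono) (auto simp: k_def intro!: mult_nonneg_nonneg)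
  moreover have "\<bar>G e' U (U' - U)\<bar> \<le> C * k * d"
    using d C0 d0 by (intro order_trans[OF bound[OF e']] mult_mono) (auto simp: k_def U_def U'_def)
  moreover have "\<bar>G e' (U' - U) U'\<bar> \<le> C * d * (k + 1)"
    using d C0 d0 k' by (intro order_trans[OF bound[OF e']] mult_mono) (auto simp: k_def U_def U'_def)
  ultimately have 1: "G e' U' U' \<le> G e U U + C * d * (k\<^sup>2 + 2 * k + 1)"
    by (simp add: algebra_simps power2_eq_square)
  have "2 * k \<le> k\<^sup>2 + 1" using zero_le_power2[of "k - 1"] by (simp add: power2_eq_square algebra_simps)
  then have "k\<^sup>2 + 2 * k + 1 \<le> 4 * k\<^sup>2 + 5" using zero_le_power2[of k] by linarith
  then have 2: "C * d * (k\<^sup>2 + 2 * k + 1) \<le> C * d * (4 * k\<^sup>2 + 5)"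
    using C0 d0 by (intro mult_left_mono) auto
  have "k\<^sup>2 = h\<^sup>2 + (norm u)\<^sup>2" by (simp add: k_def U_def norm_Pair)
  moreover have "(norm u)\<^sup>2 \<le> (2 * G e U U + energy_const * h\<^sup>2) / c"
    using energy_bound[OF e, of u h] c_pos by (simp add: U_def field_simps)
  ultimately have "k\<^sup>2 \<le> 2 * G e U U / c + (1 + energy_const / c) * h\<^sup>2"
    by (simp add: add_divide_distrib algebra_simps)
  moreover have "(1 + energy_const / c) * h\<^sup>2 \<le> (1 + energy_const / c) * l\<^sup>2"
    using h c_pos C_pos by (intro mult_left_mono) (auto simp: energy_const_def abs_le_square_iff intro: power2_le_iff_abs_le[THEN iffD2])
  ultimately have "C * d * (4 * k\<^sup>2 + 5) \<le> C * d * (4 * (2 * G e U U / c + (1 + energy_const / c) * l\<^sup>2) + 5)"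
    using C0 d0 by (intro mult_left_mono) auto
  with 1 2 have "G e' U' U' \<le> G e U U + C * d * (4 * (2 * G e U U / c + (1 + energy_const / c) * l\<^sup>2) + 5)"
    by linarith
  also have "\<dots> = (1 + 8 * C * d / c) * G e U U + C * d * (5 + 4 * (1 + energy_const / c) * l\<^sup>2)"
    by (simp add: algebra_simps)
  finally show ?thesis by (simp add: U_def U'_def)
qed

text \<open>Correcting the endpoints of the approximating curves by an affine function makes them competitors
  of the solution of the limiting boundary value problem.\<close>

lemma minimiser_lsc:
  fixes z w :: "nat \<Rightarrow> real \<Rightarrow> 'e"
  assumes m: "small m" and \<rho>: "0 < \<rho>"
    and t: "\<And>n. tn n \<in> {\<alpha>..\<beta>}" "\<And>n. tn n + hn n \<in> {\<alpha>..\<beta>}" and hn: "\<And>n. 0 \<le> hn n"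
    and z: "\<And>n s. s \<in> {0..1} \<Longrightarrow> (z n has_vector_derivative w n s) (at s within {0..1})"
    and w: "\<And>n. continuous_on {0..1} (w n)"
    and zb: "\<And>n s. s \<in> {0..1} \<Longrightarrow> z n s \<in> cball xc (\<rho> / 2)"
    and lim: "tn \<longlonglongrightarrow> t" "hn \<longlonglongrightarrow> h" "(\<lambda>n. z n 0) \<longlonglongrightarrow> z0" "(\<lambda>n. z n 1) \<longlonglongrightarrow> z1"
      "(\<lambda>n. integral {0..1} (\<lambda>s. G (tn n + hn n * s, z n s) (hn n, w n s) (hn n, w n s))) \<longlonglongrightarrow> J"
    and near: "norm (z1 - z0) + h \<le> m"
  obtains x u where "\<And>s. s \<in> {0..1} \<Longrightarrow> (x has_vector_derivative u s) (at s within {0..1})"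
    "continuous_on {0..1} u" "x 0 = z0" "x 1 = z1" "\<And>s. s \<in> {0..1} \<Longrightarrow> x s \<in> cball xc \<rho>"
    "integral {0..1} (\<lambda>s. G (t + h * s, x s) (h, u s) (h, u s)) \<le> J"
proof -
  have tlim: "t \<in> {\<alpha>..\<beta>}" "t + h \<in> {\<alpha>..\<beta>}"
    using closed_sequentially[OF closed_real_atLeastAtMost, of tn \<alpha> \<beta> t] t lim(1)
      closed_sequentially[OF closed_real_atLeastAtMost, of "\<lambda>n. tn n + hn n" \<alpha> \<beta> "t + h"]
      tendsto_add[OF lim(1,2)] by auto
  have h: "0 \<le> h" using LIMSEQ_le_const[OF lim(2)] hn by auto
  have hm: "h \<le> m" using near norm_ge_zero[of "z1 - z0"] by linarith
  have "z0 \<in> cball xc (\<rho> / 2)"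
    by (rule closed_sequentially[OF closed_cball _ lim(3)]) (rule zb, simp)
  \<comment> \<open>The starting point lies within half the radius; since 4 m is at most
    \<open>\<rho>\<close>, the other half leaves room for the displacement 2 m of the
    solution.\<close>
  then have z0: "norm (z0 - xc) + 2 * m \<le> \<rho>"
    using m by (simp add: small_def dist_norm norm_minus_commute)
  have m': "36 * (C / c) * m \<le> 1" "4 * accel_lip * (9 * m\<^sup>2 + 3 * m) \<le> 1"
    using m by (auto simp: small_def)
  obtain x u where x: "\<And>s. s \<in> {0..1} \<Longrightarrow> (x has_vector_derivative u s) (at s within {0..1})"
    and u: "\<And>s. s \<in> {0..1} \<Longrightarrow> (u has_vector_derivative accel (t + h * s, x s) (h, u s)) (at s within {0..1})"
    and x01: "x 0 = z0" "x 1 = z1" and um: "\<And>s. s \<in> {0..1} \<Longrightarrow> norm (u s) \<le> 2 * m"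
    and xb: "\<And>s. s \<in> {0..1} \<Longrightarrow> x s \<in> cball xc \<rho>"
    using el_solution[OF tlim h near z0 m'] by blast
  have th: "t' + h' * s \<in> {\<alpha>..\<beta>}" if "s \<in> {0..1}" "t' \<in> {\<alpha>..\<beta>}" "t' + h' \<in> {\<alpha>..\<beta>}" "0 \<le> h'" for s t' h'
  proof -
    have "0 \<le> h' * s" "h' * s \<le> h'" using that by (auto simp: mult_left_le)
    then show ?thesis using that by auto
  qed
  have z_cont: "continuous_on {0..1} (z n)" for n using z by (rule continuous_on_vector_derivative)
  define a where "a n = z0 - z n 0" for n
  define b where "b n = z1 - z n 1" for n
  \<comment> \<open>A single number for all discrepancies of times, durations and end points. While
    it is below half the radius, the corrected curve stays in the box, and both errors of the action
    estimate vanish with it.\<close>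
  define d where "d n = \<bar>t - tn n\<bar> + \<bar>h - hn n\<bar> + norm (a n) + norm (b n)" for n
  have "d \<longlonglongrightarrow> \<bar>t - t\<bar> + \<bar>h - h\<bar> + norm (z0 - z0) + norm (z1 - z1)"
    unfolding d_def a_def b_def by (intro tendsto_intros lim)
  then have d: "d \<longlonglongrightarrow> 0" by simp
  define J' where "J' n = integral {0..1} (\<lambda>s. G (tn n + hn n * s, z n s) (hn n, w n s) (hn n, w n s))" for n
  define l where "l = \<beta> - \<alpha>"
  define R where "R n = C * d n * (5 + 4 * (1 + energy_const / c) * l\<^sup>2)" for n
  have "integral {0..1} (\<lambda>s. G (t + h * s, x s) (h, u s) (h, u s)) \<le> (1 + 8 * C * d n / c) * J' n + R n"
    if n: "d n < min 1 (\<rho> / 2)" for n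
  proof -
    define y where "y s = z n s + ((1 - s) *\<^sub>R a n + s *\<^sub>R b n)" for s
    define v where "v s = w n s + (b n - a n)" for s
    have corr: "norm ((1 - s) *\<^sub>R a n + s *\<^sub>R b n) \<le> norm (a n) + norm (b n)" if "s \<in> {0..1}" for s
      using that by (intro order_trans[OF norm_triangle_ineq] add_mono) (auto simp: mult_left_le_one_le)
    have y: "(y has_vector_derivative v s) (at s within {0..1})" if "s \<in> {0..1}" for s
      unfolding y_def v_def using z[OF that, of n] by (auto intro!: derivative_eq_intros simp: algebra_simps)
    have v: "continuous_on {0..1} v" unfolding v_def by (intro continuous_intros w)
    have y_cont: "continuous_on {0..1} y" using y by (rule continuous_on_vector_derivative)
    have yb: "y s \<in> cball xc \<rho>" if "s \<in> {0..1}" for s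
    proof -
      have "norm (y s - xc) \<le> norm (z n s - xc) + norm ((1 - s) *\<^sub>R a n + s *\<^sub>R b n)"
        using norm_triangle_ineq[of "z n s - xc" "(1 - s) *\<^sub>R a n + s *\<^sub>R b n"]
        unfolding y_def by (simp only: diff_add_eq)
      also have "\<dots> \<le> \<rho> / 2 + d n"
        using zb[OF that, of n] corr[OF that] by (simp add: d_def dist_norm norm_minus_commute)
      finally show ?thesis using n by (simp add: dist_norm norm_minus_commute)
    qed
    have zb': "z n s \<in> cball xc \<rho>" if "s \<in> {0..1}" for s
      using zb[OF that, of n] \<rho> by simp
    have "integral {0..1} (\<lambda>s. G (t + h * s, x s) (h, u s) (h, u s))
        \<le> integral {0..1} (\<lambda>s. G (t + h * s, y s) (h, v s) (h, v s))"
      using m by (intro el_minimal[OF tlim h hm x u um xb y v yb]) (auto simp: y_def x01 a_def b_def small_def)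
    also have "\<dots> \<le> (1 + 8 * C * d n / c) * J' n + R n"
    proof (rule has_integral_le)
      show "((\<lambda>s. G (t + h * s, y s) (h, v s) (h, v s)) has_integral
          integral {0..1} (\<lambda>s. G (t + h * s, y s) (h, v s) (h, v s))) {0..1}"
        using yb th tlim h
        by (intro integrable_integral integrable_continuous_interval continuous_on_G continuous_intros y_cont v) auto
      have "((\<lambda>s. G (tn n + hn n * s, z n s) (hn n, w n s) (hn n, w n s)) has_integral J' n) {0..1}"
        unfolding J'_def using zb' th[OF _ t hn]
        by (intro integrable_integral integrable_continuous_interval continuous_on_G continuous_intros z_cont w) auto
      from has_integral_add[OF has_integral_mult_right[OF this] has_integral_const_real[of "R n" 0 1]]
      show "((\<lambda>s. (1 + 8 * C * d n / c) * G (tn n + hn n * s, z n s) (hn n, w n s) (hn n, w n s) + R n)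
          has_integral (1 + 8 * C * d n / c) * J' n + R n) {0..1}" by simp
      fix s :: real assume s: "s \<in> {0..1}"
      have "norm ((t + h * s, y s) - (tn n + hn n * s, z n s)) \<le> \<bar>(t - tn n) + (h - hn n) * s\<bar> + norm (y s - z n s)"
        using norm_Pair_le[of "(t - tn n) + (h - hn n) * s" "y s - z n s"] by (simp add: algebra_simps)
      also have "\<dots> \<le> (\<bar>t - tn n\<bar> + \<bar>h - hn n\<bar>) + (norm (a n) + norm (b n))"
        using corr[OF s] s mult_left_le[of s "\<bar>h - hn n\<bar>"]
        by (intro add_mono order_trans[OF abs_triangle_ineq]) (auto simp: y_def abs_mult)
      finally have 1: "norm ((t + h * s, y s) - (tn n + hn n * s, z n s)) \<le> d n" by (simp add: d_def)
      have "norm ((h, v s) - (hn n, w n s)) \<le> \<bar>h - hn n\<bar> + norm (b n - a n)"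
        using norm_Pair_le[of "h - hn n" "b n - a n"] by (simp add: v_def)
      then have 2: "norm ((h, v s) - (hn n, w n s)) \<le> d n"
        using norm_triangle_ineq4[of "b n" "a n"] by (simp add: d_def)
      show "G (t + h * s, y s) (h, v s) (h, v s) \<le>
          (1 + 8 * C * d n / c) * G (tn n + hn n * s, z n s) (hn n, w n s) (hn n, w n s) + R n"
        unfolding R_def
        by (rule action_perturbation[OF _ _ 1 2])
          (use n s yb zb' th[OF s tlim h] th[OF s t hn] t[of n] hn[of n] in \<open>auto simp: l_def\<close>)
    qed
    finally show ?thesis .
  qed
  moreover have "\<forall>\<^sub>F n in sequentially. d n < min 1 (\<rho> / 2)"
    using order_tendstoD(2)[OF d, of "min 1 (\<rho> / 2)"] \<rho> by simp
  ultimately have ev: "\<forall>\<^sub>F n in sequentially.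
      integral {0..1} (\<lambda>s. G (t + h * s, x s) (h, u s) (h, u s)) \<le> (1 + 8 * C * d n / c) * J' n + R n"
    by (simp add: eventually_mono)
  have J': "J' \<longlonglongrightarrow> J" using lim(5) by (simp add: J'_def[abs_def])
  have "(\<lambda>n. (1 + 8 * C * d n / c) * J' n + R n) \<longlonglongrightarrow>
      (1 + 8 * C * 0 / c) * J + C * 0 * (5 + 4 * (1 + energy_const / c) * l\<^sup>2)"
    unfolding R_def using c_pos by (intro tendsto_intros J' d) auto
  then have "(\<lambda>n. (1 + 8 * C * d n / c) * J' n + R n) \<longlonglongrightarrow> J" by simp
  then have "integral {0..1} (\<lambda>s. G (t + h * s, x s) (h, u s) (h, u s)) \<le> J"
    using ev by (rule tendsto_lowerbound) simp
  then show ?thesis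
    using x xb x01 continuous_on_vector_derivative[OF u] by (intro that[of x u]) auto
qed

end

section \<open>Uniform constants from C2 coefficients\<close>

text \<open>By bilinearity the upper bounds reduce to the finitely many pairs of basis vectors, each
  a C2 function on a compact convex set; 1 is added to their sum to make the constant positive. The
  ellipticity constant is the minimum of the form over the box and the unit sphere.\<close>

lemma lagrangian_box_exists:
  fixes G :: "real \<times> 'e::euclidean_space \<Rightarrow> real \<times> 'e \<Rightarrow> real \<times> 'e \<Rightarrow> real"
  assumes S: "open S" "{\<alpha>..\<beta>} \<times> cball xc \<rho> \<subseteq> S"
    and bil: "\<And>e. e \<in> S \<Longrightarrow> bilinear (G e)"
    and sym: "\<And>e U W. e \<in> S \<Longrightarrow> G e U W = G e W U"
    and C2: "\<And>U W. Ck_on 2 S (\<lambda>e. G e U W)"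
    and pos: "\<And>e u. e \<in> S \<Longrightarrow> u \<noteq> 0 \<Longrightarrow> 0 < G e (0, u) (0, u)"
  obtains DG C c where "lagrangian_box G DG \<alpha> \<beta> xc \<rho> C c"
proof -
  define P where "P = {\<alpha>..\<beta>} \<times> cball xc \<rho>"
  have P: "compact P" "convex P" "P \<subseteq> S"
    using S by (auto simp: P_def intro!: compact_Times convex_Times)
  define DG where "DG e Z U W = frechet_derivative (\<lambda>e. G e U W) (at e) Z" for e Z U W
  have deriv: "((\<lambda>e. G e U W) has_derivative (\<lambda>Z. DG e Z U W)) (at e)" if "e \<in> S" for e U W
    using C2[of U W] that by (auto simp: DG_def numeral_2_eq_2 intro: iffD1[OF frechet_derivative_works])
  \<comment> \<open>Bilinearity of the form at every point passes to its derivative in the base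
    point, because derivatives of sums and multiples are unique.\<close>
  have DG_eqI: "DG e Z U W = D Z"
    if "e \<in> S" "(f has_derivative D) (at e)" "\<And>e. e \<in> S \<Longrightarrow> f e = G e U W" for e Z U W f D
  proof -
    have "((\<lambda>e. G e U W) has_derivative D) (at e)"
      using has_derivative_transform_within_open[OF that(2) S(1) that(1)] that(3) by simp
    from has_derivative_unique[OF this deriv[OF that(1)]] show ?thesis by metis
  qed
  have Dbil: "bilinear (DG e Z)" if e: "e \<in> S" for e Z
  proof -
    note l = bilinear_ladd[OF bil] bilinear_radd[OF bil] bilinear_lmul[OF bil] bilinear_rmul[OF bil]
    have "DG e Z (U + U') W = DG e Z U W + DG e Z U' W" for U U' W
      by (rule DG_eqI[OF e has_derivative_add[OF deriv[OF e] deriv[OF e]]]) (simp add: l)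
    moreover have "DG e Z U (W + W') = DG e Z U W + DG e Z U W'" for U W W'
      by (rule DG_eqI[OF e has_derivative_add[OF deriv[OF e] deriv[OF e]]]) (simp add: l)
    moreover have "DG e Z (k *\<^sub>R U) W = k *\<^sub>R DG e Z U W" for k U W
      by (rule DG_eqI[OF e has_derivative_scaleR_right[OF deriv[OF e]]]) (simp add: l)
    moreover have "DG e Z U (k *\<^sub>R W) = k *\<^sub>R DG e Z U W" for k U W
      by (rule DG_eqI[OF e has_derivative_scaleR_right[OF deriv[OF e]]]) (simp add: l)
    ultimately show ?thesis by (auto simp: bilinear_def intro!: linearI)
  qed
  have Dlin: "linear (\<lambda>Z. DG e Z U W)" if "e \<in> S" for e U W
    by (rule bounded_linear.linear[OF has_derivative_bounded_linear[OF deriv[OF that]]])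
  define Pr where "Pr U W C \<longleftrightarrow> 0 \<le> C \<and> (\<forall>x\<in>P. \<bar>G x U W\<bar> \<le> C) \<and>
    (\<forall>x\<in>P. \<forall>Z. \<bar>DG x Z U W\<bar> \<le> C * norm Z) \<and>
    (\<forall>x\<in>P. \<forall>y\<in>P. \<bar>G y U W - G x U W\<bar> \<le> C * norm (y - x)) \<and>
    (\<forall>x\<in>P. \<forall>y\<in>P. \<forall>Z. \<bar>DG y Z U W - DG x Z U W\<bar> \<le> C * norm (y - x) * norm Z) \<and>
    (\<forall>x\<in>P. \<forall>y\<in>P. \<bar>G y U W - G x U W - DG x (y - x) U W\<bar> \<le> C * norm (y - x) ^ 2)" for U W C
  have "\<exists>C. Pr U W C" for U W
    unfolding DG_def Pr_def by (rule C2_bounds[OF C2[of U W] P(3,1,2)]) blast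
  \<comment> \<open>These constants depend on the pair of vectors; only those of basis pairs enter
    the final constant.\<close>
  then obtain C where C: "\<And>U W. Pr U W (C U W)" by metis
  then have C0: "\<And>U W. 0 \<le> C U W" and C1: "\<And>x U W. x \<in> P \<Longrightarrow> \<bar>G x U W\<bar> \<le> C U W"
    and C2: "\<And>x U W Z. x \<in> P \<Longrightarrow> \<bar>DG x Z U W\<bar> \<le> C U W * norm Z"
    and C3: "\<And>x y U W. x \<in> P \<Longrightarrow> y \<in> P \<Longrightarrow> \<bar>G y U W - G x U W\<bar> \<le> C U W * norm (y - x)"
    and C5: "\<And>x y U W. x \<in> P \<Longrightarrow> y \<in> P \<Longrightarrow>
      \<bar>G y U W - G x U W - DG x (y - x) U W\<bar> \<le> C U W * norm (y - x) ^ 2"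
    unfolding Pr_def by blast+
  have C4: "\<bar>DG y Z U W - DG x Z U W\<bar> \<le> C U W * (norm (y - x) * norm Z)" if "x \<in> P" "y \<in> P" for x y U W Z
  proof -
    have "\<bar>DG y Z U W - DG x Z U W\<bar> \<le> C U W * norm (y - x) * norm Z"
      using C[of U W] that unfolding Pr_def by blast
    then show ?thesis by (simp add: mult.assoc)
  qed
  define C' where "C' = (\<Sum>i\<in>(Basis::(real \<times> 'e) set). \<Sum>j\<in>Basis. C i j)"
  have C'0: "0 \<le> C'" unfolding C'_def by (intro sum_nonneg C0)
  have bsub: "bilinear (\<lambda>U W. f U W - g U W)" if "bilinear f" "bilinear g"
    for f g :: "real \<times> 'e \<Rightarrow> real \<times> 'e \<Rightarrow> real"
    using that by (simp add: bilinear_def linear_compose_sub)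
  have up: "x \<le> (C' + 1) * k * norm U * norm W" if "x \<le> C' * k * norm U * norm W" "0 \<le> k"
    for x k :: real and U W :: "real \<times> 'e"
    by (rule order_trans[OF that(1)]) (use that C'0 in \<open>auto intro!: mult_right_mono\<close>)
  define Q where "Q = P \<times> sphere (0::'e) 1"
  have "\<exists>c>0. \<forall>e\<in>P. \<forall>u. norm u = 1 \<longrightarrow> c \<le> G e (0, u) (0, u)"
  proof (cases "Q = {}")
    case True
    \<comment> \<open>The unit sphere is nonempty, so it can only be the box that is empty, and then
      any constant will do.\<close>
    then have "P = {}" using nonempty_Basis[where 'a = 'e] by (auto simp: Q_def)
    then show ?thesis by (intro exI[of _ 1]) auto
  next
    case False
    have "continuous_on P (\<lambda>e. G e i j)" for i j
      using deriv P by (intro continuous_at_imp_continuous_on) (blast dest: has_derivative_continuous)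
    then have "continuous_on Q (\<lambda>p. G (fst p) i j)" for i j
      unfolding Q_def by (rule continuous_on_compose2[OF _ continuous_on_fst[OF continuous_on_id]]) auto
    then have "continuous_on Q (\<lambda>p. \<Sum>i\<in>Basis. \<Sum>j\<in>Basis. ((0::real, snd p) \<bullet> i) * ((0::real, snd p) \<bullet> j) * G (fst p) i j)"
      by (intro continuous_intros) auto
    also have "?this \<longleftrightarrow> continuous_on Q (\<lambda>p. G (fst p) (0, snd p) (0, snd p))"
      using P by (intro continuous_on_cong refl bilinear_expand[OF bil, symmetric]) (auto simp: Q_def)
    finally have *: "continuous_on Q (\<lambda>p. G (fst p) (0, snd p) (0, snd p))" .
    have "compact Q" unfolding Q_def by (intro compact_Times P) simp
    from continuous_attains_inf[OF this False *] obtain q where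
      q: "q \<in> Q" "\<And>p. p \<in> Q \<Longrightarrow> G (fst q) (0, snd q) (0, snd q) \<le> G (fst p) (0, snd p) (0, snd p)" by blast
    have "0 < G (fst q) (0, snd q) (0, snd q)" using q(1) P by (intro pos) (auto simp: Q_def)
    moreover have "\<forall>e\<in>P. \<forall>u. norm u = 1 \<longrightarrow> G (fst q) (0, snd q) (0, snd q) \<le> G e (0, u) (0, u)"
      using q(2) by (force simp: Q_def)
    ultimately show ?thesis by blast
  qed
  then obtain c where c: "0 < c" "\<And>e u. e \<in> P \<Longrightarrow> norm u = 1 \<Longrightarrow> c \<le> G e (0, u) (0, u)" by blast
  have pos': "c * (norm u)\<^sup>2 \<le> G e (0, u) (0, u)" if e: "e \<in> P" for e u
  proof (cases "u = 0")
    case True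
    then show ?thesis using bilinear_rzero[OF bil, of e "(0, 0)"] P(3) e by (auto simp: zero_prod_def)
  next
    case False
    define v where "v = u /\<^sub>R norm u"
    have "norm v = 1" and "(0, u) = norm u *\<^sub>R (0, v)" using False by (auto simp: v_def)
    moreover from this have "G e (0, u) (0, u) = (norm u)\<^sup>2 * G e (0, v) (0, v)"
      using bilinear_lmul[OF bil, of e "norm u" "(0, v)"] bilinear_rmul[OF bil, of e _ "norm u" "(0, v)"] P(3) e
      by (auto simp: power2_eq_square)
    moreover have "(norm u)\<^sup>2 * c \<le> (norm u)\<^sup>2 * G e (0, v) (0, v)"
      using c(2)[OF e \<open>norm v = 1\<close>] by (intro mult_left_mono) auto
    ultimately show ?thesis by (simp add: mult.commute)
  qed
  have "lagrangian_box G DG \<alpha> \<beta> xc \<rho> (C' + 1) c"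
    unfolding lagrangian_box_def P_def[symmetric]
  proof (intro conjI allI impI)
    fix e e' Z U W assume e: "e \<in> P"
    then have eS: "e \<in> S" using P by auto
    show "bilinear (G e)" "G e U W = G e W U" "linear (\<lambda>Z. DG e Z U W)" "bilinear (DG e Z)"
      "((\<lambda>e. G e U W) has_derivative (\<lambda>Z. DG e Z U W)) (at e)"
      using eS bil sym Dlin Dbil deriv by blast+
    show "\<bar>G e U W\<bar> \<le> (C' + 1) * norm U * norm W"
      using bilinear_basis_bound[OF bil[OF eS], of C 1 U W] C1[OF e] up[of _ 1 U W]
      by (simp add: C'_def)
    show "\<bar>DG e Z U W\<bar> \<le> (C' + 1) * norm Z * norm U * norm W"
      using bilinear_basis_bound[OF Dbil[OF eS], of Z C "norm Z" U W] C2[OF e]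
      by (intro up) (auto simp: C'_def)
    assume e': "e' \<in> P"
    then have eS': "e' \<in> S" using P by auto
    show "\<bar>G e' U W - G e U W\<bar> \<le> (C' + 1) * norm (e' - e) * norm U * norm W"
      using bilinear_basis_bound[OF bsub[OF bil[OF eS'] bil[OF eS]], of C "norm (e' - e)" U W] C3[OF e e']
      by (intro up) (auto simp: C'_def)
    show "\<bar>DG e' Z U W - DG e Z U W\<bar> \<le> (C' + 1) * norm (e' - e) * norm Z * norm U * norm W"
      using bilinear_basis_bound[OF bsub[OF Dbil[OF eS'] Dbil[OF eS]], of Z Z C "norm (e' - e) * norm Z" U W] C4[OF e e']
        up[of _ "norm (e' - e) * norm Z" U W]
      by (simp add: C'_def mult.assoc)
    show "\<bar>G e' U W - G e U W - DG e (e' - e) U W\<bar> \<le> (C' + 1) * (norm (e' - e))\<^sup>2 * norm U * norm W"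
      using bilinear_basis_bound[OF bsub[OF bsub[OF bil[OF eS'] bil[OF eS]] Dbil[OF eS]],
          of "e' - e" C "norm (e' - e) ^ 2" U W] C5[OF e e']
      by (intro up) (auto simp: C'_def)
  qed (use C'0 c(1) pos' in auto)
  then show ?thesis by (rule that)
qed


section \<open>Curves and tangent vectors in charts\<close>

lemma continuous_on_local:
  assumes "\<And>s. s \<in> S \<Longrightarrow> \<exists>U. open U \<and> s \<in> U \<and> continuous_on (S \<inter> U) f"
  shows "continuous_on S f"
  unfolding continuous_on_def
proof
  fix s assume s: "s \<in> S"
  then obtain U where U: "open U" "s \<in> U" "continuous_on (S \<inter> U) f" using assms by blast
  have "at s within (S \<inter> U) = at s within S" by (rule at_within_nhd[OF U(2,1)]) auto
  then show "(f \<longlongrightarrow> f s) (at s within S)" using U s unfolding continuous_on_def by (metis IntI)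
qed

lemma continuous_on_preimage_open:
  assumes "continuous_on S g" "open B"
  obtains U where "open U" "S \<inter> g -` B = S \<inter> U"
  using continuous_on_open_invariant[of S g] assms by (metis inf_commute)

text \<open>By continuity the curve remains in \<open>B\<close> for parameters near
  \<open>s\<close>, so the two functions agree there. This is how expressions valid in one chart
  only are differentiated along a curve.\<close>

lemma has_vector_derivative_cong_preimage:
  assumes "continuous_on S \<gamma>" "open B" "\<gamma> s \<in> B" "s \<in> S" "\<And>\<sigma>. \<sigma> \<in> S \<Longrightarrow> \<gamma> \<sigma> \<in> B \<Longrightarrow> f \<sigma> = g \<sigma>"
    and "(f has_vector_derivative v) (at s within S)"
  shows "(g has_vector_derivative v) (at s within S)"
proof -
  obtain U where U: "open U" "S \<inter> \<gamma> -` B = S \<inter> U"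
    using continuous_on_preimage_open[OF assms(1,2)] by metis
  then have "s \<in> U" using assms(3,4) by blast
  with U(1) obtain d where d: "0 < d" "\<And>\<sigma>. dist \<sigma> s < d \<Longrightarrow> \<sigma> \<in> U"
    unfolding open_dist by blast
  show ?thesis
    by (rule has_vector_derivative_transform_within[OF assms(6) d(1) assms(4)])
      (use d(2) U(2) assms(5) in blast)
qed

context generalized_gravitational_wave
begin

section \<open>Charts, transition maps and tangent vectors\<close>

lemma charts:
  assumes "c \<in> A"
  shows open_chart: "open (fst c)" and open_chart_image: "open (snd c ` fst c)"
    and inj_on_chart: "inj_on (snd c) (fst c)"
    and continuous_on_chart: "continuous_on (fst c) (snd c)"
    and continuous_on_chart_inv: "continuous_on (snd c ` fst c) (chart_inv c)"
proof -
  have "is_chart c" using Q_atlas assms by (simp add: Ck_atlas_def)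
  then obtain g where o: "open (fst c)" "open (snd c ` fst c)"
    and g: "homeomorphism (fst c) (snd c ` fst c) (snd c) g" by (auto simp: is_chart_def)
  show "open (fst c)" "open (snd c ` fst c)" by fact+
  show inj: "inj_on (snd c) (fst c)" using homeomorphism_apply1[OF g] by (rule inj_on_inverseI)
  show "continuous_on (fst c) (snd c)" using g by (rule homeomorphism_cont1)
  have "chart_inv c x = g x" if "x \<in> snd c ` fst c" for x
    using g that inj by (auto simp: chart_inv_def homeomorphism_apply1)
  then show "continuous_on (snd c ` fst c) (chart_inv c)"
    using homeomorphism_cont2[OF g] by (simp cong: continuous_on_cong)
qed

lemma chart_exists: obtains c where "c \<in> A" "q \<in> fst c"
  using Q_atlas unfolding Ck_atlas_def by blast

lemma chart_inv_chart [simp]: "c \<in> A \<Longrightarrow> q \<in> fst c \<Longrightarrow> chart_inv c (snd c q) = q"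
  using inj_on_chart by (simp add: chart_inv_def)

lemma chart_chart_inv [simp]: "x \<in> snd c ` fst c \<Longrightarrow> snd c (chart_inv c x) = x"
  by (simp add: chart_inv_def f_inv_into_f)

lemma chart_inv_mem: "x \<in> snd c ` fst c \<Longrightarrow> chart_inv c x \<in> fst c"
  by (simp add: chart_inv_def inv_into_into)

lemma open_overlap:
  assumes "c \<in> A" "c' \<in> A"
  shows "open (snd c ` (fst c \<inter> fst c'))"
proof -
  have "snd c ` (fst c \<inter> fst c') = snd c ` fst c \<inter> chart_inv c -` fst c'"
    using assms by auto
  then show ?thesis
    using continuous_on_open_vimage[OF open_chart_image[OF assms(1)], of "chart_inv c"] assms
      continuous_on_chart_inv open_chart by (metis inf_commute)
qed

lemma transition_apply: "c \<in> A \<Longrightarrow> q \<in> fst c \<Longrightarrow> transition c c' (snd c q) = snd c' q"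
  by (simp add: transition_def)

lemma transition_C1:
  assumes "c \<in> A" "c' \<in> A"
  shows "Ck_on 1 (snd c ` (fst c \<inter> fst c')) (transition c c')"
proof -
  have "Ck_on (r + 1) (snd c ` (fst c \<inter> fst c')) (transition c c')"
    using Q_atlas assms unfolding Ck_atlas_def by blast
  then show ?thesis by (rule Ck_on_antimono[rotated]) simp
qed

lemma transition_derivative:
  assumes "c \<in> A" "c' \<in> A" "q \<in> fst c" "q \<in> fst c'"
  shows "(transition c c' has_derivative frechet_derivative (transition c c') (at (snd c q))) (at (snd c q))"
  using transition_C1[OF assms(1,2)] assms by (auto intro!: iffD1[OF frechet_derivative_works])

lemma transition_derivative_linear:
  assumes "c \<in> A" "c' \<in> A" "q \<in> fst c" "q \<in> fst c'"
  shows "linear (frechet_derivative (transition c c') (at (snd c q)))"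
  by (rule bounded_linear.linear[OF has_derivative_bounded_linear[OF transition_derivative[OF assms]]])

lemma transition_derivative_refl:
  assumes "c \<in> A" "q \<in> fst c"
  shows "frechet_derivative (transition c c) (at (snd c q)) u = u"
proof -
  have "(transition c c has_derivative (\<lambda>u. u)) (at (snd c q))"
    by (rule has_derivative_transform_within_open[OF has_derivative_ident open_chart_image[OF assms(1)]])
      (use assms in \<open>auto simp: transition_apply\<close>)
  from frechet_derivative_at[OF this] show ?thesis by metis
qed

text \<open>The chain rule: on the overlap of the first two charts, hence near the point, the
  composed transition maps agree with the direct one.\<close>

lemma transition_derivative_trans:
  assumes "c \<in> A" "c' \<in> A" "c'' \<in> A" "q \<in> fst c" "q \<in> fst c'" "q \<in> fst c''"
  shows "frechet_derivative (transition c c'') (at (snd c q)) u =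
    frechet_derivative (transition c' c'') (at (snd c' q)) (frechet_derivative (transition c c') (at (snd c q)) u)"
proof -
  have "((transition c' c'' \<circ> transition c c') has_derivative
     (frechet_derivative (transition c' c'') (at (snd c' q)) \<circ> frechet_derivative (transition c c') (at (snd c q)))) (at (snd c q))"
    using transition_derivative[OF assms(1,2,4,5)] transition_derivative[OF assms(2,3,5,6)] assms
    by (intro diff_chain_at) (auto simp: transition_apply)
  then have "(transition c c'' has_derivative
     (frechet_derivative (transition c' c'') (at (snd c' q)) \<circ> frechet_derivative (transition c c') (at (snd c q)))) (at (snd c q))"
    by (rule has_derivative_transform_within_open[OF _ open_overlap[OF assms(1,2)]])
      (use assms in \<open>auto simp: transition_apply\<close>)
  from frechet_derivative_at[OF this] show ?thesis by (metis comp_apply)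
qed

lemma coord_vector_chart [simp]: "c \<in> A \<Longrightarrow> q \<in> fst c \<Longrightarrow> coord_vector A c q u c = u"
  by (simp add: coord_vector_def transition_derivative_refl)

lemma coord_vector_tangent: "c \<in> A \<Longrightarrow> q \<in> fst c \<Longrightarrow> coord_vector A c q u \<in> tangent_space A q"
  unfolding tangent_space_def coord_vector_def
proof (intro CollectI conjI allI ballI impI)
  fix c' c'' assume c: "c \<in> A" "q \<in> fst c" "c' \<in> A" "c'' \<in> A" "q \<in> fst c' \<inter> fst c''"
  then show "(if c'' \<in> A \<and> q \<in> fst c'' then frechet_derivative (transition c c'') (at (snd c q)) u else 0) =
      frechet_derivative (transition c' c'') (at (snd c' q))
        (if c' \<in> A \<and> q \<in> fst c' then frechet_derivative (transition c c') (at (snd c q)) u else 0)"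
    using transition_derivative_trans[of c c' c'' q u] by simp
qed meson

lemma tangent_eq_coord_vector:
  "c \<in> A \<Longrightarrow> q \<in> fst c \<Longrightarrow> v \<in> tangent_space A q \<Longrightarrow> coord_vector A c q (v c) = v"
proof (rule ext)
  fix c' assume c: "c \<in> A" "q \<in> fst c" "v \<in> tangent_space A q"
  show "coord_vector A c q (v c) c' = v c'"
  proof (cases "c' \<in> A \<and> q \<in> fst c'")
    case True
    then have "v c' = frechet_derivative (transition c c') (at (snd c q)) (v c)"
      using c unfolding tangent_space_def by blast
    then show ?thesis using True by (simp add: coord_vector_def)
  next
    case False
    then have "v c' = 0" using c(3) unfolding tangent_space_def by blast
    then show ?thesis using False by (auto simp: coord_vector_def)
  qed
qed

lemma coord_vector_0 [simp]: "c \<in> A \<Longrightarrow> q \<in> fst c \<Longrightarrow> coord_vector A c q 0 = (\<lambda>_. 0)"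
  by (rule ext) (auto simp: coord_vector_def linear_0[OF transition_derivative_linear])

text \<open>The Lagrangian as a quadratic form in the extended velocity \<open>(h, v)\<close>; its value at \<open>h = 1\<close> is
  twice the Lagrangian.\<close>

definition form :: "real \<Rightarrow> 'q \<Rightarrow> real \<times> ('q, 'e) tangent_vector \<Rightarrow> real \<times> ('q, 'e) tangent_vector \<Rightarrow> real" where
  "form t q U W = a t q (snd U) (snd W) + fst U * b t q (snd W) + fst W * b t q (snd U)
     - 2 * fst U * fst W * V t q"

definition coord_form :: "('q, 'e) chart \<Rightarrow> real \<times> 'e \<Rightarrow> real \<times> 'e \<Rightarrow> real \<times> 'e \<Rightarrow> real" where
  "coord_form c e U W = (let q = chart_inv c (snd e) in
     form (fst e) q (fst U, coord_vector A c q (snd U)) (fst W, coord_vector A c q (snd W)))"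

lemma Lagrangian_form: "Lagrangian t q v = form t q (1, v) (1, v) / 2"
  by (simp add: Lagrangian_def form_def)

lemma form_coord:
  assumes "c \<in> A" "q \<in> fst c" "v \<in> tangent_space A q" "w \<in> tangent_space A q"
  shows "form t q (h, v) (k, w) = coord_form c (t, snd c q) (h, v c) (k, w c)"
  using assms by (simp add: coord_form_def tangent_eq_coord_vector)

lemma coord_form_bilinear:
  assumes "c \<in> A" "e \<in> T \<times> snd c ` fst c"
  shows "bilinear (coord_form c e)"
proof -
  define q where "q = chart_inv c (snd e)"
  have q: "q \<in> fst c" "fst e \<in> T" using assms by (auto simp: q_def chart_inv_mem)
  note a = a_bilinear[OF q(2) assms(1) q(1)]
  note b = b_linear[OF q(2) assms(1) q(1)]
  show ?thesis
    unfolding bilinear_def coord_form_def q_def[symmetric] form_def Let_def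
    by (auto intro!: linearI simp: linear_add[OF b] linear_scale[OF b] bilinear_ladd[OF a] bilinear_radd[OF a]
      bilinear_lmul[OF a] bilinear_rmul[OF a] algebra_simps)
qed

lemma coord_form_sym:
  assumes "c \<in> A" "e \<in> T \<times> snd c ` fst c"
  shows "coord_form c e U W = coord_form c e W U"
proof -
  define q where "q = chart_inv c (snd e)"
  have q: "q \<in> fst c" "fst e \<in> T" using assms by (auto simp: q_def chart_inv_mem)
  show ?thesis
    unfolding coord_form_def q_def[symmetric] form_def Let_def
    using a_sym[OF q(2) coord_vector_tangent[OF assms(1) q(1)] coord_vector_tangent[OF assms(1) q(1)]] by simp
qed

lemma coord_form_pos:
  assumes "c \<in> A" "e \<in> T \<times> snd c ` fst c" "u \<noteq> 0"
  shows "0 < coord_form c e (0, u) (0, u)"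
proof -
  define q where "q = chart_inv c (snd e)"
  have q: "q \<in> fst c" "fst e \<in> T" using assms by (auto simp: q_def chart_inv_mem)
  have "coord_vector A c q u c \<noteq> 0" using assms q by simp
  then have "coord_vector A c q u \<noteq> (\<lambda>_. 0)" by metis
  from a_pos_def[OF q(2) coord_vector_tangent[OF assms(1) q(1)] this]
  show ?thesis by (simp add: coord_form_def q_def[symmetric] form_def)
qed

lemma open_box: "c \<in> A \<Longrightarrow> open (T \<times> snd c ` fst c)"
  by (intro open_Times T_interval open_chart_image)

text \<open>For fixed \<open>U\<close> and \<open>W\<close> this is a linear combination of the
  coefficient functions, which are of class C2 because \<open>r\<close> is at least 2.\<close>

lemma coord_form_C2:
  assumes "c \<in> A"
  shows "Ck_on 2 (T \<times> snd c ` fst c) (\<lambda>e. coord_form c e U W)"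
proof -
  note r = Ck_on_antimono[OF r_ge_2]
  note s = Ck_on_scaleR[OF open_box[OF assms], where 'b = real, simplified]
  have "Ck_on 2 (T \<times> snd c ` fst c)
     (\<lambda>e. (case e of (t, x) \<Rightarrow> let q = chart_inv c x in a t q (coord_vector A c q (snd U)) (coord_vector A c q (snd W)))
       + fst U * (case e of (t, x) \<Rightarrow> let q = chart_inv c x in b t q (coord_vector A c q (snd W)))
       + fst W * (case e of (t, x) \<Rightarrow> let q = chart_inv c x in b t q (coord_vector A c q (snd U)))
       + (- 2 * fst U * fst W) * (case e of (t, x) \<Rightarrow> V t (chart_inv c x)))"
    by (intro Ck_on_add[OF open_box[OF assms]] s r[OF a_Cr[OF assms]] r[OF b_Cr[OF assms]] r[OF V_Cr[OF assms]])
  then show ?thesis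
    by (rule iffD1[OF Ck_on_cong[OF open_box[OF assms]], rotated])
      (auto simp: coord_form_def form_def Let_def)
qed

lemma continuous_on_coord_form:
  fixes e U W :: "'z::topological_space \<Rightarrow> real \<times> 'e"
  assumes c: "c \<in> A" and e: "continuous_on S e" and U: "continuous_on S U" and W: "continuous_on S W"
    and eS: "\<And>s. s \<in> S \<Longrightarrow> e s \<in> T \<times> snd c ` fst c"
  shows "continuous_on S (\<lambda>s. coord_form c (e s) (U s) (W s))"
proof -
  have C0: "continuous_on (T \<times> snd c ` fst c) (\<lambda>e. coord_form c e i j)" for i j
    using Ck_on_antimono[OF _ coord_form_C2[OF c], of 0] by simp
  have "continuous_on S (\<lambda>s. coord_form c (e s) i j)" for i j
    using eS by (intro continuous_on_compose2[OF C0 e] image_subsetI)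
  then have "continuous_on S (\<lambda>s. \<Sum>i\<in>Basis. \<Sum>j\<in>Basis. (U s \<bullet> i) * (W s \<bullet> j) * coord_form c (e s) i j)"
    using U W by (intro continuous_intros) auto
  then show ?thesis using bilinear_expand[OF coord_form_bilinear[OF c eS]] by (simp cong: continuous_on_cong)
qed

section \<open>Calculus of C1 curves in \<open>Q\<close>\<close>

lemma C1_curve_derivative:
  assumes "C1_curve A \<alpha> \<beta> \<gamma>" "c \<in> A" "s \<in> {\<alpha>..\<beta>}" "\<gamma> s \<in> fst c"
  shows "((\<lambda>s. snd c (\<gamma> s)) has_vector_derivative velocity A \<alpha> \<beta> \<gamma> s c) (at s within {\<alpha>..\<beta>})"
  using assms by (auto simp: C1_curve_def velocity_def vector_derivative_works o_def)

lemma C1_curve_continuous: "C1_curve A \<alpha> \<beta> \<gamma> \<Longrightarrow> continuous_on {\<alpha>..\<beta>} \<gamma>"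
  by (simp add: C1_curve_def)

lemma velocity_continuous:
  assumes "C1_curve A \<alpha> \<beta> \<gamma>" "c \<in> A"
  shows "continuous_on {s\<in>{\<alpha>..\<beta>}. \<gamma> s \<in> fst c} (\<lambda>s. velocity A \<alpha> \<beta> \<gamma> s c)"
proof -
  have "continuous_on {s\<in>{\<alpha>..\<beta>}. \<gamma> s \<in> fst c} (\<lambda>s. vector_derivative (snd c \<circ> \<gamma>) (at s within {\<alpha>..\<beta>}))"
    using assms by (simp add: C1_curve_def)
  then show ?thesis by (rule continuous_on_eq) (use assms in \<open>auto simp: velocity_def\<close>)
qed

lemma velocity_eqI:
  assumes "\<alpha> < \<beta>" "s \<in> {\<alpha>..\<beta>}" "c \<in> A" "\<gamma> s \<in> fst c"
    "((\<lambda>s. snd c (\<gamma> s)) has_vector_derivative u) (at s within {\<alpha>..\<beta>})"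
  shows "velocity A \<alpha> \<beta> \<gamma> s c = u"
  using assms vector_derivative_within_cbox[of \<alpha> \<beta> s "\<lambda>s. snd c (\<gamma> s)" u]
  by (simp add: velocity_def o_def)

text \<open>A candidate \<open>u\<close> for the velocity replaces the chosen
  \<open>vector_derivative\<close>. The strict inequality of the ends makes one-sided derivatives
  unique, so the two agree.\<close>

lemma C1_curveI:
  assumes ab: "\<alpha> < \<beta>" and \<gamma>: "continuous_on {\<alpha>..\<beta>} \<gamma>"
    and d: "\<And>c s. c \<in> A \<Longrightarrow> s \<in> {\<alpha>..\<beta>} \<Longrightarrow> \<gamma> s \<in> fst c \<Longrightarrow>
      ((\<lambda>s. snd c (\<gamma> s)) has_vector_derivative u s c) (at s within {\<alpha>..\<beta>})"
    and u: "\<And>c. c \<in> A \<Longrightarrow> continuous_on {s\<in>{\<alpha>..\<beta>}. \<gamma> s \<in> fst c} (\<lambda>s. u s c)"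
  shows "C1_curve A \<alpha> \<beta> \<gamma>"
  unfolding C1_curve_def
proof (intro conjI ballI impI \<gamma>)
  fix c assume c: "c \<in> A"
  show "(snd c \<circ> \<gamma>) differentiable (at s within {\<alpha>..\<beta>})" if "s \<in> {\<alpha>..\<beta>}" "\<gamma> s \<in> fst c" for s
    using d[OF c that] by (auto simp: o_def intro: differentiableI_vector)
  show "continuous_on {s\<in>{\<alpha>..\<beta>}. \<gamma> s \<in> fst c} (\<lambda>s. vector_derivative (snd c \<circ> \<gamma>) (at s within {\<alpha>..\<beta>}))"
  proof (rule continuous_on_eq[OF u[OF c]])
    fix s assume "s \<in> {s\<in>{\<alpha>..\<beta>}. \<gamma> s \<in> fst c}"
    then show "u s c = vector_derivative (snd c \<circ> \<gamma>) (at s within {\<alpha>..\<beta>})"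
      using d[OF c, of s] ab vector_derivative_within_cbox[of \<alpha> \<beta> s "\<lambda>s. snd c (\<gamma> s)" "u s c"] by (simp add: o_def)
  qed
qed

lemma velocity_tangent:
  assumes "\<alpha> < \<beta>" "C1_curve A \<alpha> \<beta> \<gamma>" "s \<in> {\<alpha>..\<beta>}"
  shows "velocity A \<alpha> \<beta> \<gamma> s \<in> tangent_space A (\<gamma> s)"
  unfolding tangent_space_def
proof (intro CollectI conjI allI ballI impI)
  show "velocity A \<alpha> \<beta> \<gamma> s c = 0" if "\<not> (c \<in> A \<and> \<gamma> s \<in> fst c)" for c
    using that by (auto simp: velocity_def)
  fix c c' assume "c \<in> A" "c' \<in> A" "\<gamma> s \<in> fst c \<inter> fst c'"
  then have c: "c \<in> A" "c' \<in> A" "\<gamma> s \<in> fst c" "\<gamma> s \<in> fst c'" by auto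
  let ?D = "frechet_derivative (transition c c') (at (snd c (\<gamma> s)))"
  have "((transition c c' \<circ> (\<lambda>s. snd c (\<gamma> s))) has_derivative (?D \<circ> (\<lambda>h. h *\<^sub>R velocity A \<alpha> \<beta> \<gamma> s c))) (at s within {\<alpha>..\<beta>})"
    using C1_curve_derivative[OF assms(2) c(1) assms(3) c(3)]
    by (intro diff_chain_within has_derivative_at_withinI[OF transition_derivative[OF c]])
      (simp add: has_vector_derivative_def)
  then have "((\<lambda>s. transition c c' (snd c (\<gamma> s))) has_vector_derivative ?D (velocity A \<alpha> \<beta> \<gamma> s c)) (at s within {\<alpha>..\<beta>})"
    using linear_scale[OF transition_derivative_linear[OF c]] by (simp add: has_vector_derivative_def o_def)
  then have "((\<lambda>s. snd c' (\<gamma> s)) has_vector_derivative ?D (velocity A \<alpha> \<beta> \<gamma> s c)) (at s within {\<alpha>..\<beta>})"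
    by (rule has_vector_derivative_cong_preimage[OF C1_curve_continuous[OF assms(2)] open_chart[OF c(1)] c(3) assms(3), rotated])
      (simp add: transition_apply c)
  from velocity_eqI[OF assms(1,3) c(2,4) this] show "velocity A \<alpha> \<beta> \<gamma> s c' = ?D (velocity A \<alpha> \<beta> \<gamma> s c)" .
qed

end

lemma has_vector_derivative_union:
  assumes "(f has_vector_derivative v) (at s within A)" "(f has_vector_derivative v) (at s within B)"
  shows "(f has_vector_derivative v) (at s within (A \<union> B))"
  using assms unfolding has_vector_derivative_def has_derivative_within
  by (auto simp: at_within_union intro: filterlim_sup)

lemma at_within_Icc_left:
  fixes s :: real
  assumes "s < b" "b \<le> c" shows "at s within {a..b} = at s within {a..c}"
  by (rule at_within_nhd[of s "{..<b}"]) (use assms in auto)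

lemma at_within_Icc_right:
  fixes s :: real
  assumes "b < s" "a \<le> b" shows "at s within {b..c} = at s within {a..c}"
  by (rule at_within_nhd[of s "{b<..}"]) (use assms in auto)

context generalized_gravitational_wave
begin

lemma continuous_on_curve_chart:
  assumes "continuous_on {\<alpha>..\<beta>} \<gamma>" "c \<in> A"
  shows "continuous_on {s\<in>{\<alpha>..\<beta>}. \<gamma> s \<in> fst c} (\<lambda>s. snd c (\<gamma> s))"
  by (rule continuous_on_compose2[OF continuous_on_chart[OF assms(2)]])
    (auto intro: continuous_on_subset[OF assms(1)])

lemma velocity_eqI':
  assumes ab: "\<alpha> < \<beta>" "s \<in> {\<alpha>..\<beta>}"
    and d: "\<And>c. c \<in> A \<Longrightarrow> \<gamma> s \<in> fst c \<Longrightarrow> ((\<lambda>s. snd c (\<gamma> s)) has_vector_derivative u c) (at s within {\<alpha>..\<beta>})"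
    and z: "\<And>c. \<not> (c \<in> A \<and> \<gamma> s \<in> fst c) \<Longrightarrow> u c = 0"
  shows "velocity A \<alpha> \<beta> \<gamma> s = u"
proof
  fix c show "velocity A \<alpha> \<beta> \<gamma> s c = u c"
  proof (cases "c \<in> A \<and> \<gamma> s \<in> fst c")
    case True then show ?thesis using velocity_eqI[OF ab, of c \<gamma>] d by blast
  next
    case False then show ?thesis using z[OF False] by (auto simp: velocity_def)
  qed
qed

text \<open>The parameter change need only be C1 and map into the old interval. It is used for
  inverses and affine maps, and for maps whose derivative vanishes at the ends.\<close>

lemma C1_curve_reparam:
  assumes ab: "\<alpha> < \<beta>" "\<alpha>' < \<beta>'" and \<gamma>: "C1_curve A \<alpha> \<beta> \<gamma>"
    and \<phi>: "\<And>s. s \<in> {\<alpha>'..\<beta>'} \<Longrightarrow> \<phi> s \<in> {\<alpha>..\<beta>}"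
    and d: "\<And>s. s \<in> {\<alpha>'..\<beta>'} \<Longrightarrow> (\<phi> has_vector_derivative \<phi>' s) (at s within {\<alpha>'..\<beta>'})"
    and \<phi>': "continuous_on {\<alpha>'..\<beta>'} \<phi>'"
  shows "C1_curve A \<alpha>' \<beta>' (\<lambda>s. \<gamma> (\<phi> s))"
    and "s \<in> {\<alpha>'..\<beta>'} \<Longrightarrow> velocity A \<alpha>' \<beta>' (\<lambda>s. \<gamma> (\<phi> s)) s = (\<lambda>c. \<phi>' s *\<^sub>R velocity A \<alpha> \<beta> \<gamma> (\<phi> s) c)"
proof -
  have cont: "continuous_on {\<alpha>'..\<beta>'} \<phi>" using d by (rule continuous_on_vector_derivative)
  have D: "((\<lambda>s. snd c (\<gamma> (\<phi> s))) has_vector_derivative \<phi>' s *\<^sub>R velocity A \<alpha> \<beta> \<gamma> (\<phi> s) c) (at s within {\<alpha>'..\<beta>'})"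
    if "c \<in> A" "s \<in> {\<alpha>'..\<beta>'}" "\<gamma> (\<phi> s) \<in> fst c" for c s
  proof -
    have "\<phi> s \<in> {\<alpha>..\<beta>}" using \<phi> that by auto
    moreover have "\<phi> ` {\<alpha>'..\<beta>'} \<subseteq> {\<alpha>..\<beta>}" using \<phi> by blast
    ultimately have "((\<lambda>s. snd c (\<gamma> s)) has_vector_derivative velocity A \<alpha> \<beta> \<gamma> (\<phi> s) c) (at (\<phi> s) within \<phi> ` {\<alpha>'..\<beta>'})"
      using C1_curve_derivative[OF \<gamma> that(1) _ that(3)] by (blast intro: has_vector_derivative_within_subset)
    from vector_diff_chain_within[OF d[OF that(2)] this] show ?thesis by (simp add: o_def)
  qed
  show "C1_curve A \<alpha>' \<beta>' (\<lambda>s. \<gamma> (\<phi> s))"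
  proof (rule C1_curveI[OF ab(2) _ D])
    show "continuous_on {\<alpha>'..\<beta>'} (\<lambda>s. \<gamma> (\<phi> s))"
      using \<phi> by (intro continuous_on_compose2[OF C1_curve_continuous[OF \<gamma>] cont] image_subsetI)
    show "continuous_on {s \<in> {\<alpha>'..\<beta>'}. \<gamma> (\<phi> s) \<in> fst c} (\<lambda>s. \<phi>' s *\<^sub>R velocity A \<alpha> \<beta> \<gamma> (\<phi> s) c)" if "c \<in> A" for c
    proof (rule continuous_on_scaleR)
      show "continuous_on {s \<in> {\<alpha>'..\<beta>'}. \<gamma> (\<phi> s) \<in> fst c} \<phi>'"
        by (rule continuous_on_subset[OF \<phi>']) auto
      show "continuous_on {s \<in> {\<alpha>'..\<beta>'}. \<gamma> (\<phi> s) \<in> fst c} (\<lambda>s. velocity A \<alpha> \<beta> \<gamma> (\<phi> s) c)"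
        by (rule continuous_on_compose2[OF velocity_continuous[OF \<gamma> that]])
          (use \<phi> in \<open>force intro: continuous_on_subset[OF cont]\<close>)+
    qed
  qed
  show "velocity A \<alpha>' \<beta>' (\<lambda>s. \<gamma> (\<phi> s)) s = (\<lambda>c. \<phi>' s *\<^sub>R velocity A \<alpha> \<beta> \<gamma> (\<phi> s) c)" if "s \<in> {\<alpha>'..\<beta>'}"
    by (rule velocity_eqI'[OF ab(2) that D[OF _ that]]) (auto simp: velocity_def)
qed

lemma C1_curve_cong:
  assumes ab: "\<alpha> < \<beta>" and \<gamma>: "C1_curve A \<alpha> \<beta> \<gamma>" and eq: "\<And>s. s \<in> {\<alpha>..\<beta>} \<Longrightarrow> \<gamma>' s = \<gamma> s"
  shows "C1_curve A \<alpha> \<beta> \<gamma>'" and "s \<in> {\<alpha>..\<beta>} \<Longrightarrow> velocity A \<alpha> \<beta> \<gamma>' s = velocity A \<alpha> \<beta> \<gamma> s"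
proof -
  have D: "((\<lambda>s. snd c (\<gamma>' s)) has_vector_derivative velocity A \<alpha> \<beta> \<gamma> s c) (at s within {\<alpha>..\<beta>})"
    if "c \<in> A" "s \<in> {\<alpha>..\<beta>}" "\<gamma>' s \<in> fst c" for c s
    by (rule has_vector_derivative_transform[OF that(2) _ C1_curve_derivative[OF \<gamma> that(1,2)]])
      (use eq that in auto)
  show "C1_curve A \<alpha> \<beta> \<gamma>'"
  proof (rule C1_curveI[OF ab _ D])
    show "continuous_on {\<alpha>..\<beta>} \<gamma>'"
      by (rule continuous_on_eq[OF C1_curve_continuous[OF \<gamma>]]) (simp add: eq)
    have "{s \<in> {\<alpha>..\<beta>}. \<gamma>' s \<in> fst c} = {s \<in> {\<alpha>..\<beta>}. \<gamma> s \<in> fst c}" for c using eq by auto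
    then show "continuous_on {s \<in> {\<alpha>..\<beta>}. \<gamma>' s \<in> fst c} (\<lambda>s. velocity A \<alpha> \<beta> \<gamma> s c)" if "c \<in> A" for c
      using velocity_continuous[OF \<gamma> that] by metis
  qed
  show "velocity A \<alpha> \<beta> \<gamma>' s = velocity A \<alpha> \<beta> \<gamma> s" if "s \<in> {\<alpha>..\<beta>}"
    by (rule velocity_eqI'[OF ab that D[OF _ that]]) (use eq[OF that] in \<open>auto simp: velocity_def\<close>)
qed

lemma C1_curve_subinterval:
  assumes "\<alpha> \<le> \<alpha>'" "\<alpha>' < \<beta>'" "\<beta>' \<le> \<beta>" "C1_curve A \<alpha> \<beta> \<gamma>"
  shows "C1_curve A \<alpha>' \<beta>' \<gamma>" and "s \<in> {\<alpha>'..\<beta>'} \<Longrightarrow> velocity A \<alpha>' \<beta>' \<gamma> s = velocity A \<alpha> \<beta> \<gamma> s"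
proof -
  have "\<alpha> < \<beta>" using assms by simp
  note * = C1_curve_reparam[OF this assms(2,4), of "\<lambda>s. s" "\<lambda>_. 1"]
  show "C1_curve A \<alpha>' \<beta>' \<gamma>" using assms by (intro *(1)) auto
  show "velocity A \<alpha>' \<beta>' \<gamma> s = velocity A \<alpha> \<beta> \<gamma> s" if "s \<in> {\<alpha>'..\<beta>'}"
    using assms that by (subst *(2)) auto
qed

lemma C1_curve_join:
  assumes ab: "\<alpha> < \<beta>" "\<beta> < \<kappa>" and 1: "C1_curve A \<alpha> \<beta> \<gamma>" and 2: "C1_curve A \<beta> \<kappa> \<gamma>"
    and eq: "velocity A \<alpha> \<beta> \<gamma> \<beta> = velocity A \<beta> \<kappa> \<gamma> \<beta>"
  shows "C1_curve A \<alpha> \<kappa> \<gamma>"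
    and "s \<in> {\<alpha>..\<kappa>} \<Longrightarrow> velocity A \<alpha> \<kappa> \<gamma> s =
      (if s \<le> \<beta> then velocity A \<alpha> \<beta> \<gamma> s else velocity A \<beta> \<kappa> \<gamma> s)"
proof -
  let ?u = "\<lambda>s. if s \<le> \<beta> then velocity A \<alpha> \<beta> \<gamma> s else velocity A \<beta> \<kappa> \<gamma> s"
  have un: "{\<alpha>..\<kappa>} = {\<alpha>..\<beta>} \<union> {\<beta>..\<kappa>}" using ab by auto
  have D: "((\<lambda>s. snd c (\<gamma> s)) has_vector_derivative ?u s c) (at s within {\<alpha>..\<kappa>})"
    if c: "c \<in> A" "s \<in> {\<alpha>..\<kappa>}" "\<gamma> s \<in> fst c" for c s
  proof -
    consider "s < \<beta>" | "s = \<beta>" | "\<beta> < s" by linarith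
    then show ?thesis
    proof cases
      case 1
      then show ?thesis
        using C1_curve_derivative[OF \<open>C1_curve A \<alpha> \<beta> \<gamma>\<close> c(1) _ c(3)] c ab at_within_Icc_left[of s \<beta> \<kappa> \<alpha>] by auto
    next
      case 2
      then show ?thesis
        using C1_curve_derivative[OF \<open>C1_curve A \<alpha> \<beta> \<gamma>\<close> c(1) _ c(3)] ab eq
          C1_curve_derivative[OF \<open>C1_curve A \<beta> \<kappa> \<gamma>\<close> c(1) _ c(3)]
        unfolding un by (intro has_vector_derivative_union) auto
    next
      case 3
      then show ?thesis
        using C1_curve_derivative[OF \<open>C1_curve A \<beta> \<kappa> \<gamma>\<close> c(1) _ c(3)] c ab at_within_Icc_right[of \<beta> s \<alpha> \<kappa>] by auto
    qed
  qed
  have cont: "continuous_on {\<alpha>..\<kappa>} \<gamma>"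
    unfolding un by (intro continuous_on_closed_Un C1_curve_continuous 1 2) auto
  show "C1_curve A \<alpha> \<kappa> \<gamma>"
  proof (rule C1_curveI[OF _ cont D])
    fix c assume c: "c \<in> A"
    have "continuous_on {s \<in> {\<alpha>..\<kappa>}. \<gamma> s \<in> fst c}
        (\<lambda>s. if s \<le> \<beta> then velocity A \<alpha> \<beta> \<gamma> s c else velocity A \<beta> \<kappa> \<gamma> s c)"
      by (intro continuous_on_cases_le continuous_intros)
        (use eq ab in \<open>auto intro: continuous_on_subset[OF velocity_continuous[OF 1 c]]
          continuous_on_subset[OF velocity_continuous[OF 2 c]]\<close>)
    then show "continuous_on {s \<in> {\<alpha>..\<kappa>}. \<gamma> s \<in> fst c} (\<lambda>s. ?u s c)"
      by (rule continuous_on_eq) auto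
  qed (use ab in auto)
  show "velocity A \<alpha> \<kappa> \<gamma> s = ?u s" if "s \<in> {\<alpha>..\<kappa>}"
    by (rule velocity_eqI'[OF _ that D[OF _ that]]) (use ab in \<open>auto simp: velocity_def\<close>)
qed

lemma C1_curve_const:
  assumes "\<alpha> < \<beta>"
  shows "C1_curve A \<alpha> \<beta> (\<lambda>_. q)" and "s \<in> {\<alpha>..\<beta>} \<Longrightarrow> velocity A \<alpha> \<beta> (\<lambda>_. q) s = (\<lambda>_. 0)"
proof -
  show "C1_curve A \<alpha> \<beta> (\<lambda>_. q)"
    by (rule C1_curveI[OF assms, where u = "\<lambda>_ _. 0"]) auto
  show "velocity A \<alpha> \<beta> (\<lambda>_. q) s = (\<lambda>_. 0)" if "s \<in> {\<alpha>..\<beta>}"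
    by (rule velocity_eqI'[OF assms that]) auto
qed

lemma C1_curve_chart_inv:
  assumes ab: "\<alpha> < \<beta>" and c: "c \<in> A"
    and x: "\<And>s. s \<in> {\<alpha>..\<beta>} \<Longrightarrow> (x has_vector_derivative u s) (at s within {\<alpha>..\<beta>})"
    and u: "continuous_on {\<alpha>..\<beta>} u" and xc: "\<And>s. s \<in> {\<alpha>..\<beta>} \<Longrightarrow> x s \<in> snd c ` fst c"
  shows "C1_curve A \<alpha> \<beta> (\<lambda>s. chart_inv c (x s))"
    and "s \<in> {\<alpha>..\<beta>} \<Longrightarrow> velocity A \<alpha> \<beta> (\<lambda>s. chart_inv c (x s)) s c = u s"
proof -
  let ?\<gamma> = "\<lambda>s. chart_inv c (x s)"
  have xcont: "continuous_on {\<alpha>..\<beta>} x" using x by (rule continuous_on_vector_derivative)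
  have cont: "continuous_on {\<alpha>..\<beta>} ?\<gamma>"
    using xc by (intro continuous_on_compose2[OF continuous_on_chart_inv[OF c] xcont]) auto
  have D: "((\<lambda>s. snd c' (?\<gamma> s)) has_vector_derivative
      frechet_derivative (transition c c') (at (x s)) (u s)) (at s within {\<alpha>..\<beta>})"
    if c': "c' \<in> A" "s \<in> {\<alpha>..\<beta>}" "?\<gamma> s \<in> fst c'" for c' s
  proof -
    have \<gamma>c: "?\<gamma> s \<in> fst c" using xc[OF c'(2)] by (rule chart_inv_mem)
    have xs: "snd c (?\<gamma> s) = x s" using xc[OF c'(2)] by simp
    note tr = transition_derivative[OF c c'(1) \<gamma>c c'(3), unfolded xs]
    have "((transition c c' \<circ> x) has_derivative
        (frechet_derivative (transition c c') (at (x s)) \<circ> (\<lambda>h. h *\<^sub>R u s))) (at s within {\<alpha>..\<beta>})"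
      using x[OF c'(2)] by (intro diff_chain_within has_derivative_at_withinI[OF tr])
        (simp add: has_vector_derivative_def)
    then have "((\<lambda>s. transition c c' (x s)) has_vector_derivative
        frechet_derivative (transition c c') (at (x s)) (u s)) (at s within {\<alpha>..\<beta>})"
      using linear_scale[OF transition_derivative_linear[OF c c'(1) \<gamma>c c'(3), unfolded xs]]
      by (simp add: has_vector_derivative_def o_def)
    then show ?thesis by (simp add: transition_def)
  qed
  show "C1_curve A \<alpha> \<beta> ?\<gamma>"
  proof (rule C1_curveI[OF ab cont D])
    fix c' assume c': "c' \<in> A"
    let ?S = "{s \<in> {\<alpha>..\<beta>}. ?\<gamma> s \<in> fst c'}"
    have xS: "x s \<in> snd c ` (fst c \<inter> fst c')" if "s \<in> ?S" for s
      using xc[of s] that chart_inv_mem[of "x s" c] by (auto intro!: image_eqI[of "x s" "snd c" "?\<gamma> s"])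
    \<comment> \<open>Class C1 of the transition map gives continuity of its derivative in each
      fixed direction; the moving direction \<open>u s\<close> is therefore split into basis
      vectors.\<close>
    have "continuous_on ?S (\<lambda>s. \<Sum>i\<in>Basis. (u s \<bullet> i) *\<^sub>R frechet_derivative (transition c c') (at (x s)) i)"
    proof (intro continuous_intros)
      show "continuous_on ?S u" by (rule continuous_on_subset[OF u]) auto
      have "continuous_on (snd c ` (fst c \<inter> fst c')) (\<lambda>x. frechet_derivative (transition c c') (at x) i)" for i
        using transition_C1[OF c c'] by simp
      then show "continuous_on ?S (\<lambda>s. frechet_derivative (transition c c') (at (x s)) i)" for i
        by (rule continuous_on_compose2) (use xS in \<open>auto intro: continuous_on_subset[OF xcont]\<close>)
    qed
    then show "continuous_on ?S (\<lambda>s. frechet_derivative (transition c c') (at (x s)) (u s))"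
    proof (rule continuous_on_eq)
      fix s assume s: "s \<in> ?S"
      then obtain q where q: "x s = snd c q" "q \<in> fst c" "q \<in> fst c'" using xS by blast
      have l: "linear (frechet_derivative (transition c c') (at (x s)))"
        using transition_derivative_linear[OF c c' q(2,3)] q(1) by simp
      have "frechet_derivative (transition c c') (at (x s)) (u s) =
          frechet_derivative (transition c c') (at (x s)) (\<Sum>i\<in>Basis. (u s \<bullet> i) *\<^sub>R i)"
        by (simp only: euclidean_representation)
      then show "(\<Sum>i\<in>Basis. (u s \<bullet> i) *\<^sub>R frechet_derivative (transition c c') (at (x s)) i) =
          frechet_derivative (transition c c') (at (x s)) (u s)"
        by (simp add: linear_sum[OF l] linear_scale[OF l])
    qed
  qed
  show "velocity A \<alpha> \<beta> ?\<gamma> s c = u s" if s: "s \<in> {\<alpha>..\<beta>}"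
  proof (rule velocity_eqI[where \<gamma> = ?\<gamma>, OF ab s c chart_inv_mem[OF xc[OF s]]])
    show "((\<lambda>s. snd c (?\<gamma> s)) has_vector_derivative u s) (at s within {\<alpha>..\<beta>})"
      by (rule has_vector_derivative_transform[OF s _ x[OF s]]) (use xc in auto)
  qed
qed

section \<open>The coefficients along curves, and their algebra\<close>

text \<open>The curve need not fit into one chart, so continuity is checked near each parameter in a
  chart around its point. \<open>t\<close> and \<open>h\<close> may vary independently of the
  curve.\<close>

lemma continuous_on_form:
  assumes ab: "\<alpha> < \<beta>" and \<gamma>: "C1_curve A \<alpha> \<beta> \<gamma>"
    and t: "continuous_on {\<alpha>..\<beta>} t" "\<And>s. s \<in> {\<alpha>..\<beta>} \<Longrightarrow> t s \<in> T" and h: "continuous_on {\<alpha>..\<beta>} h"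
  shows "continuous_on {\<alpha>..\<beta>} (\<lambda>s. form (t s) (\<gamma> s) (h s, velocity A \<alpha> \<beta> \<gamma> s) (h s, velocity A \<alpha> \<beta> \<gamma> s))"
proof (rule continuous_on_local)
  fix s assume s: "s \<in> {\<alpha>..\<beta>}"
  obtain c where c: "c \<in> A" "\<gamma> s \<in> fst c" by (rule chart_exists)
  obtain U where U: "open U" "{\<alpha>..\<beta>} \<inter> \<gamma> -` fst c = {\<alpha>..\<beta>} \<inter> U"
    by (rule continuous_on_preimage_open[OF C1_curve_continuous[OF \<gamma>] open_chart[OF c(1)]])
  have S: "{\<alpha>..\<beta>} \<inter> U = {s\<in>{\<alpha>..\<beta>}. \<gamma> s \<in> fst c}" unfolding U(2)[symmetric] by blast
  have "continuous_on ({\<alpha>..\<beta>} \<inter> U) (\<lambda>s. coord_form c (t s, snd c (\<gamma> s))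
      (h s, velocity A \<alpha> \<beta> \<gamma> s c) (h s, velocity A \<alpha> \<beta> \<gamma> s c))"
    unfolding S using t(2)
    by (intro continuous_on_coord_form[OF c(1)] continuous_on_Pair velocity_continuous[OF \<gamma> c(1)]
        continuous_on_curve_chart[OF C1_curve_continuous[OF \<gamma>] c(1)]
        continuous_on_subset[OF t(1)] continuous_on_subset[OF h]) auto
  then have "continuous_on ({\<alpha>..\<beta>} \<inter> U) (\<lambda>s. form (t s) (\<gamma> s) (h s, velocity A \<alpha> \<beta> \<gamma> s) (h s, velocity A \<alpha> \<beta> \<gamma> s))"
    by (rule continuous_on_eq) (use form_coord[OF c(1)] velocity_tangent[OF ab \<gamma>] S in auto)
  then show "\<exists>U. open U \<and> s \<in> U \<and> continuous_on ({\<alpha>..\<beta>} \<inter> U)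
      (\<lambda>s. form (t s) (\<gamma> s) (h s, velocity A \<alpha> \<beta> \<gamma> s) (h s, velocity A \<alpha> \<beta> \<gamma> s))"
    using U s c(2) by blast
qed

text \<open>At the extended velocity \<open>(h, v)\<close> the form is the polynomial a + 2 h b - 2
  \<open>h\<^sup>2\<close> V. Its values for h = 0, 1, -1 determine the three coefficients.\<close>

lemma continuous_on_abV:
  assumes ab: "\<alpha> < \<beta>" and \<gamma>: "C1_curve A \<alpha> \<beta> \<gamma>"
    and t: "continuous_on {\<alpha>..\<beta>} t" "\<And>s. s \<in> {\<alpha>..\<beta>} \<Longrightarrow> t s \<in> T"
  shows "continuous_on {\<alpha>..\<beta>} (\<lambda>s. a (t s) (\<gamma> s) (velocity A \<alpha> \<beta> \<gamma> s) (velocity A \<alpha> \<beta> \<gamma> s))"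
    and "continuous_on {\<alpha>..\<beta>} (\<lambda>s. b (t s) (\<gamma> s) (velocity A \<alpha> \<beta> \<gamma> s))"
    and "continuous_on {\<alpha>..\<beta>} (\<lambda>s. V (t s) (\<gamma> s))"
    and "continuous_on {\<alpha>..\<beta>} (\<lambda>s. Lagrangian (t s) (\<gamma> s) (velocity A \<alpha> \<beta> \<gamma> s))"
proof -
  let ?F = "\<lambda>h s. form (t s) (\<gamma> s) (h, velocity A \<alpha> \<beta> \<gamma> s) (h, velocity A \<alpha> \<beta> \<gamma> s)"
  have F: "continuous_on {\<alpha>..\<beta>} (?F h)" for h by (intro continuous_on_form assms) auto
  have "continuous_on {\<alpha>..\<beta>} (\<lambda>s. ?F 0 s)" "continuous_on {\<alpha>..\<beta>} (\<lambda>s. (?F 1 s - ?F (-1) s) / 4)"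
    "continuous_on {\<alpha>..\<beta>} (\<lambda>s. (2 * ?F 0 s - ?F 1 s - ?F (-1) s) / 4)"
    "continuous_on {\<alpha>..\<beta>} (\<lambda>s. ?F 1 s / 2)"
    by (intro continuous_intros F; simp)+
  then show "continuous_on {\<alpha>..\<beta>} (\<lambda>s. a (t s) (\<gamma> s) (velocity A \<alpha> \<beta> \<gamma> s) (velocity A \<alpha> \<beta> \<gamma> s))"
    "continuous_on {\<alpha>..\<beta>} (\<lambda>s. b (t s) (\<gamma> s) (velocity A \<alpha> \<beta> \<gamma> s))"
    "continuous_on {\<alpha>..\<beta>} (\<lambda>s. V (t s) (\<gamma> s))"
    "continuous_on {\<alpha>..\<beta>} (\<lambda>s. Lagrangian (t s) (\<gamma> s) (velocity A \<alpha> \<beta> \<gamma> s))"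
    by (simp_all add: form_def Lagrangian_def diff_divide_distrib add_divide_distrib algebra_simps)
qed

text \<open>Linearity of \<open>a\<close> and \<open>b\<close> is given in chart components, so even
  their values at the zero vector are obtained through a chart.\<close>

lemma a_zero_b_zero:
  assumes "t \<in> T" "v \<in> tangent_space A q"
  shows "a t q v (\<lambda>_. 0) = 0" "b t q (\<lambda>_. 0) = 0" "a t q (\<lambda>_. 0) v = 0"
proof -
  obtain c where c: "c \<in> A" "q \<in> fst c" by (rule chart_exists)
  show "a t q v (\<lambda>_. 0) = 0" "b t q (\<lambda>_. 0) = 0" "a t q (\<lambda>_. 0) v = 0"
    using bilinear_rzero[OF a_bilinear[OF assms(1) c], of "v c"] linear_0[OF b_linear[OF assms(1) c]]
      bilinear_lzero[OF a_bilinear[OF assms(1) c], of "v c"] c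
      tangent_eq_coord_vector[OF c assms(2)] by auto
qed

lemma zero_tangent: "(\<lambda>_. 0) \<in> tangent_space A q"
proof -
  obtain c where c: "c \<in> A" "q \<in> fst c" by (rule chart_exists)
  then show ?thesis using coord_vector_tangent[OF c, of 0] by simp
qed

lemma a_nonneg:
  assumes "t \<in> T" "v \<in> tangent_space A q" shows "0 \<le> a t q v v"
  using a_pos_def[OF assms] a_zero_b_zero[OF assms] by (cases "v = (\<lambda>_. 0)") auto

lemma tangent_scale:
  assumes "v \<in> tangent_space A q"
  shows "(\<lambda>c. k *\<^sub>R v c) \<in> tangent_space A q"
proof -
  obtain c where c: "c \<in> A" "q \<in> fst c" by (rule chart_exists)
  have "(\<lambda>c. k *\<^sub>R v c) = coord_vector A c q (k *\<^sub>R v c)"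
    by (subst tangent_eq_coord_vector[OF c assms, symmetric])
      (auto simp: coord_vector_def linear_scale[OF transition_derivative_linear] c)
  then show ?thesis using coord_vector_tangent[OF c] by metis
qed

lemma a_scale_b_scale:
  assumes "t \<in> T" "v \<in> tangent_space A q"
  shows "a t q (\<lambda>c. k *\<^sub>R v c) (\<lambda>c. k *\<^sub>R v c) = k\<^sup>2 * a t q v v" "b t q (\<lambda>c. k *\<^sub>R v c) = k * b t q v"
proof -
  obtain c where c: "c \<in> A" "q \<in> fst c" by (rule chart_exists)
  have *: "coord_vector A c q (k *\<^sub>R v c) = (\<lambda>c. k *\<^sub>R v c)"
    using tangent_eq_coord_vector[OF c tangent_scale[OF assms(2), of k]] by simp
  show "a t q (\<lambda>c. k *\<^sub>R v c) (\<lambda>c. k *\<^sub>R v c) = k\<^sup>2 * a t q v v"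
    using bilinear_lmul[OF a_bilinear[OF assms(1) c], of k "v c" "k *\<^sub>R v c"]
      bilinear_rmul[OF a_bilinear[OF assms(1) c], of "v c" k "v c"]
      tangent_eq_coord_vector[OF c assms(2)] * by (simp add: power2_eq_square)
  show "b t q (\<lambda>c. k *\<^sub>R v c) = k * b t q v"
    using linear_scale[OF b_linear[OF assms(1) c], of k "v c"] tangent_eq_coord_vector[OF c assms(2)] * by simp
qed

end

section \<open>Causal curves\<close>

lemma differentiable_on_has_vector_derivative:
  fixes f :: "real \<Rightarrow> 'a::real_normed_vector"
  shows "f differentiable_on S \<Longrightarrow> s \<in> S \<Longrightarrow>
    (f has_vector_derivative vector_derivative f (at s within S)) (at s within S)"
  by (simp add: differentiable_on_def vector_derivative_works)

lemma vector_derivative_Icc: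
  assumes "\<alpha> < \<beta>" "s \<in> {\<alpha>..\<beta>}" "(f has_vector_derivative v) (at s within {\<alpha>..\<beta>})"
  shows "vector_derivative f (at s within {\<alpha>..\<beta>}) = v"
  using vector_derivative_within_cbox[of \<alpha> \<beta> s f v] assms by simp

lemma nonneg_derivative_imp_mono:
  fixes f f' :: "real \<Rightarrow> real"
  assumes "\<And>s. s \<in> {\<alpha>..\<beta>} \<Longrightarrow> (f has_vector_derivative f' s) (at s within {\<alpha>..\<beta>})"
    and "\<And>s. s \<in> {\<alpha>..\<beta>} \<Longrightarrow> 0 \<le> f' s" and "\<alpha> \<le> s" "s \<le> s'" "s' \<le> \<beta>"
  shows "f s \<le> f s'"
proof -
  have "(f' has_integral f s' - f s) {s..s'}"
    using assms by (intro fundamental_theorem_of_calculus)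
      (auto intro!: has_vector_derivative_within_subset[OF assms(1)])
  then have "0 \<le> f s' - f s" by (rule has_integral_nonneg) (use assms in auto)
  then show ?thesis by simp
qed

lemma pos_derivative_imp_strict_mono:
  fixes f f' :: "real \<Rightarrow> real"
  assumes "\<alpha> < \<beta>" "\<And>s. s \<in> {\<alpha>..\<beta>} \<Longrightarrow> (f has_vector_derivative f' s) (at s within {\<alpha>..\<beta>})"
    and "\<And>s. s \<in> {\<alpha>..\<beta>} \<Longrightarrow> 0 < f' s"
  shows "f \<alpha> < f \<beta>"
proof (rule DERIV_pos_imp_increasing_open[OF assms(1)])
  show "\<exists>y. DERIV f s :> y \<and> 0 < y" if s: "\<alpha> < s" "s < \<beta>" for s
  proof -
    have "at s within {\<alpha>..\<beta>} = at s" using s by (intro at_within_interior) auto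
    then show ?thesis
      using assms(2)[of s] assms(3)[of s] s by (auto simp: has_real_derivative_iff_has_vector_derivative)
  qed
  show "continuous_on {\<alpha>..\<beta>} f" using assms(2) by (rule continuous_on_vector_derivative)
qed

lemma C1_real_join:
  fixes f :: "real \<Rightarrow> 'a::real_normed_vector"
  assumes ab: "\<alpha> < \<beta>" "\<beta> < \<kappa>"
    and 1: "\<And>s. s \<in> {\<alpha>..\<beta>} \<Longrightarrow> (f has_vector_derivative f1 s) (at s within {\<alpha>..\<beta>})" "continuous_on {\<alpha>..\<beta>} f1"
    and 2: "\<And>s. s \<in> {\<beta>..\<kappa>} \<Longrightarrow> (f has_vector_derivative f2 s) (at s within {\<beta>..\<kappa>})" "continuous_on {\<beta>..\<kappa>} f2"
    and eq: "f1 \<beta> = f2 \<beta>"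
  shows "continuous_on {\<alpha>..\<kappa>} (\<lambda>s. if s \<le> \<beta> then f1 s else f2 s)"
    and "s \<in> {\<alpha>..\<kappa>} \<Longrightarrow> (f has_vector_derivative (if s \<le> \<beta> then f1 s else f2 s)) (at s within {\<alpha>..\<kappa>})"
proof -
  show "continuous_on {\<alpha>..\<kappa>} (\<lambda>s. if s \<le> \<beta> then f1 s else f2 s)"
    by (intro continuous_on_cases_le continuous_intros)
      (use eq in \<open>auto intro: continuous_on_subset[OF 1(2)] continuous_on_subset[OF 2(2)]\<close>)
  assume s: "s \<in> {\<alpha>..\<kappa>}"
  have un: "{\<alpha>..\<kappa>} = {\<alpha>..\<beta>} \<union> {\<beta>..\<kappa>}" using ab by auto
  consider "s < \<beta>" | "s = \<beta>" | "\<beta> < s" by linarith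
  then show "(f has_vector_derivative (if s \<le> \<beta> then f1 s else f2 s)) (at s within {\<alpha>..\<kappa>})"
  proof cases
    case 1
    then show ?thesis using assms(3)[of s] s ab at_within_Icc_left[of s \<beta> \<kappa> \<alpha>] by auto
  next
    case 2
    then show ?thesis
      using assms(3)[of s] assms(5)[of s] ab eq unfolding un by (intro has_vector_derivative_union) auto
  next
    case 3
    then show ?thesis using assms(5)[of s] s ab at_within_Icc_right[of \<beta> s \<alpha> \<kappa>] by auto
  qed
qed

context generalized_gravitational_wave
begin

text \<open>In a chart the vanishing derivative makes the curve locally constant; the parameter
  interval is connected, so no single chart has to contain the curve.\<close>

lemma zero_velocity_imp_constant:
  assumes ab: "\<alpha> < \<beta>" and \<gamma>: "C1_curve A \<alpha> \<beta> \<gamma>"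
    and 0: "\<And>s. s \<in> {\<alpha>..\<beta>} \<Longrightarrow> velocity A \<alpha> \<beta> \<gamma> s = (\<lambda>_. 0)" and s: "s \<in> {\<alpha>..\<beta>}"
  shows "\<gamma> s = \<gamma> \<alpha>"
proof -
  have "\<gamma> constant_on {\<alpha>..\<beta>}"
  proof (rule locally_constant_imp_constant)
    fix s assume s: "s \<in> {\<alpha>..\<beta>}"
    obtain c where c: "c \<in> A" "\<gamma> s \<in> fst c" by (rule chart_exists)
    obtain U where U: "open U" "{\<alpha>..\<beta>} \<inter> \<gamma> -` fst c = {\<alpha>..\<beta>} \<inter> U"
      by (rule continuous_on_preimage_open[OF C1_curve_continuous[OF \<gamma>] open_chart[OF c(1)]])
    then have "s \<in> U" using s c by blast
    with U(1) obtain d where d: "0 < d" "ball s d \<subseteq> U" by (meson open_contains_ball)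
    have conv: "convex ({\<alpha>..\<beta>} \<inter> ball s d)" by (intro convex_Int) auto
    have sub: "\<gamma> x \<in> fst c" if "x \<in> {\<alpha>..\<beta>} \<inter> ball s d" for x using U(2) d(2) that by blast
    have "\<gamma> x = \<gamma> s" if x: "x \<in> {\<alpha>..\<beta>} \<inter> ball s d" for x
    proof -
      have "((\<lambda>s. snd c (\<gamma> s)) has_derivative (\<lambda>h. 0)) (at z within {\<alpha>..\<beta>} \<inter> ball s d)"
        if "z \<in> {\<alpha>..\<beta>} \<inter> ball s d" for z
        using C1_curve_derivative[OF \<gamma> c(1) _ sub[OF that]] that 0[of z]
        by (auto simp: has_vector_derivative_def intro: has_derivative_subset)
      from has_derivative_zero_constant[OF conv this]
      obtain k where "\<And>x. x \<in> {\<alpha>..\<beta>} \<inter> ball s d \<Longrightarrow> snd c (\<gamma> x) = k" by blast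
      then have "snd c (\<gamma> s) = snd c (\<gamma> x)" using x s d by auto
      then show ?thesis using inj_onD[OF inj_on_chart[OF c(1)] _ sub[OF x] c(2)] by simp
    qed
    moreover have "s \<in> {\<alpha>..\<beta>} \<inter> ball s d" using s d by simp
    ultimately show "\<exists>T. openin (top_of_set {\<alpha>..\<beta>}) T \<and> s \<in> T \<and> (\<forall>x\<in>T. \<gamma> x = \<gamma> s)"
      using openin_open_Int[OF open_ball] by blast
  qed auto
  then show ?thesis using s ab unfolding constant_on_def by force
qed

section \<open>The causal cone\<close>

text \<open>The 1-form dy - b + V dt. With w its value and \<tau> that of dt, the metric on a vector
  is a(v, v) - 2 \<tau> w, so \<tau> and w play the role of two null coordinates.\<close>

definition excess :: "real \<times> 'q \<times> real \<Rightarrow> real \<times> ('q, 'e) tangent_vector \<times> real \<Rightarrow> real" where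
  "excess x X = snd (snd X) - b (fst x) (fst (snd x)) (fst (snd X)) + V (fst x) (fst (snd x)) * fst X"

text \<open>The closed future cone with its tip. It is stable under multiplication by any
  nonnegative number, so curves may be slowed down to rest.\<close>

definition weakly_causal :: "real \<times> 'q \<times> real \<Rightarrow> real \<times> ('q, 'e) tangent_vector \<times> real \<Rightarrow> bool" where
  "weakly_causal x X \<longleftrightarrow> 0 \<le> fst X \<and> 0 \<le> excess x X \<and>
     a (fst x) (fst (snd x)) (fst (snd X)) (fst (snd X)) \<le> 2 * fst X * excess x X"

text \<open>The product with the time orientation is - (w + \<tau> / 2). Positivity of
  \<open>a\<close> forces \<tau> w \<ge> 0 for a causal vector, so a positive w + \<tau> / 2 means
  that both are nonnegative and not both zero.\<close>

lemma future_causal_vector_iff: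
  assumes T: "fst x \<in> T" and v: "fst (snd X) \<in> tangent_space A (fst (snd x))"
  shows "future_causal_vector x X \<longleftrightarrow> weakly_causal x X \<and> (fst X \<noteq> 0 \<or> excess x X \<noteq> 0)"
proof -
  obtain t q y where x: "x = (t, q, y)" by (cases x) auto
  obtain \<tau> v \<eta> where X: "X = (\<tau>, v, \<eta>)" by (cases X) auto
  define w where "w = excess x X"
  have w: "w = \<eta> - b t q v + V t q * \<tau>" by (simp add: w_def excess_def x X)
  have v': "v \<in> tangent_space A q" and t: "t \<in> T" using T v by (auto simp: x X)
  have 1: "metric x X X = a t q v v - 2 * \<tau> * w"
    by (simp add: x X w algebra_simps)
  have 2: "metric x X (time_orientation x) = - (w + \<tau> / 2)"
    using a_zero_b_zero[OF t v'] by (simp add: x X w algebra_simps)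
  have a0: "0 \<le> a t q v v" by (rule a_nonneg[OF t v'])
  have 3: "X = (0, (\<lambda>_. 0), 0) \<Longrightarrow> \<tau> = 0 \<and> w = 0"
    using a_zero_b_zero[OF t v'] by (simp add: X w)
  have "future_causal_vector x X \<longleftrightarrow> X \<noteq> (0, (\<lambda>_. 0), 0) \<and> a t q v v \<le> 2 * \<tau> * w \<and> 0 < w + \<tau> / 2"
    by (simp add: future_causal_vector_def 1 2 del: metric.simps time_orientation.simps) linarith
  also have "\<dots> \<longleftrightarrow> (0 \<le> \<tau> \<and> 0 \<le> w \<and> a t q v v \<le> 2 * \<tau> * w) \<and> (\<tau> \<noteq> 0 \<or> w \<noteq> 0)"
  proof
    assume L: "X \<noteq> (0, (\<lambda>_. 0), 0) \<and> a t q v v \<le> 2 * \<tau> * w \<and> 0 < w + \<tau> / 2"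
    then have "0 \<le> \<tau> * w" using a0 by simp
    then show "(0 \<le> \<tau> \<and> 0 \<le> w \<and> a t q v v \<le> 2 * \<tau> * w) \<and> (\<tau> \<noteq> 0 \<or> w \<noteq> 0)"
      using L by (auto simp: zero_le_mult_iff)
  next
    assume R: "(0 \<le> \<tau> \<and> 0 \<le> w \<and> a t q v v \<le> 2 * \<tau> * w) \<and> (\<tau> \<noteq> 0 \<or> w \<noteq> 0)"
    then show "X \<noteq> (0, (\<lambda>_. 0), 0) \<and> a t q v v \<le> 2 * \<tau> * w \<and> 0 < w + \<tau> / 2"
      using 3 by (auto simp: less_le)
  qed
  finally show ?thesis by (simp add: weakly_causal_def w_def[symmetric]) (simp add: x X)
qed

lemma weakly_causal_scale:
  assumes T: "fst x \<in> T" and v: "fst (snd X) \<in> tangent_space A (fst (snd x))" and k: "0 \<le> k" and X: "weakly_causal x X"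
  shows "weakly_causal x (k * fst X, (\<lambda>c. k *\<^sub>R fst (snd X) c), k * snd (snd X))"
proof -
  have "excess x (k * fst X, (\<lambda>c. k *\<^sub>R fst (snd X) c), k * snd (snd X)) = k * excess x X"
    by (simp add: excess_def a_scale_b_scale[OF T v] algebra_simps)
  moreover have "k\<^sup>2 * a (fst x) (fst (snd x)) (fst (snd X)) (fst (snd X)) \<le> k\<^sup>2 * (2 * fst X * excess x X)"
    using X by (intro mult_left_mono) (auto simp: weakly_causal_def)
  ultimately show ?thesis
    using X k by (simp add: weakly_causal_def a_scale_b_scale[OF T v] power2_eq_square mult_ac)
qed

section \<open>C1 curves in the spacetime\<close>

lemma C1_curve_M_I:
  assumes ab: "\<alpha> < \<beta>"
    and t: "\<And>s. s \<in> {\<alpha>..\<beta>} \<Longrightarrow> ((\<lambda>s. fst (\<gamma> s)) has_vector_derivative \<tau> s) (at s within {\<alpha>..\<beta>})" "continuous_on {\<alpha>..\<beta>} \<tau>"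
    and T: "\<And>s. s \<in> {\<alpha>..\<beta>} \<Longrightarrow> fst (\<gamma> s) \<in> T"
    and q: "C1_curve A \<alpha> \<beta> (\<lambda>s. fst (snd (\<gamma> s)))"
    and y: "\<And>s. s \<in> {\<alpha>..\<beta>} \<Longrightarrow> ((\<lambda>s. snd (snd (\<gamma> s))) has_vector_derivative \<eta> s) (at s within {\<alpha>..\<beta>})" "continuous_on {\<alpha>..\<beta>} \<eta>"
  shows "C1_curve_M \<alpha> \<beta> \<gamma>"
    and "s \<in> {\<alpha>..\<beta>} \<Longrightarrow> velocity_M \<alpha> \<beta> \<gamma> s = (\<tau> s, velocity A \<alpha> \<beta> (\<lambda>s. fst (snd (\<gamma> s))) s, \<eta> s)"
proof -
  note vt = vector_derivative_Icc[OF ab _ t(1)] and vy = vector_derivative_Icc[OF ab _ y(1)]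
  have "continuous_on {\<alpha>..\<beta>} (\<lambda>s. vector_derivative (\<lambda>s. fst (\<gamma> s)) (at s within {\<alpha>..\<beta>}))"
    by (rule continuous_on_eq[OF t(2)]) (simp add: vt)
  moreover have "continuous_on {\<alpha>..\<beta>} (\<lambda>s. vector_derivative (\<lambda>s. snd (snd (\<gamma> s))) (at s within {\<alpha>..\<beta>}))"
    by (rule continuous_on_eq[OF y(2)]) (simp add: vy)
  moreover have "\<gamma> s \<in> M" if "s \<in> {\<alpha>..\<beta>}" for s
    using T[OF that] by (cases "\<gamma> s") (auto simp: M_def)
  moreover have "(\<lambda>s. fst (\<gamma> s)) differentiable_on {\<alpha>..\<beta>}" "(\<lambda>s. snd (snd (\<gamma> s))) differentiable_on {\<alpha>..\<beta>}"
    unfolding differentiable_on_def using differentiableI_vector[OF t(1)] differentiableI_vector[OF y(1)] by blast+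
  ultimately show "C1_curve_M \<alpha> \<beta> \<gamma>"
    using q by (auto simp: C1_curve_M_def)
  show "velocity_M \<alpha> \<beta> \<gamma> s = (\<tau> s, velocity A \<alpha> \<beta> (\<lambda>s. fst (snd (\<gamma> s))) s, \<eta> s)" if "s \<in> {\<alpha>..\<beta>}"
    using that by (simp add: velocity_M_def vt vy)
qed

lemma C1_curve_M_D:
  assumes "C1_curve_M \<alpha> \<beta> \<gamma>"
  shows "\<And>s. s \<in> {\<alpha>..\<beta>} \<Longrightarrow>
      ((\<lambda>s. fst (\<gamma> s)) has_vector_derivative fst (velocity_M \<alpha> \<beta> \<gamma> s)) (at s within {\<alpha>..\<beta>})"
    and "continuous_on {\<alpha>..\<beta>} (\<lambda>s. fst (velocity_M \<alpha> \<beta> \<gamma> s))"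
    and "\<And>s. s \<in> {\<alpha>..\<beta>} \<Longrightarrow> fst (\<gamma> s) \<in> T"
    and "C1_curve A \<alpha> \<beta> (\<lambda>s. fst (snd (\<gamma> s)))"
    and "fst (snd (velocity_M \<alpha> \<beta> \<gamma> s)) = velocity A \<alpha> \<beta> (\<lambda>s. fst (snd (\<gamma> s))) s"
    and "\<And>s. s \<in> {\<alpha>..\<beta>} \<Longrightarrow>
      ((\<lambda>s. snd (snd (\<gamma> s))) has_vector_derivative snd (snd (velocity_M \<alpha> \<beta> \<gamma> s))) (at s within {\<alpha>..\<beta>})"
    and "continuous_on {\<alpha>..\<beta>} (\<lambda>s. snd (snd (velocity_M \<alpha> \<beta> \<gamma> s)))"
proof -
  note d = assms[unfolded C1_curve_M_def]
  show "((\<lambda>s. fst (\<gamma> s)) has_vector_derivative fst (velocity_M \<alpha> \<beta> \<gamma> s)) (at s within {\<alpha>..\<beta>})" if "s \<in> {\<alpha>..\<beta>}" for s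
    using d differentiable_on_has_vector_derivative[of "\<lambda>s. fst (\<gamma> s)" _ s] that by (simp add: velocity_M_def)
  show "((\<lambda>s. snd (snd (\<gamma> s))) has_vector_derivative snd (snd (velocity_M \<alpha> \<beta> \<gamma> s))) (at s within {\<alpha>..\<beta>})" if "s \<in> {\<alpha>..\<beta>}" for s
    using d differentiable_on_has_vector_derivative[of "\<lambda>s. snd (snd (\<gamma> s))" _ s] that by (simp add: velocity_M_def)
  show "fst (\<gamma> s) \<in> T" if "s \<in> {\<alpha>..\<beta>}" for s
  proof -
    have "\<gamma> s \<in> M" using d that by blast
    then show ?thesis by (auto simp: M_def)
  qed
qed (use assms in \<open>auto simp: C1_curve_M_def velocity_M_def\<close>)

lemma C1_curve_M_tangent:
  assumes "\<alpha> < \<beta>" "C1_curve_M \<alpha> \<beta> \<gamma>" "s \<in> {\<alpha>..\<beta>}"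
  shows "fst (snd (velocity_M \<alpha> \<beta> \<gamma> s)) \<in> tangent_space A (fst (snd (\<gamma> s)))"
  using velocity_tangent[OF assms(1) C1_curve_M_D(4)[OF assms(2)] assms(3)] C1_curve_M_D(5)[OF assms(2)] by simp

lemma C1_curve_M_reparam:
  assumes ab: "\<alpha> < \<beta>" "\<alpha>' < \<beta>'" and \<gamma>: "C1_curve_M \<alpha> \<beta> \<gamma>"
    and \<phi>: "\<And>s. s \<in> {\<alpha>'..\<beta>'} \<Longrightarrow> \<phi> s \<in> {\<alpha>..\<beta>}"
    and d: "\<And>s. s \<in> {\<alpha>'..\<beta>'} \<Longrightarrow> (\<phi> has_vector_derivative \<phi>' s) (at s within {\<alpha>'..\<beta>'})"
    and \<phi>': "continuous_on {\<alpha>'..\<beta>'} \<phi>'"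
  shows "C1_curve_M \<alpha>' \<beta>' (\<lambda>s. \<gamma> (\<phi> s))"
    and "s \<in> {\<alpha>'..\<beta>'} \<Longrightarrow> velocity_M \<alpha>' \<beta>' (\<lambda>s. \<gamma> (\<phi> s)) s =
      (\<phi>' s * fst (velocity_M \<alpha> \<beta> \<gamma> (\<phi> s)), \<lambda>c. \<phi>' s *\<^sub>R fst (snd (velocity_M \<alpha> \<beta> \<gamma> (\<phi> s))) c,
        \<phi>' s * snd (snd (velocity_M \<alpha> \<beta> \<gamma> (\<phi> s))))"
proof -
  note D = C1_curve_M_D[OF \<gamma>]
  have cont: "continuous_on {\<alpha>'..\<beta>'} \<phi>" using d by (rule continuous_on_vector_derivative)
  have sub: "\<phi> ` {\<alpha>'..\<beta>'} \<subseteq> {\<alpha>..\<beta>}" using \<phi> by blast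
  have chain: "((\<lambda>s. f (\<phi> s)) has_vector_derivative \<phi>' s * f' (\<phi> s)) (at s within {\<alpha>'..\<beta>'})"
    if "\<And>s. s \<in> {\<alpha>..\<beta>} \<Longrightarrow> (f has_vector_derivative f' s) (at s within {\<alpha>..\<beta>})" "s \<in> {\<alpha>'..\<beta>'}"
    for f f' :: "real \<Rightarrow> real" and s
    using vector_diff_chain_within[OF d[OF that(2)] has_vector_derivative_within_subset[OF that(1)[OF \<phi>[OF that(2)]] sub]]
    by (simp add: o_def)
  have c: "continuous_on {\<alpha>'..\<beta>'} (\<lambda>s. \<phi>' s * f (\<phi> s))" if "continuous_on {\<alpha>..\<beta>} f" for f :: "real \<Rightarrow> real"
    by (intro continuous_on_mult \<phi>' continuous_on_compose2[OF that cont sub])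
  note q = C1_curve_reparam[OF ab D(4) \<phi> d \<phi>']
  note I = C1_curve_M_I[of \<alpha>' \<beta>' "\<lambda>s. \<gamma> (\<phi> s)", OF ab(2) chain[OF D(1)] c[OF D(2)] D(3)[OF \<phi>] q(1) chain[OF D(6)] c[OF D(7)]]
  show "C1_curve_M \<alpha>' \<beta>' (\<lambda>s. \<gamma> (\<phi> s))" by (rule I(1))
  show "velocity_M \<alpha>' \<beta>' (\<lambda>s. \<gamma> (\<phi> s)) s =
      (\<phi>' s * fst (velocity_M \<alpha> \<beta> \<gamma> (\<phi> s)), \<lambda>c. \<phi>' s *\<^sub>R fst (snd (velocity_M \<alpha> \<beta> \<gamma> (\<phi> s))) c,
        \<phi>' s * snd (snd (velocity_M \<alpha> \<beta> \<gamma> (\<phi> s))))" if "s \<in> {\<alpha>'..\<beta>'}"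
    using I(2)[OF _ _ _ _ _ _ _ that] q(2)[OF _ _ that] D(5) by simp
qed

lemma C1_curve_M_cong:
  assumes ab: "\<alpha> < \<beta>" and \<gamma>: "C1_curve_M \<alpha> \<beta> \<gamma>" and eq: "\<And>s. s \<in> {\<alpha>..\<beta>} \<Longrightarrow> \<gamma>' s = \<gamma> s"
  shows "C1_curve_M \<alpha> \<beta> \<gamma>'" and "s \<in> {\<alpha>..\<beta>} \<Longrightarrow> velocity_M \<alpha> \<beta> \<gamma>' s = velocity_M \<alpha> \<beta> \<gamma> s"
proof -
  note D = C1_curve_M_D[OF \<gamma>]
  note q = C1_curve_cong[OF ab D(4), of "\<lambda>s. fst (snd (\<gamma>' s))"]
  have t: "((\<lambda>s. fst (\<gamma>' s)) has_vector_derivative fst (velocity_M \<alpha> \<beta> \<gamma> s)) (at s within {\<alpha>..\<beta>})" if "s \<in> {\<alpha>..\<beta>}" for s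
    by (rule has_vector_derivative_transform[OF that _ D(1)[OF that]]) (simp add: eq)
  have y: "((\<lambda>s. snd (snd (\<gamma>' s))) has_vector_derivative snd (snd (velocity_M \<alpha> \<beta> \<gamma> s))) (at s within {\<alpha>..\<beta>})" if "s \<in> {\<alpha>..\<beta>}" for s
    by (rule has_vector_derivative_transform[OF that _ D(6)[OF that]]) (simp add: eq)
  have q1: "C1_curve A \<alpha> \<beta> (\<lambda>s. fst (snd (\<gamma>' s)))" by (rule q(1)) (simp add: eq)
  have T: "fst (\<gamma>' s) \<in> T" if "s \<in> {\<alpha>..\<beta>}" for s using D(3)[OF that] eq[OF that] by simp
  note I = C1_curve_M_I[of \<alpha> \<beta> \<gamma>', OF ab t D(2) T q1 y D(7)]
  show "C1_curve_M \<alpha> \<beta> \<gamma>'" by (rule I(1))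
  show "velocity_M \<alpha> \<beta> \<gamma>' s = velocity_M \<alpha> \<beta> \<gamma> s" if "s \<in> {\<alpha>..\<beta>}"
    using I(2)[OF _ _ _ that] q(2)[OF _ that] eq D(5) by (simp add: prod_eq_iff)
qed

lemma future_causal_C1_curve_shift:
  assumes ab: "\<alpha> < \<beta>" and \<gamma>: "future_causal_C1_curve \<alpha> \<beta> \<gamma>"
  shows "future_causal_C1_curve (\<alpha> + d) (\<beta> + d) (\<lambda>s. \<gamma> (s - d))"
proof -
  have ab': "\<alpha> + d < \<beta> + d" using ab by simp
  have C: "C1_curve_M \<alpha> \<beta> \<gamma>" using \<gamma> by (simp add: future_causal_C1_curve_def)
  have d: "((\<lambda>s. s - d) has_vector_derivative 1) (at s within {\<alpha> + d..\<beta> + d})" for s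
    by (auto intro!: derivative_eq_intros)
  note r = C1_curve_M_reparam[OF ab ab' C, of "\<lambda>s. s - d" "\<lambda>_. 1", OF _ d]
  show ?thesis unfolding future_causal_C1_curve_def
  proof (intro conjI ballI)
    show "C1_curve_M (\<alpha> + d) (\<beta> + d) (\<lambda>s. \<gamma> (s - d))" by (rule r(1)) auto
    fix s assume s: "s \<in> {\<alpha> + d..\<beta> + d}"
    then have "velocity_M (\<alpha> + d) (\<beta> + d) (\<lambda>s. \<gamma> (s - d)) s = velocity_M \<alpha> \<beta> \<gamma> (s - d)"
      by (subst r(2)) auto
    moreover have "s - d \<in> {\<alpha>..\<beta>}" using s by auto
    ultimately show "future_causal_vector (\<gamma> (s - d)) (velocity_M (\<alpha> + d) (\<beta> + d) (\<lambda>s. \<gamma> (s - d)) s)"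
      using \<gamma> by (simp add: future_causal_C1_curve_def)
  qed
qed

lemma future_causal_C1_curve_cong:
  assumes ab: "\<alpha> < \<beta>" and \<gamma>: "future_causal_C1_curve \<alpha> \<beta> \<gamma>" and eq: "\<And>s. s \<in> {\<alpha>..\<beta>} \<Longrightarrow> \<gamma>' s = \<gamma> s"
  shows "future_causal_C1_curve \<alpha> \<beta> \<gamma>'"
  using C1_curve_M_cong[OF ab _ eq] \<gamma> eq by (simp add: future_causal_C1_curve_def)

section \<open>Concatenation of causal curves\<close>

lemma partition_mono:
  fixes p :: "nat \<Rightarrow> real"
  assumes "\<And>i. i < n \<Longrightarrow> p i < p (Suc i)" "i \<le> j" "j \<le> n"
  shows "p i \<le> p j"
  using assms(2,3)
proof (induction j rule: dec_induct)
  case (step k)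
  then show ?case using assms(1)[of k] by simp
qed simp

lemma future_causal_curve_append:
  assumes 1: "future_causal_curve \<alpha> \<beta> \<gamma>1" and 2: "future_causal_curve \<alpha>' \<beta>' \<gamma>2" and eq: "\<gamma>1 \<beta> = \<gamma>2 \<alpha>'"
  obtains \<gamma> \<kappa> where "future_causal_curve \<alpha> \<kappa> \<gamma>" "\<gamma> \<alpha> = \<gamma>1 \<alpha>" "\<gamma> \<kappa> = \<gamma>2 \<beta>'"
proof -
  obtain n p where p: "0 < n" "p 0 = \<alpha>" "p n = \<beta>" "\<And>i. i < n \<Longrightarrow> p i < p (Suc i)"
    and pc: "\<And>i. i < n \<Longrightarrow> future_causal_C1_curve (p i) (p (Suc i)) \<gamma>1"
    using 1 unfolding future_causal_curve_def by blast
  obtain m r where r: "0 < m" "r 0 = \<alpha>'" "r m = \<beta>'" "\<And>i. i < m \<Longrightarrow> r i < r (Suc i)"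
    and rc: "\<And>i. i < m \<Longrightarrow> future_causal_C1_curve (r i) (r (Suc i)) \<gamma>2"
    using 2 unfolding future_causal_curve_def by blast
  define d where "d = \<beta> - \<alpha>'"
  define \<gamma> where "\<gamma> s = (if s \<le> \<beta> then \<gamma>1 s else \<gamma>2 (s - d))" for s
  \<comment> \<open>At the common index \<open>n\<close> both formulas give the same value, since
    \<open>d\<close> shifts \<open>\<alpha>'\<close> to \<open>\<beta>\<close>.\<close>
  define P where "P i = (if i \<le> n then p i else r (i - n) + d)" for i
  have P2: "P (n + i) = r i + d" for i using p r by (cases "i = 0") (auto simp: P_def d_def)
  have pb: "p i \<le> \<beta>" if "i \<le> n" for i using partition_mono[of n p i n, OF p(4)] that p(3) by simp
  have rb: "\<alpha>' \<le> r i" if "i \<le> m" for i using partition_mono[of m r 0 i, OF r(4)] that r(2) by simp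
  have \<gamma>2: "\<gamma> s = \<gamma>2 (s - d)" if "\<beta> \<le> s" for s using that eq by (auto simp: \<gamma>_def d_def)
  have "P i < P (Suc i) \<and> future_causal_C1_curve (P i) (P (Suc i)) \<gamma>" if i: "i < n + m" for i
  proof (cases "i < n")
    case True
    then have "P i = p i" "P (Suc i) = p (Suc i)" by (auto simp: P_def)
    moreover have "future_causal_C1_curve (p i) (p (Suc i)) \<gamma>"
      using pb[of "Suc i"] True by (intro future_causal_C1_curve_cong[OF p(4) pc]) (auto simp: \<gamma>_def)
    ultimately show ?thesis using p(4) True by simp
  next
    case False
    define j where "j = i - n"
    have j: "i = n + j" "j < m" using False i by (auto simp: j_def)
    have "P i = r j + d" "P (Suc i) = r (Suc j) + d" using P2[of j] P2[of "Suc j"] j by auto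
    moreover have "future_causal_C1_curve (r j + d) (r (Suc j) + d) \<gamma>"
    proof (rule future_causal_C1_curve_cong[OF _ future_causal_C1_curve_shift[OF r(4) rc]])
      show "\<gamma> s = \<gamma>2 (s - d)" if "s \<in> {r j + d..r (Suc j) + d}" for s
        using that rb[of j] j by (intro \<gamma>2) (auto simp: d_def)
    qed (use j r(4)[OF j(2)] in auto)
    ultimately show ?thesis using r(4)[OF j(2)] by simp
  qed
  then have "future_causal_curve \<alpha> (\<beta>' + d) \<gamma>"
    unfolding future_causal_curve_def using p r P2[of m]
    by (intro exI[of _ "n + m"] exI[of _ P]) (auto simp: P_def)
  moreover have "\<gamma> \<alpha> = \<gamma>1 \<alpha>" using pb[of 0] p by (simp add: \<gamma>_def)
  moreover have "\<gamma> (\<beta>' + d) = \<gamma>2 \<beta>'" using rb[of m] r by (subst \<gamma>2) (auto simp: d_def)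
  ultimately show ?thesis by (rule that)
qed

lemma J_plus_trans:
  assumes "x' \<in> J_plus x" "x'' \<in> J_plus x'" shows "x'' \<in> J_plus x"
proof -
  consider "x' = x" | "x'' = x'"
    | \<alpha> \<beta> \<gamma> \<alpha>' \<beta>' \<gamma>' where "future_causal_curve \<alpha> \<beta> \<gamma>" "\<gamma> \<alpha> = x" "\<gamma> \<beta> = x'"
      "future_causal_curve \<alpha>' \<beta>' \<gamma>'" "\<gamma>' \<alpha>' = x'" "\<gamma>' \<beta>' = x''"
    using assms by (auto simp: J_plus_def)
  then show ?thesis
  proof cases
    case 3
    then obtain \<gamma>'' \<kappa> where "future_causal_curve \<alpha> \<kappa> \<gamma>''" "\<gamma>'' \<alpha> = \<gamma> \<alpha>" "\<gamma>'' \<kappa> = \<gamma>' \<beta>'"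
      using future_causal_curve_append[of \<alpha> \<beta> \<gamma> \<alpha>' \<beta>' \<gamma>'] by metis
    then show ?thesis using 3 by (auto simp: J_plus_def)
  qed (use assms in auto)
qed

lemma J_minus_iff: "x \<in> J_minus x' \<longleftrightarrow> x' \<in> J_plus x"
  by (auto simp: J_minus_def J_plus_def)

section \<open>Lifting curves of bounded action\<close>

lemma future_causal_C1_curve_imp_curve:
  assumes "\<alpha> < \<beta>" "future_causal_C1_curve \<alpha> \<beta> \<gamma>" shows "future_causal_curve \<alpha> \<beta> \<gamma>"
  unfolding future_causal_curve_def using assms
  by (intro exI[of _ 1] exI[of _ "\<lambda>i. if i = 0 then \<alpha> else \<beta>"]) auto

lemma J_plus_C1:
  assumes "\<alpha> < \<beta>" "future_causal_C1_curve \<alpha> \<beta> \<gamma>" shows "\<gamma> \<beta> \<in> J_plus (\<gamma> \<alpha>)"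
  using future_causal_C1_curve_imp_curve[OF assms] by (auto simp: J_plus_def)

text \<open>The \<open>y\<close> direction is null and future-directed: dt and v vanish there, and w
  is 1.\<close>

lemma J_plus_vertical:
  assumes "t \<in> T" "y \<le> y'" shows "(t, q, y') \<in> J_plus (t, q, y)"
proof (cases "y = y'")
  case True
  then show ?thesis by (simp add: J_plus_def)
next
  case False
  then have y: "y < y'" using assms by simp
  let ?\<gamma> = "\<lambda>s::real. (t, q, s)"
  have d: "((\<lambda>s. snd (snd (?\<gamma> s))) has_vector_derivative 1) (at s within {y..y'})" for s
    by (auto intro!: derivative_eq_intros)
  have d0: "((\<lambda>s. fst (?\<gamma> s)) has_vector_derivative 0) (at s within {y..y'})" for s
    by (auto intro!: derivative_eq_intros)
  have q: "C1_curve A y y' (\<lambda>s. fst (snd (?\<gamma> s)))" using C1_curve_const(1)[OF y] by simp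
  note I = C1_curve_M_I[of y y' ?\<gamma>, OF y d0 continuous_on_const _ q d continuous_on_const]
  have "future_causal_C1_curve y y' ?\<gamma>"
    unfolding future_causal_C1_curve_def
  proof (intro conjI ballI)
    show "C1_curve_M y y' ?\<gamma>" using assms by (intro I(1)) auto
    fix s assume s: "s \<in> {y..y'}"
    have "velocity_M y y' ?\<gamma> s = (0, (\<lambda>_. 0), 1)"
      using I(2)[OF _ s] assms C1_curve_const(2)[OF y s, of q] by simp
    moreover have "future_causal_vector (t, q, s) (0, (\<lambda>_. 0), 1)"
      using a_zero_b_zero[OF assms(1) zero_tangent, of q] assms zero_tangent[of q]
      by (subst future_causal_vector_iff) (auto simp: weakly_causal_def excess_def)
    ultimately show "future_causal_vector (t, q, s) (velocity_M y y' ?\<gamma> s)" by simp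
  qed
  from J_plus_C1[OF y this] show ?thesis .
qed

lemma lift_causal:
  assumes ab: "\<alpha> < \<beta>" and q: "C1_curve A \<alpha> \<beta> q" and T: "{\<alpha>..\<beta>} \<subseteq> T"
    and y: "\<And>s. s \<in> {\<alpha>..\<beta>} \<Longrightarrow> (y has_vector_derivative \<eta> s) (at s within {\<alpha>..\<beta>})" "continuous_on {\<alpha>..\<beta>} \<eta>"
    and L: "\<And>s. s \<in> {\<alpha>..\<beta>} \<Longrightarrow> Lagrangian s (q s) (velocity A \<alpha> \<beta> q s) \<le> \<eta> s"
  shows "(\<beta>, q \<beta>, y \<beta>) \<in> J_plus (\<alpha>, q \<alpha>, y \<alpha>)"
proof -
  let ?\<gamma> = "\<lambda>s. (s, q s, y s)"
  have d: "((\<lambda>s. fst (?\<gamma> s)) has_vector_derivative 1) (at s within {\<alpha>..\<beta>})" for s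
    by (auto intro!: derivative_eq_intros)
  have q': "C1_curve A \<alpha> \<beta> (\<lambda>s. fst (snd (?\<gamma> s)))" using q by simp
  have y': "((\<lambda>s. snd (snd (?\<gamma> s))) has_vector_derivative \<eta> s) (at s within {\<alpha>..\<beta>})" if "s \<in> {\<alpha>..\<beta>}" for s
    using y(1)[OF that] by simp
  note I = C1_curve_M_I[of \<alpha> \<beta> ?\<gamma>, OF ab d continuous_on_const _ q' y' y(2)]
  have "future_causal_C1_curve \<alpha> \<beta> ?\<gamma>"
    unfolding future_causal_C1_curve_def
  proof (intro conjI ballI)
    show "C1_curve_M \<alpha> \<beta> ?\<gamma>" using T by (intro I(1)) auto
    fix s assume s: "s \<in> {\<alpha>..\<beta>}"
    have sT: "s \<in> T" using s T by auto
    note v = velocity_tangent[OF ab q s]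
    have "velocity_M \<alpha> \<beta> ?\<gamma> s = (1, velocity A \<alpha> \<beta> q s, \<eta> s)"
      using I(2)[OF _ _ s] subsetD[OF T] by simp
    moreover have "future_causal_vector (?\<gamma> s) (1, velocity A \<alpha> \<beta> q s, \<eta> s)"
      using L[OF s] v sT a_nonneg[OF sT v]
      by (subst future_causal_vector_iff) (auto simp: weakly_causal_def excess_def Lagrangian_def)
    ultimately show "future_causal_vector (?\<gamma> s) (velocity_M \<alpha> \<beta> ?\<gamma> s)" by simp
  qed
  from J_plus_C1[OF ab this] show ?thesis .
qed

lemma T_Icc: "\<alpha> \<in> T \<Longrightarrow> \<beta> \<in> T \<Longrightarrow> {\<alpha>..\<beta>} \<subseteq> T"
  using T_interval(1) unfolding is_interval_1 by (meson atLeastAtMost_iff subsetI)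

lemma Lagrangian_continuous:
  assumes "\<alpha> < \<beta>" "C1_curve A \<alpha> \<beta> q" "{\<alpha>..\<beta>} \<subseteq> T"
  shows "continuous_on {\<alpha>..\<beta>} (\<lambda>s. Lagrangian s (q s) (velocity A \<alpha> \<beta> q s))"
  by (rule continuous_on_abV(4)[OF assms(1,2)]) (use assms(3) in auto)

text \<open>The lift starts at height \<open>y0\<close> and ends exactly at \<open>y1\<close>. Each
  of its subarcs is causal as well, which places all its points in one diamond.\<close>

lemma lift_J:
  assumes ab: "\<alpha> < \<beta>" and q: "C1_curve A \<alpha> \<beta> q" and T: "{\<alpha>..\<beta>} \<subseteq> T"
    and S: "integral {\<alpha>..\<beta>} (\<lambda>s. Lagrangian s (q s) (velocity A \<alpha> \<beta> q s)) \<le> y1 - y0"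
  obtains y where "y \<alpha> = y0" "y \<beta> = y1"
    "\<And>s. s \<in> {\<alpha>..\<beta>} \<Longrightarrow> (s, q s, y s) \<in> J_plus (\<alpha>, q \<alpha>, y0) \<inter> J_minus (\<beta>, q \<beta>, y1)"
proof -
  let ?L = "\<lambda>s. Lagrangian s (q s) (velocity A \<alpha> \<beta> q s)"
  \<comment> \<open>The surplus of \<open>y1 - y0\<close> over the action is spread evenly over the
    interval, so the slope of the lift exceeds the Lagrangian by the constant
    \<open>k\<close>.\<close>
  define k where "k = (y1 - y0 - integral {\<alpha>..\<beta>} ?L) / (\<beta> - \<alpha>)"
  have k: "0 \<le> k" using S ab by (simp add: k_def)
  define y where "y s = y0 + integral {\<alpha>..s} ?L + k * (s - \<alpha>)" for s
  note Lc = Lagrangian_continuous[OF ab q T]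
  have y: "(y has_vector_derivative ?L s + k) (at s within {\<alpha>..\<beta>})" if s: "s \<in> {\<alpha>..\<beta>}" for s
  proof -
    have "((\<lambda>s. k * (s - \<alpha>)) has_vector_derivative k) (at s within {\<alpha>..\<beta>})"
      by (auto intro!: derivative_eq_intros)
    from has_vector_derivative_add[OF has_vector_derivative_add[OF has_vector_derivative_const[of y0]
        integral_has_vector_derivative[OF Lc s]] this]
    show ?thesis by (simp add: y_def[abs_def])
  qed
  have y0: "y \<alpha> = y0" by (simp add: y_def)
  have y1: "y \<beta> = y1" using ab by (simp add: y_def k_def)
  have J: "(s', q s', y s') \<in> J_plus (s, q s, y s)" if s: "\<alpha> \<le> s" "s < s'" "s' \<le> \<beta>" for s s'
  proof (rule lift_causal[OF s(2) C1_curve_subinterval(1)[OF s q]])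
    have sub: "{s..s'} \<subseteq> {\<alpha>..\<beta>}" using s by auto
    then show "{s..s'} \<subseteq> T" using T by (rule subset_trans)
    show "(y has_vector_derivative ?L \<sigma> + k) (at \<sigma> within {s..s'})" if "\<sigma> \<in> {s..s'}" for \<sigma>
      using y[of \<sigma>] sub that by (blast intro: has_vector_derivative_within_subset)
    show "continuous_on {s..s'} (\<lambda>\<sigma>. ?L \<sigma> + k)"
      by (intro continuous_intros continuous_on_subset[OF Lc sub])
    show "Lagrangian \<sigma> (q \<sigma>) (velocity A s s' q \<sigma>) \<le> ?L \<sigma> + k" if "\<sigma> \<in> {s..s'}" for \<sigma>
      using C1_curve_subinterval(2)[OF s q that] k by simp
  qed
  show ?thesis
  proof (rule that[OF y0 y1])
    fix s assume s: "s \<in> {\<alpha>..\<beta>}"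
    have "(s, q s, y s) \<in> J_plus (\<alpha>, q \<alpha>, y0)"
      using J[of \<alpha> s] s y0 by (cases "s = \<alpha>") (auto simp: J_plus_def)
    moreover have "(\<beta>, q \<beta>, y1) \<in> J_plus (s, q s, y s)"
      using J[of s \<beta>] s y1 by (cases "s = \<beta>") (auto simp: J_plus_def)
    ultimately show "(s, q s, y s) \<in> J_plus (\<alpha>, q \<alpha>, y0) \<inter> J_minus (\<beta>, q \<beta>, y1)"
      by (simp add: J_minus_iff)
  qed
qed

theorem globally_hyperbolic_imp_coercive:
  assumes gh: globally_hyperbolic and t: "t0 \<in> T" "t1 \<in> T" "t0 < t1"
  shows "coercive (t0, q0) (t1, q1)"
  unfolding coercive_def
proof (intro allI impI)
  fix \<gamma> :: "nat \<Rightarrow> real \<Rightarrow> 'q"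
  assume "(\<forall>n. \<gamma> n \<in> C1_curves_between (t0, q0) (t1, q1)) \<and> (\<exists>B. \<forall>n. action (t0, q0) (t1, q1) (\<gamma> n) \<le> B)"
  then obtain B where \<gamma>: "\<And>n. \<gamma> n \<in> C1_curves_between (t0, q0) (t1, q1)"
    and B: "\<And>n. action (t0, q0) (t1, q1) (\<gamma> n) \<le> B" by blast
  \<comment> \<open>All lifts start at height 0. As the actions are at most \<open>B\<close>, all of
    them can be made to end at height \<open>B\<close>, so one diamond contains them all.\<close>
  let ?D = "J_plus (t0, q0, 0) \<inter> J_minus (t1, q1, B)"
  let ?K = "(fst \<circ> snd) ` ?D"
  have "compact ?D" using gh t by (auto simp: globally_hyperbolic_def M_def)
  then have "compact ?K"
    by (intro compact_continuous_image) (auto simp: o_def intro!: continuous_intros)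
  moreover have "\<gamma> n ` {t0..t1} \<subseteq> ?K" for n
  proof
    fix z assume "z \<in> \<gamma> n ` {t0..t1}"
    then obtain s where s: "s \<in> {t0..t1}" "z = \<gamma> n s" by blast
    have q: "C1_curve A t0 t1 (\<gamma> n)" and ends: "\<gamma> n t0 = q0" "\<gamma> n t1 = q1"
      using \<gamma>[of n] by (auto simp: C1_curves_between_def)
    have "integral {t0..t1} (\<lambda>s. Lagrangian s (\<gamma> n s) (velocity A t0 t1 (\<gamma> n) s)) \<le> B - 0"
      using B[of n] by (simp add: action_def)
    from lift_J[OF t(3) q T_Icc[OF t(1,2)] this] obtain y where
      "\<And>s. s \<in> {t0..t1} \<Longrightarrow> (s, \<gamma> n s, y s) \<in> ?D"
      using ends by metis
    from imageI[OF this[OF s(1)], of "fst \<circ> snd"] show "z \<in> ?K" using s(2) by simp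
  qed
  ultimately show "\<exists>K. compact K \<and> (\<forall>n. \<gamma> n ` {fst (t0, q0)..fst (t1, q1)} \<subseteq> K)"
    by (intro exI[of _ ?K]) auto
qed

end

section \<open>Approximation of causal curves by curves parametrised by time\<close>

text \<open>The difference quotients of the inverse are reciprocals of those of \<open>f\<close>,
  and the inverse is continuous because the interval is compact. The derivatives are relative to the
  interval, so the ends are included.\<close>

lemma C1_inverse_Icc:
  fixes f f' :: "real \<Rightarrow> real"
  assumes ab: "\<alpha> < \<beta>"
    and f: "\<And>s. s \<in> {\<alpha>..\<beta>} \<Longrightarrow> (f has_vector_derivative f' s) (at s within {\<alpha>..\<beta>})"
    and pos: "\<And>s. s \<in> {\<alpha>..\<beta>} \<Longrightarrow> 0 < f' s" and f': "continuous_on {\<alpha>..\<beta>} f'"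
  obtains g where "\<And>s. s \<in> {\<alpha>..\<beta>} \<Longrightarrow> f s \<in> {f \<alpha>..f \<beta>}" "\<And>s. s \<in> {\<alpha>..\<beta>} \<Longrightarrow> g (f s) = s"
    "\<And>z. z \<in> {f \<alpha>..f \<beta>} \<Longrightarrow> g z \<in> {\<alpha>..\<beta>}" "\<And>z. z \<in> {f \<alpha>..f \<beta>} \<Longrightarrow> f (g z) = z"
    "\<And>z. z \<in> {f \<alpha>..f \<beta>} \<Longrightarrow> (g has_vector_derivative 1 / f' (g z)) (at z within {f \<alpha>..f \<beta>})"
    "continuous_on {f \<alpha>..f \<beta>} (\<lambda>z. 1 / f' (g z))"
proof -
  have cont: "continuous_on {\<alpha>..\<beta>} f" using f by (rule continuous_on_vector_derivative)
  have less: "f s < f s'" if "s \<in> {\<alpha>..\<beta>}" "s' \<in> {\<alpha>..\<beta>}" "s < s'" for s s'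
    by (rule pos_derivative_imp_strict_mono[where f' = f'])
      (use that pos in \<open>auto intro!: has_vector_derivative_within_subset[OF f]\<close>)
  have inj: "inj_on f {\<alpha>..\<beta>}" by (intro linorder_inj_onI) (use less in force)+
  have mem: "f s \<in> {f \<alpha>..f \<beta>}" if "s \<in> {\<alpha>..\<beta>}" for s
    using less[of \<alpha> s] less[of s \<beta>] that ab by (cases "s = \<alpha>"; cases "s = \<beta>") force+
  have im: "f ` {\<alpha>..\<beta>} = {f \<alpha>..f \<beta>}"
  proof (intro equalityI image_subsetI mem subsetI)
    fix z assume "z \<in> {f \<alpha>..f \<beta>}"
    then show "z \<in> f ` {\<alpha>..\<beta>}" using IVT'[of f \<alpha> z \<beta>] cont ab by force
  qed
  obtain g where g: "homeomorphism {\<alpha>..\<beta>} {f \<alpha>..f \<beta>} f g"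
    using homeomorphism_compact[OF _ cont im inj] by auto
  note g1 = homeomorphism_apply1[OF g] and g2 = homeomorphism_apply2[OF g]
  have gm: "g z \<in> {\<alpha>..\<beta>}" if "z \<in> {f \<alpha>..f \<beta>}" for z
    using homeomorphism_image2[OF g] that by blast
  have gc: "continuous_on {f \<alpha>..f \<beta>} g" by (rule homeomorphism_cont2[OF g])
  have gd: "(g has_vector_derivative 1 / f' (g z)) (at z within {f \<alpha>..f \<beta>})" if z: "z \<in> {f \<alpha>..f \<beta>}" for z
  proof -
    have "(f has_field_derivative f' (g z)) (at (g z) within {\<alpha>..\<beta>})"
      using f[OF gm[OF z]] by (simp add: has_real_derivative_iff_has_vector_derivative)
    then have "((\<lambda>s. (f s - f (g z)) / (s - g z)) \<longlongrightarrow> f' (g z)) (at (g z) within {\<alpha>..\<beta>})"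
      by (simp add: has_field_derivative_iff)
    moreover have "filterlim g (at (g z) within {\<alpha>..\<beta>}) (at z within {f \<alpha>..f \<beta>})"
      unfolding filterlim_at
    proof
      show "\<forall>\<^sub>F w in at z within {f \<alpha>..f \<beta>}. g w \<in> {\<alpha>..\<beta>} \<and> g w \<noteq> g z"
        using gm g2 z unfolding eventually_at_filter by (intro always_eventually) metis
      show "(g \<longlongrightarrow> g z) (at z within {f \<alpha>..f \<beta>})" using gc z by (simp add: continuous_on_def)
    qed
    ultimately have "((\<lambda>w. (f (g w) - f (g z)) / (g w - g z)) \<longlongrightarrow> f' (g z)) (at z within {f \<alpha>..f \<beta>})"
      by (rule filterlim_compose)
    then have "((\<lambda>w. inverse ((f (g w) - f (g z)) / (g w - g z))) \<longlongrightarrow> inverse (f' (g z))) (at z within {f \<alpha>..f \<beta>})"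
      using pos[OF gm[OF z]] by (intro tendsto_inverse) auto
    then have "((\<lambda>w. (g w - g z) / (w - z)) \<longlongrightarrow> inverse (f' (g z))) (at z within {f \<alpha>..f \<beta>})"
      by (rule Lim_transform_eventually)
        (use g2 z in \<open>auto simp: eventually_at_filter field_simps inverse_eq_divide\<close>)
    then show ?thesis
      by (simp add: has_field_derivative_iff has_real_derivative_iff_has_vector_derivative[symmetric]
          inverse_eq_divide)
  qed
  have "continuous_on {f \<alpha>..f \<beta>} (\<lambda>z. f' (g z))"
    by (rule continuous_on_compose2[OF f' gc]) (use gm in auto)
  then have "continuous_on {f \<alpha>..f \<beta>} (\<lambda>z. 1 / f' (g z))"
    by (intro continuous_intros) (use pos[OF gm] in \<open>force+\<close>)
  with mem g1 gm g2 gd show ?thesis by (intro that[of g]) auto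
qed

text \<open>A finite cover leaves finitely many constants; the sum of their absolute values
  dominates each, and the property survives enlarging the constant.\<close>

lemma compact_uniform_bound:
  fixes P :: "real \<Rightarrow> 'a::topological_space \<Rightarrow> bool"
  assumes K: "compact K" and loc: "\<And>q. q \<in> K \<Longrightarrow> \<exists>N C. open N \<and> q \<in> N \<and> (\<forall>p\<in>N. P C p)"
    and mono: "\<And>C C' p. C \<le> C' \<Longrightarrow> P C p \<Longrightarrow> P C' p"
  obtains C where "0 \<le> C" "\<And>p. p \<in> K \<Longrightarrow> P C p"
proof -
  obtain N C where N: "\<And>q. q \<in> K \<Longrightarrow> open (N q)" "\<And>q. q \<in> K \<Longrightarrow> q \<in> N q" "\<And>q p. q \<in> K \<Longrightarrow> p \<in> N q \<Longrightarrow> P (C q) p"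
    using loc by metis
  have "K \<subseteq> (\<Union>q\<in>K. N q)" using N(2) by blast
  from compactE_image[OF K N(1) this] obtain F where F: "F \<subseteq> K" "finite F" "K \<subseteq> (\<Union>q\<in>F. N q)"
    by blast
  show ?thesis
  proof (rule that[of "\<Sum>q\<in>F. \<bar>C q\<bar>"])
    fix p assume "p \<in> K"
    then obtain q where q: "q \<in> F" "p \<in> N q" using F by blast
    have "C q \<le> (\<Sum>q\<in>F. \<bar>C q\<bar>)"
      using member_le_sum[of q F "\<lambda>q. \<bar>C q\<bar>"] q F by simp
    then show "P (\<Sum>q\<in>F. \<bar>C q\<bar>) p" using N(3)[of q p] q F mono by blast
  qed (simp add: sum_nonneg)
qed

context generalized_gravitational_wave
begin

text \<open>The velocity may vanish, and it does at both ends, so that such curves can be joined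
  without losing differentiability.\<close>

definition weakly_causal_curve :: "real \<Rightarrow> real \<Rightarrow> (real \<Rightarrow> real \<times> 'q \<times> real) \<Rightarrow> bool" where
  "weakly_causal_curve \<alpha> \<beta> \<gamma> \<longleftrightarrow> \<alpha> < \<beta> \<and> C1_curve_M \<alpha> \<beta> \<gamma> \<and>
     (\<forall>s\<in>{\<alpha>..\<beta>}. weakly_causal (\<gamma> s) (velocity_M \<alpha> \<beta> \<gamma> s)) \<and>
     velocity_M \<alpha> \<beta> \<gamma> \<alpha> = (0, (\<lambda>_. 0), 0) \<and> velocity_M \<alpha> \<beta> \<gamma> \<beta> = (0, (\<lambda>_. 0), 0)"

section \<open>Causal curves that rest at their ends\<close>

text \<open>The hypothesis \<open>ends\<close> has two uses: the parameter change comes to rest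
  itself, or it is affine and the given curve is already at rest.\<close>

lemma weakly_causal_reparam:
  assumes ab: "\<alpha> < \<beta>" "\<alpha>' < \<beta>'" and \<gamma>: "C1_curve_M \<alpha> \<beta> \<gamma>"
    and wc: "\<And>s. s \<in> {\<alpha>..\<beta>} \<Longrightarrow> weakly_causal (\<gamma> s) (velocity_M \<alpha> \<beta> \<gamma> s)"
    and \<phi>: "\<And>s. s \<in> {\<alpha>'..\<beta>'} \<Longrightarrow> \<phi> s \<in> {\<alpha>..\<beta>}"
    and d: "\<And>s. s \<in> {\<alpha>'..\<beta>'} \<Longrightarrow> (\<phi> has_vector_derivative \<phi>' s) (at s within {\<alpha>'..\<beta>'})"
    and \<phi>': "continuous_on {\<alpha>'..\<beta>'} \<phi>'" "\<And>s. s \<in> {\<alpha>'..\<beta>'} \<Longrightarrow> 0 \<le> \<phi>' s"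
    and ends: "\<And>s. s = \<alpha>' \<or> s = \<beta>' \<Longrightarrow> \<phi>' s = 0 \<or> velocity_M \<alpha> \<beta> \<gamma> (\<phi> s) = (0, (\<lambda>_. 0), 0)"
  shows "weakly_causal_curve \<alpha>' \<beta>' (\<lambda>s. \<gamma> (\<phi> s))"
  unfolding weakly_causal_curve_def
proof (intro conjI ballI)
  note r = C1_curve_M_reparam[OF ab \<gamma> \<phi> d \<phi>'(1)]
  show "C1_curve_M \<alpha>' \<beta>' (\<lambda>s. \<gamma> (\<phi> s))" by (rule r(1))
  show "weakly_causal (\<gamma> (\<phi> s)) (velocity_M \<alpha>' \<beta>' (\<lambda>s. \<gamma> (\<phi> s)) s)" if s: "s \<in> {\<alpha>'..\<beta>'}" for s
    using r(2)[OF _ _ s] weakly_causal_scale[OF C1_curve_M_D(3)[OF \<gamma> \<phi>[OF s]] C1_curve_M_tangent[OF ab(1) \<gamma> \<phi>[OF s]]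
      \<phi>'(2)[OF s] wc[OF \<phi>[OF s]]] by simp
  have "velocity_M \<alpha>' \<beta>' (\<lambda>s. \<gamma> (\<phi> s)) s = (0, (\<lambda>_. 0), 0)" if s: "s = \<alpha>' \<or> s = \<beta>'" for s
  proof -
    have "s \<in> {\<alpha>'..\<beta>'}" using s ab by auto
    from r(2)[OF _ _ this] ends[OF s] show ?thesis by auto
  qed
  then show "velocity_M \<alpha>' \<beta>' (\<lambda>s. \<gamma> (\<phi> s)) \<alpha>' = (0, (\<lambda>_. 0), 0)"
    "velocity_M \<alpha>' \<beta>' (\<lambda>s. \<gamma> (\<phi> s)) \<beta>' = (0, (\<lambda>_. 0), 0)" by auto
qed (use ab in auto)

lemma weakly_causal_curve_smoothing:
  assumes ab: "\<alpha> < \<beta>" and \<gamma>: "future_causal_C1_curve \<alpha> \<beta> \<gamma>"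
  obtains \<gamma>' where "weakly_causal_curve \<alpha> \<beta> \<gamma>'" "\<gamma>' \<alpha> = \<gamma> \<alpha>" "\<gamma>' \<beta> = \<gamma> \<beta>"
proof -
  define x where "x s = (s - \<alpha>) / (\<beta> - \<alpha>)" for s
  \<comment> \<open>The cubic 3 \<open>x\<^sup>2\<close> - 2 \<open>x^3\<close> runs from 0 to 1 and
    has derivative 6 x (1 - x), which vanishes at both ends only.\<close>
  define \<phi> where "\<phi> s = \<alpha> + (\<beta> - \<alpha>) * (3 * (x s)\<^sup>2 - 2 * (x s) ^ 3)" for s
  define \<phi>' where "\<phi>' s = 6 * x s * (1 - x s)" for s
  have x: "0 \<le> x s" "x s \<le> 1" if "s \<in> {\<alpha>..\<beta>}" for s using that ab by (auto simp: x_def field_simps)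
  have xd: "(x has_real_derivative 1 / (\<beta> - \<alpha>)) (at s within S)" for s S
    unfolding x_def using ab by (auto intro!: derivative_eq_intros)
  have C: "C1_curve_M \<alpha> \<beta> \<gamma>" using \<gamma> by (simp add: future_causal_C1_curve_def)
  have "weakly_causal_curve \<alpha> \<beta> (\<lambda>s. \<gamma> (\<phi> s))"
  proof (rule weakly_causal_reparam[OF ab ab C])
    show "weakly_causal (\<gamma> s) (velocity_M \<alpha> \<beta> \<gamma> s)" if "s \<in> {\<alpha>..\<beta>}" for s
      using \<gamma> that future_causal_vector_iff[OF C1_curve_M_D(3)[OF C that] C1_curve_M_tangent[OF ab C that]]
      by (simp add: future_causal_C1_curve_def)
    show "\<phi> s \<in> {\<alpha>..\<beta>}" if s: "s \<in> {\<alpha>..\<beta>}" for s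
    proof -
      have "3 * (x s)\<^sup>2 - 2 * (x s) ^ 3 = (x s)\<^sup>2 * (3 - 2 * x s)"
        "1 - (3 * (x s)\<^sup>2 - 2 * (x s) ^ 3) = (1 - x s)\<^sup>2 * (1 + 2 * x s)"
        by (simp_all add: power2_eq_square power3_eq_cube algebra_simps)
      moreover have "0 \<le> (x s)\<^sup>2 * (3 - 2 * x s)" "0 \<le> (1 - x s)\<^sup>2 * (1 + 2 * x s)"
        using x[OF s] by (auto intro!: mult_nonneg_nonneg)
      ultimately have *: "0 \<le> 3 * (x s)\<^sup>2 - 2 * (x s) ^ 3" "3 * (x s)\<^sup>2 - 2 * (x s) ^ 3 \<le> 1"
        by linarith+
      then have "0 \<le> (\<beta> - \<alpha>) * (3 * (x s)\<^sup>2 - 2 * (x s) ^ 3)" "(\<beta> - \<alpha>) * (3 * (x s)\<^sup>2 - 2 * (x s) ^ 3) \<le> \<beta> - \<alpha>"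
        using ab by (auto intro!: mult_nonneg_nonneg mult_left_le)
      then show ?thesis by (simp add: \<phi>_def)
    qed
    show "(\<phi> has_vector_derivative \<phi>' s) (at s within {\<alpha>..\<beta>})" for s
    proof -
      define l where "l = \<beta> - \<alpha>"
      have l: "l \<noteq> 0" using ab by (simp add: l_def)
      have "((\<lambda>s. \<alpha> + l * (3 * (x s)\<^sup>2 - 2 * (x s) ^ 3)) has_real_derivative
          l * (3 * (2 * x s * (1 / l)) - 2 * (3 * (x s)\<^sup>2 * (1 / l)))) (at s within {\<alpha>..\<beta>})"
        by (auto intro!: derivative_eq_intros xd simp: l_def)
      also have "l * (3 * (2 * x s * (1 / l)) - 2 * (3 * (x s)\<^sup>2 * (1 / l))) = \<phi>' s"
        using l by (simp add: \<phi>'_def field_simps power2_eq_square)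
      finally show ?thesis
        by (simp add: \<phi>_def[abs_def] l_def has_real_derivative_iff_has_vector_derivative)
    qed
    show "continuous_on {\<alpha>..\<beta>} \<phi>'" unfolding \<phi>'_def x_def using ab by (intro continuous_intros) auto
    show "0 \<le> \<phi>' s" if "s \<in> {\<alpha>..\<beta>}" for s using x[OF that] by (simp add: \<phi>'_def)
    show "\<phi>' s = 0 \<or> velocity_M \<alpha> \<beta> \<gamma> (\<phi> s) = (0, (\<lambda>_. 0), 0)" if "s = \<alpha> \<or> s = \<beta>" for s
      using that ab by (auto simp: \<phi>'_def x_def)
  qed
  then show ?thesis using ab by (intro that[of "\<lambda>s. \<gamma> (\<phi> s)"]) (auto simp: \<phi>_def x_def)
qed

lemma weakly_causal_curve_affine:
  assumes \<gamma>: "weakly_causal_curve \<alpha> \<beta> \<gamma>" and ab': "\<alpha>' < \<beta>'"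
  obtains \<gamma>' where "weakly_causal_curve \<alpha>' \<beta>' \<gamma>'" "\<gamma>' \<alpha>' = \<gamma> \<alpha>" "\<gamma>' \<beta>' = \<gamma> \<beta>"
proof -
  have ab: "\<alpha> < \<beta>" using \<gamma> by (simp add: weakly_causal_curve_def)
  define k where "k = (\<beta> - \<alpha>) / (\<beta>' - \<alpha>')"
  define \<phi> where "\<phi> s = \<alpha> + k * (s - \<alpha>')" for s
  have k: "0 < k" "k * (\<beta>' - \<alpha>') = \<beta> - \<alpha>" using ab ab' by (auto simp: k_def)
  have "weakly_causal_curve \<alpha>' \<beta>' (\<lambda>s. \<gamma> (\<phi> s))"
  proof (rule weakly_causal_reparam[OF ab ab', where \<phi>' = "\<lambda>_. k"])
    show "\<phi> s \<in> {\<alpha>..\<beta>}" if "s \<in> {\<alpha>'..\<beta>'}" for s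
      using that k mult_left_mono[of "s - \<alpha>'" "\<beta>' - \<alpha>'" k] by (simp add: \<phi>_def)
    show "(\<phi> has_vector_derivative k) (at s within {\<alpha>'..\<beta>'})" for s
      unfolding \<phi>_def by (auto intro!: derivative_eq_intros)
    show "k = 0 \<or> velocity_M \<alpha> \<beta> \<gamma> (\<phi> s) = (0, (\<lambda>_. 0), 0)" if "s = \<alpha>' \<or> s = \<beta>'" for s
      using that k \<gamma> by (auto simp: \<phi>_def weakly_causal_curve_def)
  qed (use \<gamma> k in \<open>auto simp: weakly_causal_curve_def\<close>)
  then show ?thesis using k by (intro that[of "\<lambda>s. \<gamma> (\<phi> s)"]) (auto simp: \<phi>_def)
qed

lemma weakly_causal_curve_join:
  assumes 1: "weakly_causal_curve \<alpha> \<beta> \<gamma>1" and 2: "weakly_causal_curve \<beta> \<kappa> \<gamma>2" and eq: "\<gamma>1 \<beta> = \<gamma>2 \<beta>"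
  shows "weakly_causal_curve \<alpha> \<kappa> (\<lambda>s. if s \<le> \<beta> then \<gamma>1 s else \<gamma>2 s)"
proof -
  define \<gamma> where "\<gamma> s = (if s \<le> \<beta> then \<gamma>1 s else \<gamma>2 s)" for s
  have ab: "\<alpha> < \<beta>" "\<beta> < \<kappa>" and C: "C1_curve_M \<alpha> \<beta> \<gamma>1" "C1_curve_M \<beta> \<kappa> \<gamma>2"
    using 1 2 by (auto simp: weakly_causal_curve_def)
  have e1: "\<gamma> s = \<gamma>1 s" if "s \<in> {\<alpha>..\<beta>}" for s using that by (simp add: \<gamma>_def)
  have e2: "\<gamma> s = \<gamma>2 s" if "s \<in> {\<beta>..\<kappa>}" for s using that eq by (auto simp: \<gamma>_def)
  note c1 = C1_curve_M_cong[where \<gamma>' = \<gamma>, OF ab(1) C(1) e1]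
  note c2 = C1_curve_M_cong[where \<gamma>' = \<gamma>, OF ab(2) C(2) e2]
  have 1: "C1_curve_M \<alpha> \<beta> \<gamma>" by (rule c1(1))
  have 2: "C1_curve_M \<beta> \<kappa> \<gamma>" by (rule c2(1))
  have v1: "velocity_M \<alpha> \<beta> \<gamma> s = velocity_M \<alpha> \<beta> \<gamma>1 s" if "s \<in> {\<alpha>..\<beta>}" for s using c1(2)[OF _ that] by simp
  have v2: "velocity_M \<beta> \<kappa> \<gamma> s = velocity_M \<beta> \<kappa> \<gamma>2 s" if "s \<in> {\<beta>..\<kappa>}" for s using c2(2)[OF _ that] by simp
  have z1: "velocity_M \<alpha> \<beta> \<gamma> \<beta> = (0, (\<lambda>_. 0), 0)" "velocity_M \<alpha> \<beta> \<gamma> \<alpha> = (0, (\<lambda>_. 0), 0)"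
    using assms(1) v1 ab by (auto simp: weakly_causal_curve_def)
  have z2: "velocity_M \<beta> \<kappa> \<gamma> \<beta> = (0, (\<lambda>_. 0), 0)" "velocity_M \<beta> \<kappa> \<gamma> \<kappa> = (0, (\<lambda>_. 0), 0)"
    using assms(2) v2 ab by (auto simp: weakly_causal_curve_def)
  note D1 = C1_curve_M_D[OF 1] and D2 = C1_curve_M_D[OF 2]
  have vq: "velocity A \<alpha> \<beta> (\<lambda>s. fst (snd (\<gamma> s))) \<beta> = velocity A \<beta> \<kappa> (\<lambda>s. fst (snd (\<gamma> s))) \<beta>"
    using D1(5)[of \<beta>] D2(5)[of \<beta>] z1 z2 by simp
  note q = C1_curve_join[OF ab D1(4) D2(4) vq]
  have "fst (velocity_M \<alpha> \<beta> \<gamma> \<beta>) = fst (velocity_M \<beta> \<kappa> \<gamma> \<beta>)" by (simp add: z1 z2)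
  note t = C1_real_join[OF ab D1(1,2) D2(1,2) this]
  have "snd (snd (velocity_M \<alpha> \<beta> \<gamma> \<beta>)) = snd (snd (velocity_M \<beta> \<kappa> \<gamma> \<beta>))" by (simp add: z1 z2)
  note y = C1_real_join[OF ab D1(6,7) D2(6,7) this]
  have T: "fst (\<gamma> s) \<in> T" if "s \<in> {\<alpha>..\<kappa>}" for s
    using D1(3)[of s] D2(3)[of s] that by (cases "s \<le> \<beta>") auto
  have t1: "continuous_on {\<alpha>..\<kappa>} (\<lambda>s. if s \<le> \<beta> then fst (velocity_M \<alpha> \<beta> \<gamma> s) else fst (velocity_M \<beta> \<kappa> \<gamma> s))"
    by (rule t(1))
  have y1: "continuous_on {\<alpha>..\<kappa>} (\<lambda>s. if s \<le> \<beta> then snd (snd (velocity_M \<alpha> \<beta> \<gamma> s)) else snd (snd (velocity_M \<beta> \<kappa> \<gamma> s)))"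
    by (rule y(1))
  have t2: "((\<lambda>s. fst (\<gamma> s)) has_vector_derivative (if s \<le> \<beta> then fst (velocity_M \<alpha> \<beta> \<gamma> s) else fst (velocity_M \<beta> \<kappa> \<gamma> s))) (at s within {\<alpha>..\<kappa>})"
    if "s \<in> {\<alpha>..\<kappa>}" for s using t(2)[OF _ _ that] by simp
  have y2: "((\<lambda>s. snd (snd (\<gamma> s))) has_vector_derivative (if s \<le> \<beta> then snd (snd (velocity_M \<alpha> \<beta> \<gamma> s)) else snd (snd (velocity_M \<beta> \<kappa> \<gamma> s)))) (at s within {\<alpha>..\<kappa>})"
    if "s \<in> {\<alpha>..\<kappa>}" for s using y(2)[OF _ _ that] by simp
  have ak: "\<alpha> < \<kappa>" using ab by simp
  note I = C1_curve_M_I[of \<alpha> \<kappa> \<gamma>, OF ak t2 t1 T q(1) y2 y1]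
  have v: "velocity_M \<alpha> \<kappa> \<gamma> s = (if s \<le> \<beta> then velocity_M \<alpha> \<beta> \<gamma> s else velocity_M \<beta> \<kappa> \<gamma> s)" if s: "s \<in> {\<alpha>..\<kappa>}" for s
    using I(2)[OF _ _ _ s] q(2)[OF s] D1(5)[of s] D2(5)[of s] by (auto simp: prod_eq_iff)
  have "weakly_causal_curve \<alpha> \<kappa> \<gamma>"
    unfolding weakly_causal_curve_def
  proof (intro conjI ballI)
    show "C1_curve_M \<alpha> \<kappa> \<gamma>" by (rule I(1))
    fix s assume s: "s \<in> {\<alpha>..\<kappa>}"
    show "weakly_causal (\<gamma> s) (velocity_M \<alpha> \<kappa> \<gamma> s)"
    proof (cases "s \<le> \<beta>")
      case True
      then show ?thesis using assms(1) s v[OF s] v1[of s] e1[of s] by (simp add: weakly_causal_curve_def)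
    next
      case False
      then show ?thesis using assms(2) s v[OF s] v2[of s] e2[of s] by (simp add: weakly_causal_curve_def)
    qed
  qed (use v z1 z2 ab in auto)
  then show ?thesis by (simp add: \<gamma>_def[abs_def])
qed

lemma future_causal_curve_weakly_causal_curve:
  assumes "future_causal_curve \<alpha> \<beta> \<gamma>"
  obtains \<gamma>' where "weakly_causal_curve \<alpha> \<beta> \<gamma>'" "\<gamma>' \<alpha> = \<gamma> \<alpha>" "\<gamma>' \<beta> = \<gamma> \<beta>"
proof -
  obtain n p where p: "0 < n" "p 0 = \<alpha>" "p n = \<beta>" "\<And>i. i < n \<Longrightarrow> p i < p (Suc i)"
    and pc: "\<And>i. i < n \<Longrightarrow> future_causal_C1_curve (p i) (p (Suc i)) \<gamma>"
    using assms unfolding future_causal_curve_def by blast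
  have "\<exists>\<gamma>'. weakly_causal_curve (p 0) (p (Suc k)) \<gamma>' \<and> \<gamma>' (p 0) = \<gamma> (p 0) \<and> \<gamma>' (p (Suc k)) = \<gamma> (p (Suc k))" if "Suc k \<le> n" for k
    using that
  proof (induction k)
    case 0
    then have "0 < n" by simp
    from weakly_causal_curve_smoothing[OF p(4)[OF this] pc[OF this]] show ?case by metis
  next
    case (Suc k)
    then obtain \<gamma>1 where 1: "weakly_causal_curve (p 0) (p (Suc k)) \<gamma>1" "\<gamma>1 (p 0) = \<gamma> (p 0)" "\<gamma>1 (p (Suc k)) = \<gamma> (p (Suc k))" by auto
    have k: "Suc k < n" using Suc by simp
    obtain \<gamma>2 where 2: "weakly_causal_curve (p (Suc k)) (p (Suc (Suc k))) \<gamma>2" "\<gamma>2 (p (Suc k)) = \<gamma> (p (Suc k))"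
        "\<gamma>2 (p (Suc (Suc k))) = \<gamma> (p (Suc (Suc k)))"
      using weakly_causal_curve_smoothing[OF p(4)[OF k] pc[OF k]] by metis
    have "weakly_causal_curve (p 0) (p (Suc (Suc k))) (\<lambda>s. if s \<le> p (Suc k) then \<gamma>1 s else \<gamma>2 s)"
      using 1 2 by (intro weakly_causal_curve_join) auto
    moreover have "p 0 < p (Suc k)" using 1 by (simp add: weakly_causal_curve_def)
    ultimately show ?case using 1 2 p(4)[OF k]
      by (intro exI[of _ "\<lambda>s. if s \<le> p (Suc k) then \<gamma>1 s else \<gamma>2 s"]) auto
  qed
  from this[of "n - 1"] p show ?thesis by (auto intro: that)
qed

lemma weakly_causal_curve_const:
  assumes "x \<in> M" "\<alpha> < \<beta>" shows "weakly_causal_curve \<alpha> \<beta> (\<lambda>_. x)"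
proof -
  have T: "fst x \<in> T" using assms by (auto simp: M_def)
  have q: "C1_curve A \<alpha> \<beta> (\<lambda>_. fst (snd x))" by (rule C1_curve_const(1)[OF assms(2)])
  note I = C1_curve_M_I[of \<alpha> \<beta> "\<lambda>_. x", OF assms(2) has_vector_derivative_const continuous_on_const T q
    has_vector_derivative_const continuous_on_const]
  have v: "velocity_M \<alpha> \<beta> (\<lambda>_. x) s = (0, (\<lambda>_. 0), 0)" if "s \<in> {\<alpha>..\<beta>}" for s
    using I(2)[OF that] C1_curve_const(2)[OF assms(2) that] by simp
  have "weakly_causal x (0, (\<lambda>_. 0), 0)"
    using a_zero_b_zero[OF T zero_tangent, of "fst (snd x)"] by (simp add: weakly_causal_def excess_def)
  then show ?thesis unfolding weakly_causal_curve_def using assms(2) I(1) v by auto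
qed

lemma J_plus_weakly_causal_curve:
  assumes "x \<in> M" "x' \<in> J_plus x" "\<alpha> < \<beta>"
  obtains \<gamma> where "weakly_causal_curve \<alpha> \<beta> \<gamma>" "\<gamma> \<alpha> = x" "\<gamma> \<beta> = x'"
proof (cases "x' = x")
  case True
  then show ?thesis using weakly_causal_curve_const[OF assms(1,3)] that by blast
next
  case False
  then obtain \<alpha>' \<beta>' \<gamma> where \<gamma>: "future_causal_curve \<alpha>' \<beta>' \<gamma>" "\<gamma> \<alpha>' = x" "\<gamma> \<beta>' = x'"
    using assms(2) by (auto simp: J_plus_def)
  obtain \<gamma>1 where 1: "weakly_causal_curve \<alpha>' \<beta>' \<gamma>1" "\<gamma>1 \<alpha>' = \<gamma> \<alpha>'" "\<gamma>1 \<beta>' = \<gamma> \<beta>'" by (rule future_causal_curve_weakly_causal_curve[OF \<gamma>(1)])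
  obtain \<gamma>2 where "weakly_causal_curve \<alpha> \<beta> \<gamma>2" "\<gamma>2 \<alpha> = \<gamma>1 \<alpha>'" "\<gamma>2 \<beta> = \<gamma>1 \<beta>'" by (rule weakly_causal_curve_affine[OF 1(1) assms(3)])
  then show ?thesis using that 1 \<gamma> by simp
qed

section \<open>Time along causal curves\<close>

lemma weakly_causal_time_mono:
  assumes "C1_curve_M \<alpha> \<beta> \<gamma>" "\<And>s. s \<in> {\<alpha>..\<beta>} \<Longrightarrow> weakly_causal (\<gamma> s) (velocity_M \<alpha> \<beta> \<gamma> s)"
    and "\<alpha> \<le> s" "s \<le> s'" "s' \<le> \<beta>"
  shows "fst (\<gamma> s) \<le> fst (\<gamma> s')"
  by (rule nonneg_derivative_imp_mono[OF C1_curve_M_D(1)[OF assms(1)] _ assms(3-5)])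
    (use assms(2) in \<open>auto simp: weakly_causal_def\<close>)

text \<open>Monotonicity makes the time constant, so \<tau> = 0. Then a(v, v) \<le> 0 forces v = 0,
  and w reduces to the \<open>y\<close> component.\<close>

lemma weakly_causal_constant_time:
  assumes ab: "\<alpha> < \<beta>" and C: "C1_curve_M \<alpha> \<beta> \<gamma>"
    and wc: "\<And>s. s \<in> {\<alpha>..\<beta>} \<Longrightarrow> weakly_causal (\<gamma> s) (velocity_M \<alpha> \<beta> \<gamma> s)"
    and t: "fst (\<gamma> \<alpha>) = fst (\<gamma> \<beta>)" and s: "s \<in> {\<alpha>..\<beta>}"
  shows "fst (velocity_M \<alpha> \<beta> \<gamma> s) = 0" "fst (snd (velocity_M \<alpha> \<beta> \<gamma> s)) = (\<lambda>_. 0)"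
    "snd (snd (velocity_M \<alpha> \<beta> \<gamma> s)) = excess (\<gamma> s) (velocity_M \<alpha> \<beta> \<gamma> s)"
proof -
  note D = C1_curve_M_D[OF C] and mono = weakly_causal_time_mono[OF C wc]
  have "((\<lambda>s. fst (\<gamma> s)) has_vector_derivative 0) (at s within {\<alpha>..\<beta>})"
  proof (rule has_vector_derivative_transform[OF s _ has_vector_derivative_const[of "fst (\<gamma> \<alpha>)"]])
    show "fst (\<gamma> x) = fst (\<gamma> \<alpha>)" if "x \<in> {\<alpha>..\<beta>}" for x
      using mono[of \<alpha> x] mono[of x \<beta>] t that by auto
  qed
  from vector_derivative_Icc[OF ab s this] vector_derivative_Icc[OF ab s D(1)[OF s]]
  show \<tau>: "fst (velocity_M \<alpha> \<beta> \<gamma> s) = 0" by simp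
  show v: "fst (snd (velocity_M \<alpha> \<beta> \<gamma> s)) = (\<lambda>_. 0)"
  proof (rule ccontr)
    assume "fst (snd (velocity_M \<alpha> \<beta> \<gamma> s)) \<noteq> (\<lambda>_. 0)"
    from a_pos_def[OF D(3)[OF s] C1_curve_M_tangent[OF ab C s] this] wc[OF s] \<tau>
    show False by (simp add: weakly_causal_def)
  qed
  show "snd (snd (velocity_M \<alpha> \<beta> \<gamma> s)) = excess (\<gamma> s) (velocity_M \<alpha> \<beta> \<gamma> s)"
    using v \<tau> a_zero_b_zero[OF D(3)[OF s] zero_tangent[of "fst (snd (\<gamma> s))"]] by (simp add: excess_def)
qed

lemma weakly_causal_curve_mono:
  assumes "weakly_causal_curve \<alpha> \<beta> \<gamma>" "\<alpha> \<le> s" "s \<le> s'" "s' \<le> \<beta>"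
  shows "fst (\<gamma> s) \<le> fst (\<gamma> s')"
  using assms by (intro weakly_causal_time_mono) (auto simp: weakly_causal_curve_def)

lemma weakly_causal_curve_vertical:
  assumes \<gamma>: "weakly_causal_curve \<alpha> \<beta> \<gamma>" and t: "fst (\<gamma> \<alpha>) = fst (\<gamma> \<beta>)"
  shows "fst (snd (\<gamma> \<alpha>)) = fst (snd (\<gamma> \<beta>))" "snd (snd (\<gamma> \<alpha>)) \<le> snd (snd (\<gamma> \<beta>))"
proof -
  have ab: "\<alpha> < \<beta>" and C: "C1_curve_M \<alpha> \<beta> \<gamma>"
    and wc: "\<And>s. s \<in> {\<alpha>..\<beta>} \<Longrightarrow> weakly_causal (\<gamma> s) (velocity_M \<alpha> \<beta> \<gamma> s)" using \<gamma> by (auto simp: weakly_causal_curve_def)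
  note D = C1_curve_M_D[OF C] and const = weakly_causal_constant_time[OF ab C wc t]
  have "fst (snd (\<gamma> \<beta>)) = fst (snd (\<gamma> \<alpha>))"
    by (rule zero_velocity_imp_constant[OF ab D(4)]) (use const(2) D(5) ab in auto)
  then show "fst (snd (\<gamma> \<alpha>)) = fst (snd (\<gamma> \<beta>))" by simp
  have "0 \<le> snd (snd (velocity_M \<alpha> \<beta> \<gamma> s))" if s: "s \<in> {\<alpha>..\<beta>}" for s
    using wc[OF s] const(3)[OF _ s] by (simp add: weakly_causal_def)
  from nonneg_derivative_imp_mono[OF D(6) this, of \<alpha> \<beta>] show "snd (snd (\<gamma> \<alpha>)) \<le> snd (snd (\<gamma> \<beta>))" using ab by simp
qed


section \<open>Uniform constants over compact sets\<close>

lemma chart_box: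
  assumes "{t0..t1} \<subseteq> T"
  obtains c \<rho> DG C k where "c \<in> A" "q \<in> fst c" "0 < \<rho>" "cball (snd c q) \<rho> \<subseteq> snd c ` fst c"
    "lagrangian_box (coord_form c) DG t0 t1 (snd c q) \<rho> C k"
proof -
  obtain c where c: "c \<in> A" "q \<in> fst c" by (rule chart_exists)
  obtain \<rho> where \<rho>: "0 < \<rho>" "cball (snd c q) \<rho> \<subseteq> snd c ` fst c"
    using open_chart_image[OF c(1)] c(2) by (metis imageI open_contains_cball)
  have "{t0..t1} \<times> cball (snd c q) \<rho> \<subseteq> T \<times> snd c ` fst c" using assms \<rho>(2) by blast
  from lagrangian_box_exists[OF open_box[OF c(1)] this coord_form_bilinear[OF c(1)] coord_form_sym[OF c(1)]
      coord_form_C2[OF c(1)] coord_form_pos[OF c(1)]]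
  obtain DG C k where "lagrangian_box (coord_form c) DG t0 t1 (snd c q) \<rho> C k" by blast
  with c \<rho> show ?thesis by (rule that)
qed

lemma open_chart_ball:
  assumes "c \<in> A"
  shows "open {p \<in> fst c. snd c p \<in> ball x \<rho>}"
proof -
  have "{p \<in> fst c. snd c p \<in> ball x \<rho>} = fst c \<inter> snd c -` ball x \<rho>" by auto
  then show ?thesis
    using continuous_open_preimage[OF continuous_on_chart[OF assms] open_chart[OF assms] open_ball] by simp
qed

text \<open>The ball is carried over by the inverse chart. Compactness in \<open>Q\<close>, and not
  merely in the chart, later makes such sets closed in \<open>Q\<close>, so that limits of points in
  them stay in the chart.\<close>

lemma compact_chart_cball:
  assumes "c \<in> A" "cball x \<rho> \<subseteq> snd c ` fst c"
  shows "compact {p \<in> fst c. snd c p \<in> cball x \<rho>}"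
proof -
  have "{p \<in> fst c. snd c p \<in> cball x \<rho>} = chart_inv c ` cball x \<rho>"
  proof (intro equalityI subsetI)
    fix p assume "p \<in> chart_inv c ` cball x \<rho>"
    then obtain z where "p = chart_inv c z" "z \<in> cball x \<rho>" by blast
    then show "p \<in> {p \<in> fst c. snd c p \<in> cball x \<rho>}" using chart_inv_mem[of z c] assms by auto
  next
    fix p assume "p \<in> {p \<in> fst c. snd c p \<in> cball x \<rho>}"
    then show "p \<in> chart_inv c ` cball x \<rho>"
      using assms by (intro image_eqI[of p "chart_inv c" "snd c p"]) auto
  qed
  then show ?thesis
    using compact_continuous_image[OF continuous_on_subset[OF continuous_on_chart_inv[OF assms(1)] assms(2)] compact_cball]
    by simp
qed

text \<open>The change of the coefficients when the time moves while the point and the vector stay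
  fixed, together with a lower bound for the Lagrangian. The vector is unbounded, so the change of
  \<open>a\<close> is relative and that of \<open>b\<close> is measured by 1 + a. No chart occurs,
  so the property passes to compact sets.\<close>

definition time_bound :: "real \<Rightarrow> real \<Rightarrow> real \<Rightarrow> 'q \<Rightarrow> bool" where
  "time_bound t0 t1 C p \<longleftrightarrow> 0 \<le> C \<and> (\<forall>v\<in>tangent_space A p. \<forall>z\<in>{t0..t1}. \<forall>z'\<in>{t0..t1}.
     a z p v v \<le> (1 + C * \<bar>z - z'\<bar>) * a z' p v v \<and>
     \<bar>b z p v - b z' p v\<bar> \<le> C * \<bar>z - z'\<bar> * (1 + a z' p v v) \<and>
     \<bar>V z p - V z' p\<bar> \<le> C * \<bar>z - z'\<bar> \<and> \<bar>V z p\<bar> \<le> C \<and> - C \<le> Lagrangian z p v)"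

lemma time_bound_mono:
  assumes T: "{t0..t1} \<subseteq> T" and le: "C \<le> C'" and C: "time_bound t0 t1 C p"
  shows "time_bound t0 t1 C' p"
  unfolding time_bound_def
proof (intro conjI ballI)
  show C': "0 \<le> C'" using C le by (simp add: time_bound_def)
  fix v z z' assume v: "v \<in> tangent_space A p" and z: "z \<in> {t0..t1}" "z' \<in> {t0..t1}"
  have a0: "0 \<le> a z' p v v" using a_nonneg[OF _ v] T z by auto
  note d = C[unfolded time_bound_def, THEN conjunct2, THEN bspec, OF v, THEN bspec, OF z(1), THEN bspec, OF z(2)]
  have 1: "C * \<bar>z - z'\<bar> \<le> C' * \<bar>z - z'\<bar>" using le by (intro mult_right_mono) auto
  show "a z p v v \<le> (1 + C' * \<bar>z - z'\<bar>) * a z' p v v"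
    using d mult_right_mono[OF 1 a0] by (simp add: algebra_simps)
  have "C * \<bar>z - z'\<bar> * (1 + a z' p v v) \<le> C' * \<bar>z - z'\<bar> * (1 + a z' p v v)"
    by (rule mult_right_mono[OF 1]) (use a0 in simp)
  then show "\<bar>b z p v - b z' p v\<bar> \<le> C' * \<bar>z - z'\<bar> * (1 + a z' p v v)" using d by linarith
  show "\<bar>V z p - V z' p\<bar> \<le> C' * \<bar>z - z'\<bar>" "\<bar>V z p\<bar> \<le> C'" "- C' \<le> Lagrangian z p v" using d 1 le by auto
qed

text \<open>The bounds are those of the coordinate form at special vectors: a pair of
  \<open>(0, v)\<close> gives \<open>a\<close>, the pair \<open>(1, 0)\<close>,
  \<open>(0, v)\<close> gives \<open>b\<close>, and twice \<open>(1, 0)\<close> gives -2 V. The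
  lower bound for the Lagrangian is the energy estimate with the space term dropped.\<close>

lemma time_bound_local:
  assumes T: "{t0..t1} \<subseteq> T"
  shows "\<exists>N C. open N \<and> q \<in> N \<and> (\<forall>p\<in>N. time_bound t0 t1 C p)"
proof -
  obtain c \<rho> DG C k where c: "c \<in> A" "q \<in> fst c" "0 < \<rho>" "cball (snd c q) \<rho> \<subseteq> snd c ` fst c"
    and box: "lagrangian_box (coord_form c) DG t0 t1 (snd c q) \<rho> C k"
    by (rule chart_box[OF T])
  interpret lagrangian_box "coord_form c" DG t0 t1 "snd c q" \<rho> C k by (rule box)
  define C' where "C' = C + C / k + energy_const"
  have pos: "0 < C" "0 < k" "0 \<le> C / k" "0 \<le> energy_const"
    using C_pos c_pos by (auto simp: energy_const_def)
  have "time_bound t0 t1 C' p" if p: "p \<in> fst c" "snd c p \<in> ball (snd c q) \<rho>" for p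
    unfolding time_bound_def
  proof (intro conjI ballI)
    show "0 \<le> C'" using pos by (simp add: C'_def)
    fix v z z' assume v: "v \<in> tangent_space A p" and z: "z \<in> {t0..t1}" "z' \<in> {t0..t1}"
    define e where "e z = (z, snd c p)" for z :: real
    have eb: "e z \<in> {t0..t1} \<times> cball (snd c q) \<rho>" if "z \<in> {t0..t1}" for z
      using that p(2) by (simp add: e_def)
    have en: "norm (e z - e z') = \<bar>z - z'\<bar>" by (simp add: e_def)
    have zT: "z \<in> T" "z' \<in> T" using z T by auto
    have form: "coord_form c (e z) (h, v c) (l, v c) = form z p (h, v) (l, v)" for h l z
      using form_coord[OF c(1) p(1) v v] by (simp add: e_def)
    have form0: "coord_form c (e z) (h, 0) (l, w c) = form z p (h, \<lambda>_. 0) (l, w)" if "w \<in> tangent_space A p" for h l w z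
      using form_coord[OF c(1) p(1) zero_tangent that] by (simp add: e_def)
    have a: "coord_form c (e z) (0, v c) (0, v c) = a z p v v" for z
      by (simp add: form form_def)
    have b: "coord_form c (e z) (1, 0) (0, v c) = b z p v" if "z \<in> T" for z
      using a_zero_b_zero[OF that v] by (simp add: form0[OF v] form_def)
    have V: "coord_form c (e z) (1, 0) (1, 0) = - 2 * V z p" if "z \<in> T" for z
      using form0[OF zero_tangent, of z 1 1] a_zero_b_zero[OF that zero_tangent, of p] by (simp add: form_def)
    have u2: "(norm (v c))\<^sup>2 \<le> a z' p v v / k"
      using lagrangian_box.pos[OF box eb[OF z(2)], of "v c"] pos by (simp add: a field_simps)
    have a0: "0 \<le> a z' p v v" by (rule a_nonneg[OF zT(2) v])
    have "\<bar>a z p v v - a z' p v v\<bar> \<le> C * \<bar>z - z'\<bar> * (norm (v c))\<^sup>2"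
      using lip[OF eb[OF z(2)] eb[OF z(1)], of "(0, v c)" "(0, v c)"] by (simp add: a en power2_eq_square mult.assoc)
    also have "\<dots> \<le> C * \<bar>z - z'\<bar> * (a z' p v v / k)"
      using u2 pos by (intro mult_left_mono) auto
    also have "\<dots> = C / k * (\<bar>z - z'\<bar> * a z' p v v)" by simp
    also have "\<dots> \<le> C' * (\<bar>z - z'\<bar> * a z' p v v)"
      using a0 pos by (intro mult_right_mono) (auto simp: C'_def)
    finally show "a z p v v \<le> (1 + C' * \<bar>z - z'\<bar>) * a z' p v v" by (simp add: algebra_simps)
    have n1: "norm (v c) \<le> 1 + a z' p v v / k"
    proof -
      have "2 * norm (v c) \<le> (norm (v c))\<^sup>2 + 1"
        using zero_le_power2[of "norm (v c) - 1"] unfolding power2_diff by simp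
      with norm_ge_zero[of "v c"] have "norm (v c) \<le> 1 + (norm (v c))\<^sup>2" by linarith
      then show ?thesis using u2 by linarith
    qed
    have "\<bar>b z p v - b z' p v\<bar> \<le> C * \<bar>z - z'\<bar> * norm (v c)"
      using lip[OF eb[OF z(2)] eb[OF z(1)], of "(1, 0)" "(0, v c)"] by (simp add: b zT en mult.assoc)
    also have "\<dots> \<le> C * \<bar>z - z'\<bar> * (1 + a z' p v v / k)"
      using n1 pos by (intro mult_left_mono) auto
    also have "\<dots> = \<bar>z - z'\<bar> * (C + C / k * a z' p v v)" by (simp add: algebra_simps)
    also have "\<dots> \<le> \<bar>z - z'\<bar> * (C' + C' * a z' p v v)"
      using a0 pos by (intro mult_left_mono add_mono mult_right_mono) (auto simp: C'_def)
    finally show "\<bar>b z p v - b z' p v\<bar> \<le> C' * \<bar>z - z'\<bar> * (1 + a z' p v v)" by (simp add: algebra_simps)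
    have CC': "C \<le> C'" using pos by (simp add: C'_def)
    have two: "\<bar>2 * V z' p - 2 * V z p\<bar> = 2 * \<bar>V z p - V z' p\<bar>"
      by (metis abs_minus_commute abs_mult abs_numeral right_diff_distrib)
    have "2 * \<bar>V z p - V z' p\<bar> \<le> C * \<bar>z - z'\<bar>"
      using lip[OF eb[OF z(2)] eb[OF z(1)], of "(1, 0)" "(1, 0)"] two by (simp add: V zT en)
    moreover have "C * \<bar>z - z'\<bar> \<le> C' * \<bar>z - z'\<bar>" using CC' by (intro mult_right_mono) auto
    moreover have "\<bar>V z p - V z' p\<bar> \<le> 2 * \<bar>V z p - V z' p\<bar>" by simp
    ultimately show "\<bar>V z p - V z' p\<bar> \<le> C' * \<bar>z - z'\<bar>" by (meson order_trans)
    have "2 * \<bar>V z p\<bar> \<le> C" using bound[OF eb[OF z(1)], of "(1, 0)" "(1, 0)"] by (simp add: V zT)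
    then show "\<bar>V z p\<bar> \<le> C'" using CC' by linarith
    have "0 \<le> k * (norm (v c))\<^sup>2" using pos by simp
    also have "\<dots> \<le> 4 * Lagrangian z p v + energy_const"
      using energy_bound[OF eb[OF z(1)], of "v c" 1] by (simp add: form Lagrangian_form)
    finally have "0 \<le> 4 * Lagrangian z p v + energy_const" .
    then show "- C' \<le> Lagrangian z p v" using pos unfolding C'_def by linarith
  qed
  moreover have "q \<in> {p \<in> fst c. snd c p \<in> ball (snd c q) \<rho>}" using c by simp
  ultimately show ?thesis using open_chart_ball[OF c(1)] by blast
qed

lemma time_bound_compact:
  assumes "{t0..t1} \<subseteq> T" "compact K"
  obtains C where "0 \<le> C" "\<And>p. p \<in> K \<Longrightarrow> time_bound t0 t1 C p"
  by (rule compact_uniform_bound[OF assms(2) time_bound_local[OF assms(1)] time_bound_mono[OF assms(1)]]) blast+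

lemma time_boundD:
  assumes "time_bound t0 t1 C p" "v \<in> tangent_space A p" "z \<in> {t0..t1}" "z' \<in> {t0..t1}"
  shows "a z p v v \<le> (1 + C * \<bar>z - z'\<bar>) * a z' p v v"
    "\<bar>b z p v - b z' p v\<bar> \<le> C * \<bar>z - z'\<bar> * (1 + a z' p v v)"
    "\<bar>V z p - V z' p\<bar> \<le> C * \<bar>z - z'\<bar>" "\<bar>V z p\<bar> \<le> C" "- C \<le> Lagrangian z p v"
  using assms unfolding time_bound_def by blast+

text \<open>Where \<open>dt\<close> vanishes along a causal curve, the curve cannot be parametrised by time; so the
  time is replaced by a nearby function \<open>\<theta>\<close> of positive derivative.\<close>

lemma weakly_causal_curve_approximation:
  assumes \<gamma>: "weakly_causal_curve \<alpha> \<beta> \<gamma>" and t: "fst (\<gamma> \<alpha>) = t0" "fst (\<gamma> \<beta>) = t1" "t0 < t1" and \<delta>: "0 < \<delta>"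
  obtains q where "C1_curve A t0 t1 q" "q t0 = fst (snd (\<gamma> \<alpha>))" "q t1 = fst (snd (\<gamma> \<beta>))"
    "\<And>s. s \<in> {\<alpha>..\<beta>} \<Longrightarrow> \<exists>z\<in>{t0..t1}. \<bar>z - fst (\<gamma> s)\<bar> \<le> \<delta> \<and> q z = fst (snd (\<gamma> s)) \<and>
      integral {t0..z} (\<lambda>z. Lagrangian z (q z) (velocity A t0 t1 q z)) \<le> snd (snd (\<gamma> s)) - snd (snd (\<gamma> \<alpha>)) + \<delta> \<and>
      integral {z..t1} (\<lambda>z. Lagrangian z (q z) (velocity A t0 t1 q z)) \<le> snd (snd (\<gamma> \<beta>)) - snd (snd (\<gamma> s)) + \<delta>"
proof -
  have ab: "\<alpha> < \<beta>" and C: "C1_curve_M \<alpha> \<beta> \<gamma>"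
    and wc: "\<And>s. s \<in> {\<alpha>..\<beta>} \<Longrightarrow> weakly_causal (\<gamma> s) (velocity_M \<alpha> \<beta> \<gamma> s)" using \<gamma> by (auto simp: weakly_causal_curve_def)
  note D = C1_curve_M_D[OF C]
  define tt where "tt s = fst (\<gamma> s)" for s
  define p where "p s = fst (snd (\<gamma> s))" for s
  define y where "y s = snd (snd (\<gamma> s))" for s
  define \<tau> where "\<tau> s = fst (velocity_M \<alpha> \<beta> \<gamma> s)" for s
  define v where "v s = velocity A \<alpha> \<beta> p s" for s
  define \<eta> where "\<eta> s = snd (snd (velocity_M \<alpha> \<beta> \<gamma> s))" for s
  define w where "w s = \<eta> s - b (tt s) (p s) (v s) + V (tt s) (p s) * \<tau> s" for s
  have pC: "C1_curve A \<alpha> \<beta> p" using D(4) by (simp add: p_def[abs_def])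
  have v: "v s = fst (snd (velocity_M \<alpha> \<beta> \<gamma> s))" for s by (simp add: v_def D(5) p_def[abs_def])
  have vT: "v s \<in> tangent_space A (p s)" if "s \<in> {\<alpha>..\<beta>}" for s
    unfolding v_def by (rule velocity_tangent[OF ab pC that])
  have tt_d: "(tt has_vector_derivative \<tau> s) (at s within {\<alpha>..\<beta>})" if "s \<in> {\<alpha>..\<beta>}" for s
    using D(1)[OF that] by (simp add: tt_def[abs_def] \<tau>_def)
  have y_d: "(y has_vector_derivative \<eta> s) (at s within {\<alpha>..\<beta>})" if "s \<in> {\<alpha>..\<beta>}" for s
    using D(6)[OF that] by (simp add: y_def[abs_def] \<eta>_def)
  have \<tau>c: "continuous_on {\<alpha>..\<beta>} \<tau>" and \<eta>c: "continuous_on {\<alpha>..\<beta>} \<eta>"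
    using D(2,7) by (simp_all add: \<tau>_def[abs_def] \<eta>_def[abs_def])
  have ttc: "continuous_on {\<alpha>..\<beta>} tt" using tt_d by (rule continuous_on_vector_derivative)
  have ttT: "tt s \<in> T" if "s \<in> {\<alpha>..\<beta>}" for s using D(3)[OF that] by (simp add: tt_def)
  have tI: "tt s \<in> {t0..t1}" if "s \<in> {\<alpha>..\<beta>}" for s
    using weakly_causal_curve_mono[OF \<gamma>, of \<alpha> s] weakly_causal_curve_mono[OF \<gamma>, of s \<beta>] that t by (auto simp: tt_def)
  have t0T: "{t0..t1} \<subseteq> T" using ttT[of \<alpha>] ttT[of \<beta>] ab t T_Icc by (simp add: tt_def)
  have cau: "0 \<le> \<tau> s" "0 \<le> w s" "a (tt s) (p s) (v s) (v s) \<le> 2 * \<tau> s * w s" if "s \<in> {\<alpha>..\<beta>}" for s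
    using wc[OF that] by (auto simp: weakly_causal_def excess_def w_def \<tau>_def v \<eta>_def tt_def p_def)
  note abV = continuous_on_abV[OF ab pC ttc ttT, folded v_def]
  have "compact (p ` {\<alpha>..\<beta>})" by (intro compact_continuous_image C1_curve_continuous[OF pC]) simp
  then have "\<exists>K\<ge>0. \<forall>x\<in>p ` {\<alpha>..\<beta>}. time_bound t0 t1 K x"
    by (rule time_bound_compact[OF t0T]) auto
  then obtain K where K0: "0 \<le> K" "\<And>x. x \<in> p ` {\<alpha>..\<beta>} \<Longrightarrow> time_bound t0 t1 K x" by meson
  have K: "0 \<le> K" "\<And>s. s \<in> {\<alpha>..\<beta>} \<Longrightarrow> time_bound t0 t1 K (p s)"
    using K0(1) K0(2)[OF imageI] by auto
  have wcont: "continuous_on {\<alpha>..\<beta>} w" unfolding w_def by (intro continuous_intros abV \<eta>c \<tau>c)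
  have "\<exists>B\<ge>0. \<forall>s\<in>{\<alpha>..\<beta>}. \<bar>a (tt s) (p s) (v s) (v s)\<bar> \<le> B"
    by (rule continuous_on_compact_bound[OF compact_Icc abV(1)]) auto
  then obtain A0 where A0: "0 \<le> A0" "\<And>s. s \<in> {\<alpha>..\<beta>} \<Longrightarrow> \<bar>a (tt s) (p s) (v s) (v s)\<bar> \<le> A0" by meson
  have "\<exists>B\<ge>0. \<forall>s\<in>{\<alpha>..\<beta>}. \<bar>w s\<bar> \<le> B"
    by (rule continuous_on_compact_bound[OF compact_Icc wcont]) auto
  then obtain W0 where W0: "0 \<le> W0" "\<And>s. s \<in> {\<alpha>..\<beta>} \<Longrightarrow> \<bar>w s\<bar> \<le> W0" by meson
  have "\<exists>B\<ge>0. \<forall>s\<in>{\<alpha>..\<beta>}. \<bar>\<tau> s\<bar> \<le> B"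
    by (rule continuous_on_compact_bound[OF compact_Icc \<tau>c]) auto
  then obtain T0 where T0: "0 \<le> T0" "\<And>s. s \<in> {\<alpha>..\<beta>} \<Longrightarrow> \<bar>\<tau> s\<bar> \<le> T0" by meson
  define l where "l = \<beta> - \<alpha>"
  define d where "d = t1 - t0"
  have l: "0 < l" and d: "0 < d" using ab t by (auto simp: l_def d_def)
  \<comment> \<open>The summands bound the errors in the quadratic term, in \<open>b\<close>, in
    \<open>V\<close> at the shifted time, and from the speed of the new parameter.
    \<open>W0\<close>, \<open>A0\<close> and \<open>T0\<close> are bounds along the curve, so the
    total vanishes with \<open>\<epsilon>\<close>.\<close>
  define E where "E \<epsilon> = ((1 + K * (2 * \<epsilon> * l)) * (1 + \<epsilon> * l / d) - 1) * W0 + K * (2 * \<epsilon> * l) * (1 + A0)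
     + K * (2 * \<epsilon> * l) * T0 + K * (\<epsilon> * l / d * T0 + \<epsilon>)" for \<epsilon>
  have "isCont E 0" unfolding E_def using d by (intro continuous_intros) auto
  then have "(E \<longlongrightarrow> 0) (at 0)" by (simp add: isCont_def E_def)
  then have "\<forall>\<^sub>F \<epsilon> in at 0. E \<epsilon> < \<delta> / l" using order_tendstoD(2)[of E 0] \<delta> l by simp
  moreover have "((\<lambda>\<epsilon>. 2 * \<epsilon> * l) \<longlongrightarrow> 2 * 0 * l) (at 0)" by (intro tendsto_intros)
  then have "\<forall>\<^sub>F \<epsilon> in at 0. 2 * \<epsilon> * l < \<delta>" using order_tendstoD(2)[of _ "2 * 0 * l"] \<delta> by simp
  ultimately have "\<forall>\<^sub>F \<epsilon> in at 0. E \<epsilon> < \<delta> / l \<and> 2 * \<epsilon> * l < \<delta>" by eventually_elim simp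
  then have "\<forall>\<^sub>F \<epsilon> in at_right 0. E \<epsilon> < \<delta> / l \<and> 2 * \<epsilon> * l < \<delta> \<and> 0 < \<epsilon>"
    by (auto simp: eventually_at_filter elim: eventually_mono)
  then obtain \<epsilon> where \<epsilon>: "E \<epsilon> < \<delta> / l" "2 * \<epsilon> * l < \<delta>" "0 < \<epsilon>"
    using eventually_happens'[OF trivial_limit_at_right_real] by blast
  \<comment> \<open>The function \<open>tt s + \<epsilon> * (s - \<alpha>)\<close> increases by d +
    \<epsilon> l; this factor scales the increase back to d, so that \<open>\<theta>\<close> has the
    end values of the time.\<close>
  define \<kappa> where "\<kappa> = d / (d + \<epsilon> * l)"
  have el: "0 < \<epsilon> * l" using \<epsilon> l by simp
  have \<kappa>: "0 < \<kappa>" "\<kappa> \<le> 1" "1 / \<kappa> = 1 + \<epsilon> * l / d" "(1 - \<kappa>) \<le> \<epsilon> * l / d" "(1 - \<kappa>) * d \<le> \<epsilon> * l"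
  proof -
    have "0 < d + \<epsilon> * l" using d el by simp
    then show "0 < \<kappa>" "\<kappa> \<le> 1" "1 / \<kappa> = 1 + \<epsilon> * l / d" using d el by (auto simp: \<kappa>_def field_simps)
    have "1 - \<kappa> = \<epsilon> * l / (d + \<epsilon> * l)" using \<open>0 < d + \<epsilon> * l\<close> by (simp add: \<kappa>_def field_simps)
    also have "\<dots> \<le> \<epsilon> * l / d" using d el by (intro divide_left_mono) auto
    finally show "(1 - \<kappa>) \<le> \<epsilon> * l / d" .
    then show "(1 - \<kappa>) * d \<le> \<epsilon> * l" using d by (simp add: field_simps)
  qed
  define \<theta> where "\<theta> s = t0 + \<kappa> * (tt s - t0 + \<epsilon> * (s - \<alpha>))" for s
  define \<theta>' where "\<theta>' s = \<kappa> * (\<tau> s + \<epsilon>)" for s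
  have \<theta>_ends: "\<theta> \<alpha> = t0" "\<theta> \<beta> = t1"
  proof -
    show "\<theta> \<alpha> = t0" using t by (simp add: \<theta>_def tt_def)
    have "\<theta> \<beta> = t0 + \<kappa> * (d + \<epsilon> * l)" using t by (simp add: \<theta>_def tt_def d_def l_def)
    also have "\<dots> = t1" using d el by (simp add: \<kappa>_def d_def)
    finally show "\<theta> \<beta> = t1" .
  qed
  have \<theta>_d: "(\<theta> has_vector_derivative \<theta>' s) (at s within {\<alpha>..\<beta>})" if "s \<in> {\<alpha>..\<beta>}" for s
    using tt_d[OF that] unfolding \<theta>_def \<theta>'_def has_real_derivative_iff_has_vector_derivative[symmetric]
    by (auto intro!: derivative_eq_intros)
  have \<theta>'0: "0 < \<theta>' s" if "s \<in> {\<alpha>..\<beta>}" for s using cau(1)[OF that] \<kappa> \<epsilon> by (simp add: \<theta>'_def)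
  have \<theta>'c: "continuous_on {\<alpha>..\<beta>} \<theta>'" unfolding \<theta>'_def by (intro continuous_intros \<tau>c)
  obtain g where g: "\<And>s. s \<in> {\<alpha>..\<beta>} \<Longrightarrow> \<theta> s \<in> {t0..t1}" "\<And>s. s \<in> {\<alpha>..\<beta>} \<Longrightarrow> g (\<theta> s) = s"
    "\<And>z. z \<in> {t0..t1} \<Longrightarrow> g z \<in> {\<alpha>..\<beta>}" "\<And>z. z \<in> {t0..t1} \<Longrightarrow> \<theta> (g z) = z"
    "\<And>z. z \<in> {t0..t1} \<Longrightarrow> (g has_vector_derivative 1 / \<theta>' (g z)) (at z within {t0..t1})"
    "continuous_on {t0..t1} (\<lambda>z. 1 / \<theta>' (g z))"
    using C1_inverse_Icc[OF ab \<theta>_d \<theta>'0 \<theta>'c, unfolded \<theta>_ends] by blast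
  have near: "\<bar>\<theta> s - tt s\<bar> \<le> 2 * \<epsilon> * l" if s: "s \<in> {\<alpha>..\<beta>}" for s
  proof -
    have "\<theta> s - tt s = \<kappa> * (\<epsilon> * (s - \<alpha>)) - (1 - \<kappa>) * (tt s - t0)" by (simp add: \<theta>_def algebra_simps)
    moreover have "0 \<le> \<kappa> * (\<epsilon> * (s - \<alpha>))" using \<kappa> \<epsilon> s by simp
    moreover have "\<kappa> * (\<epsilon> * (s - \<alpha>)) \<le> 1 * (\<epsilon> * l)" using \<kappa> \<epsilon> s by (intro mult_mono) (auto simp: l_def)
    moreover have "0 \<le> (1 - \<kappa>) * (tt s - t0)" using \<kappa> tI[OF s] by simp
    moreover have "(1 - \<kappa>) * (tt s - t0) \<le> (1 - \<kappa>) * d" using \<kappa> tI[OF s] by (intro mult_left_mono) (auto simp: d_def)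
    ultimately show ?thesis using \<kappa>(5) by linarith
  qed
  \<comment> \<open>On the left is the Lagrangian of the curve parametrised by
    \<open>\<theta>\<close>, multiplied by the derivative of \<open>\<theta>\<close>.\<close>
  have key: "a (\<theta> s) (p s) (v s) (v s) / (2 * \<theta>' s) + b (\<theta> s) (p s) (v s) - V (\<theta> s) (p s) * \<theta>' s \<le> \<eta> s + \<delta> / l"
    if s: "s \<in> {\<alpha>..\<beta>}" for s
  proof -
    define dd where "dd = 2 * \<epsilon> * l"
    have dd0: "0 \<le> dd" using el by (simp add: dd_def)
    note tb = time_boundD[OF K(2)[OF s] vT[OF s] g(1)[OF s] tI[OF s]]
    have n: "\<bar>\<theta> s - tt s\<bar> \<le> dd" using near[OF s] by (simp add: dd_def)
    have Kn: "K * \<bar>\<theta> s - tt s\<bar> \<le> K * dd" using n K by (intro mult_left_mono) auto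
    have a0: "0 \<le> a (tt s) (p s) (v s) (v s)" by (rule a_nonneg[OF ttT[OF s] vT[OF s]])
    have aA: "a (tt s) (p s) (v s) (v s) \<le> A0" using A0(2)[OF s] by simp
    have \<tau>0: "0 \<le> \<tau> s" "\<tau> s \<le> T0" and w0: "0 \<le> w s" "w s \<le> W0"
      using cau[OF s] T0(2)[OF s] W0(2)[OF s] by auto
    have "a (\<theta> s) (p s) (v s) (v s) \<le> (1 + K * dd) * a (tt s) (p s) (v s) (v s)"
      using tb(1) Kn a0 by (meson add_left_mono mult_right_mono order_trans)
    also have "\<dots> \<le> (1 + K * dd) * (2 * \<tau> s * w s)"
      using cau(3)[OF s] K dd0 by (intro mult_left_mono) auto
    \<comment> \<open>The sum \<tau> + \<epsilon> is also a factor of the derivative of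
      \<open>\<theta>\<close> and cancels in the quotient. Thus nothing is lost where \<tau> is
      small or zero.\<close>
    also have "\<dots> \<le> (1 + K * dd) * (2 * (\<tau> s + \<epsilon>) * w s)"
      using w0 \<epsilon> K dd0 by (intro mult_left_mono mult_right_mono) auto
    finally have "a (\<theta> s) (p s) (v s) (v s) / (2 * \<theta>' s) \<le> (1 + K * dd) * (2 * (\<tau> s + \<epsilon>) * w s) / (2 * \<theta>' s)"
      using \<theta>'0[OF s] by (intro divide_right_mono) auto
    also have "\<dots> = (1 + K * dd) * (1 / \<kappa>) * w s"
      using \<kappa> \<epsilon> \<tau>0 by (simp add: \<theta>'_def divide_simps) 
    also have "\<dots> = w s + ((1 + K * dd) * (1 + \<epsilon> * l / d) - 1) * w s" by (simp add: \<kappa> algebra_simps)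
    also have "\<dots> \<le> w s + ((1 + K * dd) * (1 + \<epsilon> * l / d) - 1) * W0"
    proof (intro add_left_mono mult_left_mono w0)
      have "1 * 1 \<le> (1 + K * dd) * (1 + \<epsilon> * l / d)"
        using K dd0 el d by (intro mult_mono) auto
      then show "0 \<le> (1 + K * dd) * (1 + \<epsilon> * l / d) - 1" by simp
    qed
    finally have 1: "a (\<theta> s) (p s) (v s) (v s) / (2 * \<theta>' s) \<le> w s + ((1 + K * dd) * (1 + \<epsilon> * l / d) - 1) * W0" .
    have "K * \<bar>\<theta> s - tt s\<bar> * (1 + a (tt s) (p s) (v s) (v s)) \<le> K * dd * (1 + A0)"
      by (rule mult_mono[OF Kn]) (use aA a0 K(1) dd0 in auto)
    then have 2: "b (\<theta> s) (p s) (v s) \<le> b (tt s) (p s) (v s) + K * dd * (1 + A0)" using tb(2) by linarith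
    have "(V (tt s) (p s) - V (\<theta> s) (p s)) * \<tau> s \<le> K * dd * T0"
      using tb(3) Kn K dd0 \<tau>0 by (intro mult_mono) auto
    moreover have "V (\<theta> s) (p s) * (\<tau> s - \<theta>' s) \<le> K * (\<epsilon> * l / d * T0 + \<epsilon>)"
    proof -
      have "\<tau> s - \<theta>' s = (1 - \<kappa>) * \<tau> s - \<kappa> * \<epsilon>" by (simp add: \<theta>'_def algebra_simps)
      moreover have "(1 - \<kappa>) * \<tau> s \<le> \<epsilon> * l / d * T0" using \<kappa> \<tau>0 el d by (intro mult_mono) auto
      moreover have "0 \<le> (1 - \<kappa>) * \<tau> s" using \<kappa> \<tau>0 by simp
      moreover have "\<kappa> * \<epsilon> \<le> \<epsilon>" "0 \<le> \<kappa> * \<epsilon>" using \<kappa> \<epsilon> by auto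
      ultimately have "\<bar>\<tau> s - \<theta>' s\<bar> \<le> \<epsilon> * l / d * T0 + \<epsilon>" by linarith
      then have "\<bar>V (\<theta> s) (p s) * (\<tau> s - \<theta>' s)\<bar> \<le> K * (\<epsilon> * l / d * T0 + \<epsilon>)"
        unfolding abs_mult using tb(4) K by (intro mult_mono) auto
      then show ?thesis by linarith
    qed
    ultimately have 3: "- V (\<theta> s) (p s) * \<theta>' s \<le> - V (tt s) (p s) * \<tau> s + K * dd * T0 + K * (\<epsilon> * l / d * T0 + \<epsilon>)"
      by (simp add: algebra_simps)
    have "w s + b (tt s) (p s) (v s) - V (tt s) (p s) * \<tau> s = \<eta> s" by (simp add: w_def)
    moreover have "E \<epsilon> = ((1 + K * dd) * (1 + \<epsilon> * l / d) - 1) * W0 + K * dd * (1 + A0) + K * dd * T0 + K * (\<epsilon> * l / d * T0 + \<epsilon>)"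
      by (simp add: E_def dd_def)
    ultimately show ?thesis using 1 2 3 \<epsilon>(1) by linarith
  qed
  define q where "q z = p (g z)" for z
  note r = C1_curve_reparam[OF ab t(3) pC g(3) g(5) g(6)]
  have qC: "C1_curve A t0 t1 q" unfolding q_def by (rule r(1))
  have qv: "velocity A t0 t1 q z = (\<lambda>c. (1 / \<theta>' (g z)) *\<^sub>R v (g z) c)" if "z \<in> {t0..t1}" for z
    unfolding q_def v_def by (rule r(2)) (use that in auto)
  \<comment> \<open>The height is raised at the rate \<delta> / l, which pays for the error in
    \<open>key\<close> and amounts to \<open>\<delta>\<close> over the whole interval.\<close>
  define Y where "Y z = y (g z) + \<delta> / l * (g z - \<alpha>)" for z
  define Y' where "Y' z = (\<eta> (g z) + \<delta> / l) * (1 / \<theta>' (g z))" for z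
  have Yd: "(Y has_vector_derivative Y' z) (at z within {t0..t1})" if z: "z \<in> {t0..t1}" for z
  proof -
    have "g ` {t0..t1} \<subseteq> {\<alpha>..\<beta>}" using g(3) by blast
    from vector_diff_chain_within[OF g(5)[OF z] has_vector_derivative_within_subset[OF y_d[OF g(3)[OF z]] this]]
    have "((\<lambda>z. y (g z)) has_vector_derivative 1 / \<theta>' (g z) * \<eta> (g z)) (at z within {t0..t1})" by (simp add: o_def)
    then show ?thesis
      using g(5)[OF z] l unfolding Y_def Y'_def has_real_derivative_iff_has_vector_derivative[symmetric]
      by (auto intro!: derivative_eq_intros simp: algebra_simps)
  qed
  let ?L = "\<lambda>z. Lagrangian z (q z) (velocity A t0 t1 q z)"
  have LY: "?L z \<le> Y' z" if z: "z \<in> {t0..t1}" for z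
  proof -
    define s where "s = g z"
    have s: "s \<in> {\<alpha>..\<beta>}" "\<theta> s = z" using g(3,4)[OF z] by (auto simp: s_def)
    note v = vT[OF s(1)]
    have zT: "z \<in> T" using z t0T by auto
    have th: "0 < \<theta>' s" by (rule \<theta>'0[OF s(1)])
    have "?L z = (1 / \<theta>' s)\<^sup>2 * a z (p s) (v s) (v s) / 2 + 1 / \<theta>' s * b z (p s) (v s) - V z (p s)"
      using a_scale_b_scale[OF zT v, of "1 / \<theta>' s"] qv[OF z] by (simp add: Lagrangian_def q_def s_def)
    also have "\<dots> = (a z (p s) (v s) (v s) / (2 * \<theta>' s) + b z (p s) (v s) - V z (p s) * \<theta>' s) * (1 / \<theta>' s)"
      using th by (simp add: field_simps power2_eq_square)
    also have "\<dots> \<le> (\<eta> s + \<delta> / l) * (1 / \<theta>' s)"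
      using key[OF s(1)] th s(2) by (intro mult_right_mono) auto
    finally show ?thesis by (simp add: Y'_def s_def)
  qed
  note Lc = Lagrangian_continuous[OF t(3) qC t0T]
  have int: "integral {z..z'} ?L \<le> Y z' - Y z" if "t0 \<le> z" "z \<le> z'" "z' \<le> t1" for z z'
  proof (rule has_integral_le)
    show "(?L has_integral integral {z..z'} ?L) {z..z'}"
      using that by (intro integrable_integral integrable_continuous_interval continuous_on_subset[OF Lc]) auto
    show "(Y' has_integral Y z' - Y z) {z..z'}"
      using that by (intro fundamental_theorem_of_calculus) (auto intro!: has_vector_derivative_within_subset[OF Yd])
    show "?L x \<le> Y' x" if "x \<in> {z..z'}" for x using LY[of x] that \<open>t0 \<le> z\<close> \<open>z' \<le> t1\<close> by auto
  qed
  have g_ends: "g t0 = \<alpha>" "g t1 = \<beta>" using g(2)[of \<alpha>] g(2)[of \<beta>] ab \<theta>_ends by auto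
  show ?thesis
  proof (rule that[OF qC])
    show "q t0 = fst (snd (\<gamma> \<alpha>))" "q t1 = fst (snd (\<gamma> \<beta>))" by (auto simp: q_def g_ends p_def)
    fix s assume s: "s \<in> {\<alpha>..\<beta>}"
    have dl: "0 \<le> \<delta> / l * (s - \<alpha>)" "\<delta> / l * (s - \<alpha>) \<le> \<delta>" using s \<delta> l by (auto simp: l_def field_simps)
    have Ys: "Y (\<theta> s) = y s + \<delta> / l * (s - \<alpha>)" by (simp add: Y_def g(2)[OF s])
    have Y0: "Y t0 = y \<alpha>" "Y t1 = y \<beta> + \<delta>" using l by (auto simp: Y_def g_ends l_def)
    have "integral {t0..\<theta> s} ?L \<le> y s - y \<alpha> + \<delta>" "integral {\<theta> s..t1} ?L \<le> y \<beta> - y s + \<delta>"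
      using int[of t0 "\<theta> s"] int[of "\<theta> s" t1] g(1)[OF s] Ys Y0 dl by auto
    moreover have "\<bar>\<theta> s - fst (\<gamma> s)\<bar> \<le> \<delta>" using near[OF s] \<epsilon>(2) by (simp add: tt_def)
    moreover have "q (\<theta> s) = fst (snd (\<gamma> s))" by (simp add: q_def g(2)[OF s] p_def)
    ultimately show "\<exists>z\<in>{t0..t1}. \<bar>z - fst (\<gamma> s)\<bar> \<le> \<delta> \<and> q z = fst (snd (\<gamma> s)) \<and>
      integral {t0..z} ?L \<le> snd (snd (\<gamma> s)) - snd (snd (\<gamma> \<alpha>)) + \<delta> \<and>
      integral {z..t1} ?L \<le> snd (snd (\<gamma> \<beta>)) - snd (snd (\<gamma> s)) + \<delta>"
      using g(1)[OF s] by (auto simp: y_def)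
  qed
qed

end

section \<open>Compactness of curves of bounded action\<close>

lemma affine_integral:
  fixes f :: "real \<Rightarrow> real"
  assumes "0 \<le> h" "continuous_on {\<sigma>..\<sigma> + h} f"
  shows "h * integral {0..1} (\<lambda>\<tau>. f (\<sigma> + h * \<tau>)) = integral {\<sigma>..\<sigma> + h} f"
proof -
  define F where "F z = integral {\<sigma>..z} f" for z
  have im: "(\<lambda>\<tau>. \<sigma> + h * \<tau>) ` {0..1} \<subseteq> {\<sigma>..\<sigma> + h}" using assms(1) by (auto simp: mult_left_le)
  have "((\<lambda>\<tau>. F (\<sigma> + h * \<tau>)) has_vector_derivative h * f (\<sigma> + h * \<tau>)) (at \<tau> within {0..1})" if "\<tau> \<in> {0..1}" for \<tau>
  proof -
    have "((\<lambda>\<tau>. \<sigma> + h * \<tau>) has_vector_derivative h) (at \<tau> within {0..1})"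
      by (auto intro!: derivative_eq_intros)
    moreover have "\<sigma> + h * \<tau> \<in> {\<sigma>..\<sigma> + h}" using im that by blast
    then have "(F has_vector_derivative f (\<sigma> + h * \<tau>)) (at (\<sigma> + h * \<tau>) within (\<lambda>\<tau>. \<sigma> + h * \<tau>) ` {0..1})"
      unfolding F_def using integral_has_vector_derivative[OF assms(2)] im
      by (blast intro: has_vector_derivative_within_subset)
    ultimately show ?thesis using vector_diff_chain_within by (fastforce simp: o_def)
  qed
  then have "((\<lambda>\<tau>. h * f (\<sigma> + h * \<tau>)) has_integral F (\<sigma> + h * 1) - F (\<sigma> + h * 0)) {0..1}"
    by (intro fundamental_theorem_of_calculus) auto
  then have "integral {0..1} (\<lambda>\<tau>. h * f (\<sigma> + h * \<tau>)) = F (\<sigma> + h * 1) - F (\<sigma> + h * 0)"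
    by (rule integral_unique)
  then show ?thesis by (simp add: F_def)
qed

text \<open>Finitely many successive extractions; convergence obtained earlier survives by
  \<open>sub\<close>.\<close>

lemma common_subsequence:
  fixes conv :: "nat \<Rightarrow> (nat \<Rightarrow> nat) \<Rightarrow> bool"
  assumes ex: "\<And>i (r :: nat \<Rightarrow> nat). strict_mono r \<Longrightarrow> \<exists>r' :: nat \<Rightarrow> nat. strict_mono r' \<and> conv i (r \<circ> r')"
    and sub: "\<And>i (r :: nat \<Rightarrow> nat) (r' :: nat \<Rightarrow> nat). conv i r \<Longrightarrow> strict_mono r' \<Longrightarrow> conv i (r \<circ> r')"
  shows "\<exists>r. strict_mono r \<and> (\<forall>i<k. conv i r)"
proof (induction k)
  case 0
  show ?case by (intro exI[of _ id]) (simp add: strict_mono_def)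
next
  case (Suc k)
  then obtain r where r: "strict_mono r" "\<forall>i<k. conv i r" by blast
  obtain r' where r': "strict_mono r'" "conv k (r \<circ> r')" using ex[OF r(1)] by blast
  have "\<forall>i<Suc k. conv i (r \<circ> r')" using sub r(2) r' by (auto simp: less_Suc_eq)
  moreover have "strict_mono (r \<circ> r')" using r(1) r'(1) by (rule strict_mono_o)
  ultimately show ?case by blast
qed

context generalized_gravitational_wave
begin

section \<open>Sequential compactness and an exhaustion of \<open>Q\<close>\<close>

lemma tendsto_chart:
  assumes "c \<in> A" "p \<in> fst c" "(f \<longlongrightarrow> p) F"
  shows "((\<lambda>n. snd c (f n)) \<longlongrightarrow> snd c p) F"
proof -
  have "isCont (snd c) p"
    using continuous_on_chart[OF assms(1)] open_chart[OF assms(1)] assms(2) by (simp add: continuous_on_eq_continuous_at)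
  then show ?thesis using assms(3) by (rule isCont_tendsto_compose)
qed

lemma chart_tendsto:
  assumes c: "c \<in> A" and p: "p \<in> fst c" and f: "\<forall>\<^sub>F n in F. f n \<in> fst c"
    and x: "((\<lambda>n. snd c (f n)) \<longlongrightarrow> snd c p) F"
  shows "(f \<longlongrightarrow> p) F"
proof -
  have "isCont (chart_inv c) (snd c p)"
    using continuous_on_chart_inv[OF c] open_chart_image[OF c] p by (simp add: continuous_on_eq_continuous_at)
  from isCont_tendsto_compose[OF this x] have "((\<lambda>n. chart_inv c (snd c (f n))) \<longlongrightarrow> p) F"
    using c p by simp
  then show ?thesis by (rule Lim_transform_eventually) (use f c in \<open>auto elim: eventually_mono\<close>)
qed

text \<open>\<open>Q\<close> is only a topological space, so a cluster point comes from a covering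
  argument. Balls of radius 1/(n + 1) in a chart around it then select the subsequence.\<close>

lemma compact_subsequence:
  fixes f :: "nat \<Rightarrow> 'q"
  assumes K: "compact K" and f: "\<And>n. f n \<in> K"
  obtains p \<nu> where "p \<in> K" "strict_mono \<nu>" "(f \<circ> \<nu>) \<longlonglongrightarrow> p"
proof -
  \<comment> \<open>Otherwise each point of \<open>K\<close> has a neighbourhood that the sequence
    eventually avoids, and finitely many of these cover \<open>K\<close>.\<close>
  have "\<exists>p\<in>K. \<forall>U. open U \<and> p \<in> U \<longrightarrow> (\<exists>\<^sub>F n in sequentially. f n \<in> U)"
  proof (rule ccontr)
    assume "\<not> ?thesis"
    then have "\<forall>p\<in>K. \<exists>U. open U \<and> p \<in> U \<and> (\<forall>\<^sub>F n in sequentially. f n \<notin> U)"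
      by (auto simp: frequently_def)
    then obtain U where U: "\<And>p. p \<in> K \<Longrightarrow> open (U p)" "\<And>p. p \<in> K \<Longrightarrow> p \<in> U p"
      "\<And>p. p \<in> K \<Longrightarrow> \<forall>\<^sub>F n in sequentially. f n \<notin> U p" by metis
    have "K \<subseteq> (\<Union>p\<in>K. U p)" using U(2) by blast
    from compactE_image[OF K U(1) this] obtain S where S: "S \<subseteq> K" "finite S" "K \<subseteq> (\<Union>p\<in>S. U p)" by blast
    have "\<forall>\<^sub>F n in sequentially. \<forall>p\<in>S. f n \<notin> U p" using S U(3) by (intro eventually_ball_finite) auto
    then obtain n where "\<forall>p\<in>S. f n \<notin> U p" using eventually_happens'[OF sequentially_bot] by blast
    then show False using S(3) f[of n] by blast
  qed
  then obtain p where p: "p \<in> K" "\<And>U. open U \<Longrightarrow> p \<in> U \<Longrightarrow> \<exists>\<^sub>F n in sequentially. f n \<in> U" by blast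
  obtain c where c: "c \<in> A" "p \<in> fst c" by (rule chart_exists)
  define B where "B n = {q \<in> fst c. snd c q \<in> ball (snd c p) (inverse (real (Suc n)))}" for n
  have ex: "\<exists>m>k. f m \<in> B n" for n k
  proof -
    have "\<exists>\<^sub>F m in sequentially. f m \<in> B n"
      unfolding B_def using c by (intro p(2) open_chart_ball) auto
    then obtain m where "Suc k \<le> m" "f m \<in> B n" unfolding frequently_sequentially by blast
    then show ?thesis by (intro exI[of _ m]) simp
  qed
  have "\<exists>\<nu>. \<forall>n. f (\<nu> n) \<in> B n \<and> \<nu> n < \<nu> (Suc n)"
    by (rule dependent_nat_choice) (use ex in blast)+
  then obtain \<nu> where \<nu>': "\<And>n. f (\<nu> n) \<in> B n" "\<And>n. \<nu> n < \<nu> (Suc n)" by blast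
  have \<nu>: "\<And>n. f (\<nu> n) \<in> {q \<in> fst c. snd c q \<in> ball (snd c p) (inverse (real (Suc n)))}" "\<And>n. \<nu> n < \<nu> (Suc n)"
    using \<nu>' unfolding B_def by blast+
  have "(\<lambda>n. dist (snd c p) (snd c ((f \<circ> \<nu>) n))) \<longlonglongrightarrow> 0"
    by (rule Lim_null_comparison[OF _ LIMSEQ_inverse_real_of_nat]) (use \<nu>(1) in \<open>auto simp: less_imp_le\<close>)
  then have "(\<lambda>n. snd c ((f \<circ> \<nu>) n)) \<longlonglongrightarrow> snd c p" by (subst tendsto_dist_iff) (simp add: dist_commute)
  then have "(f \<circ> \<nu>) \<longlonglongrightarrow> p" by (intro chart_tendsto[OF c]) (use \<nu>(1) in auto)
  then show ?thesis using p(1) \<nu>(2) by (intro that[of p \<nu>]) (auto simp: strict_mono_Suc_iff)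
qed

text \<open>The classical argument that a connected paracompact manifold is a countable union of
  compact sets: a compact set meets only finitely many members of a locally finite cover by
  relatively compact open sets.\<close>

lemma exhaustion:
  obtains K :: "nat \<Rightarrow> 'q set" where "\<And>n. compact (K n)" "\<And>n. K n \<subseteq> interior (K (Suc n))" "(\<Union>n. K n) = UNIV"
proof -
  define \<U> where "\<U> = {U :: 'q set. open U \<and> (\<exists>C. compact C \<and> U \<subseteq> C)}"
  have "\<exists>U\<in>\<U>. q \<in> U" for q
  proof -
    obtain c where c: "c \<in> A" "q \<in> fst c" by (rule chart_exists)
    obtain \<rho> where \<rho>: "0 < \<rho>" "cball (snd c q) \<rho> \<subseteq> snd c ` fst c"
      using open_chart_image[OF c(1)] c(2) by (metis imageI open_contains_cball)
    let ?U = "{p \<in> fst c. snd c p \<in> ball (snd c q) \<rho>}"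
    have "?U \<subseteq> {p \<in> fst c. snd c p \<in> cball (snd c q) \<rho>}" by auto
    then have "?U \<in> \<U>" using open_chart_ball[OF c(1)] compact_chart_cball[OF c(1) \<rho>(2)] by (auto simp: \<U>_def)
    moreover have "q \<in> ?U" using c \<rho> by simp
    ultimately show ?thesis by (rule bexI[rotated])
  qed
  then have "(\<forall>U\<in>\<U>. openin euclidean U) \<and> \<Union>\<U> = topspace (euclidean :: 'q topology)" by (auto simp: \<U>_def)
  from Q_paracompact[unfolded paracompact_space_def, rule_format, OF this]
  obtain \<V> :: "'q set set" where \<V>: "(\<forall>V\<in>\<V>. openin euclidean V \<and> (\<exists>U\<in>\<U>. V \<subseteq> U)) \<and>
      \<Union>\<V> = topspace euclidean \<and> locally_finite_in euclidean \<V>" by (rule exE)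
  have V: "\<And>V. V \<in> \<V> \<Longrightarrow> open V" "\<And>V. V \<in> \<V> \<Longrightarrow> \<exists>U\<in>\<U>. V \<subseteq> U" "\<Union>\<V> = UNIV"
    and lf: "locally_finite_in euclidean \<V>"
    using \<V> by simp_all
  have cV: "compact (closure V)" if V': "V \<in> \<V>" for V
  proof -
    obtain C where C: "compact C" "V \<subseteq> C" using V(2)[OF V'] by (auto simp: \<U>_def)
    then have "closure V \<subseteq> C" by (intro closure_minimal compact_imp_closed)
    then have "closure V = C \<inter> closure V" by blast
    then show ?thesis using compact_Int_closed[OF C(1) closed_closure] by metis
  qed
  have fin: "finite {V \<in> \<V>. V \<inter> C \<noteq> {}}" if C: "compact C" for C
  proof -
    have "\<forall>x\<in>C. \<exists>N. open N \<and> x \<in> N \<and> finite {V \<in> \<V>. V \<inter> N \<noteq> {}}"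
      using lf by (auto simp: locally_finite_in_def)
    from bchoice[OF this] obtain O' where O: "\<And>x. x \<in> C \<Longrightarrow> open (O' x)" "\<And>x. x \<in> C \<Longrightarrow> x \<in> O' x"
      "\<And>x. x \<in> C \<Longrightarrow> finite {V \<in> \<V>. V \<inter> O' x \<noteq> {}}" by auto
    have "C \<subseteq> (\<Union>x\<in>C. O' x)" using O(2) by blast
    from compactE_image[OF C O(1) this] obtain S where S: "S \<subseteq> C" "finite S" "C \<subseteq> (\<Union>x\<in>S. O' x)" by blast
    have "{V \<in> \<V>. V \<inter> C \<noteq> {}} \<subseteq> (\<Union>x\<in>S. {V \<in> \<V>. V \<inter> O' x \<noteq> {}})" using S(3) by blast
    moreover have "finite (\<Union>x\<in>S. {V \<in> \<V>. V \<inter> O' x \<noteq> {}})" using S O(3) by blast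
    ultimately show ?thesis by (rule finite_subset)
  qed
  \<comment> \<open>Adding the closures of all members that meet \<open>C\<close> gives a compact
    set whose interior contains \<open>C\<close>.\<close>
  define step where "step C = (\<Union>V\<in>{V \<in> \<V>. V \<inter> C \<noteq> {}}. closure V)" for C
  have step_compact: "compact (step C)" if "compact C" for C
    unfolding step_def using fin[OF that] cV by (intro compact_UN) auto
  have step_int: "C \<subseteq> interior (step C)" for C
  proof -
    have "(\<Union>V\<in>{V \<in> \<V>. V \<inter> C \<noteq> {}}. V) \<subseteq> interior (step C)"
      using V(1) by (intro interior_maximal) (auto simp: step_def intro: subsetD[OF closure_subset])
    moreover have "C \<subseteq> (\<Union>V\<in>{V \<in> \<V>. V \<inter> C \<noteq> {}}. V)"
    proof
      fix x assume x: "x \<in> C"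
      have "x \<in> \<Union>\<V>" using V(3) by simp
      then show "x \<in> (\<Union>V\<in>{V \<in> \<V>. V \<inter> C \<noteq> {}}. V)" using x by blast
    qed
    ultimately show ?thesis by blast
  qed
  \<comment> \<open>The starting point \<open>undefined\<close> is an arbitrary point of
    \<open>Q\<close>.\<close>
  define K where "K n = (step ^^ n) {undefined}" for n
  have K: "compact (K n)" for n by (induction n) (auto simp: K_def intro: step_compact)
  have Kint: "K n \<subseteq> interior (K (Suc n))" for n using step_int[of "K n"] by (simp add: K_def)
  define W where "W = (\<Union>n. K n)"
  have "open W"
  proof -
    have "W = (\<Union>n. interior (K n))"
      unfolding W_def using Kint interior_subset by blast
    then show ?thesis by auto
  qed
  \<comment> \<open>A member of the cover that meets \<open>K n\<close> lies in the next set, hence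
    in \<open>W\<close>. So every member around a point outside \<open>W\<close> is disjoint from
    \<open>W\<close>.\<close>
  moreover have "open (- W)"
  proof -
    have "- W = (\<Union>V\<in>{V \<in> \<V>. V \<inter> W = {}}. V)"
    proof (intro equalityI subsetI)
      fix x assume x: "x \<in> - W"
      have "x \<in> \<Union>\<V>" using V(3) by simp
      then obtain V where V': "V \<in> \<V>" "x \<in> V" by (rule UnionE)
      have "V \<inter> W = {}"
      proof (rule ccontr)
        assume "V \<inter> W \<noteq> {}"
        then obtain n where "V \<inter> K n \<noteq> {}" by (auto simp: W_def)
        then have "closure V \<subseteq> step (K n)" using V' by (auto simp: step_def)
        then have "x \<in> K (Suc n)" using V' closure_subset by (auto simp: K_def)
        then show False using x by (auto simp: W_def)
      qed
      then show "x \<in> (\<Union>V\<in>{V \<in> \<V>. V \<inter> W = {}}. V)" using V' by blast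
    qed blast
    then show ?thesis using V(1) by auto
  qed
  moreover have "undefined \<in> W" unfolding W_def by (rule UN_I[of 0]) (auto simp: K_def)
  ultimately have "- W = {}" using Q_connected unfolding connected_def by blast
  then have "(\<Union>n. K n) = UNIV" by (auto simp: W_def)
  with K Kint show ?thesis by (rule that)
qed

text \<open>If no compact set were large enough, one could choose for each n a curve leaving the
  n-th set of the exhaustion. A compact set containing all these curves would lie in one set of the
  exhaustion.\<close>

lemma coercive_uniform:
  assumes "coercive e0 e1"
  obtains K where "compact K"
    "\<And>\<gamma>. \<gamma> \<in> C1_curves_between e0 e1 \<Longrightarrow> action e0 e1 \<gamma> \<le> B \<Longrightarrow> \<gamma> ` {fst e0..fst e1} \<subseteq> K"
proof (rule ccontr)
  assume "\<not> thesis"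
  then have no: "\<exists>\<gamma>. \<gamma> \<in> C1_curves_between e0 e1 \<and> action e0 e1 \<gamma> \<le> B \<and> \<not> \<gamma> ` {fst e0..fst e1} \<subseteq> K" if "compact K" for K
    using that \<open>\<And>K. \<lbrakk>compact K; \<And>\<gamma>. \<lbrakk>\<gamma> \<in> C1_curves_between e0 e1; action e0 e1 \<gamma> \<le> B\<rbrakk> \<Longrightarrow> \<gamma> ` {fst e0..fst e1} \<subseteq> K\<rbrakk> \<Longrightarrow> thesis\<close>
    by blast
  obtain K :: "nat \<Rightarrow> 'q set" where K: "\<And>n. compact (K n)" "\<And>n. K n \<subseteq> interior (K (Suc n))" "(\<Union>n. K n) = UNIV"
    by (rule exhaustion) blast
  have "\<forall>n. \<exists>\<gamma>. \<gamma> \<in> C1_curves_between e0 e1 \<and> action e0 e1 \<gamma> \<le> B \<and> \<not> \<gamma> ` {fst e0..fst e1} \<subseteq> K n"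
    using no K(1) by blast
  then obtain \<gamma> where \<gamma>: "\<And>n. \<gamma> n \<in> C1_curves_between e0 e1" "\<And>n. action e0 e1 (\<gamma> n) \<le> B"
    "\<And>n. \<not> \<gamma> n ` {fst e0..fst e1} \<subseteq> K n" by metis
  then have "(\<forall>n. \<gamma> n \<in> C1_curves_between e0 e1) \<and> (\<exists>B. \<forall>n. action e0 e1 (\<gamma> n) \<le> B)" by blast
  from assms[unfolded coercive_def, rule_format, OF this]
  obtain C where "compact C \<and> (\<forall>n. \<gamma> n ` {fst e0..fst e1} \<subseteq> C)" by (rule exE)
  then have C: "compact C" "\<And>n. \<gamma> n ` {fst e0..fst e1} \<subseteq> C" by simp_all
  have mono: "K m \<subseteq> K n" if "m \<le> n" for m n
    using that by (rule lift_Suc_mono_le[rotated]) (use K(2) interior_subset in blast)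
  have "C \<subseteq> (\<Union>n\<in>UNIV. interior (K n))"
  proof
    fix x
    obtain n where "x \<in> K n" using K(3) by (metis UNIV_I UN_E)
    then have "x \<in> interior (K (Suc n))" using K(2) by (rule subsetD[rotated])
    then show "x \<in> (\<Union>n\<in>UNIV. interior (K n))" by (rule UN_I[OF UNIV_I])
  qed
  from compactE_image[OF C(1) _ this] obtain S where S: "finite S" "C \<subseteq> (\<Union>n\<in>S. interior (K n))" by auto
  have "C \<subseteq> K (Max (insert 0 S))"
  proof
    fix x assume "x \<in> C"
    then obtain n where n: "n \<in> S" "x \<in> K n" using S(2) interior_subset by blast
    then show "x \<in> K (Max (insert 0 S))" using mono[of n "Max (insert 0 S)"] S(1) by auto
  qed
  then show False using C(2) \<gamma>(3) by blast
qed

section \<open>Equicontinuity from bounded action\<close>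

text \<open>All subarcs are included: the Lagrangian may be negative, so a bound for the total
  action does not pass to the parts by itself.\<close>

definition bounded_action :: "real \<Rightarrow> real \<Rightarrow> real \<Rightarrow> (real \<Rightarrow> 'q) \<Rightarrow> bool" where
  "bounded_action t0 t1 B \<gamma> \<longleftrightarrow> C1_curve A t0 t1 \<gamma> \<and>
     (\<forall>s s'. t0 \<le> s \<and> s \<le> s' \<and> s' \<le> t1 \<longrightarrow>
        integral {s..s'} (\<lambda>t. Lagrangian t (\<gamma> t) (velocity A t0 t1 \<gamma> t)) \<le> B)"

text \<open>The speed is at most l times its square plus 1 / (4 l), and the square is bounded by the
  Lagrangian. Taking \<open>l\<close> proportional to \<open>\<epsilon>\<close> and then a short
  duration makes both contributions small.\<close>

lemma chart_displacement:
  assumes t01: "t0 < t1" and T: "{t0..t1} \<subseteq> T" and c: "c \<in> A"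
    and box: "lagrangian_box (coord_form c) DG t0 t1 xc \<rho> C k"
    and \<epsilon>: "0 < \<epsilon>" and B: "0 \<le> B"
  obtains h where "0 < h" "\<And>\<gamma> s s'. bounded_action t0 t1 B \<gamma> \<Longrightarrow> t0 \<le> s \<Longrightarrow> s \<le> s' \<Longrightarrow> s' \<le> t1 \<Longrightarrow>
    s' - s \<le> h \<Longrightarrow> (\<And>\<sigma>. \<sigma> \<in> {s..s'} \<Longrightarrow> \<gamma> \<sigma> \<in> fst c \<and> snd c (\<gamma> \<sigma>) \<in> cball xc \<rho>) \<Longrightarrow>
    norm (snd c (\<gamma> s') - snd c (\<gamma> s)) \<le> \<epsilon>"
proof -
  interpret lagrangian_box "coord_form c" DG t0 t1 xc \<rho> C k by (rule box)
  have k: "0 < k" and E: "0 \<le> energy_const" using c_pos C_pos by (auto simp: energy_const_def)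
  \<comment> \<open>This makes l / k (4 B + energy_const + 1) equal to \<epsilon> / 2; the 1 keeps
    the denominator positive.\<close>
  define l where "l = \<epsilon> * k / (2 * (4 * B + energy_const + 1))"
  have den: "0 < 4 * B + energy_const + 1" using B E by simp
  have l: "0 < l" using \<epsilon> k den by (simp add: l_def)
  \<comment> \<open>The bound 1 keeps the share of \<open>energy_const\<close> within the first half
    of \<open>\<epsilon>\<close>; the bound 2 l \<epsilon> limits the duration times 1 / (4 l) to
    the second half.\<close>
  define h where "h = min 1 (2 * l * \<epsilon>)"
  show ?thesis
  proof (rule that[of h])
    show "0 < h" using l \<epsilon> by (simp add: h_def)
    fix \<gamma> s s' assume \<gamma>: "bounded_action t0 t1 B \<gamma>" and s: "t0 \<le> s" "s \<le> s'" "s' \<le> t1" "s' - s \<le> h"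
      and inb: "\<And>\<sigma>. \<sigma> \<in> {s..s'} \<Longrightarrow> \<gamma> \<sigma> \<in> fst c \<and> snd c (\<gamma> \<sigma>) \<in> cball xc \<rho>"
    have C1: "C1_curve A t0 t1 \<gamma>" using \<gamma> by (simp add: bounded_action_def)
    let ?v = "\<lambda>t. velocity A t0 t1 \<gamma> t"
    let ?L = "\<lambda>t. Lagrangian t (\<gamma> t) (?v t)"
    have sub: "{s..s'} \<subseteq> {t0..t1}" using s by auto
    have d: "((\<lambda>t. snd c (\<gamma> t)) has_vector_derivative ?v t c) (at t within {s..s'})" if "t \<in> {s..s'}" for t
      using C1_curve_derivative[OF C1 c, of t] inb[OF that] sub that
      by (blast intro: has_vector_derivative_within_subset)
    have vc: "continuous_on {s..s'} (\<lambda>t. ?v t c)"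
      by (rule continuous_on_subset[OF velocity_continuous[OF C1 c]]) (use inb sub in auto)
    have Lc: "continuous_on {s..s'} ?L"
      using continuous_on_subset[OF Lagrangian_continuous[OF t01 C1 T] sub] .
    have "((\<lambda>t. ?v t c) has_integral snd c (\<gamma> s') - snd c (\<gamma> s)) {s..s'}"
      using d s by (intro fundamental_theorem_of_calculus) auto
    then have "norm (snd c (\<gamma> s') - snd c (\<gamma> s)) = norm (integral {s..s'} (\<lambda>t. ?v t c))" by (simp add: integral_unique)
    also have "\<dots> \<le> integral {s..s'} (\<lambda>t. l / k * 4 * ?L t + (l / k * energy_const + 1 / (4 * l)))"
    proof (rule Henstock_Kurzweil_Integration.integral_norm_bound_integral)
      show "(\<lambda>t. ?v t c) integrable_on {s..s'}" by (rule integrable_continuous_interval[OF vc])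
      show "(\<lambda>t. l / k * 4 * ?L t + (l / k * energy_const + 1 / (4 * l))) integrable_on {s..s'}"
        by (intro integrable_continuous_interval continuous_intros Lc)
      fix t assume t: "t \<in> {s..s'}"
      have v: "?v t \<in> tangent_space A (\<gamma> t)" using velocity_tangent[OF t01 C1] t sub by blast
      have "(t, snd c (\<gamma> t)) \<in> {t0..t1} \<times> cball xc \<rho>" using inb[OF t] t sub by auto
      from energy_bound[OF this, of "?v t c" 1] have "k * (norm (?v t c))\<^sup>2 \<le> 4 * ?L t + energy_const"
        using form_coord[OF c _ v v, of t 1 1] inb[OF t] by (simp add: Lagrangian_form)
      then have "(norm (?v t c))\<^sup>2 \<le> (4 * ?L t + energy_const) / k" using k by (simp add: field_simps)
      then have "l * (norm (?v t c))\<^sup>2 \<le> l * ((4 * ?L t + energy_const) / k)" using l by (intro mult_left_mono) auto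
      moreover have "norm (?v t c) \<le> l * (norm (?v t c))\<^sup>2 + 1 / (4 * l)"
      proof -
        have "0 \<le> (2 * l * norm (?v t c) - 1)\<^sup>2 / (4 * l)" using l by simp
        also have "\<dots> = l * (norm (?v t c))\<^sup>2 + 1 / (4 * l) - norm (?v t c)"
          using l by (simp add: power2_eq_square field_simps)
        finally show ?thesis by simp
      qed
      ultimately show "norm (?v t c) \<le> l / k * 4 * ?L t + (l / k * energy_const + 1 / (4 * l))"
        by (simp add: algebra_simps add_divide_distrib)
    qed
    also have "\<dots> = l / k * 4 * integral {s..s'} ?L + (s' - s) * (l / k * energy_const + 1 / (4 * l))"
    proof (rule integral_unique)
      show "((\<lambda>t. l / k * 4 * ?L t + (l / k * energy_const + 1 / (4 * l))) has_integral
        l / k * 4 * integral {s..s'} ?L + (s' - s) * (l / k * energy_const + 1 / (4 * l))) {s..s'}"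
        using has_integral_const_real[of "l / k * energy_const + 1 / (4 * l)" s s'] s
        by (intro has_integral_add has_integral_mult_right integrable_integral integrable_continuous_interval Lc) auto
    qed
    also have "\<dots> \<le> l / k * 4 * B + (l / k * energy_const + \<epsilon> / 2)"
    proof (intro add_mono)
      have "integral {s..s'} ?L \<le> B" using \<gamma> s by (simp add: bounded_action_def)
      then show "l / k * 4 * integral {s..s'} ?L \<le> l / k * 4 * B" using l k by (intro mult_left_mono) auto
      have "(s' - s) * (l / k * energy_const) \<le> 1 * (l / k * energy_const)"
        using s l k E by (intro mult_right_mono) (auto simp: h_def)
      moreover have "(s' - s) * (1 / (4 * l)) \<le> 2 * l * \<epsilon> * (1 / (4 * l))"
        using s l by (intro mult_right_mono) (auto simp: h_def)
      moreover have "2 * l * \<epsilon> * (1 / (4 * l)) = \<epsilon> / 2" using l by simp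
      ultimately show "(s' - s) * (l / k * energy_const + 1 / (4 * l)) \<le> l / k * energy_const + \<epsilon> / 2"
        unfolding distrib_left by linarith
    qed
    also have "\<dots> = l / k * (4 * B + energy_const) + \<epsilon> / 2" by (simp add: algebra_simps)
    also have "l / k * (4 * B + energy_const) \<le> l / k * (4 * B + energy_const + 1)"
      using l k by (intro mult_left_mono) auto
    also have "\<dots> = \<epsilon> / 2"
    proof -
      have "\<epsilon> * k / (2 * D) / k * D = \<epsilon> / 2" if "D \<noteq> 0" for D using that k by simp
      from this[of "4 * B + energy_const + 1"] den show ?thesis by (simp only: l_def)
    qed
    finally show "norm (snd c (\<gamma> s') - snd c (\<gamma> s)) \<le> \<epsilon>" by simp
  qed
qed


lemma bounded_actionD:
  assumes "bounded_action t0 t1 B \<gamma>"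
  shows "C1_curve A t0 t1 \<gamma>"
    and "t0 \<le> s \<Longrightarrow> s \<le> s' \<Longrightarrow> s' \<le> t1 \<Longrightarrow>
      integral {s..s'} (\<lambda>t. Lagrangian t (\<gamma> t) (velocity A t0 t1 \<gamma> t)) \<le> B"
  using assms by (auto simp: bounded_action_def)

text \<open>A first exit argument. As long as the arc stays within radius 3 \<epsilon>, it moves by
  at most \<epsilon> and so is within 2 \<epsilon>. That smaller set is closed in \<open>Q\<close>,
  so the arc is still in it at the first exit time, a contradiction.\<close>

lemma chart_confinement:
  assumes t01: "t0 < t1" and T: "{t0..t1} \<subseteq> T" and c: "c \<in> A"
    and box: "lagrangian_box (coord_form c) DG t0 t1 xc \<rho> C k"
    and \<rho>: "cball xc \<rho> \<subseteq> snd c ` fst c" and \<epsilon>: "0 < \<epsilon>" "4 * \<epsilon> \<le> \<rho>" and B: "0 \<le> B"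
  obtains h where "0 < h" "\<And>\<gamma> s s' \<sigma>. bounded_action t0 t1 B \<gamma> \<Longrightarrow> t0 \<le> s \<Longrightarrow> s' \<le> t1 \<Longrightarrow>
    s' - s \<le> h \<Longrightarrow> \<gamma> s \<in> fst c \<Longrightarrow> snd c (\<gamma> s) \<in> ball xc \<epsilon> \<Longrightarrow> \<sigma> \<in> {s..s'} \<Longrightarrow>
    \<gamma> \<sigma> \<in> fst c \<and> snd c (\<gamma> \<sigma>) \<in> cball xc (2 * \<epsilon>)"
proof -
  obtain h where h: "0 < h" and disp: "\<And>\<gamma> s s'. bounded_action t0 t1 B \<gamma> \<Longrightarrow> t0 \<le> s \<Longrightarrow> s \<le> s' \<Longrightarrow> s' \<le> t1 \<Longrightarrow>
    s' - s \<le> h \<Longrightarrow> (\<And>\<sigma>. \<sigma> \<in> {s..s'} \<Longrightarrow> \<gamma> \<sigma> \<in> fst c \<and> snd c (\<gamma> \<sigma>) \<in> cball xc \<rho>) \<Longrightarrow>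
    norm (snd c (\<gamma> s') - snd c (\<gamma> s)) \<le> \<epsilon>"
    by (rule chart_displacement[OF t01 T c box \<epsilon>(1) B]) blast
  define N where "N = {p \<in> fst c. snd c p \<in> ball xc (3 * \<epsilon>)}"
  define N' where "N' = {p \<in> fst c. snd c p \<in> cball xc (2 * \<epsilon>)}"
  have N: "open N" unfolding N_def by (rule open_chart_ball[OF c])
  have "cball xc (2 * \<epsilon>) \<subseteq> snd c ` fst c" using \<rho> \<epsilon> by (intro order_trans[OF _ \<rho>] subset_cball) simp
  then have "compact N'" unfolding N'_def by (rule compact_chart_cball[OF c])
  then have N': "closed N'" by (rule compact_imp_closed)
  have N'N: "N' \<subseteq> N" using \<epsilon> by (auto simp: N_def N'_def)
  show ?thesis
  proof (rule that[OF h])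
    fix \<gamma> s s' \<sigma>
    assume \<gamma>: "bounded_action t0 t1 B \<gamma>" and s: "t0 \<le> s" "s' \<le> t1" "s' - s \<le> h"
      and \<gamma>s: "\<gamma> s \<in> fst c" "snd c (\<gamma> s) \<in> ball xc \<epsilon>" and \<sigma>: "\<sigma> \<in> {s..s'}"
    have cont: "continuous_on {s..s'} \<gamma>"
      using s by (intro continuous_on_subset[OF C1_curve_continuous[OF bounded_actionD(1)[OF \<gamma>]]]) auto
    have est: "\<gamma> \<tau> \<in> N'" if \<tau>: "\<tau> \<in> {s..s'}" and inN: "\<And>x. x \<in> {s..\<tau>} \<Longrightarrow> \<gamma> x \<in> N" for \<tau>
    proof -
      have "norm (snd c (\<gamma> \<tau>) - snd c (\<gamma> s)) \<le> \<epsilon>"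
      proof (rule disp[OF \<gamma>])
        show "\<gamma> x \<in> fst c \<and> snd c (\<gamma> x) \<in> cball xc \<rho>" if "x \<in> {s..\<tau>}" for x
          using inN[OF that] \<epsilon> by (auto simp: N_def)
      qed (use \<tau> s in auto)
      moreover have "norm (xc - snd c (\<gamma> s)) < \<epsilon>" using \<gamma>s(2) by (simp add: dist_norm)
      moreover have "norm (xc - snd c (\<gamma> \<tau>)) \<le> norm (xc - snd c (\<gamma> s)) + norm (snd c (\<gamma> \<tau>) - snd c (\<gamma> s))"
        using norm_triangle_ineq4[of "xc - snd c (\<gamma> s)" "snd c (\<gamma> \<tau>) - snd c (\<gamma> s)"] by simp
      ultimately have "norm (xc - snd c (\<gamma> \<tau>)) \<le> 2 * \<epsilon>" by linarith
      then show ?thesis using inN[of \<tau>] \<tau> by (auto simp: N_def N'_def dist_norm)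
    qed
    define bad where "bad = {s..s'} \<inter> \<gamma> -` (- N)"
    have "closed bad" unfolding bad_def using N by (intro continuous_closed_preimage cont) auto
    have "bad = {}"
    proof (rule ccontr)
      assume ne: "bad \<noteq> {}"
      have bdd: "bdd_below bad" by (auto simp: bad_def intro: bdd_belowI[of _ s])
      define \<tau> where "\<tau> = Inf bad"
      have \<tau>: "\<tau> \<in> bad" unfolding \<tau>_def by (rule closed_contains_Inf[OF ne bdd \<open>closed bad\<close>])
      then have \<tau>s: "\<tau> \<in> {s..s'}" by (simp add: bad_def)
      have good: "\<gamma> x \<in> N" if "x \<in> {s..<\<tau>}" for x
      proof (rule ccontr)
        assume "\<gamma> x \<notin> N"
        then have "x \<in> bad" using that \<tau>s by (auto simp: bad_def)
        then show False using cInf_lower[OF _ bdd, of x] that by (simp add: \<tau>_def)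
      qed
      have "\<gamma> s \<in> N" using \<gamma>s \<epsilon> by (auto simp: N_def)
      then have "s \<noteq> \<tau>" using \<tau> by (auto simp: bad_def)
      then have less: "s < \<tau>" using \<tau>s by auto
      have "closed ({s..s'} \<inter> \<gamma> -` N')" using N' by (intro continuous_closed_preimage cont) auto
      moreover have "{s..<\<tau>} \<subseteq> {s..s'} \<inter> \<gamma> -` N'"
      proof
        fix x assume x: "x \<in> {s..<\<tau>}"
        then have "\<gamma> x \<in> N'" using \<tau>s good by (intro est) auto
        then show "x \<in> {s..s'} \<inter> \<gamma> -` N'" using x \<tau>s by auto
      qed
      ultimately have "closure {s..<\<tau>} \<subseteq> {s..s'} \<inter> \<gamma> -` N'" by (intro closure_minimal)
      moreover have "\<tau> \<in> closure {s..<\<tau>}" using less by (simp add: closure_atLeastLessThan)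
      ultimately have "\<gamma> \<tau> \<in> N'" by blast
      then show False using \<tau> N'N by (auto simp: bad_def)
    qed
    then have "\<gamma> x \<in> N" if "x \<in> {s..s'}" for x using that by (auto simp: bad_def)
    then have "\<gamma> \<sigma> \<in> N'" using \<sigma> by (intro est) auto
    then show "\<gamma> \<sigma> \<in> fst c \<and> snd c (\<gamma> \<sigma>) \<in> cball xc (2 * \<epsilon>)" by (simp add: N'_def)
  qed
qed

section \<open>Limits of short arcs\<close>

definition converging_arcs where
  "converging_arcs t0 t1 B \<gamma> \<sigma> \<sigma>' s z s' z' \<longleftrightarrow>
     (\<forall>n. bounded_action t0 t1 B (\<gamma> n) \<and> t0 \<le> \<sigma> n \<and> \<sigma> n \<le> \<sigma>' n \<and> \<sigma>' n \<le> t1) \<and>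
     \<sigma> \<longlonglongrightarrow> s \<and> \<sigma>' \<longlonglongrightarrow> s' \<and> (\<lambda>n. \<gamma> n (\<sigma> n)) \<longlonglongrightarrow> z \<and> (\<lambda>n. \<gamma> n (\<sigma>' n)) \<longlonglongrightarrow> (z' :: 'q)"

definition arc_action :: "real \<Rightarrow> real \<Rightarrow> (real \<Rightarrow> 'q) \<Rightarrow> real \<Rightarrow> real \<Rightarrow> real" where
  "arc_action t0 t1 \<gamma> s s' = integral {s..s'} (\<lambda>t. Lagrangian t (\<gamma> t) (velocity A t0 t1 \<gamma> t))"

lemma converging_arcs_shift:
  assumes "converging_arcs t0 t1 B \<gamma> \<sigma> \<sigma>' s z s' z'"
  shows "converging_arcs t0 t1 B (\<lambda>n. \<gamma> (n + m)) (\<lambda>n. \<sigma> (n + m)) (\<lambda>n. \<sigma>' (n + m)) s z s' z'"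
  using assms LIMSEQ_ignore_initial_segment[of \<sigma> s m] LIMSEQ_ignore_initial_segment[of \<sigma>' s' m]
    LIMSEQ_ignore_initial_segment[of "\<lambda>n. \<gamma> n (\<sigma> n)" z m]
    LIMSEQ_ignore_initial_segment[of "\<lambda>n. \<gamma> n (\<sigma>' n)" z' m]
  by (simp add: converging_arcs_def)

text \<open>The durations tend to zero, so for every small \<open>\<epsilon>\<close> the arcs are
  eventually confined to the ball of radius 2 \<epsilon> around \<open>z\<close>, which is closed
  and thus contains the limit of the end points.\<close>

lemma converging_arcs_point:
  assumes t01: "t0 < t1" and T: "{t0..t1} \<subseteq> T" and B: "0 \<le> B"
    and arcs: "converging_arcs t0 t1 B \<gamma> \<sigma> \<sigma>' s z s z'"
  shows "z' = z"
proof -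
  obtain c \<rho> DG C k where c: "c \<in> A" "z \<in> fst c" "0 < \<rho>" "cball (snd c z) \<rho> \<subseteq> snd c ` fst c"
    and box: "lagrangian_box (coord_form c) DG t0 t1 (snd c z) \<rho> C k"
    by (rule chart_box[OF T])
  have in2: "z' \<in> fst c \<and> snd c z' \<in> cball (snd c z) (2 * \<epsilon>)" if \<epsilon>: "0 < \<epsilon>" "4 * \<epsilon> \<le> \<rho>" for \<epsilon>
  proof -
    obtain h where h: "0 < h" and conf: "\<And>\<gamma> s s' \<sigma>. bounded_action t0 t1 B \<gamma> \<Longrightarrow> t0 \<le> s \<Longrightarrow> s' \<le> t1 \<Longrightarrow>
      s' - s \<le> h \<Longrightarrow> \<gamma> s \<in> fst c \<Longrightarrow> snd c (\<gamma> s) \<in> ball (snd c z) \<epsilon> \<Longrightarrow> \<sigma> \<in> {s..s'} \<Longrightarrow>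
      \<gamma> \<sigma> \<in> fst c \<and> snd c (\<gamma> \<sigma>) \<in> cball (snd c z) (2 * \<epsilon>)"
      by (rule chart_confinement[OF t01 T c(1) box c(4) \<epsilon> B]) blast
    let ?N' = "{p \<in> fst c. snd c p \<in> cball (snd c z) (2 * \<epsilon>)}"
    have "cball (snd c z) (2 * \<epsilon>) \<subseteq> snd c ` fst c" using c(4) \<epsilon> by (intro order_trans[OF _ c(4)] subset_cball) simp
    then have closed: "closed ?N'" by (intro compact_imp_closed compact_chart_cball[OF c(1)])
    have "(\<lambda>n. \<sigma>' n - \<sigma> n) \<longlonglongrightarrow> s - s" using arcs by (intro tendsto_diff) (auto simp: converging_arcs_def)
    then have e1: "\<forall>\<^sub>F n in sequentially. \<sigma>' n - \<sigma> n < h" using order_tendstoD(2)[of _ 0 _ h] h by simp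
    have "open {p \<in> fst c. snd c p \<in> ball (snd c z) \<epsilon>}" by (rule open_chart_ball[OF c(1)])
    then have e2: "\<forall>\<^sub>F n in sequentially. \<gamma> n (\<sigma> n) \<in> {p \<in> fst c. snd c p \<in> ball (snd c z) \<epsilon>}"
      using arcs c(2) \<epsilon>(1) unfolding converging_arcs_def by (intro topological_tendstoD[of _ z]) auto
    from e1 e2 have "\<forall>\<^sub>F n in sequentially. \<gamma> n (\<sigma>' n) \<in> ?N'"
    proof eventually_elim
      case (elim n)
      have "bounded_action t0 t1 B (\<gamma> n)" "t0 \<le> \<sigma> n" "\<sigma> n \<le> \<sigma>' n" "\<sigma>' n \<le> t1"
        using arcs by (auto simp: converging_arcs_def)
      then show ?case using conf[of "\<gamma> n" "\<sigma> n" "\<sigma>' n" "\<sigma>' n"] elim by auto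
    qed
    then have "z' \<in> ?N'"
      using arcs unfolding converging_arcs_def by (intro Lim_in_closed_set[OF closed _ sequentially_bot]) auto
    then show ?thesis by simp
  qed
  have z': "z' \<in> fst c" using in2[of "\<rho> / 4"] c(3) by simp
  have "dist (snd c z) (snd c z') \<le> 0"
  proof (rule field_le_epsilon)
    fix e :: real assume "0 < e"
    define \<epsilon> where "\<epsilon> = min (e / 2) (\<rho> / 4)"
    have \<epsilon>: "0 < \<epsilon>" "4 * \<epsilon> \<le> \<rho>" "2 * \<epsilon> \<le> e" using \<open>0 < e\<close> c(3) by (auto simp: \<epsilon>_def)
    then show "dist (snd c z) (snd c z') \<le> 0 + e" using in2[OF \<epsilon>(1,2)] by simp
  qed
  then show ?thesis using inj_onD[OF inj_on_chart[OF c(1)] _ z' c(2)] by simp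
qed

text \<open>The part of the limit curve theorem that is proved in a single chart.\<close>

definition arcs_close_up :: "real \<Rightarrow> real \<Rightarrow> real \<Rightarrow> real \<Rightarrow> 'q \<Rightarrow> bool" where
  "arcs_close_up t0 t1 B h z \<longleftrightarrow> (\<forall>\<gamma> \<sigma> \<sigma>' s s' z' J y.
     converging_arcs t0 t1 B \<gamma> \<sigma> \<sigma>' s z s' z' \<and> s < s' \<and> (\<forall>n. \<sigma>' n - \<sigma> n \<le> h) \<and>
     (\<lambda>n. arc_action t0 t1 (\<gamma> n) (\<sigma> n) (\<sigma>' n)) \<longlonglongrightarrow> J \<longrightarrow> (s', z', y + J) \<in> J_plus (s, z, y))"

text \<open>Confinement puts the arcs into the box, where the limit of their ends is joined by a
  minimiser whose action is at most \<open>J\<close>. Transported back to \<open>Q\<close> and to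
  the time interval, it lifts to a causal curve ending at height \<open>y + J\<close>.\<close>

lemma arcs_close_up_local:
  assumes t01: "t0 < t1" and T: "{t0..t1} \<subseteq> T" and B: "0 \<le> B"
  shows "\<exists>N h. open N \<and> q \<in> N \<and> 0 < h \<and> (\<forall>z\<in>N. arcs_close_up t0 t1 B h z)"
proof -
  obtain c \<rho> DG C k where c: "c \<in> A" "q \<in> fst c" "0 < \<rho>" "cball (snd c q) \<rho> \<subseteq> snd c ` fst c"
    and box: "lagrangian_box (coord_form c) DG t0 t1 (snd c q) \<rho> C k"
    by (rule chart_box[OF T])
  interpret lagrangian_box "coord_form c" DG t0 t1 "snd c q" \<rho> C k by (rule box)
  obtain m where m: "small m" by (rule small_exists[OF c(3)])
  then have m0: "0 < m" by (simp add: small_def)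
  \<comment> \<open>The ends of a limit arc are at most 3 \<epsilon>, hence m / 2, apart; the
    duration takes up the other half of m. The first bound keeps the arcs within half the radius of
    the box.\<close>
  define \<epsilon> where "\<epsilon> = min (\<rho> / 4) (m / 8)"
  have \<epsilon>: "0 < \<epsilon>" "4 * \<epsilon> \<le> \<rho>" "4 * \<epsilon> \<le> m / 2" using c(3) m0 by (auto simp: \<epsilon>_def)
  obtain h where h: "0 < h" and conf: "\<And>\<gamma> s s' \<sigma>. bounded_action t0 t1 B \<gamma> \<Longrightarrow> t0 \<le> s \<Longrightarrow> s' \<le> t1 \<Longrightarrow>
      s' - s \<le> h \<Longrightarrow> \<gamma> s \<in> fst c \<Longrightarrow> snd c (\<gamma> s) \<in> ball (snd c q) \<epsilon> \<Longrightarrow> \<sigma> \<in> {s..s'} \<Longrightarrow>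
      \<gamma> \<sigma> \<in> fst c \<and> snd c (\<gamma> \<sigma>) \<in> cball (snd c q) (2 * \<epsilon>)"
    by (rule chart_confinement[OF t01 T c(1) box c(4) \<epsilon>(1,2) B]) blast
  define h0 where "h0 = min h (m / 2)"
  define N where "N = {p \<in> fst c. snd c p \<in> ball (snd c q) \<epsilon>}"
  have N: "open N" unfolding N_def by (rule open_chart_ball[OF c(1)])
  have "arcs_close_up t0 t1 B h0 z" if z: "z \<in> N" for z
    unfolding arcs_close_up_def
  proof (intro allI impI, elim conjE)
    fix \<gamma>' \<sigma>1 \<sigma>1' s s' z' J y
    assume arcs': "converging_arcs t0 t1 B \<gamma>' \<sigma>1 \<sigma>1' s z s' z'" and ss: "s < s'"
      and step': "\<forall>n. \<sigma>1' n - \<sigma>1 n \<le> h0"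
      and J': "(\<lambda>n. arc_action t0 t1 (\<gamma>' n) (\<sigma>1 n) (\<sigma>1' n)) \<longlonglongrightarrow> J"
    have "\<forall>\<^sub>F n in sequentially. \<gamma>' n (\<sigma>1 n) \<in> N"
      using arcs' N z unfolding converging_arcs_def by (intro topological_tendstoD[of _ z]) auto
    \<comment> \<open>Arcs that start outside \<open>N\<close> are finitely many and are dropped, so
      that all later estimates hold for every index.\<close>
    then obtain n0 where n0: "\<And>n. n0 \<le> n \<Longrightarrow> \<gamma>' n (\<sigma>1 n) \<in> N" by (auto simp: eventually_sequentially)
    define \<gamma> where "\<gamma> n = \<gamma>' (n + n0)" for n
    define \<sigma> where "\<sigma> n = \<sigma>1 (n + n0)" for n
    define \<sigma>' where "\<sigma>' n = \<sigma>1' (n + n0)" for n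
    have arcs: "converging_arcs t0 t1 B \<gamma> \<sigma> \<sigma>' s z s' z'"
      using converging_arcs_shift[OF arcs', of n0] by (simp add: \<gamma>_def[abs_def] \<sigma>_def[abs_def] \<sigma>'_def[abs_def])
    have inN: "\<gamma> n (\<sigma> n) \<in> N" for n using n0 by (simp add: \<gamma>_def \<sigma>_def)
    have J: "(\<lambda>n. arc_action t0 t1 (\<gamma> n) (\<sigma> n) (\<sigma>' n)) \<longlonglongrightarrow> J"
      using LIMSEQ_ignore_initial_segment[OF J', of n0] by (simp add: \<gamma>_def \<sigma>_def \<sigma>'_def)
    have bd: "bounded_action t0 t1 B (\<gamma> n)" and \<sigma>: "t0 \<le> \<sigma> n" "\<sigma> n \<le> \<sigma>' n" "\<sigma>' n \<le> t1" for n
      using arcs by (auto simp: converging_arcs_def)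
    have C1: "C1_curve A t0 t1 (\<gamma> n)" for n by (rule bounded_actionD(1)[OF bd])
    define hn where "hn n = \<sigma>' n - \<sigma> n" for n
    have hn: "0 \<le> hn n" "hn n \<le> h0" for n using \<sigma> step' by (auto simp: hn_def \<sigma>_def \<sigma>'_def)
    have stay: "\<gamma> n \<tau> \<in> fst c \<and> snd c (\<gamma> n \<tau>) \<in> cball (snd c q) (2 * \<epsilon>)" if "\<tau> \<in> {\<sigma> n..\<sigma>' n}" for n \<tau>
      using conf[of "\<gamma> n" "\<sigma> n" "\<sigma>' n" \<tau>] bd[of n] \<sigma>[of n] inN[of n] hn(2)[of n] that
      by (auto simp: N_def hn_def h0_def)
    define x where "x n \<tau> = snd c (\<gamma> n (\<sigma> n + hn n * \<tau>))" for n \<tau>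
    define w where "w n \<tau> = hn n *\<^sub>R velocity A t0 t1 (\<gamma> n) (\<sigma> n + hn n * \<tau>) c" for n \<tau>
    have im: "\<sigma> n + hn n * \<tau> \<in> {\<sigma> n..\<sigma>' n}" if "\<tau> \<in> {0..1}" for n \<tau>
    proof -
      have "0 \<le> hn n * \<tau>" "hn n * \<tau> \<le> hn n" using that hn(1)[of n] by (auto simp: mult_left_le)
      then show ?thesis by (auto simp: hn_def)
    qed
    have sub: "{\<sigma> n..\<sigma>' n} \<subseteq> {t0..t1}" for n using \<sigma>(1,3)[of n] by auto
    have dv: "((\<lambda>\<tau>. \<sigma> n + hn n * \<tau>) has_vector_derivative hn n) (at \<tau> within {0..1})" for n \<tau>
      by (auto intro!: derivative_eq_intros)
    have x_d: "(x n has_vector_derivative w n \<tau>) (at \<tau> within {0..1})" if \<tau>: "\<tau> \<in> {0..1}" for n \<tau>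
    proof -
      have "((\<lambda>s. snd c (\<gamma> n s)) has_vector_derivative velocity A t0 t1 (\<gamma> n) (\<sigma> n + hn n * \<tau>) c)
          (at (\<sigma> n + hn n * \<tau>) within {t0..t1})"
        using C1_curve_derivative[OF C1 c(1)] im[OF \<tau>, of n] stay[OF im[OF \<tau>]] sub[of n] by blast
      then have "((\<lambda>s. snd c (\<gamma> n s)) has_vector_derivative velocity A t0 t1 (\<gamma> n) (\<sigma> n + hn n * \<tau>) c)
          (at (\<sigma> n + hn n * \<tau>) within (\<lambda>\<tau>. \<sigma> n + hn n * \<tau>) ` {0..1})"
        using im sub[of n] by (blast intro: has_vector_derivative_within_subset)
      from vector_diff_chain_within[OF dv this] show ?thesis by (simp add: x_def[abs_def] w_def o_def)
    qed
    have cont_aff: "continuous_on {0..1} (\<lambda>\<tau>. \<sigma> n + hn n * \<tau>)" for n by (intro continuous_intros)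
    have w_c: "continuous_on {0..1} (w n)" for n
      unfolding w_def
      by (intro continuous_intros continuous_on_compose2[OF velocity_continuous[OF C1 c(1)] cont_aff] image_subsetI)
        (use im stay sub in blast)
    have xb: "x n \<tau> \<in> cball (snd c q) (\<rho> / 2)" if "\<tau> \<in> {0..1}" for n \<tau>
      using stay[OF im[OF that, of n]] \<epsilon> by (auto simp: x_def)
    have lim\<sigma>: "\<sigma> \<longlonglongrightarrow> s" "\<sigma>' \<longlonglongrightarrow> s'" "(\<lambda>n. \<gamma> n (\<sigma> n)) \<longlonglongrightarrow> z" "(\<lambda>n. \<gamma> n (\<sigma>' n)) \<longlonglongrightarrow> z'"
      using arcs by (auto simp: converging_arcs_def)
    have limh: "hn \<longlonglongrightarrow> s' - s" unfolding hn_def by (intro tendsto_diff lim\<sigma>)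
    have zc: "z \<in> fst c" using z by (simp add: N_def)
    let ?N' = "{p \<in> fst c. snd c p \<in> cball (snd c q) (2 * \<epsilon>)}"
    have "cball (snd c q) (2 * \<epsilon>) \<subseteq> snd c ` fst c" using c(4) \<epsilon> by (intro order_trans[OF _ c(4)] subset_cball) simp
    then have closed: "closed ?N'" by (intro compact_imp_closed compact_chart_cball[OF c(1)])
    have z'N: "z' \<in> ?N'"
    proof (rule Lim_in_closed_set[OF closed _ sequentially_bot lim\<sigma>(4)])
      show "\<forall>\<^sub>F n in sequentially. \<gamma> n (\<sigma>' n) \<in> ?N'"
        using stay \<sigma>(2) by (intro always_eventually allI) simp
    qed
    have lx0: "(\<lambda>n. x n 0) \<longlonglongrightarrow> snd c z" using tendsto_chart[OF c(1) zc lim\<sigma>(3)] by (simp add: x_def)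
    have lx1: "(\<lambda>n. x n 1) \<longlonglongrightarrow> snd c z'" using tendsto_chart[OF c(1) _ lim\<sigma>(4)] z'N by (simp add: x_def hn_def)
    \<comment> \<open>The extended velocity is h times (1, v), which gives 2
      \<open>h\<^sup>2\<close> times the Lagrangian; passing from [0, 1] back to an interval of
      length h takes away one factor h.\<close>
    have act: "integral {0..1} (\<lambda>\<tau>. coord_form c (\<sigma> n + hn n * \<tau>, x n \<tau>) (hn n, w n \<tau>) (hn n, w n \<tau>)) =
        2 * hn n * arc_action t0 t1 (\<gamma> n) (\<sigma> n) (\<sigma>' n)" for n
    proof -
      let ?L = "\<lambda>t. Lagrangian t (\<gamma> n t) (velocity A t0 t1 (\<gamma> n) t)"
      have "coord_form c (\<sigma> n + hn n * \<tau>, x n \<tau>) (hn n, w n \<tau>) (hn n, w n \<tau>) = 2 * (hn n)\<^sup>2 * ?L (\<sigma> n + hn n * \<tau>)"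
        if \<tau>: "\<tau> \<in> {0..1}" for \<tau>
      proof -
        define t where "t = \<sigma> n + hn n * \<tau>"
        have t: "t \<in> {t0..t1}" using im[OF \<tau>] sub unfolding t_def by blast
        have tc: "\<gamma> n t \<in> fst c" using stay[OF im[OF \<tau>]] by (simp add: t_def)
        have v: "velocity A t0 t1 (\<gamma> n) t \<in> tangent_space A (\<gamma> n t)" by (rule velocity_tangent[OF t01 C1 t])
        have "(t, snd c (\<gamma> n t)) \<in> T \<times> snd c ` fst c" using t T tc by blast
        note bl = coord_form_bilinear[OF c(1) this]
        have "(hn n, w n \<tau>) = hn n *\<^sub>R (1, velocity A t0 t1 (\<gamma> n) t c)" by (simp add: w_def t_def)
        then have "coord_form c (t, snd c (\<gamma> n t)) (hn n, w n \<tau>) (hn n, w n \<tau>) =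
            (hn n)\<^sup>2 * coord_form c (t, snd c (\<gamma> n t)) (1, velocity A t0 t1 (\<gamma> n) t c) (1, velocity A t0 t1 (\<gamma> n) t c)"
          by (simp only: bilinear_lmul[OF bl] bilinear_rmul[OF bl]) (simp add: power2_eq_square)
        also have "\<dots> = 2 * (hn n)\<^sup>2 * ?L t"
          using form_coord[OF c(1) tc v v, of t 1 1] by (simp add: Lagrangian_form)
        finally show ?thesis by (simp add: t_def x_def)
      qed
      then have "integral {0..1} (\<lambda>\<tau>. coord_form c (\<sigma> n + hn n * \<tau>, x n \<tau>) (hn n, w n \<tau>) (hn n, w n \<tau>)) =
          integral {0..1} (\<lambda>\<tau>. 2 * (hn n)\<^sup>2 * ?L (\<sigma> n + hn n * \<tau>))" by (intro integral_cong)
      also have "\<dots> = 2 * hn n * (hn n * integral {0..1} (\<lambda>\<tau>. ?L (\<sigma> n + hn n * \<tau>)))"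
        by (simp add: power2_eq_square)
      also have "hn n * integral {0..1} (\<lambda>\<tau>. ?L (\<sigma> n + hn n * \<tau>)) = integral {\<sigma> n..\<sigma> n + hn n} ?L"
        using sub[of n] by (intro affine_integral hn continuous_on_subset[OF Lagrangian_continuous[OF t01 C1 T]])
          (simp add: hn_def)
      finally show ?thesis by (simp add: arc_action_def hn_def)
    qed
    define hh where "hh = s' - s"
    have hh: "0 < hh" using ss by (simp add: hh_def)
    have limJ: "(\<lambda>n. integral {0..1} (\<lambda>\<tau>. coord_form c (\<sigma> n + hn n * \<tau>, x n \<tau>) (hn n, w n \<tau>) (hn n, w n \<tau>)))
        \<longlonglongrightarrow> 2 * hh * J"
      unfolding act hh_def by (intro tendsto_intros limh J)
    have near: "norm (snd c z' - snd c z) + hh \<le> m"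
    proof -
      have "norm (snd c z' - snd c z) \<le> norm (snd c q - snd c z) + norm (snd c q - snd c z')"
        using norm_triangle_ineq4[of "snd c q - snd c z" "snd c q - snd c z'"] by simp
      also have "\<dots> \<le> \<epsilon> + 2 * \<epsilon>" using z z'N by (intro add_mono) (auto simp: N_def dist_norm)
      finally have "norm (snd c z' - snd c z) \<le> m / 2" using \<epsilon> by linarith
      moreover have "hh \<le> m / 2"
        using LIMSEQ_le_const2[OF limh, of "m / 2"] hn(2) by (auto simp: hh_def h0_def)
      ultimately show ?thesis by simp
    qed
    have tn: "\<sigma> n \<in> {t0..t1}" "\<sigma> n + hn n \<in> {t0..t1}" for n
      using \<sigma>(1)[of n] \<sigma>(2)[of n] \<sigma>(3)[of n] by (auto simp: hn_def)
    obtain X u where X: "\<And>\<tau>. \<tau> \<in> {0..1} \<Longrightarrow> (X has_vector_derivative u \<tau>) (at \<tau> within {0..1})"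
      and u: "continuous_on {0..1} u" and ends: "X 0 = snd c z" "X 1 = snd c z'"
      and Xb: "\<And>\<tau>. \<tau> \<in> {0..1} \<Longrightarrow> X \<tau> \<in> cball (snd c q) \<rho>"
      and XJ: "integral {0..1} (\<lambda>\<tau>. coord_form c (s + hh * \<tau>, X \<tau>) (hh, u \<tau>) (hh, u \<tau>)) \<le> 2 * hh * J"
      using minimiser_lsc[OF m c(3) tn hn(1) x_d w_c xb lim\<sigma>(1) limh[folded hh_def] lx0 lx1 limJ near] by blast
    \<comment> \<open>The minimiser lives on [0, 1]; here it is returned to the time interval of the
      limit arc.\<close>
    define g where "g t = (t - s) / hh" for t
    have g: "g t \<in> {0..1}" if "t \<in> {s..s'}" for t using that hh by (auto simp: g_def hh_def field_simps)
    have sT: "{s..s'} \<subseteq> T"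
    proof -
      have "\<sigma> n \<in> {t0..t1}" "\<sigma>' n \<in> {t0..t1}" for n using \<sigma>(1)[of n] \<sigma>(2)[of n] \<sigma>(3)[of n] by auto
      then have "s \<in> {t0..t1}" "s' \<in> {t0..t1}"
        using closed_sequentially[OF closed_real_atLeastAtMost _ lim\<sigma>(1), of t0 t1]
          closed_sequentially[OF closed_real_atLeastAtMost _ lim\<sigma>(2), of t0 t1] by blast+
      then have "{s..s'} \<subseteq> {t0..t1}" by simp
      then show ?thesis using T by (rule subset_trans)
    qed
    have Xg: "((\<lambda>t. X (g t)) has_vector_derivative (1 / hh) *\<^sub>R u (g t)) (at t within {s..s'})" if t: "t \<in> {s..s'}" for t
    proof -
      have "(g has_vector_derivative 1 / hh) (at t within {s..s'})"
        unfolding g_def has_real_derivative_iff_has_vector_derivative[symmetric] using hh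
        by (auto intro!: derivative_eq_intros)
      moreover have "g ` {s..s'} \<subseteq> {0..1}" using g by blast
      then have "(X has_vector_derivative u (g t)) (at (g t) within g ` {s..s'})"
        by (rule has_vector_derivative_within_subset[OF X[OF g[OF t]]])
      ultimately show ?thesis using vector_diff_chain_within[of g "1 / hh" t "{s..s'}" X "u (g t)"] by (simp add: o_def)
    qed
    have gc: "continuous_on {s..s'} g" unfolding g_def using hh by (intro continuous_intros) auto
    have uc: "continuous_on {s..s'} (\<lambda>t. (1 / hh) *\<^sub>R u (g t))"
      using g by (intro continuous_intros continuous_on_compose2[OF u gc]) auto
    have Xc: "X (g t) \<in> snd c ` fst c" if "t \<in> {s..s'}" for t using Xb[OF g[OF that]] c(4) by blast
    define p where "p t = chart_inv c (X (g t))" for t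
    note P = C1_curve_chart_inv[OF ss c(1) Xg uc Xc]
    have pC: "C1_curve A s s' p" unfolding p_def by (rule P(1))
    have pv: "velocity A s s' p t c = (1 / hh) *\<^sub>R u (g t)" if "t \<in> {s..s'}" for t
      unfolding p_def by (rule P(2)) (use that in auto)
    let ?L = "\<lambda>t. Lagrangian t (p t) (velocity A s s' p t)"
    have L: "?L (s + hh * \<tau>) = coord_form c (s + hh * \<tau>, X \<tau>) (hh, u \<tau>) (hh, u \<tau>) / (2 * hh\<^sup>2)" if \<tau>: "\<tau> \<in> {0..1}" for \<tau>
    proof -
      define t where "t = s + hh * \<tau>"
      have gt: "g t = \<tau>" using hh by (simp add: t_def g_def)
      have "0 \<le> hh * \<tau>" "hh * \<tau> \<le> hh" using \<tau> hh by (auto simp: mult_left_le)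
      then have t: "t \<in> {s..s'}" unfolding t_def using hh_def by simp
      have pt: "p t \<in> fst c" "snd c (p t) = X \<tau>" 
        using chart_inv_mem[OF Xc[OF t]] chart_chart_inv[OF Xc[OF t]] by (simp_all only: p_def gt)
      have v: "velocity A s s' p t \<in> tangent_space A (p t)" by (rule velocity_tangent[OF ss pC t])
      have "(t, X \<tau>) \<in> T \<times> snd c ` fst c" using t sT Xc[OF t] gt by auto
      note bl = coord_form_bilinear[OF c(1) this]
      have "(hh, u \<tau>) = hh *\<^sub>R (1, (1 / hh) *\<^sub>R u \<tau>)" using hh by simp
      then have "coord_form c (t, X \<tau>) (hh, u \<tau>) (hh, u \<tau>) =
          hh\<^sup>2 * coord_form c (t, X \<tau>) (1, (1 / hh) *\<^sub>R u \<tau>) (1, (1 / hh) *\<^sub>R u \<tau>)"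
        by (simp only: bilinear_lmul[OF bl] bilinear_rmul[OF bl]) (simp add: power2_eq_square)
      also have "\<dots> = hh\<^sup>2 * (2 * ?L t)"
        using form_coord[OF c(1) pt(1) v v, of t 1 1] pv[OF t] pt(2) gt by (simp add: Lagrangian_form)
      finally show ?thesis using hh by (simp add: t_def)
    qed
    have "integral {s..s'} ?L = hh * integral {0..1} (\<lambda>\<tau>. ?L (s + hh * \<tau>))"
      using affine_integral[of hh s ?L] Lagrangian_continuous[OF ss pC sT] hh by (simp add: hh_def)
    also have "integral {0..1} (\<lambda>\<tau>. ?L (s + hh * \<tau>)) =
        integral {0..1} (\<lambda>\<tau>. coord_form c (s + hh * \<tau>, X \<tau>) (hh, u \<tau>) (hh, u \<tau>) / (2 * hh\<^sup>2))"
      using L by (intro integral_cong)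
    also have "\<dots> = integral {0..1} (\<lambda>\<tau>. coord_form c (s + hh * \<tau>, X \<tau>) (hh, u \<tau>) (hh, u \<tau>)) / (2 * hh\<^sup>2)"
      by simp
    also have "hh * \<dots> \<le> hh * (2 * hh * J / (2 * hh\<^sup>2))"
      using hh XJ by (intro mult_left_mono divide_right_mono) auto
    also have "\<dots> = J" using hh by (simp add: power2_eq_square)
    finally have "integral {s..s'} ?L \<le> (y + J) - y" by simp
    from lift_J[OF ss pC sT this] obtain yy where "(s', p s', yy s') \<in> J_plus (s, p s, y)" "yy s' = y + J"
      using ss by (metis Int_iff atLeastAtMost_iff less_eq_real_def)
    moreover have "p s = z" "p s' = z'"
      using ends zc z'N c(1) hh by (auto simp: p_def g_def hh_def[symmetric])
    ultimately show "(s', z', y + J) \<in> J_plus (s, z, y)" by simp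
  qed
  moreover have "q \<in> N" using c \<epsilon> by (simp add: N_def)
  moreover have "0 < h0" using h m0 by (simp add: h0_def)
  ultimately show ?thesis using N by blast
qed


lemma arcs_close_up_mono: "arcs_close_up t0 t1 B h z \<Longrightarrow> h' \<le> h \<Longrightarrow> arcs_close_up t0 t1 B h' z"
  unfolding arcs_close_up_def by (meson order_trans)

text \<open>The property becomes weaker as \<open>h\<close> decreases, so its reciprocal plays the
  role of the constant in the covering argument.\<close>

lemma arcs_close_up_compact:
  assumes t01: "t0 < t1" and T: "{t0..t1} \<subseteq> T" and B: "0 \<le> B" and K: "compact K"
  obtains h where "0 < h" "\<And>z. z \<in> K \<Longrightarrow> arcs_close_up t0 t1 B h z"
proof -
  let ?P = "\<lambda>C z. 0 < C \<and> arcs_close_up t0 t1 B (1 / C) z"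
  have loc: "\<exists>N C. open N \<and> q \<in> N \<and> (\<forall>z\<in>N. ?P C z)" for q
  proof -
    obtain N h where "open N" "q \<in> N" "0 < h" "\<forall>z\<in>N. arcs_close_up t0 t1 B h z"
      using arcs_close_up_local[OF t01 T B] by blast
    then show ?thesis by (intro exI[of _ N] exI[of _ "1 / h"]) auto
  qed
  have mono: "?P C' z" if "C \<le> C'" "?P C z" for C C' z
    using that arcs_close_up_mono[of t0 t1 B "1 / C" z "1 / C'"] by (auto simp: frac_le)
  have "\<exists>C\<ge>0. \<forall>z\<in>K. ?P C z"
    by (rule compact_uniform_bound[OF K loc mono]) auto
  then obtain C where C: "0 \<le> C" "\<forall>z\<in>K. ?P C z" by blast
  show ?thesis
  proof (cases "K = {}")
    case True then show ?thesis using that[of 1] by simp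
  next
    case False
    then have "0 < C" using C by blast
    then show ?thesis using C that[of "1 / C"] by simp
  qed
qed

section \<open>Limits of long arcs\<close>

text \<open>Over \<open>K\<close> the Lagrangian is at least - C. The rest of the curve therefore
  contributes at least - C times its duration, which bounds the action of each subarc from
  above.\<close>

lemma bounded_actionI:
  assumes t01: "t0 < t1" and T: "{t0..t1} \<subseteq> T" and \<gamma>: "C1_curve A t0 t1 \<gamma>" "\<gamma> ` {t0..t1} \<subseteq> K"
    and C: "0 \<le> C" "\<And>p. p \<in> K \<Longrightarrow> time_bound t0 t1 C p"
    and B: "arc_action t0 t1 \<gamma> t0 t1 \<le> B"
  shows "bounded_action t0 t1 (B + C * (t1 - t0)) \<gamma>"
    and "t0 \<le> s \<Longrightarrow> s \<le> s' \<Longrightarrow> s' \<le> t1 \<Longrightarrow> - C * (s' - s) \<le> arc_action t0 t1 \<gamma> s s'"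
proof -
  let ?L = "\<lambda>t. Lagrangian t (\<gamma> t) (velocity A t0 t1 \<gamma> t)"
  note Lc = Lagrangian_continuous[OF t01 \<gamma>(1) T]
  have low: "- C * (s' - s) \<le> integral {s..s'} ?L" if "t0 \<le> s" "s \<le> s'" "s' \<le> t1" for s s'
  proof (rule has_integral_le)
    show "((\<lambda>_. - C) has_integral - C * (s' - s)) {s..s'}"
      using has_integral_const_real[of "- C" s s'] that by (simp add: algebra_simps)
    show "(?L has_integral integral {s..s'} ?L) {s..s'}"
      using that by (intro integrable_integral integrable_continuous_interval continuous_on_subset[OF Lc]) auto
    fix t assume t: "t \<in> {s..s'}"
    then have t': "t \<in> {t0..t1}" using that by auto
    then have "\<gamma> t \<in> K" using \<gamma>(2) by blast
    then show "- C \<le> ?L t" using time_boundD(5)[OF C(2) velocity_tangent[OF t01 \<gamma>(1) t'] t' t'] by simp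
  qed
  then show "t0 \<le> s \<Longrightarrow> s \<le> s' \<Longrightarrow> s' \<le> t1 \<Longrightarrow> - C * (s' - s) \<le> arc_action t0 t1 \<gamma> s s'"
    by (simp add: arc_action_def)
  show "bounded_action t0 t1 (B + C * (t1 - t0)) \<gamma>"
    unfolding bounded_action_def
  proof (intro conjI allI impI \<gamma>(1), elim conjE)
    fix s s' assume s: "t0 \<le> s" "s \<le> s'" "s' \<le> t1"
    have I: "?L integrable_on {t0..t1}" by (rule integrable_continuous_interval[OF Lc])
    have "?L integrable_on {t0..s'}"
      using s by (intro integrable_continuous_interval continuous_on_subset[OF Lc]) auto
    then have "integral {t0..s} ?L + integral {s..s'} ?L + integral {s'..t1} ?L = integral {t0..t1} ?L"
      using s I by (simp add: Henstock_Kurzweil_Integration.integral_combine)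
    moreover have "- C * (s - t0) \<le> integral {t0..s} ?L" "- C * (t1 - s') \<le> integral {s'..t1} ?L"
      using s low[of t0 s] low[of s' t1] by auto
    moreover have "C * (s - t0) + C * (t1 - s') \<le> C * (t1 - t0)"
      using mult_left_mono[OF s(2) C(1)] by (simp add: algebra_simps)
    ultimately show "integral {s..s'} ?L \<le> B + C * (t1 - t0)" using B by (simp add: arc_action_def)
  qed
qed

lemma arc_action_add:
  assumes "bounded_action t0 t1 B \<gamma>" "t0 < t1" "{t0..t1} \<subseteq> T" "t0 \<le> s" "s \<le> s'" "s' \<le> s''" "s'' \<le> t1"
  shows "arc_action t0 t1 \<gamma> s s' + arc_action t0 t1 \<gamma> s' s'' = arc_action t0 t1 \<gamma> s s''"
  unfolding arc_action_def using assms
  by (intro Henstock_Kurzweil_Integration.integral_combine integrable_continuous_interval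
      continuous_on_subset[OF Lagrangian_continuous[OF assms(2) bounded_actionD(1)[OF assms(1)] assms(3)]]) auto

lemma bounded_subsequence:
  fixes f :: "nat \<Rightarrow> real"
  assumes "\<And>n. f n \<in> {l..u}"
  obtains \<nu> x where "strict_mono \<nu>" "(f \<circ> \<nu>) \<longlonglongrightarrow> x"
  using assms compact_Icc[of l u] unfolding compact_eq_seq_compact_metric seq_compact_def by metis

text \<open>No uniform convergence is needed: the arcs are divided into a fixed number of parts of
  duration at most \<open>h\<close>, and only the division points and the partial actions have to
  converge. \<open>Y\<close> holds upper bounds for the actions, because the actions themselves need
  not converge.\<close>

theorem limit_of_arcs:
  assumes t01: "t0 < t1" and T: "{t0..t1} \<subseteq> T" and K: "compact K"
    and \<gamma>: "\<And>n. C1_curve A t0 t1 (\<gamma> n)" "\<And>n. \<gamma> n ` {t0..t1} \<subseteq> K" "\<And>n. arc_action t0 t1 (\<gamma> n) t0 t1 \<le> B0"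
    and \<sigma>: "\<And>n. t0 \<le> \<sigma> n" "\<And>n. \<sigma> n \<le> \<sigma>' n" "\<And>n. \<sigma>' n \<le> t1"
    and lim: "\<sigma> \<longlonglongrightarrow> s" "\<sigma>' \<longlonglongrightarrow> s'" "(\<lambda>n. \<gamma> n (\<sigma> n)) \<longlonglongrightarrow> z" "(\<lambda>n. \<gamma> n (\<sigma>' n)) \<longlonglongrightarrow> z'"
    and Y: "\<And>n. arc_action t0 t1 (\<gamma> n) (\<sigma> n) (\<sigma>' n) \<le> Y n" "Y \<longlonglongrightarrow> J"
  shows "(s', z', y + J) \<in> J_plus (s, z, y)"
proof -
  obtain C where C: "0 \<le> C" "\<And>p. p \<in> K \<Longrightarrow> time_bound t0 t1 C p"
    using time_bound_compact[OF T K] by metis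
  note bI = bounded_actionI[OF t01 T \<gamma>(1,2) C \<gamma>(3)]
  define B where "B = max 0 (B0 + C * (t1 - t0))"
  have bd: "bounded_action t0 t1 B (\<gamma> n)" for n
    using bI(1)[of n] unfolding bounded_action_def B_def by (meson max.coboundedI2)
  have B: "0 \<le> B" by (simp add: B_def)
  have low: "- C * (x' - x) \<le> arc_action t0 t1 (\<gamma> n) x x'" if "t0 \<le> x" "x \<le> x'" "x' \<le> t1" for n x x'
    by (rule bI(2)) (use that in auto)
  have le: "arc_action t0 t1 (\<gamma> n) x x' \<le> B" if "t0 \<le> x" "x \<le> x'" "x' \<le> t1" for n x x'
    using bounded_actionD(2)[OF bd that] by (simp add: arc_action_def)
  have arcs: "converging_arcs t0 t1 B \<gamma> \<sigma> \<sigma>' s z s' z'"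
    using bd \<sigma> lim by (simp add: converging_arcs_def)
  have s: "s \<in> {t0..t1}" "s' \<in> {t0..t1}" "s \<le> s'"
  proof -
    have "\<sigma> n \<in> {t0..t1}" "\<sigma>' n \<in> {t0..t1}" for n using \<sigma>(1)[of n] \<sigma>(2)[of n] \<sigma>(3)[of n] by auto
    then show "s \<in> {t0..t1}" "s' \<in> {t0..t1}"
      using closed_sequentially[OF closed_real_atLeastAtMost _ lim(1), of t0 t1]
        closed_sequentially[OF closed_real_atLeastAtMost _ lim(2), of t0 t1] by blast+
    show "s \<le> s'" by (rule LIMSEQ_le[OF lim(1,2)]) (use \<sigma>(2) in auto)
  qed
  show ?thesis
  proof (cases "s = s'")
    case True
    then have "z' = z" using converging_arcs_point[OF t01 T B] arcs by blast
    moreover have "0 \<le> J"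
    proof -
      have "(\<lambda>n. - C * (\<sigma>' n - \<sigma> n)) \<longlonglongrightarrow> - C * (s' - s)" by (intro tendsto_intros lim)
      then have "(\<lambda>n. - C * (\<sigma>' n - \<sigma> n)) \<longlonglongrightarrow> 0" using True by simp
      moreover have "- C * (\<sigma>' n - \<sigma> n) \<le> Y n" for n using low[OF \<sigma>, of n n] Y(1)[of n] by linarith
      ultimately show ?thesis by (intro LIMSEQ_le[OF _ Y(2)]) auto
    qed
    ultimately show ?thesis using J_plus_vertical[of s y "y + J" z] True s T by auto
  next
    case False
    then have ss: "s < s'" using s by simp
    obtain h where h: "0 < h" "\<And>z. z \<in> K \<Longrightarrow> arcs_close_up t0 t1 B h z"
      by (rule arcs_close_up_compact[OF t01 T B K]) blast
    \<comment> \<open>One number of parts serves for all arcs, since none lasts longer than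
      \<open>t1 - t0\<close>.\<close>
    obtain N where N: "(t1 - t0) / h < real N" using reals_Archimedean2 by blast
    have "0 < (t1 - t0) / h" using h t01 by simp
    then have N0: "0 < real N" using N by linarith
    have Nh: "(t1 - t0) / real N \<le> h" using N N0 h by (simp add: field_simps less_imp_le)
    define \<sigma>i where "\<sigma>i i n = \<sigma> n + real i / real N * (\<sigma>' n - \<sigma> n)" for i n
    have frac: "0 \<le> real i / real N" "real i / real N \<le> 1" if "i \<le> N" for i using that N0 by auto
    have \<sigma>i: "\<sigma> n \<le> \<sigma>i i n" "\<sigma>i i n \<le> \<sigma>' n" if "i \<le> N" for i n
    proof -
      have "0 \<le> real i / real N * (\<sigma>' n - \<sigma> n)" using frac[OF that] \<sigma>(2)[of n] by (intro mult_nonneg_nonneg) auto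
      moreover have "real i / real N * (\<sigma>' n - \<sigma> n) \<le> 1 * (\<sigma>' n - \<sigma> n)"
        using frac[OF that] \<sigma>(2)[of n] by (intro mult_right_mono) auto
      ultimately show "\<sigma> n \<le> \<sigma>i i n" "\<sigma>i i n \<le> \<sigma>' n" by (auto simp: \<sigma>i_def)
    qed
    have \<sigma>i': "t0 \<le> \<sigma>i i n" "\<sigma>i i n \<le> t1" if "i \<le> N" for i n
      using \<sigma>i[OF that, of n] \<sigma>(1)[of n] \<sigma>(3)[of n] by auto
    have step: "\<sigma>i (Suc i) n = \<sigma>i i n + (\<sigma>' n - \<sigma> n) / real N" for i n
      by (simp add: \<sigma>i_def add_divide_distrib diff_divide_distrib algebra_simps)
    have width: "0 \<le> (\<sigma>' n - \<sigma> n) / real N" "(\<sigma>' n - \<sigma> n) / real N \<le> h" for n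
    proof -
      show "0 \<le> (\<sigma>' n - \<sigma> n) / real N" using \<sigma>(2)[of n] N0 by simp
      have "(\<sigma>' n - \<sigma> n) / real N \<le> (t1 - t0) / real N"
        using \<sigma>(1)[of n] \<sigma>(3)[of n] N0 by (intro divide_right_mono) auto
      then show "(\<sigma>' n - \<sigma> n) / real N \<le> h" using Nh by linarith
    qed
    \<comment> \<open>Indices above \<open>N\<close> satisfy this trivially, so that the extraction
      step can be proved for every index.\<close>
    define conv where "conv i \<nu> \<longleftrightarrow> N < i \<or> (\<exists>p Z. (\<lambda>n. \<gamma> (\<nu> n) (\<sigma>i i (\<nu> n))) \<longlonglongrightarrow> p \<and> p \<in> K \<and>
        (\<lambda>n. arc_action t0 t1 (\<gamma> (\<nu> n)) (\<sigma> (\<nu> n)) (\<sigma>i i (\<nu> n))) \<longlonglongrightarrow> Z)" for i and \<nu> :: "nat \<Rightarrow> nat"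
    have "\<exists>\<nu>. strict_mono \<nu> \<and> (\<forall>i<Suc N. conv i \<nu>)"
    proof (rule common_subsequence)
      fix i and \<nu> :: "nat \<Rightarrow> nat" assume \<nu>: "strict_mono \<nu>"
      show "\<exists>\<nu>'. strict_mono \<nu>' \<and> conv i (\<nu> \<circ> \<nu>')"
      proof (cases "N < i")
        case True
        then show ?thesis by (intro exI[of _ id]) (auto simp: conv_def strict_mono_def)
      next
        case False
        then have i: "i \<le> N" by simp
        define F where "F n = \<gamma> (\<nu> n) (\<sigma>i i (\<nu> n))" for n
        have "F n \<in> K" for n
          using \<gamma>(2)[of "\<nu> n"] \<sigma>i'[OF i, of "\<nu> n"] by (force simp: image_subset_iff F_def)
        then obtain p \<nu>1 where 1: "p \<in> K" "strict_mono \<nu>1" "(F \<circ> \<nu>1) \<longlonglongrightarrow> p"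
          using compact_subsequence[OF K, of F] by metis
        then have 1: "p \<in> K" "strict_mono \<nu>1" "(\<lambda>n. \<gamma> (\<nu> (\<nu>1 n)) (\<sigma>i i (\<nu> (\<nu>1 n)))) \<longlonglongrightarrow> p"
          by (simp_all add: F_def o_def)
        define f where "f n = arc_action t0 t1 (\<gamma> (\<nu> (\<nu>1 n))) (\<sigma> (\<nu> (\<nu>1 n))) (\<sigma>i i (\<nu> (\<nu>1 n)))" for n
        have "f n \<in> {- C * (t1 - t0)..B}" for n
        proof -
          let ?n = "\<nu> (\<nu>1 n)"
          have "C * (\<sigma>i i ?n - \<sigma> ?n) \<le> C * (t1 - t0)"
            using C(1) \<sigma>(1)[of ?n] \<sigma>i'[OF i, of ?n] by (intro mult_left_mono) auto
          then show ?thesis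
            using low[OF \<sigma>(1) \<sigma>i(1)[OF i] \<sigma>i'(2)[OF i], of ?n ?n] le[OF \<sigma>(1) \<sigma>i(1)[OF i] \<sigma>i'(2)[OF i], of ?n ?n]
            by (simp add: f_def)
        qed
        then obtain \<nu>2 Z where 2: "strict_mono \<nu>2" "(f \<circ> \<nu>2) \<longlonglongrightarrow> Z"
          using bounded_subsequence[of f] by metis
        have "(\<lambda>n. \<gamma> (\<nu> (\<nu>1 (\<nu>2 n))) (\<sigma>i i (\<nu> (\<nu>1 (\<nu>2 n))))) \<longlonglongrightarrow> p"
          using LIMSEQ_subseq_LIMSEQ[OF 1(3) 2(1)] by (simp add: o_def)
        then have "conv i (\<nu> \<circ> (\<nu>1 \<circ> \<nu>2))" using 2(2) 1(1) by (auto simp: conv_def f_def o_def)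
        moreover have "strict_mono (\<nu>1 \<circ> \<nu>2)" using 1(2) 2(1) by (rule strict_mono_o)
        ultimately show ?thesis by blast
      qed
    next
      fix i and \<nu> \<nu>' :: "nat \<Rightarrow> nat" assume c: "conv i \<nu>" and m: "strict_mono \<nu>'"
      show "conv i (\<nu> \<circ> \<nu>')"
      proof (cases "N < i")
        case False
        then obtain p Z where "(\<lambda>n. \<gamma> (\<nu> n) (\<sigma>i i (\<nu> n))) \<longlonglongrightarrow> p" "p \<in> K"
          "(\<lambda>n. arc_action t0 t1 (\<gamma> (\<nu> n)) (\<sigma> (\<nu> n)) (\<sigma>i i (\<nu> n))) \<longlonglongrightarrow> Z" using c by (auto simp: conv_def)
        from this(2) LIMSEQ_subseq_LIMSEQ[OF this(1) m] LIMSEQ_subseq_LIMSEQ[OF this(3) m]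
        show ?thesis by (auto simp: conv_def o_def)
      qed (simp add: conv_def)
    qed
    then obtain \<nu> where \<nu>: "strict_mono \<nu>" "\<And>i. i \<le> N \<Longrightarrow> conv i \<nu>" unfolding less_Suc_eq_le by blast
    define lims where "lims i p Z \<longleftrightarrow> (\<lambda>n. \<gamma> (\<nu> n) (\<sigma>i i (\<nu> n))) \<longlonglongrightarrow> p \<and> p \<in> K \<and>
        (\<lambda>n. arc_action t0 t1 (\<gamma> (\<nu> n)) (\<sigma> (\<nu> n)) (\<sigma>i i (\<nu> n))) \<longlonglongrightarrow> Z" for i p Z
    have "\<exists>p Z. lims i p Z" if "i \<le> N" for i
      using \<nu>(2)[OF that] that by (auto simp: conv_def lims_def)
    then obtain p Z where "\<And>i. i \<le> N \<Longrightarrow> lims i (p i) (Z i)" by metis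
    then have p: "\<And>i. i \<le> N \<Longrightarrow> (\<lambda>n. \<gamma> (\<nu> n) (\<sigma>i i (\<nu> n))) \<longlonglongrightarrow> p i" "\<And>i. i \<le> N \<Longrightarrow> p i \<in> K"
      and Z: "\<And>i. i \<le> N \<Longrightarrow> (\<lambda>n. arc_action t0 t1 (\<gamma> (\<nu> n)) (\<sigma> (\<nu> n)) (\<sigma>i i (\<nu> n))) \<longlonglongrightarrow> Z i"
      by (simp_all add: lims_def)
    define si where "si i = s + real i / real N * (s' - s)" for i
    have lim\<nu>: "(\<lambda>n. \<sigma> (\<nu> n)) \<longlonglongrightarrow> s" "(\<lambda>n. \<sigma>' (\<nu> n)) \<longlonglongrightarrow> s'"
      "(\<lambda>n. \<gamma> (\<nu> n) (\<sigma> (\<nu> n))) \<longlonglongrightarrow> z" "(\<lambda>n. \<gamma> (\<nu> n) (\<sigma>' (\<nu> n))) \<longlonglongrightarrow> z'" "(\<lambda>n. Y (\<nu> n)) \<longlonglongrightarrow> J"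
      using LIMSEQ_subseq_LIMSEQ[OF lim(1) \<nu>(1)] LIMSEQ_subseq_LIMSEQ[OF lim(2) \<nu>(1)]
        LIMSEQ_subseq_LIMSEQ[OF lim(3) \<nu>(1)] LIMSEQ_subseq_LIMSEQ[OF lim(4) \<nu>(1)]
        LIMSEQ_subseq_LIMSEQ[OF Y(2) \<nu>(1)] by (simp_all add: o_def)
    have si: "(\<lambda>n. \<sigma>i i (\<nu> n)) \<longlonglongrightarrow> si i" for i
      unfolding \<sigma>i_def si_def by (intro tendsto_intros lim\<nu>)
    have link: "(si (Suc i), p (Suc i), y + Z (Suc i)) \<in> J_plus (si i, p i, y + Z i)" if i: "Suc i \<le> N" for i
    proof -
      have i': "i \<le> N" using i by simp
      have "converging_arcs t0 t1 B (\<lambda>n. \<gamma> (\<nu> n)) (\<lambda>n. \<sigma>i i (\<nu> n)) (\<lambda>n. \<sigma>i (Suc i) (\<nu> n)) (si i) (p i) (si (Suc i)) (p (Suc i))"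
        unfolding converging_arcs_def
      proof (intro conjI allI)
        show "\<sigma>i i (\<nu> n) \<le> \<sigma>i (Suc i) (\<nu> n)" for n using width(1)[of "\<nu> n"] by (simp add: step)
      qed (use bd \<sigma>i' i i' si p in auto)
      moreover have "si i < si (Suc i)" using ss N0 by (simp add: si_def divide_simps)
      moreover have "\<forall>n. \<sigma>i (Suc i) (\<nu> n) - \<sigma>i i (\<nu> n) \<le> h" using width(2) by (simp add: step)
      moreover have "(\<lambda>n. arc_action t0 t1 (\<gamma> (\<nu> n)) (\<sigma>i i (\<nu> n)) (\<sigma>i (Suc i) (\<nu> n))) \<longlonglongrightarrow> Z (Suc i) - Z i"
      proof -
        have "arc_action t0 t1 (\<gamma> n) (\<sigma>i i n) (\<sigma>i (Suc i) n) =
            arc_action t0 t1 (\<gamma> n) (\<sigma> n) (\<sigma>i (Suc i) n) - arc_action t0 t1 (\<gamma> n) (\<sigma> n) (\<sigma>i i n)" for n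
        proof -
          have "\<sigma>i i n \<le> \<sigma>i (Suc i) n" using width(1)[of n] by (simp add: step)
          then show ?thesis
            using arc_action_add[OF bd[of n] t01 T \<sigma>(1)[of n] \<sigma>i(1)[OF i', of n] _ \<sigma>i'(2)[OF i, of n]] by simp
        qed
        then show ?thesis using tendsto_diff[OF Z[OF i] Z[OF i']] by simp
      qed
      ultimately have "(si (Suc i), p (Suc i), (y + Z i) + (Z (Suc i) - Z i)) \<in> J_plus (si i, p i, y + Z i)"
        using h(2)[OF p(2)[OF i']] unfolding arcs_close_up_def by blast
      then show ?thesis by simp
    qed
    have chain: "(si i, p i, y + Z i) \<in> J_plus (si 0, p 0, y + Z 0)" if "i \<le> N" for i
      using that
    proof (induction i)
      case 0 then show ?case by (simp add: J_plus_def)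
    next
      case (Suc i)
      then show ?case using link[of i] J_plus_trans by simp
    qed
    have NN: "real N \<noteq> 0" using N0 by simp
    have "\<sigma>i 0 n = \<sigma> n" "\<sigma>i N n = \<sigma>' n" for n using NN by (simp_all add: \<sigma>i_def)
    then have "p 0 = z" "p N = z'" and Z0: "Z 0 = 0" and ZN: "(\<lambda>n. arc_action t0 t1 (\<gamma> (\<nu> n)) (\<sigma> (\<nu> n)) (\<sigma>' (\<nu> n))) \<longlonglongrightarrow> Z N"
      using LIMSEQ_unique[OF p(1)[of 0]] LIMSEQ_unique[OF p(1)[of N]] lim\<nu>(3,4) Z[of 0] Z[of N]
        tendsto_unique[OF sequentially_bot p(1)[of 0] ] tendsto_unique[OF sequentially_bot p(1)[of N]]
      by (auto simp: arc_action_def LIMSEQ_const_iff)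
    moreover have "si 0 = s" "si N = s'" using NN by (simp_all add: si_def)
    ultimately have "(s', z', y + Z N) \<in> J_plus (s, z, y)" using chain[of N] by simp
    moreover have "Z N \<le> J" by (rule LIMSEQ_le[OF ZN lim\<nu>(5)]) (use Y(1) in auto)
    \<comment> \<open>The limit of the actions may lie below the limit of their bounds; the
      difference is made up along the fibre.\<close>
    then have "(s', z', y + J) \<in> J_plus (s', z', y + Z N)" using s T by (intro J_plus_vertical) auto
    ultimately show ?thesis by (rule J_plus_trans)
  qed
qed

end

section \<open>Global hyperbolicity\<close>

lemma dist_inverse_Suc_tendsto:
  assumes "\<And>n. dist l (g n) < inverse (real (Suc n))"
  shows "g \<longlonglongrightarrow> l"
proof (subst tendsto_dist_iff, rule Lim_null_comparison[OF _ LIMSEQ_inverse_real_of_nat])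
  show "\<forall>\<^sub>F n in sequentially. norm (dist (g n) l) \<le> inverse (real (Suc n))"
    using assms by (intro always_eventually allI) (simp add: dist_commute less_imp_le)
qed

context generalized_gravitational_wave
begin

section \<open>Causality\<close>

text \<open>If the time does not increase, it is constant; then the \<open>y\<close> component of
  the velocity is w, which cannot vanish together with \<tau> for a causal vector.\<close>

lemma future_causal_C1_curve_lex:
  assumes ab: "\<alpha> < \<beta>" and \<gamma>: "future_causal_C1_curve \<alpha> \<beta> \<gamma>"
  shows "fst (\<gamma> \<alpha>) < fst (\<gamma> \<beta>) \<or> fst (\<gamma> \<alpha>) = fst (\<gamma> \<beta>) \<and> snd (snd (\<gamma> \<alpha>)) < snd (snd (\<gamma> \<beta>))"
proof -
  have C: "C1_curve_M \<alpha> \<beta> \<gamma>"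
    and fc: "\<And>s. s \<in> {\<alpha>..\<beta>} \<Longrightarrow> future_causal_vector (\<gamma> s) (velocity_M \<alpha> \<beta> \<gamma> s)"
    using \<gamma> by (auto simp: future_causal_C1_curve_def)
  note D = C1_curve_M_D[OF C]
  have wc: "weakly_causal (\<gamma> s) (velocity_M \<alpha> \<beta> \<gamma> s) \<and>
      (fst (velocity_M \<alpha> \<beta> \<gamma> s) \<noteq> 0 \<or> excess (\<gamma> s) (velocity_M \<alpha> \<beta> \<gamma> s) \<noteq> 0)" if "s \<in> {\<alpha>..\<beta>}" for s
    using fc[OF that] future_causal_vector_iff[OF D(3)[OF that] C1_curve_M_tangent[OF ab C that]] by simp
  then have wc': "\<And>s. s \<in> {\<alpha>..\<beta>} \<Longrightarrow> weakly_causal (\<gamma> s) (velocity_M \<alpha> \<beta> \<gamma> s)" by blast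
  show ?thesis
  proof (cases "fst (\<gamma> \<alpha>) = fst (\<gamma> \<beta>)")
    case False
    then show ?thesis using weakly_causal_time_mono[OF C wc', of \<alpha> \<beta>] ab by simp
  next
    case True
    have "0 < snd (snd (velocity_M \<alpha> \<beta> \<gamma> s))" if s: "s \<in> {\<alpha>..\<beta>}" for s
      using wc[OF s] weakly_causal_constant_time(1,3)[OF ab C wc' True s] by (simp add: weakly_causal_def)
    from pos_derivative_imp_strict_mono[OF ab D(6) this] show ?thesis using True by simp
  qed
qed

lemma spacetime_causal: causal
  unfolding causal_def
proof (intro notI, elim exE conjE)
  fix \<alpha> \<beta> \<gamma> assume \<gamma>: "future_causal_curve \<alpha> \<beta> \<gamma>" "\<gamma> \<alpha> = \<gamma> \<beta>"
  obtain n p where p: "0 < n" "p 0 = \<alpha>" "p n = \<beta>" "\<And>i. i < n \<Longrightarrow> p i < p (Suc i)"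
    and pc: "\<And>i. i < n \<Longrightarrow> future_causal_C1_curve (p i) (p (Suc i)) \<gamma>"
    using \<gamma>(1) unfolding future_causal_curve_def by blast
  define less where "less x x' \<longleftrightarrow> fst x < fst x' \<or> fst x = fst x' \<and> snd (snd x) < snd (snd x')"
    for x x' :: "real \<times> 'q \<times> real"
  have "less (\<gamma> (p 0)) (\<gamma> (p (Suc i)))" if "i < n" for i
    using that
  proof (induction i)
    case 0 then show ?case using future_causal_C1_curve_lex[OF p(4) pc] by (simp add: less_def)
  next
    case (Suc i)
    then have "less (\<gamma> (p 0)) (\<gamma> (p (Suc i)))" by simp
    moreover have "less (\<gamma> (p (Suc i))) (\<gamma> (p (Suc (Suc i))))"
      using future_causal_C1_curve_lex[OF p(4) pc] Suc by (simp add: less_def)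
    ultimately show ?case by (auto simp: less_def)
  qed
  from this[of "n - 1"] have "less (\<gamma> \<alpha>) (\<gamma> \<beta>)" using p by simp
  then show False using \<gamma>(2) by (simp add: less_def)
qed

lemma J_plus_time_le:
  assumes "x \<in> M" "x' \<in> J_plus x" shows "fst x \<le> fst x'"
proof -
  obtain \<gamma> where \<gamma>: "weakly_causal_curve 0 1 \<gamma>" "\<gamma> 0 = x" "\<gamma> 1 = x'" using J_plus_weakly_causal_curve[OF assms, of 0 1] by auto
  then show ?thesis using weakly_causal_curve_mono[OF \<gamma>(1), of 0 1] by simp
qed

lemma J_plus_same_time:
  assumes "x \<in> M" "x' \<in> J_plus x" "fst x = fst x'"
  shows "fst (snd x) = fst (snd x')" "snd (snd x) \<le> snd (snd x')"
proof -
  obtain \<gamma> where \<gamma>: "weakly_causal_curve 0 1 \<gamma>" "\<gamma> 0 = x" "\<gamma> 1 = x'" using J_plus_weakly_causal_curve[OF assms(1,2), of 0 1] by auto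
  show "fst (snd x) = fst (snd x')" "snd (snd x) \<le> snd (snd x')"
    using weakly_causal_curve_vertical[OF \<gamma>(1)] \<gamma>(2,3) assms(3) by auto
qed

lemma J_plus_M:
  assumes "x \<in> M" "x' \<in> J_plus x" shows "x' \<in> M"
proof -
  obtain \<gamma> where \<gamma>: "weakly_causal_curve 0 1 \<gamma>" "\<gamma> 0 = x" "\<gamma> 1 = x'" using J_plus_weakly_causal_curve[OF assms, of 0 1] by auto
  then have "C1_curve_M 0 1 \<gamma>" by (simp add: weakly_causal_curve_def)
  then have "\<gamma> 1 \<in> M" unfolding C1_curve_M_def by auto
  then show ?thesis using \<gamma>(3) by simp
qed

section \<open>Compactness of causal diamonds\<close>

text \<open>The causal curves to and from \<open>x\<close> are joined before they are approximated.
  This yields one curve between the tips, to which coercivity applies, and it still passes through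
  the \<open>Q\<close> component of \<open>x\<close> at nearly the right time.\<close>

lemma diamond_approximation:
  assumes x0: "x0 \<in> M" and x: "x \<in> J_plus x0 \<inter> J_minus x1" and t: "fst x0 < fst x1" and \<delta>: "0 < \<delta>"
  obtains q z where "C1_curve A (fst x0) (fst x1) q" "q (fst x0) = fst (snd x0)" "q (fst x1) = fst (snd x1)"
    "z \<in> {fst x0..fst x1}" "\<bar>z - fst x\<bar> \<le> \<delta>" "q z = fst (snd x)"
    "arc_action (fst x0) (fst x1) q (fst x0) z \<le> snd (snd x) - snd (snd x0) + \<delta>"
    "arc_action (fst x0) (fst x1) q z (fst x1) \<le> snd (snd x1) - snd (snd x) + \<delta>"
proof -
  have J: "x \<in> J_plus x0" "x1 \<in> J_plus x" using x by (auto simp: J_minus_iff)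
  obtain \<gamma>1 where 1: "weakly_causal_curve 0 1 \<gamma>1" "\<gamma>1 0 = x0" "\<gamma>1 1 = x" using J_plus_weakly_causal_curve[OF x0 J(1), of 0 1] by auto
  obtain \<gamma>2 where 2: "weakly_causal_curve 1 2 \<gamma>2" "\<gamma>2 1 = x" "\<gamma>2 2 = x1"
    using J_plus_weakly_causal_curve[OF J_plus_M[OF x0 J(1)] J(2), of 1 2] by auto
  define \<gamma> where "\<gamma> s = (if s \<le> 1 then \<gamma>1 s else \<gamma>2 s)" for s
  have wc: "weakly_causal_curve 0 2 \<gamma>" unfolding \<gamma>_def using 1 2 by (intro weakly_causal_curve_join) auto
  have \<gamma>: "\<gamma> 0 = x0" "\<gamma> 1 = x" "\<gamma> 2 = x1" using 1 2 by (auto simp: \<gamma>_def)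
  have "fst (\<gamma> 0) = fst x0" "fst (\<gamma> 2) = fst x1" by (simp_all add: \<gamma>)
  from weakly_causal_curve_approximation[OF wc this t \<delta>] obtain q where q: "C1_curve A (fst x0) (fst x1) q"
    "q (fst x0) = fst (snd (\<gamma> 0))" "q (fst x1) = fst (snd (\<gamma> 2))"
    "\<And>s. s \<in> {0..2} \<Longrightarrow> \<exists>z\<in>{fst x0..fst x1}. \<bar>z - fst (\<gamma> s)\<bar> \<le> \<delta> \<and> q z = fst (snd (\<gamma> s)) \<and>
      arc_action (fst x0) (fst x1) q (fst x0) z \<le> snd (snd (\<gamma> s)) - snd (snd (\<gamma> 0)) + \<delta> \<and>
      arc_action (fst x0) (fst x1) q z (fst x1) \<le> snd (snd (\<gamma> 2)) - snd (snd (\<gamma> s)) + \<delta>"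
    unfolding arc_action_def by blast
  from q(4)[of 1] obtain z where "z \<in> {fst x0..fst x1}" "\<bar>z - fst (\<gamma> 1)\<bar> \<le> \<delta>" "q z = fst (snd (\<gamma> 1))"
      "arc_action (fst x0) (fst x1) q (fst x0) z \<le> snd (snd (\<gamma> 1)) - snd (snd (\<gamma> 0)) + \<delta>"
      "arc_action (fst x0) (fst x1) q z (fst x1) \<le> snd (snd (\<gamma> 2)) - snd (snd (\<gamma> 1)) + \<delta>" by auto
  with q(1-3) show ?thesis unfolding \<gamma> by (rule that)
qed

text \<open>A chart around the middle component supplies a countable base of neighbourhoods.\<close>

lemma closure_sequence:
  fixes D :: "(real \<times> 'q \<times> real) set"
  assumes "x \<in> closure D"
  obtains f where "\<And>n. f n \<in> D" "f \<longlonglongrightarrow> x"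
proof -
  obtain t q y where x: "x = (t, q, y)" by (cases x) auto
  obtain c where c: "c \<in> A" "q \<in> fst c" by (rule chart_exists)
  define N where "N n = {p \<in> fst c. snd c p \<in> ball (snd c q) (inverse (real (Suc n)))}" for n
  define U where "U n = ball t (inverse (real (Suc n))) \<times> N n \<times> ball y (inverse (real (Suc n)))" for n
  have "\<exists>f. f \<in> D \<inter> U n" for n
  proof -
    have "open (U n)" unfolding U_def N_def by (intro open_Times open_ball open_chart_ball[OF c(1)])
    moreover have "x \<in> U n" using c by (simp add: U_def N_def x)
    ultimately have "U n \<inter> D \<noteq> {}" using assms open_Int_closure_eq_empty[of "U n" D] by blast
    then show ?thesis by blast
  qed
  then obtain f where f: "\<And>n. f n \<in> D" "\<And>n. f n \<in> U n" by (metis IntD1 IntD2)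
  have f': "dist t (fst (f n)) < inverse (real (Suc n))" "fst (snd (f n)) \<in> fst c"
    "dist (snd c q) (snd c (fst (snd (f n)))) < inverse (real (Suc n))"
    "dist y (snd (snd (f n))) < inverse (real (Suc n))" for n
    using f(2)[of n] by (auto simp: U_def N_def)
  have "(\<lambda>n. fst (f n)) \<longlonglongrightarrow> t" "(\<lambda>n. snd (snd (f n))) \<longlonglongrightarrow> y"
    by (intro dist_inverse_Suc_tendsto f')+
  moreover have "(\<lambda>n. fst (snd (f n))) \<longlonglongrightarrow> q"
    by (intro chart_tendsto[OF c] dist_inverse_Suc_tendsto f' always_eventually allI)
  ultimately have "(\<lambda>n. (fst (f n), fst (snd (f n)), snd (snd (f n)))) \<longlonglongrightarrow> x"
    unfolding x by (intro tendsto_Pair)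
  then show ?thesis using f(1) by (intro that[of f]) simp_all
qed

lemma compact_diamond:
  assumes x0: "x0 \<in> M" and x1: "x1 \<in> M" and t: "fst x0 < fst x1"
    and coer: "coercive (fst x0, fst (snd x0)) (fst x1, fst (snd x1))"
  shows "compact (J_plus x0 \<inter> J_minus x1)"
proof -
  let ?D = "J_plus x0 \<inter> J_minus x1"
  define t0 where "t0 = fst x0"
  define t1 where "t1 = fst x1"
  define y0 where "y0 = snd (snd x0)"
  define y1 where "y1 = snd (snd x1)"
  have t01: "t0 < t1" using t by (simp add: t0_def t1_def)
  have T: "{t0..t1} \<subseteq> T" using x0 x1 by (intro T_Icc) (auto simp: t0_def t1_def M_def)
  obtain K where K: "compact K" "\<And>\<gamma>. \<gamma> \<in> C1_curves_between (fst x0, fst (snd x0)) (fst x1, fst (snd x1)) \<Longrightarrow>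
      action (fst x0, fst (snd x0)) (fst x1, fst (snd x1)) \<gamma> \<le> y1 - y0 + 2 \<Longrightarrow> \<gamma> ` {t0..t1} \<subseteq> K"
    using coercive_uniform[OF coer, where B = "y1 - y0 + 2"] by (auto simp: t0_def t1_def)
  obtain C where C: "0 \<le> C" "\<And>p. p \<in> K \<Longrightarrow> time_bound t0 t1 C p" using time_bound_compact[OF T K(1)] by metis
  \<comment> \<open>For \<delta> \<le> 1 the two partial actions add up to at most
    \<open>y1 - y0 + 2\<close>, the level for which \<open>K\<close> was chosen.\<close>
  have approx: "\<exists>q z. C1_curve A t0 t1 q \<and> q ` {t0..t1} \<subseteq> K \<and> arc_action t0 t1 q t0 t1 \<le> y1 - y0 + 2 \<and>
      q t0 = fst (snd x0) \<and> q t1 = fst (snd x1) \<and>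
      z \<in> {t0..t1} \<and> \<bar>z - fst x\<bar> \<le> \<delta> \<and> q z = fst (snd x) \<and>
      arc_action t0 t1 q t0 z \<le> snd (snd x) - y0 + \<delta> \<and> arc_action t0 t1 q z t1 \<le> y1 - snd (snd x) + \<delta>"
    if x: "x \<in> ?D" and \<delta>: "0 < \<delta>" "\<delta> \<le> 1" for x \<delta>
  proof -
    obtain q z where q: "C1_curve A t0 t1 q" "q t0 = fst (snd x0)" "q t1 = fst (snd x1)"
      "z \<in> {t0..t1}" "\<bar>z - fst x\<bar> \<le> \<delta>" "q z = fst (snd x)"
      "arc_action t0 t1 q t0 z \<le> snd (snd x) - y0 + \<delta>" "arc_action t0 t1 q z t1 \<le> y1 - snd (snd x) + \<delta>"
      using diamond_approximation[OF x0 x t \<delta>(1)] unfolding t0_def t1_def y0_def y1_def by blast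
    have "arc_action t0 t1 q t0 z + arc_action t0 t1 q z t1 = arc_action t0 t1 q t0 t1"
      unfolding arc_action_def using q(4) t01
      by (intro Henstock_Kurzweil_Integration.integral_combine integrable_continuous_interval
          Lagrangian_continuous[OF t01 q(1) T]) auto
    then have act: "arc_action t0 t1 q t0 t1 \<le> y1 - y0 + 2" using q(7,8) \<delta>(2) by linarith
    have "q ` {t0..t1} \<subseteq> K"
    proof (rule K(2))
      show "q \<in> C1_curves_between (fst x0, fst (snd x0)) (fst x1, fst (snd x1))"
        using q(1-3) by (simp add: C1_curves_between_def t0_def t1_def)
      show "action (fst x0, fst (snd x0)) (fst x1, fst (snd x1)) q \<le> y1 - y0 + 2"
        using act by (simp add: action_def arc_action_def t0_def t1_def)
    qed
    with q act show ?thesis by blast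
  qed
  \<comment> \<open>Each partial action is at least - C (t1 - t0), and its upper bound contains the
    height of the point; the two parts bound this height from both sides.\<close>
  define I where "I = {y0 - 1 - C * (t1 - t0)..y1 + 1 + C * (t1 - t0)}"
  have "?D \<subseteq> {t0..t1} \<times> K \<times> I"
  proof
    fix x assume x: "x \<in> ?D"
    have J: "x \<in> J_plus x0" "x1 \<in> J_plus x" using x by (auto simp: J_minus_iff)
    have "fst x \<in> {t0..t1}"
      using J_plus_time_le[OF x0 J(1)] J_plus_time_le[OF J_plus_M[OF x0 J(1)] J(2)] by (simp add: t0_def t1_def)
    moreover obtain q z where q: "C1_curve A t0 t1 q" "q ` {t0..t1} \<subseteq> K" "arc_action t0 t1 q t0 t1 \<le> y1 - y0 + 2"
      "z \<in> {t0..t1}" "q z = fst (snd x)"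
      "arc_action t0 t1 q t0 z \<le> snd (snd x) - y0 + 1" "arc_action t0 t1 q z t1 \<le> y1 - snd (snd x) + 1"
      using approx[OF x, of 1] by auto
    moreover have "fst (snd x) \<in> K" using q(2,4,5) by (metis imageI subsetD)
    moreover have "snd (snd x) \<in> I"
    proof -
      note low = bounded_actionI(2)[OF t01 T q(1,2) C q(3)]
      have "C * (z - t0) \<le> C * (t1 - t0)" "C * (t1 - z) \<le> C * (t1 - t0)"
        using C(1) q(4) by (auto intro!: mult_left_mono)
      then show ?thesis using low[of t0 z] low[of z t1] q(4,6,7) by (simp add: I_def)
    qed
    ultimately show "x \<in> {t0..t1} \<times> K \<times> I" by (simp add: mem_Times_iff)
  qed
  moreover have "compact ({t0..t1} \<times> K \<times> I)" unfolding I_def by (intro compact_Times K(1) compact_Icc)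
  moreover have "closed ?D"
  proof -
    have "x \<in> ?D" if x: "x \<in> closure ?D" for x
    proof -
      obtain f where f: "\<And>n. f n \<in> ?D" "f \<longlonglongrightarrow> x" by (rule closure_sequence[OF x]) blast
      define \<delta> where "\<delta> n = inverse (real (Suc n))" for n
      have \<delta>: "0 < \<delta> n" "\<delta> n \<le> 1" for n by (auto simp: \<delta>_def field_simps)
      have \<delta>0: "\<delta> \<longlonglongrightarrow> 0" unfolding \<delta>_def by (rule LIMSEQ_inverse_real_of_nat)
      have "\<forall>n. \<exists>q z. C1_curve A t0 t1 q \<and> q ` {t0..t1} \<subseteq> K \<and> arc_action t0 t1 q t0 t1 \<le> y1 - y0 + 2 \<and>
        q t0 = fst (snd x0) \<and> q t1 = fst (snd x1) \<and>
        z \<in> {t0..t1} \<and> \<bar>z - fst (f n)\<bar> \<le> \<delta> n \<and> q z = fst (snd (f n)) \<and>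
        arc_action t0 t1 q t0 z \<le> snd (snd (f n)) - y0 + \<delta> n \<and> arc_action t0 t1 q z t1 \<le> y1 - snd (snd (f n)) + \<delta> n"
        using approx[OF f(1) \<delta>] by blast
      then obtain q z where q: "\<And>n. C1_curve A t0 t1 (q n)" "\<And>n. q n ` {t0..t1} \<subseteq> K"
        "\<And>n. arc_action t0 t1 (q n) t0 t1 \<le> y1 - y0 + 2" "\<And>n. q n t0 = fst (snd x0)" "\<And>n. q n t1 = fst (snd x1)"
        and z: "\<And>n. z n \<in> {t0..t1}" "\<And>n. \<bar>z n - fst (f n)\<bar> \<le> \<delta> n" "\<And>n. q n (z n) = fst (snd (f n))"
        and act: "\<And>n. arc_action t0 t1 (q n) t0 (z n) \<le> snd (snd (f n)) - y0 + \<delta> n"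
          "\<And>n. arc_action t0 t1 (q n) (z n) t1 \<le> y1 - snd (snd (f n)) + \<delta> n"
        by metis
      have lim: "(\<lambda>n. fst (f n)) \<longlonglongrightarrow> fst x" "(\<lambda>n. fst (snd (f n))) \<longlonglongrightarrow> fst (snd x)" "(\<lambda>n. snd (snd (f n))) \<longlonglongrightarrow> snd (snd x)"
        by (intro tendsto_fst tendsto_snd f(2))+
      have "(\<lambda>n. z n - fst (f n)) \<longlonglongrightarrow> 0"
        by (rule Lim_null_comparison[OF _ \<delta>0]) (use z(2) in auto)
      from tendsto_add[OF this lim(1)] have zl: "z \<longlonglongrightarrow> fst x" by simp
      have qz: "(\<lambda>n. q n (z n)) \<longlonglongrightarrow> fst (snd x)" using lim(2) by (simp add: z(3))
      have z': "t0 \<le> z n" "z n \<le> t1" for n using z(1)[of n] by auto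
      have q0: "(\<lambda>n. q n t0) \<longlonglongrightarrow> fst (snd x0)" "(\<lambda>n. q n t1) \<longlonglongrightarrow> fst (snd x1)" by (simp_all add: q)
      have l0: "(\<lambda>n. snd (snd (f n)) - y0 + \<delta> n) \<longlonglongrightarrow> snd (snd x) - y0 + 0"
        and l1: "(\<lambda>n. y1 - snd (snd (f n)) + \<delta> n) \<longlonglongrightarrow> y1 - snd (snd x) + 0"
        by (intro tendsto_intros lim \<delta>0)+
      \<comment> \<open>The arcs before and after \<open>z n\<close> are treated separately. The
        limits of their action bounds are the height differences, so the limit arcs meet exactly at
        \<open>x\<close>.\<close>
      have "(fst x, fst (snd x), y0 + (snd (snd x) - y0 + 0)) \<in> J_plus (t0, fst (snd x0), y0)"
        by (rule limit_of_arcs[OF t01 T K(1) q(1-3) _ z' tendsto_const zl q0(1) qz act(1) l0]) simp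
      moreover have "(t1, fst (snd x1), snd (snd x) + (y1 - snd (snd x) + 0)) \<in> J_plus (fst x, fst (snd x), snd (snd x))"
        by (rule limit_of_arcs[OF t01 T K(1) q(1-3) z' _ zl tendsto_const qz q0(2) act(2) l1]) simp
      ultimately show ?thesis by (simp add: J_minus_iff t0_def t1_def y0_def y1_def)
    qed
    then have "closure ?D \<subseteq> ?D" by blast
    then show ?thesis by (metis closed_closure closure_subset subset_antisym)
  qed
  ultimately show ?thesis by (metis compact_Int_closed inf.absorb_iff2 inf_commute)
qed

theorem coercive_imp_globally_hyperbolic:
  assumes coer: "\<And>t0 q0 t1 q1. t0 \<in> T \<Longrightarrow> t1 \<in> T \<Longrightarrow> t0 < t1 \<Longrightarrow> coercive (t0, q0) (t1, q1)"
  shows globally_hyperbolic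
  unfolding globally_hyperbolic_def
proof (intro conjI ballI spacetime_causal)
  fix x0 x1 assume x: "x0 \<in> M" "x1 \<in> M"
  have T: "fst x0 \<in> T" "fst x1 \<in> T" using x by (auto simp: M_def)
  let ?D = "J_plus x0 \<inter> J_minus x1"
  consider "fst x0 < fst x1" | "fst x1 < fst x0" | "fst x0 = fst x1" by linarith
  then show "compact ?D"
  proof cases
    case 1
    then show ?thesis using coer[OF T 1] by (intro compact_diamond x) auto
  next
    case 2
    have "?D = {}"
    proof (rule ccontr)
      assume "?D \<noteq> {}"
      then obtain x where "x \<in> J_plus x0" "x1 \<in> J_plus x" by (auto simp: J_minus_iff)
      then show False using J_plus_time_le[OF x(1) J_plus_trans[of x x0 x1]] 2 by simp
    qed
    then show ?thesis by simp
  next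
    case 3
    obtain t q0 y0 where x0: "x0 = (t, q0, y0)" by (cases x0) auto
    obtain q1 y1 where x1: "x1 = (t, q1, y1)" using 3 x0 by (cases x1) auto
    \<comment> \<open>Without lapse of time causal curves move in the \<open>y\<close> direction
      only, so the diamond is a segment of a fibre or empty.\<close>
    have "?D = (if q0 = q1 then (\<lambda>y. (t, q0, y)) ` {y0..y1} else {})" (is "_ = ?S")
    proof (intro equalityI subsetI)
      fix x' assume "x' \<in> ?D"
      then have J: "x' \<in> J_plus x0" "x1 \<in> J_plus x'" by (auto simp: J_minus_iff)
      have M': "x' \<in> M" by (rule J_plus_M[OF x(1) J(1)])
      have t': "fst x0 = fst x'" "fst x' = fst x1"
        using J_plus_time_le[OF x(1) J(1)] J_plus_time_le[OF M' J(2)] 3 by auto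
      from J_plus_same_time[OF x(1) J(1) t'(1)] J_plus_same_time[OF M' J(2) t'(2)] t'
      show "x' \<in> ?S" by (cases x') (auto simp: x0 x1)
    next
      fix x' assume "x' \<in> ?S"
      then obtain y where "q0 = q1" "x' = (t, q0, y)" "y0 \<le> y" "y \<le> y1" by (auto split: if_splits)
      then show "x' \<in> ?D" using T J_plus_vertical[of t y0 y q0] J_plus_vertical[of t y y1 q0]
        by (simp add: J_minus_iff x0 x1)
    qed
    moreover have "compact ((\<lambda>y. (t, q0, y)) ` {y0..y1})"
      by (intro compact_continuous_image continuous_intros compact_Icc)
    ultimately show ?thesis by (cases "q0 = q1") auto
  qed
qed

end

theorem theorem4p27:
  fixes r :: nat
    and A :: "('q::t2_space, 'e::euclidean_space) chart set"
    and T :: "real set"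
    and a :: "real \<Rightarrow> 'q \<Rightarrow> ('q, 'e) tangent_vector \<Rightarrow> ('q, 'e) tangent_vector \<Rightarrow> real"
    and b :: "real \<Rightarrow> 'q \<Rightarrow> ('q, 'e) tangent_vector \<Rightarrow> real"
    and V :: "real \<Rightarrow> 'q \<Rightarrow> real"
  assumes "generalized_gravitational_wave r A T a b V"
  shows "generalized_gravitational_wave.globally_hyperbolic A T a b V \<longleftrightarrow>
    (\<forall>t0 q0 t1 q1. t0 \<in> T \<and> t1 \<in> T \<and> t0 < t1 \<longrightarrow>
      generalized_gravitational_wave.coercive A a b V (t0, q0) (t1, q1))"
proof -
  interpret generalized_gravitational_wave r A T a b V by (rule assms)
  show ?thesis using globally_hyperbolic_imp_coercive coercive_imp_globally_hyperbolic by blast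
qed

end
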